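(* Let $1\le m<n$, $1\le l\le n-1$ and $k\ge2$ be integers. Let $\Sigma$ be an $m$-dimensional compact $C^k$ submanifold of $\mathbb{R}^n$ parameterized by $s:[0,1]^m\to\mathbb{R}^n$. Then for any $\rho>0$ there is a perturbation $\Sigma'$ of $\Sigma$, the image of some $s':[0,1]^m\to\mathbb{R}^n$ with $\|D^\gamma(s-s')\|_\infty\le\rho$ for all multi-indices $|\gamma|<k$, such that for every $\varepsilon>0$ there is $R_0(\varepsilon)$ with \[\big(C'_{\Sigma',l}(R)\big)^2\ge R^{\alpha-\varepsilon}\quad\text{for all }R\ge R_0(\varepsilon),\qquad\alpha=\frac{lm}{m+k(n-m)}.\]
   Context: For an $m$-dimensional submanifold $\Sigma$ with surface measure $d\sigma$, $C'_{\Sigma,l}(R)$ is the smallest constant such that $\|\hat w\|_{L^2(\Sigma,d\sigma)}\le R^{\frac{n-l-m}{2}}C'_{\Sigma,l}(R)\|w\|_{L^1}^{1/2}\|\mathcal{M}_lw\|_{L^\infty(\mathrm{Gr}(l,n))}^{1/2}$ for all nonnegative weights $w$ supported in the ball $B_R$ of radius $R$ centered at the origin. Here $\hat w(\xi)=\int w(x)e^{-2\pi i x\cdot\xi}dx$, and for $b$ in the Grassmannian $\mathrm{Gr}(l,n)$ of $l$-dimensional subspaces, $\mathcal{M}_lw(b)=\sup_T\int_T w$, the supremum over $1$-neighborhoods $T$ of translates of $b$. *)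

theory Defs
  imports "HOL-Analysis.Analysis"
begin

definition unit_cube :: "(real^'m) set" where
  "unit_cube = cbox 0 One"

text \<open>Iterated partial derivatives: pdiff [i1,...,ir] f = D_i1 ... D_ir f
  (a multi-index gamma of order r corresponds to a list of length r).\<close>
fun pdiff :: "'m list \<Rightarrow> (real^'m \<Rightarrow> real^'n) \<Rightarrow> real^'m \<Rightarrow> real^'n" where
  "pdiff [] f = f"
| "pdiff (i # is) f =
     (\<lambda>x. vector_derivative (\<lambda>t. pdiff is f (x + t *\<^sub>R axis i 1)) (at 0))"

definition Ck_on :: "nat \<Rightarrow> (real^'m) set \<Rightarrow> (real^'m \<Rightarrow> real^'n) \<Rightarrow> bool" where
  "Ck_on k U f \<longleftrightarrow>
     (\<forall>is i x. length is < k \<longrightarrow> x \<in> U \<longrightarrow>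
        ((\<lambda>t. pdiff is f (x + t *\<^sub>R axis i 1)) has_vector_derivative pdiff (i # is) f x) (at 0))
   \<and> (\<forall>is. length is \<le> k \<longrightarrow> continuous_on U (pdiff is f))"

definition param_submanifold :: "nat \<Rightarrow> (real^'m \<Rightarrow> real^'n) \<Rightarrow> bool" where
  "param_submanifold k s \<longleftrightarrow>
     (\<exists>U. open U \<and> unit_cube \<subseteq> U \<and> Ck_on k U s)
   \<and> inj_on s unit_cube
   \<and> (\<forall>t\<in>unit_cube. inj (frechet_derivative s (at t)))"

definition surf_jac :: "(real^'m \<Rightarrow> real^'n) \<Rightarrow> real^'m \<Rightarrow> real" where
  "surf_jac s t = sqrt (det (\<chi> i j. pdiff [i] s t \<bullet> pdiff [j] s t))"

definition surf_L2_norm :: "(real^'m \<Rightarrow> real^'n) \<Rightarrow> (real^'n \<Rightarrow> complex) \<Rightarrow> real" where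
  "surf_L2_norm s g =
     sqrt (\<integral>t. indicator unit_cube t * (cmod (g (s t)))\<^sup>2 * surf_jac s t \<partial>lborel)"

definition fourier :: "(real^'n \<Rightarrow> real) \<Rightarrow> real^'n \<Rightarrow> complex" where
  "fourier w \<xi> = (\<integral>x. complex_of_real (w x) * cis (- 2 * pi * (x \<bullet> \<xi>)) \<partial>lborel)"

definition L1_norm :: "(real^'n \<Rightarrow> real) \<Rightarrow> real" where
  "L1_norm w = (\<integral>x. \<bar>w x\<bar> \<partial>lborel)"

definition grassmannian :: "nat \<Rightarrow> (real^'n) set set" where
  "grassmannian l = {b. subspace b \<and> dim b = l}"

definition max_fun :: "(real^'n \<Rightarrow> real) \<Rightarrow> (real^'n) set \<Rightarrow> real" where
  "max_fun w b = Sup {(\<integral>x. indicator {x. infdist x ((+) v ` b) < 1} x * w x \<partial>lborel) | v. True}"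

definition max_fun_sup :: "nat \<Rightarrow> (real^'n \<Rightarrow> real) \<Rightarrow> real" where
  "max_fun_sup l w = Sup (max_fun w ` grassmannian l)"

definition admissible_weight :: "real \<Rightarrow> (real^'n \<Rightarrow> real) \<Rightarrow> bool" where
  "admissible_weight R w \<longleftrightarrow>
     (\<forall>x. 0 \<le> w x) \<and> integrable lborel w \<and> (\<forall>x. x \<notin> ball 0 R \<longrightarrow> w x = 0)"

text \<open>C'_{Sigma,l}(R): smallest constant (as an extended real, +infinity if none).\<close>
definition C_prime :: "nat \<Rightarrow> (real^'m \<Rightarrow> real^'n) \<Rightarrow> real \<Rightarrow> ereal" where
  "C_prime l s R = Inf (ereal ` {C. \<forall>w. admissible_weight R w \<longrightarrow>
      surf_L2_norm s (fourier w)
        \<le> R powr ((real CARD('n) - real l - real CARD('m)) / 2) * C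
           * sqrt (L1_norm w) * sqrt (max_fun_sup l w)})"

end

theory Submission
  imports Defs "HOL-Computational_Algebra.Polynomial" "HOL-Computational_Algebra.Primes"
begin

text \<open>The weight at scale \<open>R\<close> is a tent function on a box of size \<open>R\<close> times the squared modulus of
  \<open>\<Sum>\<^sub>a e(x \<bullet> Va)\<close>, where \<open>a\<close> runs over the integer points of the box \<open>[0, A)\<^sup>D\<close>, the rank \<open>D\<close> is a large
  constant and \<open>A\<^sup>D\<close> is slightly smaller than \<open>R\<^sup>l\<close>. Since the Fourier transform of a tent is
  nonnegative, the transform of the weight is of maximal size within \<open>1/R\<close> of every frequency \<open>Va\<close>
  with small \<open>a\<close>, whereas its integral over a tube around an \<open>l\<close>-plane \<open>b\<close> is governed by the number of \<open>a\<close>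
  for which the projection of \<open>Va\<close> to \<open>b\<close> is \<open>O(1/R)\<close>. For random generators \<open>V\<close> this number is
  \<open>R\<^sup>\<epsilon>\<close> for all \<open>b\<close> simultaneously: exposing the generators one at a time, each new one creates a
  resonance with probability less than \<open>R\<^sup>-\<^sup>\<epsilon>\<close>, so a large bounded number of resonances is too unlikely
  to occur for any plane in a polynomially large net.

  By Chebyshev's inequality the frequencies \<open>Va\<close> also meet most of any given family of sets of
  measure \<open>R\<^sup>-\<^sup>l\<^sup>+\<^sup>\<epsilon>\<close>. Such sets are the neighbourhoods of width \<open>\<delta>\<^sup>k\<close> of the patches of side \<open>\<delta>\<close>
  of the submanifold, with \<open>\<delta>\<close> to the power \<open>m + k(n - m)\<close> about \<open>R\<^sup>-\<^sup>l\<close>. Moving the patches by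
  \<open>C\<^sup>k\<close>-small bumps onto the frequencies met, at all dyadic scales \<open>R\<close> in disjoint regions, gives the
  perturbation.\<close>

section \<open>Echelon bases and sheared product integrals\<close>

text \<open>The exponent comes from one balance, up to \<open>R^\<epsilon>\<close> losses. The
  squared surface norm of the transform is at least \<open>B^2 * R^(2n - m)\<close> times the number
  of patches met, where \<open>B\<close> counts exponent vectors, while mass times largest tube
  integral is about \<open>B^2 * R^(n + l)\<close>. After division by the normalising power
  \<open>R^(n - l - m)\<close> only the number of patches is left, which is
  \<open>\<delta>^(-m) = R^(lm / (m + k(n - m)))\<close>. Three obstacles shape the construction.
  All \<open>l\<close>-planes must be controlled by one choice of generators, whence echelon bases
  with bounded entries, which have nets of polynomial size. Pairwise independence of the hits needs
  invertible coefficient differences, so the generators are drawn from residues modulo a prime;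
  reduction moves frequencies by integer vectors, and the coordinate vectors join the generators to
  undo this, at the cost of a bounded power of the small coefficient range. Finally, one
  perturbation has to serve every \<open>\<epsilon>\<close>, so the data of each scale are picked
  diagonally.\<close>

text \<open>Gaussian elimination with the largest coordinate as pivot: each dimension multiplies the
  entry bound by at most \<open>1 + CARD('n)\<close>. The bounded entries make rounding to a finite
  net possible, and the last clause describes a plane as a graph over its pivot coordinates.\<close>

lemma echelon_basis:
  fixes b :: "(real^'n) set"
  assumes "subspace b" "dim b = l"
  shows "\<exists>(I::'n set) u. card I = l \<and>
    (\<forall>i\<in>I. u i \<in> b \<and> (\<forall>i'\<in>I. u i $ i' = (if i' = i then 1 else 0)) \<and>
        (\<forall>j. \<bar>u i $ j\<bar> \<le> (1 + real CARD('n)) ^ l)) \<and>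
    (\<forall>y\<in>b. y = (\<Sum>i\<in>I. (y $ i) *\<^sub>R u i))"
  using assms
proof (induction l arbitrary: b)
  case 0
  then have "b \<subseteq> {0}" by (simp add: dim_eq_0)
  then show ?case by (intro exI[of _ "{}"]) auto
next
  case (Suc l)
  have "\<not> b \<subseteq> {0}" using Suc.prems by (metis dim_eq_0 nat.distinct(1))
  then obtain x0 where x0: "x0 \<in> b" "x0 \<noteq> 0" by auto
  obtain i where i: "\<And>j. \<bar>x0 $ j\<bar> \<le> \<bar>x0 $ i\<bar>"
  proof -
    have "Max (range (\<lambda>j. \<bar>x0 $ j\<bar>)) \<in> range (\<lambda>j. \<bar>x0 $ j\<bar>)" by (intro Max_in) auto
    then obtain i where "Max (range (\<lambda>j. \<bar>x0 $ j\<bar>)) = \<bar>x0 $ i\<bar>" by (rule rangeE)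
    then have "\<And>j. \<bar>x0 $ j\<bar> \<le> \<bar>x0 $ i\<bar>" by (metis Max_ge finite_imageI finite rangeI)
    then show ?thesis using that by blast
  qed
  have ne: "x0 $ i \<noteq> 0"
  proof
    assume "x0 $ i = 0"
    with i have "x0 = 0" by (simp add: vec_eq_iff)
    with x0 show False by simp
  qed
  define x where "x = (1 / x0 $ i) *\<^sub>R x0"
  have xb: "x \<in> b" using x0 Suc.prems(1) by (simp add: x_def subspace_scale)
  have xi: "x $ i = 1" using ne by (simp add: x_def)
  have xj: "\<bar>x $ j\<bar> \<le> 1" for j using i[of j] ne by (simp add: x_def abs_mult divide_simps)
  define b' where "b' = {y\<in>b. y $ i = 0}"
  have sb': "subspace b'" using Suc.prems(1) by (auto simp: b'_def subspace_def)
  have "x \<notin> b'" using xi by (simp add: b'_def)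
  have bb': "span (insert x b') = b"
  proof
    show "span (insert x b') \<subseteq> b" using xb Suc.prems(1)
      by (intro span_minimal) (auto simp: b'_def)
    show "b \<subseteq> span (insert x b')"
    proof
      fix y assume y: "y \<in> b"
      have "y - (y $ i) *\<^sub>R x \<in> b'" using y xb xi Suc.prems(1)
        by (simp add: b'_def subspace_diff subspace_scale)
      then have "y - (y $ i) *\<^sub>R x \<in> span (insert x b')" by (simp add: span_base)
      moreover have "(y $ i) *\<^sub>R x \<in> span (insert x b')" by (simp add: span_base span_scale)
      ultimately have "(y - (y $ i) *\<^sub>R x) + (y $ i) *\<^sub>R x \<in> span (insert x b')" by (rule span_add)
      then show "y \<in> span (insert x b')" by simp
    qed
  qed
  have "dim b = dim (insert x b')" using bb' by (metis dim_span)
  also have "\<dots> = Suc (dim b')" using \<open>x \<notin> b'\<close> sb'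
    by (simp add: dim_insert span_eq_iff[THEN iffD2])
  finally have "dim b' = l" using Suc.prems by simp
  from Suc.IH[OF sb' this] obtain I' u' where
    cI: "card I' = l" and
    ua: "\<forall>i\<in>I'. u' i \<in> b' \<and> (\<forall>i'\<in>I'. u' i $ i' = (if i' = i then 1 else 0)) \<and>
        (\<forall>j. \<bar>u' i $ j\<bar> \<le> (1 + real CARD('n)) ^ l)" and
    ub: "\<forall>y\<in>b'. y = (\<Sum>i\<in>I'. (y $ i) *\<^sub>R u' i)" by blast
  have u': "\<And>k. k \<in> I' \<Longrightarrow> u' k \<in> b'" "\<And>k k'. k \<in> I' \<Longrightarrow> k' \<in> I' \<Longrightarrow> u' k $ k' = (if k' = k then 1 else 0)"
       "\<And>k j. k \<in> I' \<Longrightarrow> \<bar>u' k $ j\<bar> \<le> (1 + real CARD('n)) ^ l"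
    using ua by blast+
  have rep: "\<And>y. y \<in> b' \<Longrightarrow> y = (\<Sum>i\<in>I'. (y $ i) *\<^sub>R u' i)" using ub by blast
  have i0: "u' k $ i = 0" if "k \<in> I'" for k using u'(1)[OF that] by (simp add: b'_def)
  have inI: "i \<notin> I'" using i0 u'(2) by force
  \<comment> \<open>Clearing the old pivot entries of \<open>x\<close> subtracts at most
    \<open>CARD('n)\<close> old basis vectors with coefficients at most 1. The entry at
    \<open>i\<close> stays 1 because the old basis vanishes there.\<close>
  define X where "X = x - (\<Sum>k\<in>I'. (x $ k) *\<^sub>R u' k)"
  define u where "u k = (if k = i then X else u' k)" for k
  have b'b: "b' \<subseteq> b" by (auto simp: b'_def)
  have Xb: "X \<in> b" unfolding X_def using u'(1) b'b xb Suc.prems(1)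
    by (intro subspace_diff subspace_sum subspace_scale) auto
  have Xi: "X $ i = 1" using i0 by (simp add: X_def xi)
  have Xk: "X $ k = 0" if "k \<in> I'" for k
  proof -
    have "(\<Sum>k'\<in>I'. x $ k' * u' k' $ k) = (\<Sum>k'\<in>I'. if k' = k then x $ k' else 0)"
      using that u'(2) by (intro sum.cong) auto
    then show ?thesis using that by (simp add: X_def)
  qed
  have K1: "(1 + real CARD('n)) ^ l \<ge> 1" by simp
  have Xj: "\<bar>X $ j\<bar> \<le> (1 + real CARD('n)) ^ Suc l" for j
  proof -
    have "\<bar>X $ j\<bar> \<le> \<bar>x $ j\<bar> + \<bar>\<Sum>k\<in>I'. x $ k * u' k $ j\<bar>" by (simp add: X_def)
    also have "\<dots> \<le> 1 + (\<Sum>k\<in>I'. \<bar>x $ k * u' k $ j\<bar>)" using xj by (intro add_mono) auto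
    also have "(\<Sum>k\<in>I'. \<bar>x $ k * u' k $ j\<bar>) \<le> (\<Sum>k\<in>I'. 1 * (1 + real CARD('n)) ^ l)"
      unfolding abs_mult using xj u'(3) by (intro sum_mono mult_mono) auto
    also have "\<dots> \<le> real CARD('n) * (1 + real CARD('n)) ^ l"
      by (simp add: mult_right_mono card_mono)
    finally have "\<bar>X $ j\<bar> \<le> 1 + real CARD('n) * (1 + real CARD('n)) ^ l" by simp
    also have "\<dots> \<le> (1 + real CARD('n)) ^ Suc l" using K1 by (simp only: power_Suc distrib_right mult_1 add_mono)
    finally show ?thesis .
  qed
  have mono: "(1 + real CARD('n)) ^ l \<le> (1 + real CARD('n)) ^ Suc l"
    by (intro power_increasing) auto
  show ?case
  proof (rule exI[of _ "insert i I'"], rule exI[of _ u], intro conjI ballI allI)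
    show "card (insert i I') = Suc l" using inI cI by simp
  next
    fix k assume "k \<in> insert i I'"
    then show "u k \<in> b" using Xb u'(1) b'b by (auto simp: u_def)
  next
    fix k k' assume "k \<in> insert i I'" "k' \<in> insert i I'"
    then show "u k $ k' = (if k' = k then 1 else 0)" using Xi Xk i0 u'(2) inI by (auto simp: u_def)
  next
    fix k j assume "k \<in> insert i I'"
    then show "\<bar>u k $ j\<bar> \<le> (1 + real CARD('n)) ^ Suc l"
      using Xj u'(3)[of k j] mono by (auto simp: u_def simp del: power_Suc intro: order_trans)
  next
    fix y assume y: "y \<in> b"
    have yb: "y - (y $ i) *\<^sub>R x \<in> b'" using y xb xi Suc.prems(1)
      by (simp add: b'_def subspace_diff subspace_scale)
    have "(\<Sum>k\<in>insert i I'. (y $ k) *\<^sub>R u k) = (y $ i) *\<^sub>R X + (\<Sum>k\<in>I'. (y $ k) *\<^sub>R u' k)"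
      using inI by (auto simp: u_def intro!: sum.cong)
    also have "\<dots> = (y $ i) *\<^sub>R x + (\<Sum>k\<in>I'. ((y - (y $ i) *\<^sub>R x) $ k) *\<^sub>R u' k)"
      by (simp add: X_def algebra_simps sum_subtractf scaleR_sum_right)
    also have "\<dots> = (y $ i) *\<^sub>R x + (y - (y $ i) *\<^sub>R x)" by (simp only: rep[OF yb, symmetric])
    also have "\<dots> = y" by simp
    finally show "y = (\<Sum>k\<in>insert i I'. (y $ k) *\<^sub>R u k)" by simp
  qed
qed

text \<open>Boxes determine Lebesgue measure, and both sides give a box the product of its side
  lengths. In the form of a product measure, Fubini can be applied to an arbitrary subset of the
  coordinates.\<close>

lemma lborel_vec_eq_PiM:
  "(lborel :: (real^'n) measure) = distr (PiM UNIV (\<lambda>_. lborel)) borel (\<lambda>f. \<chi> i. f i)"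
proof (rule lborel_eqI)
  interpret product_sigma_finite "\<lambda>_::'n. lborel :: real measure" ..
  have meas: "(\<lambda>f. \<chi> i. f i) \<in> measurable (PiM (UNIV::'n set) (\<lambda>_. lborel)) (borel :: (real^'n) measure)"
    by (subst borel_measurable_euclidean_space) (auto simp: Basis_vec_def inner_axis)
  fix l u :: "real^'n"
  assume lu: "\<And>b. b \<in> Basis \<Longrightarrow> l \<bullet> b \<le> u \<bullet> b"
  then have lu': "l $ i \<le> u $ i" for i
    using lu[of "axis i 1"] by (simp add: inner_axis axis_in_Basis_iff)
  have "emeasure (distr (PiM UNIV (\<lambda>_. lborel)) borel (\<lambda>f. \<chi> i. f i)) (box l u)
     = emeasure (PiM UNIV (\<lambda>_. lborel)) (PiE UNIV (\<lambda>i. {l $ i <..< u $ i}))"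
    by (subst emeasure_distr[OF meas])
       (auto intro!: arg_cong2[where f=emeasure] simp: space_PiM mem_box_cart PiE_iff)
  also have "\<dots> = (\<Prod>i\<in>UNIV. emeasure lborel {l $ i <..< u $ i})"
    by (rule emeasure_PiM) auto
  also have "\<dots> = (\<Prod>i\<in>UNIV. ennreal (u $ i - l $ i))" using lu' by simp
  also have "\<dots> = ennreal (\<Prod>i\<in>UNIV. u $ i - l $ i)" using lu' by (simp add: prod_ennreal)
  also have "(\<Prod>i\<in>UNIV. u $ i - l $ i) = (\<Prod>b\<in>Basis. (u - l) \<bullet> b)"
  proof -
    have "(Basis :: (real^'n) set) = range (\<lambda>i. axis i 1)" by (auto simp: Basis_vec_def)
    moreover have "inj (\<lambda>i::'n. axis i (1::real))" by (simp add: inj_on_def axis_eq_axis)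
    ultimately have "(\<Prod>b\<in>Basis. (u - l) \<bullet> b) = (\<Prod>i\<in>UNIV. (u - l) \<bullet> axis i 1)"
      using prod.reindex[of "\<lambda>i::'n. axis i (1::real)" UNIV "\<lambda>b. (u - l) \<bullet> b"] by (simp only: o_def)
    then show ?thesis by (simp add: inner_axis)
  qed
  finally show "emeasure (distr (PiM UNIV (\<lambda>_. lborel)) borel (\<lambda>f. \<chi> i. f i)) (box l u)
     = (\<Prod>b\<in>Basis. (u - l) \<bullet> b)" .
qed simp

text \<open>A shear has determinant one. With the coordinates in \<open>I\<close> fixed, the others
  see only translates of \<open>\<alpha> j\<close>, whose integrals do not depend on the
  shift.\<close>

lemma integral_sheared_prod:
  fixes \<alpha> :: "'n::finite \<Rightarrow> real \<Rightarrow> complex" and c :: "'n \<Rightarrow> 'n \<Rightarrow> real"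
  assumes \<alpha>: "\<And>i. integrable lborel (\<alpha> i)"
    and int: "integrable lborel (\<lambda>x::real^'n. (\<Prod>i\<in>I. \<alpha> i (x $ i)) *
          (\<Prod>j\<in>-I. \<alpha> j (x $ j - (\<Sum>i\<in>I. c i j * x $ i))))"
  shows "(\<integral>x. (\<Prod>i\<in>I. \<alpha> i (x $ i)) *
          (\<Prod>j\<in>-I. \<alpha> j (x $ j - (\<Sum>i\<in>I. c i j * x $ i))) \<partial>(lborel :: (real^'n) measure))
       = (\<Prod>i\<in>UNIV. integral\<^sup>L lborel (\<alpha> i))"
proof -
  interpret product_sigma_finite "\<lambda>_::'n. lborel :: real measure" ..
  have meas: "(\<lambda>f. \<chi> i. f i) \<in> measurable (PiM (UNIV::'n set) (\<lambda>_. lborel)) (borel :: (real^'n) measure)"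
    by (subst borel_measurable_euclidean_space) (auto simp: Basis_vec_def inner_axis)
  have [measurable]: "\<alpha> i \<in> borel_measurable borel" for i
    using borel_measurable_integrable[OF \<alpha>[of i]] by simp
  let ?F = "\<lambda>x::real^'n. (\<Prod>i\<in>I. \<alpha> i (x $ i)) *
          (\<Prod>j\<in>-I. \<alpha> j (x $ j - (\<Sum>i\<in>I. c i j * x $ i)))"
  let ?f = "\<lambda>x. (\<Prod>i\<in>I. \<alpha> i (x i)) * (\<Prod>j\<in>-I. \<alpha> j (x j - (\<Sum>i\<in>I. c i j * x i)))"
  have Fm: "?F \<in> borel_measurable borel" using borel_measurable_integrable[OF int] by simp
  have U: "UNIV = I \<union> - I" by auto
  have fint: "integrable (PiM (I \<union> -I) (\<lambda>_. lborel)) ?f"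
  proof -
    have "integrable (distr (PiM UNIV (\<lambda>_. lborel)) borel (\<lambda>f. \<chi> i. f i)) ?F"
      using int lborel_vec_eq_PiM[where 'n='n] by simp
    from integrable_distr[OF meas this]
    have "integrable (PiM UNIV (\<lambda>_. lborel)) ?f" by (simp only: vec_lambda_beta)
    then show ?thesis by (simp only: U[symmetric])
  qed
  have "(\<integral>x. ?F x \<partial>lborel) = (\<integral>x. ?f x \<partial>PiM (I \<union> -I) (\<lambda>_. lborel))"
    unfolding U[symmetric] by (subst lborel_vec_eq_PiM, subst integral_distr[OF meas Fm]) simp
  also have "\<dots> = (\<integral>x. (\<integral>y. ?f (merge I (-I) (x, y)) \<partial>PiM (-I) (\<lambda>_. lborel)) \<partial>PiM I (\<lambda>_. lborel))"
    by (rule product_integral_fold[OF _ _ _ fint]) auto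
  also have "\<dots> = (\<integral>x. (\<Prod>i\<in>I. \<alpha> i (x i)) * (\<Prod>j\<in>-I. integral\<^sup>L lborel (\<alpha> j)) \<partial>PiM I (\<lambda>_. lborel))"
  proof (rule Bochner_Integration.integral_cong[OF refl])
    fix x
    define d where "d j = (\<Sum>i\<in>I. c i j * x i)" for j
    have "(\<integral>y. ?f (merge I (-I) (x, y)) \<partial>PiM (-I) (\<lambda>_. lborel))
       = (\<integral>y. (\<Prod>i\<in>I. \<alpha> i (x i)) * (\<Prod>j\<in>-I. \<alpha> j (y j - d j)) \<partial>PiM (-I) (\<lambda>_. lborel))"
      by (intro Bochner_Integration.integral_cong refl arg_cong2[where f="(*)"] prod.cong)
         (auto simp: merge_def d_def)
    also have "\<dots> = (\<Prod>i\<in>I. \<alpha> i (x i)) * (\<integral>y. (\<Prod>j\<in>-I. \<alpha> j (y j - d j)) \<partial>PiM (-I) (\<lambda>_. lborel))"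
      by simp
    also have "(\<integral>y. (\<Prod>j\<in>-I. \<alpha> j (y j - d j)) \<partial>PiM (-I) (\<lambda>_. lborel)) = (\<Prod>j\<in>-I. (\<integral>t. \<alpha> j (t - d j) \<partial>lborel))"
    proof (rule product_integral_prod)
      fix j
      show "integrable lborel (\<lambda>t. \<alpha> j (t - d j))"
        using lborel_integrable_real_affine[OF \<alpha>[of j], of 1 "- d j"] by simp
    qed simp
    also have "\<dots> = (\<Prod>j\<in>-I. integral\<^sup>L lborel (\<alpha> j))"
    proof (intro prod.cong refl)
      fix j
      show "(\<integral>t. \<alpha> j (t - d j) \<partial>lborel) = integral\<^sup>L lborel (\<alpha> j)"
        by (subst lborel_integral_real_affine[of 1 _ "d j"]) auto
    qed
    finally show "(\<integral>y. ?f (merge I (-I) (x, y)) \<partial>PiM (-I) (\<lambda>_. lborel))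
       = (\<Prod>i\<in>I. \<alpha> i (x i)) * (\<Prod>j\<in>-I. integral\<^sup>L lborel (\<alpha> j))" .
  qed
  also have "\<dots> = (\<Prod>i\<in>I. integral\<^sup>L lborel (\<alpha> i)) * (\<Prod>j\<in>-I. integral\<^sup>L lborel (\<alpha> j))"
    by (simp add: product_integral_prod[OF finite \<alpha>])
  also have "\<dots> = (\<Prod>i\<in>UNIV. integral\<^sup>L lborel (\<alpha> i))"
    using prod.union_disjoint[of I "-I" "\<lambda>i. integral\<^sup>L lborel (\<alpha> i)"] by (simp add: U[symmetric])
  finally show ?thesis .
qed

section \<open>Tent functions and exponential sums\<close>

definition tent :: "real \<Rightarrow> real" where
  "tent x = max 0 (1 - \<bar>x\<bar>)"

text \<open>The squared sinc function, that is, the square of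
  \<open>sin (pi * \<theta>) / (pi * \<theta>)\<close>. The cosine transform is the full Fourier
  transform because \<open>tent\<close> is even.\<close>

definition tent_ft :: "real \<Rightarrow> real" where
  "tent_ft \<theta> = (\<integral>x. tent x * cos (2 * pi * \<theta> * x) \<partial>lborel)"

lemma tent_nonneg: "0 \<le> tent x" by (simp add: tent_def)
lemma tent_le_1: "tent x \<le> 1" by (simp add: tent_def)
lemma tent_zero: "1 \<le> \<bar>x\<bar> \<Longrightarrow> tent x = 0" by (simp add: tent_def)
lemma tent_minus: "tent (- x) = tent x" by (simp add: tent_def)
lemma continuous_on_tent [continuous_intros]:
  "continuous_on S f \<Longrightarrow> continuous_on S (\<lambda>x. tent (f x))"
  unfolding tent_def by (intro continuous_intros)

lemma integrable_tent_mult: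
  fixes f :: "real \<Rightarrow> 'a::euclidean_space"
  assumes "continuous_on UNIV f"
  shows "integrable lborel (\<lambda>x. tent x *\<^sub>R f x)"
proof -
  have "integrable lborel (\<lambda>x. indicator {-1..1} x *\<^sub>R (tent x *\<^sub>R f x))"
    using assms by (intro borel_integrable_compact continuous_intros)
      (auto intro: continuous_on_subset)
  moreover have "(\<lambda>x. indicator {-1..1} x *\<^sub>R (tent x *\<^sub>R f x)) = (\<lambda>x. tent x *\<^sub>R f x)"
    by (rule ext) (auto simp: indicator_def tent_def max_def abs_if split: if_splits)
  ultimately show ?thesis by simp
qed

lemma has_integral_tent_cos:
  assumes "c \<noteq> 0"
  shows "((\<lambda>x. tent x * cos (c * x)) has_integral (2 * (1 - cos c) / c\<^sup>2)) {-1..1}"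
proof -
  have "((\<lambda>x. (1 + x) * cos (c * x)) has_integral
      ((1 + 0) * sin (c * 0) / c + cos (c * 0) / c\<^sup>2) - ((1 + -1) * sin (c * -1) / c + cos (c * -1) / c\<^sup>2)) {-1..0}"
    using assms by (intro fundamental_theorem_of_calculus)
      (auto intro!: derivative_eq_intros simp: has_real_derivative_iff_has_vector_derivative[symmetric] power2_eq_square field_simps)
  then have "((\<lambda>x. (1 + x) * cos (c * x)) has_integral (1 - cos c) / c\<^sup>2) {-1..0}"
    by (simp add: diff_divide_distrib)
  then have 1: "((\<lambda>x. tent x * cos (c * x)) has_integral (1 - cos c) / c\<^sup>2) {-1..0}"
    by (rule has_integral_eq[rotated]) (auto simp: tent_def)
  have "((\<lambda>x. (1 - x) * cos (c * x)) has_integral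
      ((1 - 1) * sin (c * 1) / c - cos (c * 1) / c\<^sup>2) - ((1 - 0) * sin (c * 0) / c - cos (c * 0) / c\<^sup>2)) {0..1}"
    using assms by (intro fundamental_theorem_of_calculus)
      (auto intro!: derivative_eq_intros simp: has_real_derivative_iff_has_vector_derivative[symmetric] power2_eq_square field_simps)
  then have "((\<lambda>x. (1 - x) * cos (c * x)) has_integral (1 - cos c) / c\<^sup>2) {0..1}"
    by (simp add: diff_divide_distrib)
  then have 2: "((\<lambda>x. tent x * cos (c * x)) has_integral (1 - cos c) / c\<^sup>2) {0..1}"
    by (rule has_integral_eq[rotated]) (auto simp: tent_def)
  have "((\<lambda>x. tent x * cos (c * x)) has_integral (1 - cos c) / c\<^sup>2 + (1 - cos c) / c\<^sup>2) {-1..1}"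
    by (rule has_integral_combine[OF _ _ 1 2]) auto
  then show ?thesis by (simp add: add_divide_distrib[symmetric])
qed

lemma has_integral_tent: "((\<lambda>x. tent x) has_integral 1) {-1..1}"
proof -
  have "((\<lambda>x::real. (1 + x)) has_integral (0 + 0^2/2) - (-1 + (-1)^2/2)) {-1..0}"
    by (intro fundamental_theorem_of_calculus)
      (auto intro!: derivative_eq_intros simp: has_real_derivative_iff_has_vector_derivative[symmetric] power2_eq_square field_simps)
  then have "((\<lambda>x::real. 1 + x) has_integral 1/2) {-1..0}" by simp
  then have 1: "(tent has_integral 1/2) {-1..0}"
    by (rule has_integral_eq[rotated]) (auto simp: tent_def)
  have "((\<lambda>x::real. (1 - x)) has_integral (1 - 1^2/2) - (0 - 0^2/2)) {0..1}"
    by (intro fundamental_theorem_of_calculus)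
      (auto intro!: derivative_eq_intros simp: has_real_derivative_iff_has_vector_derivative[symmetric] power2_eq_square field_simps)
  then have "((\<lambda>x::real. 1 - x) has_integral 1/2) {0..1}" by simp
  then have 2: "(tent has_integral 1/2) {0..1}"
    by (rule has_integral_eq[rotated]) (auto simp: tent_def)
  have "((\<lambda>x. tent x) has_integral 1/2 + 1/2) {-1..1}"
    by (rule has_integral_combine[OF _ _ 1 2]) auto
  then show ?thesis by simp
qed

lemma lborel_integral_supported_Icc:
  fixes f :: "real \<Rightarrow> real"
  assumes "continuous_on {a..b} f" "\<And>x. x \<notin> {a..b} \<Longrightarrow> f x = 0" "(f has_integral I) {a..b}"
  shows "(\<integral>x. f x \<partial>lborel) = I"
proof -
  have "set_integrable lborel {a..b} f" using assms(1) by (rule borel_integrable_atLeastAtMost')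
  then have "(LINT x:{a..b}|lborel. f x) = integral {a..b} f" by (rule set_borel_integral_eq_integral(2))
  also have "\<dots> = I" using assms(3) by (rule integral_unique)
  also have "(LINT x:{a..b}|lborel. f x) = (\<integral>x. f x \<partial>lborel)"
    unfolding set_lebesgue_integral_def using assms(2)
    by (intro Bochner_Integration.integral_cong) (auto simp: indicator_def)
  finally show ?thesis .
qed

lemma integral_tent: "(\<integral>x. tent x \<partial>lborel) = 1"
  by (rule lborel_integral_supported_Icc[OF _ _ has_integral_tent])
     (auto intro!: continuous_intros tent_zero)

lemma tent_ft_eq: "\<theta> \<noteq> 0 \<Longrightarrow> tent_ft \<theta> = 2 * (1 - cos (2 * pi * \<theta>)) / (2 * pi * \<theta>)\<^sup>2"
  unfolding tent_ft_def
  by (rule lborel_integral_supported_Icc[OF _ _ has_integral_tent_cos])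
     (auto intro!: continuous_intros tent_zero)

lemma integrable_tent_cos: "integrable lborel (\<lambda>x. tent x * cos (c * x))"
proof -
  have "continuous_on UNIV (\<lambda>x. cos (c * x))" by (intro continuous_intros)
  from integrable_tent_mult[OF this] show ?thesis by simp
qed

lemma integrable_tent: "integrable lborel tent"
  using integrable_tent_cos[of 0] by simp

lemma tent_ft_nonneg: "0 \<le> tent_ft \<theta>"
proof (cases "\<theta> = 0")
  case True
  then show ?thesis by (simp add: tent_ft_def integral_tent)
next
  case False
  then show ?thesis by (simp add: tent_ft_eq)
qed

lemma tent_ft_le_1: "tent_ft \<theta> \<le> 1"
proof -
  have "tent_ft \<theta> \<le> (\<integral>x. tent x \<partial>lborel)" unfolding tent_ft_def
    by (intro integral_mono integrable_tent_cos integrable_tent mult_left_le) (auto simp: tent_nonneg)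
  then show ?thesis by (simp add: integral_tent)
qed

text \<open>Quadratic decay, with 9 standing in for the square of pi; it is enough to make sums over
  unit cells converge.\<close>

lemma tent_ft_le:
  assumes t: "\<theta> \<noteq> 0"
  shows "tent_ft \<theta> \<le> 1 / (9 * \<theta>\<^sup>2)"
proof -
  have "2 * (1 - cos y) \<le> 4" for y :: real
  proof -
    have "2 * (1 - cos y) \<le> 2 * (1 - (-1))" by (intro mult_left_mono diff_left_mono cos_ge_minus_one) simp
    also have "\<dots> = 4" by simp
    finally show ?thesis .
  qed
  then have "tent_ft \<theta> \<le> 4 / (2 * pi * \<theta>)\<^sup>2" unfolding tent_ft_eq[OF t]
    by (intro divide_right_mono) auto
  also have "\<dots> = 1 / (pi\<^sup>2 * \<theta>\<^sup>2)" by (simp add: power_mult_distrib)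
  also have "\<dots> \<le> 1 / (9 * \<theta>\<^sup>2)"
  proof (intro divide_left_mono mult_right_mono)
    have "3\<^sup>2 \<le> pi\<^sup>2" using pi_gt3 by (intro power_mono) auto
    then show "9 \<le> pi\<^sup>2" by simp
  qed (use t in auto)
  finally show ?thesis .
qed

text \<open>For such \<open>\<theta>\<close> the phase stays within \<open>pi / 3\<close> on the
  support of \<open>tent\<close>, where the cosine is at least 1/2. This is the origin of the radius
  \<open>1 / (6 * R)\<close> of the peaks.\<close>

lemma tent_ft_ge: "\<bar>\<theta>\<bar> \<le> 1/6 \<Longrightarrow> 1/2 \<le> tent_ft \<theta>"
proof -
  assume t: "\<bar>\<theta>\<bar> \<le> 1/6"
  have "(\<integral>x. tent x * (1/2) \<partial>lborel) \<le> tent_ft \<theta>" unfolding tent_ft_def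
  proof (intro integral_mono integrable_tent_cos integrable_mult_left integrable_tent)
    fix x
    show "tent x * (1/2) \<le> tent x * cos (2 * pi * \<theta> * x)"
    proof (cases "\<bar>x\<bar> \<ge> 1")
      case True then show ?thesis by (simp add: tent_zero)
    next
      case False
      have "\<bar>2 * pi * \<theta> * x\<bar> = 2 * pi * \<bar>\<theta>\<bar> * \<bar>x\<bar>" by (simp add: abs_mult)
      also have "\<dots> \<le> 2 * pi * (1/6) * 1" using t False by (intro mult_mono) auto
      finally have "\<bar>2 * pi * \<theta> * x\<bar> \<le> pi / 3" by simp
      then have "cos (pi/3) \<le> cos \<bar>2 * pi * \<theta> * x\<bar>" by (intro cos_monotone_0_pi_le) auto
      then have "1/2 \<le> cos (2 * pi * \<theta> * x)" by (simp add: cos_60)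
      then show ?thesis by (intro mult_left_mono tent_nonneg)
    qed
  qed
  then show ?thesis by (simp add: integral_tent)
qed

lemma integrable_tent_cis: "integrable lborel (\<lambda>x. complex_of_real (tent x) * cis (c * x))"
proof -
  have "continuous_on UNIV (\<lambda>x. cis (c * x))" by (intro continuous_intros)
  from integrable_tent_mult[OF this] show ?thesis by (simp add: scaleR_conv_of_real)
qed

lemma integral_tent_cis:
  "(\<integral>x. complex_of_real (tent x) * cis (2 * pi * \<theta> * x) \<partial>lborel) = complex_of_real (tent_ft \<theta>)"
proof (rule complex_eqI)
  let ?f = "\<lambda>x. complex_of_real (tent x) * cis (2 * pi * \<theta> * x)"
  show "Re (\<integral>x. ?f x \<partial>lborel) = Re (complex_of_real (tent_ft \<theta>))"
    using integral_Re[OF integrable_tent_cis[of "2 * pi * \<theta>"]] by (simp add: tent_ft_def)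
  have "Im (\<integral>x. ?f x \<partial>lborel) = (\<integral>x. tent x * sin (2 * pi * \<theta> * x) \<partial>lborel)" (is "_ = ?S")
    using integral_Im[OF integrable_tent_cis[of "2 * pi * \<theta>"]] by simp
  also have "?S = 0"
  proof -
    have "?S = - ?S"
      by (subst lborel_integral_real_affine[of "-1" _ 0]) (auto simp: tent_minus)
    then show ?thesis by simp
  qed
  finally show "Im (\<integral>x. ?f x \<partial>lborel) = Im (complex_of_real (tent_ft \<theta>))" by simp
qed

lemma tent_scaled_cis:
  assumes "0 < r"
  shows "integrable lborel (\<lambda>x. complex_of_real (tent ((x - a) / r)) * cis (2 * pi * \<theta> * x))"
    and "(\<integral>x. complex_of_real (tent ((x - a) / r)) * cis (2 * pi * \<theta> * x) \<partial>lborel)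
      = cis (2 * pi * \<theta> * a) * complex_of_real (r * tent_ft (r * \<theta>))"
proof -
  let ?f = "\<lambda>x. complex_of_real (tent ((x - a) / r)) * cis (2 * pi * \<theta> * x)"
  have eq: "?f (a + r * x) = cis (2 * pi * \<theta> * a) * (complex_of_real (tent x) * cis (2 * pi * (r * \<theta>) * x))" for x
    using assms by (simp add: cis_mult algebra_simps)
  have "integrable lborel (\<lambda>x. ?f (a + r * x))" unfolding eq
    by (intro integrable_mult_right integrable_tent_cis)
  then show "integrable lborel ?f" using assms
    by (subst (asm) lborel_integrable_real_affine_iff) auto
  have "(\<integral>x. ?f x \<partial>lborel) = \<bar>r\<bar> *\<^sub>R (\<integral>x. ?f (a + r * x) \<partial>lborel)"
    using assms by (intro lborel_integral_real_affine) auto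
  also have "\<dots> = cis (2 * pi * \<theta> * a) * complex_of_real (r * tent_ft (r * \<theta>))"
    unfolding eq using integral_tent_cis[of "r * \<theta>"] assms by (simp add: scaleR_conv_of_real)
  finally show "(\<integral>x. ?f x \<partial>lborel) = cis (2 * pi * \<theta> * a) * complex_of_real (r * tent_ft (r * \<theta>))" .
qed

text \<open>A smooth stand-in for a box around an affine plane that is a graph over its pivot
  coordinates \<open>I\<close>. The sheared coordinates measure the displacement from the plane;
  \<open>d\<close> is the centre and \<open>r\<close> gives the half-widths. With
  \<open>I = UNIV\<close> it is a product of tents on an axis-parallel box.\<close>

definition slab_tent :: "'n::finite set \<Rightarrow> ('n \<Rightarrow> real^'n) \<Rightarrow> ('n \<Rightarrow> real) \<Rightarrow> ('n \<Rightarrow> real) \<Rightarrow> real^'n \<Rightarrow> real" where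
  "slab_tent I u d r x = (\<Prod>i\<in>I. tent ((x $ i - d i) / r i)) *
     (\<Prod>j\<in>-I. tent ((x $ j - (\<Sum>i\<in>I. u i $ j * x $ i) - d j) / r j))"

lemma slab_tent_nonneg: "0 \<le> slab_tent I u d r x"
  by (simp add: slab_tent_def prod_nonneg tent_nonneg)

lemma continuous_on_slab_tent: "(\<And>i. r i > 0) \<Longrightarrow> continuous_on S (slab_tent I u d r)"
  unfolding slab_tent_def by (intro continuous_intros) (auto simp: less_imp_neq[symmetric])

lemma slab_tent_mult_integrable:
  fixes f :: "real^'n \<Rightarrow> 'a::euclidean_space"
  assumes r: "\<And>i. r i > 0" and f: "continuous_on UNIV f"
  shows "integrable lborel (\<lambda>x. slab_tent I u d r x *\<^sub>R f x)"
proof -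
  \<comment> \<open>Bounds for the coordinates on the support: the pivot coordinates are bounded
    directly, the others after adding the largest possible shear.\<close>
  define M where "M i = (if i \<in> I then \<bar>d i\<bar> + r i else \<bar>d i\<bar> + r i + (\<Sum>k\<in>I. \<bar>u k $ i\<bar> * (\<bar>d k\<bar> + r k)))" for i
  define b :: "real^'n" where "b = (\<chi> i. M i)"
  have supp: "x \<in> cbox (-b) b" if "slab_tent I u d r x \<noteq> 0" for x
  proof -
    have 1: "tent ((x $ i - d i) / r i) \<noteq> 0" if "i \<in> I" for i
      using \<open>slab_tent I u d r x \<noteq> 0\<close> that by (auto simp: slab_tent_def)
    have 2: "tent ((x $ j - (\<Sum>i\<in>I. u i $ j * x $ i) - d j) / r j) \<noteq> 0" if "j \<notin> I" for j
      using \<open>slab_tent I u d r x \<noteq> 0\<close> that by (auto simp: slab_tent_def)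
    have 3: "\<bar>x $ i\<bar> \<le> \<bar>d i\<bar> + r i" if "i \<in> I" for i
    proof -
      have "\<bar>(x $ i - d i) / r i\<bar> < 1" using 1[OF that] tent_zero by force
      then show ?thesis using r[of i] by simp
    qed
    have 4: "\<bar>x $ j\<bar> \<le> M j" if "j \<notin> I" for j
    proof -
      have "\<bar>(x $ j - (\<Sum>i\<in>I. u i $ j * x $ i) - d j) / r j\<bar> < 1" using 2[OF that] tent_zero by force
      then have "\<bar>x $ j - (\<Sum>i\<in>I. u i $ j * x $ i) - d j\<bar> < r j" using r[of j] by simp
      then have "\<bar>x $ j\<bar> \<le> \<bar>d j\<bar> + r j + \<bar>\<Sum>i\<in>I. u i $ j * x $ i\<bar>" by linarith
      also have "\<bar>\<Sum>i\<in>I. u i $ j * x $ i\<bar> \<le> (\<Sum>i\<in>I. \<bar>u i $ j * x $ i\<bar>)" by (rule sum_abs)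
      also have "\<dots> \<le> (\<Sum>k\<in>I. \<bar>u k $ j\<bar> * (\<bar>d k\<bar> + r k))" unfolding abs_mult
        by (intro sum_mono mult_left_mono 3) auto
      finally show ?thesis using that by (simp add: M_def)
    qed
    have "\<bar>x $ i\<bar> \<le> M i" for i using 3[of i] 4[of i] by (cases "i \<in> I") (auto simp: M_def)
    then show ?thesis by (auto simp: mem_box_cart b_def abs_le_iff minus_le_iff)
  qed
  have "integrable lborel (\<lambda>x. indicator (cbox (-b) b) x *\<^sub>R (slab_tent I u d r x *\<^sub>R f x))"
    using f r by (intro borel_integrable_compact continuous_intros continuous_on_slab_tent)
      (auto intro: continuous_on_subset)
  moreover have "(\<lambda>x. indicator (cbox (-b) b) x *\<^sub>R (slab_tent I u d r x *\<^sub>R f x))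
     = (\<lambda>x. slab_tent I u d r x *\<^sub>R f x)"
    using supp by (intro ext) (auto simp: indicator_def)
  ultimately show ?thesis by simp
qed

text \<open>The coordinates of the frequency \<open>\<eta>\<close> that are dual to the sheared coordinates in the definition
  of \<open>slab_tent\<close>.\<close>

definition slab_dual :: "'n::finite set \<Rightarrow> ('n \<Rightarrow> real^'n) \<Rightarrow> real^'n \<Rightarrow> 'n \<Rightarrow> real" where
  "slab_dual I u \<eta> i = (if i \<in> I then \<eta> $ i + (\<Sum>j\<in>-I. u i $ j * \<eta> $ j) else \<eta> $ i)"

lemma inner_slab_dual:
  "x \<bullet> \<eta> = (\<Sum>i\<in>I. slab_dual I u \<eta> i * x $ i) +
     (\<Sum>j\<in>-I. slab_dual I u \<eta> j * (x $ j - (\<Sum>i\<in>I. u i $ j * x $ i)))"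
proof -
  have "x \<bullet> \<eta> = (\<Sum>i\<in>I. x $ i * \<eta> $ i) + (\<Sum>j\<in>-I. x $ j * \<eta> $ j)"
    unfolding inner_vec_def inner_real_def
    by (subst sum.union_disjoint[symmetric]) auto
  moreover have "(\<Sum>i\<in>I. slab_dual I u \<eta> i * x $ i) = (\<Sum>i\<in>I. x $ i * \<eta> $ i) + (\<Sum>i\<in>I. \<Sum>j\<in>-I. u i $ j * \<eta> $ j * x $ i)"
    by (simp add: slab_dual_def algebra_simps sum.distrib sum_distrib_left)
  moreover have "(\<Sum>j\<in>-I. slab_dual I u \<eta> j * (x $ j - (\<Sum>i\<in>I. u i $ j * x $ i)))
     = (\<Sum>j\<in>-I. x $ j * \<eta> $ j) - (\<Sum>j\<in>-I. \<Sum>i\<in>I. u i $ j * \<eta> $ j * x $ i)"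
    by (simp add: slab_dual_def algebra_simps sum_subtractf sum_distrib_left)
  moreover have "(\<Sum>j\<in>-I. \<Sum>i\<in>I. u i $ j * \<eta> $ j * x $ i) = (\<Sum>i\<in>I. \<Sum>j\<in>-I. u i $ j * \<eta> $ j * x $ i)"
    by (rule sum.swap)
  ultimately show ?thesis by linarith
qed

lemma cis_sum: "finite A \<Longrightarrow> cis (\<Sum>a\<in>A. f a) = (\<Prod>a\<in>A. cis (f a))"
  by (induction A rule: finite_induct) (auto simp: cis_mult[symmetric])

text \<open>In sheared coordinates and their duals the character factorises, so the integral is a
  product of one-dimensional tent transforms. The centre \<open>d\<close> enters only through
  factors of modulus one.\<close>

lemma slab_tent_cis:
  fixes \<eta> :: "real^'n"
  assumes r: "\<And>i. r i > 0"
  shows "integrable lborel (\<lambda>x. complex_of_real (slab_tent I u d r x) * cis (2 * pi * (x \<bullet> \<eta>)))" (is ?int)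
    and "(\<integral>x. complex_of_real (slab_tent I u d r x) * cis (2 * pi * (x \<bullet> \<eta>)) \<partial>lborel)
       = (\<Prod>i\<in>UNIV. cis (2 * pi * slab_dual I u \<eta> i * d i)) *
          complex_of_real (\<Prod>i\<in>UNIV. r i * tent_ft (r i * slab_dual I u \<eta> i))"
proof -
  show int: ?int
  proof -
    have "continuous_on UNIV (\<lambda>x. cis (2 * pi * (x \<bullet> \<eta>)))" by (intro continuous_intros)
    from slab_tent_mult_integrable[where r=r, OF r this] show ?thesis by (simp add: scaleR_conv_of_real)
  qed
  define \<alpha> where "\<alpha> i t = complex_of_real (tent ((t - d i) / r i)) * cis (2 * pi * slab_dual I u \<eta> i * t)" for i t
  have eq: "complex_of_real (slab_tent I u d r x) * cis (2 * pi * (x \<bullet> \<eta>))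
     = (\<Prod>i\<in>I. \<alpha> i (x $ i)) * (\<Prod>j\<in>-I. \<alpha> j (x $ j - (\<Sum>i\<in>I. u i $ j * x $ i)))" for x
  proof -
    have "cis (2 * pi * (x \<bullet> \<eta>)) = cis ((\<Sum>i\<in>I. 2 * pi * slab_dual I u \<eta> i * x $ i) +
       (\<Sum>j\<in>-I. 2 * pi * slab_dual I u \<eta> j * (x $ j - (\<Sum>i\<in>I. u i $ j * x $ i))))"
      by (subst inner_slab_dual[of x \<eta> I u]) (simp only: distrib_left sum_distrib_left mult.assoc)
    also have "\<dots> = (\<Prod>i\<in>I. cis (2 * pi * slab_dual I u \<eta> i * x $ i)) *
       (\<Prod>j\<in>-I. cis (2 * pi * slab_dual I u \<eta> j * (x $ j - (\<Sum>i\<in>I. u i $ j * x $ i))))"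
      by (simp add: cis_mult[symmetric] cis_sum)
    finally show ?thesis
      by (simp add: slab_tent_def \<alpha>_def prod.distrib)
  qed
  have ai: "integrable lborel (\<alpha> i)" for i unfolding \<alpha>_def by (rule tent_scaled_cis(1)[OF r])
  have "(\<integral>x. complex_of_real (slab_tent I u d r x) * cis (2 * pi * (x \<bullet> \<eta>)) \<partial>lborel)
     = (\<Prod>i\<in>UNIV. integral\<^sup>L lborel (\<alpha> i))"
    using int unfolding eq by (intro integral_sheared_prod ai)
  also have "\<dots> = (\<Prod>i\<in>UNIV. cis (2 * pi * slab_dual I u \<eta> i * d i) * complex_of_real (r i * tent_ft (r i * slab_dual I u \<eta> i)))"
    unfolding \<alpha>_def by (intro prod.cong refl tent_scaled_cis(2) r)
  finally show "(\<integral>x. complex_of_real (slab_tent I u d r x) * cis (2 * pi * (x \<bullet> \<eta>)) \<partial>lborel)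
       = (\<Prod>i\<in>UNIV. cis (2 * pi * slab_dual I u \<eta> i * d i)) *
          complex_of_real (\<Prod>i\<in>UNIV. r i * tent_ft (r i * slab_dual I u \<eta> i))"
    by (simp add: prod.distrib)
qed

definition expsum :: "'a set \<Rightarrow> ('a \<Rightarrow> real^'n) \<Rightarrow> real^'n \<Rightarrow> complex" where
  "expsum S f x = (\<Sum>a\<in>S. cis (2 * pi * (x \<bullet> f a)))"

lemma continuous_on_expsum [continuous_intros]: "continuous_on X (expsum S f)"
  unfolding expsum_def by (intro continuous_intros)

lemma expsum_norm_sq:
  "complex_of_real ((cmod (expsum S f x))\<^sup>2) = (\<Sum>a\<in>S. \<Sum>b\<in>S. cis (2 * pi * (x \<bullet> (f a - f b))))"
proof -
  have "complex_of_real ((cmod (expsum S f x))\<^sup>2) = expsum S f x * cnj (expsum S f x)"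
    by (rule complex_norm_square)
  also have "\<dots> = (\<Sum>a\<in>S. \<Sum>b\<in>S. cis (2 * pi * (x \<bullet> f a)) * cis (- (2 * pi * (x \<bullet> f b))))"
    by (simp add: expsum_def sum_product cis_cnj)
  finally show ?thesis by (simp add: cis_mult inner_diff_right algebra_simps)
qed

text \<open>The centre \<open>d\<close> is gone from the right-hand side, since taking absolute
  values removes its phases. One bound therefore serves all translates of a tube, which is what the
  supremum over tubes requires.\<close>

lemma integral_slab_tent_expsum_le:
  assumes r: "\<And>i. r i > 0"
  shows "(\<integral>x. slab_tent I u d r x * (cmod (expsum S f x))\<^sup>2 \<partial>lborel)
     \<le> (\<Sum>a\<in>S. \<Sum>b\<in>S. \<Prod>i\<in>UNIV. r i * tent_ft (r i * slab_dual I u (f a - f b) i))"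
proof -
  have "complex_of_real (\<integral>x. slab_tent I u d r x * (cmod (expsum S f x))\<^sup>2 \<partial>lborel)
     = (\<integral>x. complex_of_real (slab_tent I u d r x * (cmod (expsum S f x))\<^sup>2) \<partial>lborel)"
    by (rule integral_complex_of_real[symmetric])
  also have "\<dots> = (\<integral>x. (\<Sum>a\<in>S. \<Sum>b\<in>S. complex_of_real (slab_tent I u d r x) * cis (2 * pi * (x \<bullet> (f a - f b)))) \<partial>lborel)"
    by (simp add: expsum_norm_sq sum_distrib_left flip: of_real_power)
  also have "\<dots> = (\<Sum>a\<in>S. \<Sum>b\<in>S. (\<integral>x. complex_of_real (slab_tent I u d r x) * cis (2 * pi * (x \<bullet> (f a - f b))) \<partial>lborel))"
    by (subst Bochner_Integration.integral_sum, (intro Bochner_Integration.integrable_sum slab_tent_cis(1) r),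
        intro sum.cong refl Bochner_Integration.integral_sum slab_tent_cis(1) r)
  finally have eq: "complex_of_real (\<integral>x. slab_tent I u d r x * (cmod (expsum S f x))\<^sup>2 \<partial>lborel) = \<dots>" .
  have "(\<integral>x. slab_tent I u d r x * (cmod (expsum S f x))\<^sup>2 \<partial>lborel)
    \<le> cmod (complex_of_real (\<integral>x. slab_tent I u d r x * (cmod (expsum S f x))\<^sup>2 \<partial>lborel))" by simp
  also have "\<dots> \<le> (\<Sum>a\<in>S. \<Sum>b\<in>S. cmod (\<integral>x. complex_of_real (slab_tent I u d r x) * cis (2 * pi * (x \<bullet> (f a - f b))) \<partial>lborel))"
    unfolding eq by (intro order_trans[OF norm_sum] sum_mono norm_sum)
  also have "\<dots> = (\<Sum>a\<in>S. \<Sum>b\<in>S. \<Prod>i\<in>UNIV. r i * tent_ft (r i * slab_dual I u (f a - f b) i))"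
    using r tent_ft_nonneg by (subst slab_tent_cis(2)[OF r])
      (simp add: norm_mult prod_norm[symmetric] abs_prod abs_mult less_imp_le)
  finally show ?thesis .
qed

section \<open>Resonances of integer combinations\<close>

text \<open>Polymorphic in the scalars, so that the same combination can be formed from integer
  vectors, where reduction modulo a prime is exact, and from their real images, where tubes are
  tested.\<close>

fun comb :: "int list \<Rightarrow> ('a::comm_ring_1^'n) list \<Rightarrow> 'a^'n" where
  "comb (a # as) (v # vs) = of_int a *s v + comb as vs"
| "comb [] vs = 0"
| "comb as [] = 0"

definition exps :: "nat \<Rightarrow> nat \<Rightarrow> int list set" where
  "exps A L = {as. set as \<subseteq> {0..<int A} \<and> length as = L}"

text \<open>The list \<open>vs\<close> holds the generators already exposed and \<open>v\<close> is
  the new one. The coefficient \<open>d\<close> must be nonzero, so that the condition really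
  restricts \<open>v\<close>; this is what makes it improbable for each fixed
  \<open>vs\<close>.\<close>

definition resonant :: "'n set \<Rightarrow> ('n \<Rightarrow> real^'n) \<Rightarrow> real \<Rightarrow> nat \<Rightarrow> real^'n \<Rightarrow> (real^'n) list \<Rightarrow> bool" where
  "resonant I u \<delta> A v vs \<longleftrightarrow> (\<exists>d ds. d \<noteq> 0 \<and> \<bar>d\<bar> < int A \<and> length ds = length vs \<and>
     (\<forall>x\<in>set ds. \<bar>x\<bar> < int A) \<and> (\<forall>i\<in>I. \<bar>u i \<bullet> comb (d # ds) (v # vs)\<bar> \<le> \<delta>))"

text \<open>The list is read from its end: every entry is tested against the entries behind it,
  which corresponds to exposing generators by consing.\<close>

fun count_along :: "('a \<Rightarrow> 'a list \<Rightarrow> bool) \<Rightarrow> 'a list \<Rightarrow> nat" where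
  "count_along B [] = 0"
| "count_along B (v # vs) = (if B v vs then 1 else 0) + count_along B vs"

lemma card_exps: "card (exps A L) = A ^ L" and finite_exps: "finite (exps A L)"
  using card_lists_length_eq[of "{0..<int A}" L] finite_lists_length_eq[of "{0..<int A}" L]
  by (simp_all add: exps_def)

lemma comb_diff:
  "length as = length vs \<Longrightarrow> length bs = length vs \<Longrightarrow>
     comb as vs - comb bs vs = comb (map2 (-) as bs) vs"
proof (induction vs arbitrary: as bs)
  case Nil then show ?case by simp
next
  case (Cons v vs)
  then obtain a as' b bs' where "as = a # as'" "bs = b # bs'"
    by (cases as; cases bs) auto
  with Cons.prems Cons.IH[of as' bs', symmetric] show ?case
    by (simp add: vec_eq_iff algebra_simps)
qed

lemma map2_diff_bound:
  assumes "as \<in> exps A L" "bs \<in> exps A L"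
  shows "length (map2 (-) as bs) = L" "\<forall>x\<in>set (map2 (-) as bs). \<bar>x\<bar> < int A"
proof -
  show "length (map2 (-) as bs) = L" using assms by (simp add: exps_def)
  show "\<forall>x\<in>set (map2 (-) as bs). \<bar>x\<bar> < int A"
  proof
    fix x assume "x \<in> set (map2 (-) as bs)"
    then obtain a b where ab: "(a, b) \<in> set (zip as bs)" "x = a - b" by auto
    from set_zip_leftD[OF ab(1)] set_zip_rightD[OF ab(1)] assms
    have "a \<in> {0..<int A}" "b \<in> {0..<int A}" by (auto simp: exps_def)
    with ab show "\<bar>x\<bar> < int A" by auto
  qed
qed

text \<open>If the head generator is not resonant with its tail, two close exponents must have the
  same leading coefficient, as their difference would otherwise be a resonance; nothing is lost in
  passing to the tail. Each resonance costs at most a factor \<open>A\<close> for the choice of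
  leading coefficient, and each vector of \<open>E\<close> another one.\<close>

lemma card_close_exps_le:
  fixes u :: "'n \<Rightarrow> real^'n"
  assumes "S \<subseteq> exps A (length (vs @ E))"
    and "\<And>a b i. a \<in> S \<Longrightarrow> b \<in> S \<Longrightarrow> i \<in> I \<Longrightarrow> \<bar>u i \<bullet> (comb a (vs @ E) - comb b (vs @ E))\<bar> \<le> \<delta>"
  shows "card S \<le> A ^ (count_along (\<lambda>v ws. resonant I u \<delta> A v (ws @ E)) vs + length E)"
  using assms
proof (induction vs arbitrary: S)
  case Nil
  then show ?case using card_mono[OF finite_exps Nil(1)] by (simp add: card_exps)
next
  case (Cons v vs)
  let ?c = "count_along (\<lambda>v ws. resonant I u \<delta> A v (ws @ E)) vs + length E"
  define T where "T h = {as. h # as \<in> S}" for h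
  have Tsub: "T h \<subseteq> exps A (length (vs @ E))" for h
    using Cons.prems(1) by (fastforce simp: T_def exps_def)
  have T: "card (T h) \<le> A ^ ?c" for h
  proof (rule Cons.IH[OF Tsub])
    fix a b i assume "a \<in> T h" "b \<in> T h" "i \<in> I"
    then show "\<bar>u i \<bullet> (comb a (vs @ E) - comb b (vs @ E))\<bar> \<le> \<delta>"
      using Cons.prems(2)[of "h # a" "h # b" i] by (simp add: T_def)
  qed
  have Tfin: "finite (T h)" for h using Tsub finite_exps finite_subset by blast
  have shape: "\<exists>h as. h \<in> {0..<int A} \<and> as \<in> T h \<and> x = h # as" if "x \<in> S" for x
    using that Cons.prems(1) by (cases x) (auto simp: exps_def T_def)
  show ?case
  proof (cases "resonant I u \<delta> A v (vs @ E)")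
    case True
    have "S \<subseteq> (\<Union>h\<in>{0..<int A}. (#) h ` T h)" using shape by blast
    then have "card S \<le> card (\<Union>h\<in>{0..<int A}. (#) h ` T h)" using Tfin by (intro card_mono) auto
    also have "\<dots> \<le> (\<Sum>h\<in>{0..<int A}. card ((#) h ` T h))" by (rule card_UN_le) simp
    also have "\<dots> \<le> (\<Sum>h\<in>{0..<int A}. A ^ ?c)"
      using card_image_le[OF Tfin] T order_trans by (intro sum_mono) blast
    also have "\<dots> = A ^ Suc ?c" by simp
    finally show ?thesis using True by simp
  next
    case False
    have heads: "h = h'" if x: "h # as \<in> S" "h' # bs \<in> S" for h h' as bs
    proof (rule ccontr)
      assume ne: "h \<noteq> h'"
      have ex: "h # as \<in> exps A (length ((v # vs) @ E))" "h' # bs \<in> exps A (length ((v # vs) @ E))"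
        using x Cons.prems(1) by auto
      then have ex': "as \<in> exps A (length (vs @ E))" "bs \<in> exps A (length (vs @ E))"
        and hh: "h \<in> {0..<int A}" "h' \<in> {0..<int A}" by (auto simp: exps_def)
      have eq: "comb (h # as) ((v # vs) @ E) - comb (h' # bs) ((v # vs) @ E)
          = comb ((h - h') # map2 (-) as bs) (v # (vs @ E))"
        using comb_diff[of "h # as" "(v # vs) @ E" "h' # bs"] ex by (simp add: exps_def del: comb.simps)
      have "\<forall>i\<in>I. \<bar>u i \<bullet> comb ((h - h') # map2 (-) as bs) (v # (vs @ E))\<bar> \<le> \<delta>"
        using Cons.prems(2)[OF x] unfolding eq by blast
      then have "resonant I u \<delta> A v (vs @ E)"
        unfolding resonant_def using ne hh map2_diff_bound[OF ex']
        by (intro exI[of _ "h - h'"] exI[of _ "map2 (-) as bs"]) auto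
      with False show False by simp
    qed
    have "card S \<le> A ^ ?c"
    proof (cases "S = {}")
      case False
      then obtain x where "x \<in> S" by auto
      from shape[OF this] obtain h as where h: "h # as \<in> S" by (auto simp: T_def)
      have "S \<subseteq> (#) h ` T h"
      proof
        fix y assume "y \<in> S"
        from shape[OF this] obtain h' bs where y: "y = h' # bs" "h' # bs \<in> S" by (auto simp: T_def)
        with heads[OF h y(2)] show "y \<in> (#) h ` T h" by (auto simp: T_def)
      qed
      then have "card S \<le> card ((#) h ` T h)" using Tfin by (intro card_mono) auto
      also have "\<dots> \<le> card (T h)" using Tfin by (rule card_image_le)
      finally show ?thesis using T[of h] by simp
    qed simp
    with False show ?thesis by simp
  qed
qed

text \<open>There are at most \<open>2 ^ D\<close> sets of positions for the bad entries, and by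
  successive exposure each set of \<open>q\<close> positions is bad with probability at most
  \<open>\<beta> ^ q\<close>. The induction splits on the head: the tail has \<open>q\<close> bad
  entries, or it has \<open>q - 1\<close> and the head is bad.\<close>

lemma card_count_along_ge:
  fixes X :: "'a set" and \<beta> :: real
  assumes X: "finite X" and \<beta>: "0 \<le> \<beta>"
    and B: "\<And>vs. set vs \<subseteq> X \<Longrightarrow> length vs < D \<Longrightarrow> real (card {v\<in>X. B v vs}) \<le> \<beta> * card X"
  shows "real (card {vs. set vs \<subseteq> X \<and> length vs = D \<and> q \<le> count_along B vs}) \<le> 2 ^ D * \<beta> ^ q * real (card X) ^ D"
  using B
proof (induction D arbitrary: q)
  case 0
  show ?case
  proof (cases q)
    case 0
    have "{vs. set vs \<subseteq> X \<and> length vs = 0 \<and> q \<le> count_along B vs} = {[]}" using 0 by auto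
    then show ?thesis using 0 by simp
  next
    case (Suc q')
    have "{vs. set vs \<subseteq> X \<and> length vs = 0 \<and> q \<le> count_along B vs} = {}" using Suc by auto
    then show ?thesis using \<beta> by (simp only: card.empty) simp
  qed
next
  case (Suc D)
  define L where "L q = {vs. set vs \<subseteq> X \<and> length vs = D \<and> q \<le> count_along B vs}" for q
  have Lfin: "finite (L q)" for q
    by (rule finite_subset[OF _ finite_lists_length_eq[OF X, of D]]) (auto simp: L_def)
  have IH: "real (card (L q)) \<le> 2 ^ D * \<beta> ^ q * real (card X) ^ D" for q
    unfolding L_def using Suc.prems by (intro Suc.IH) auto
  let ?S = "{vs. set vs \<subseteq> X \<and> length vs = Suc D \<and> q \<le> count_along B vs}"
  have sub: "?S \<subseteq> (\<lambda>(v, vs). v # vs) ` (X \<times> L q) \<union> (\<lambda>(vs, v). v # vs) ` (SIGMA vs:L (q - 1). {v\<in>X. B v vs})"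
  proof
    fix x assume x: "x \<in> ?S"
    then obtain v vs where "x = v # vs" by (cases x) auto
    with x show "x \<in> (\<lambda>(v, vs). v # vs) ` (X \<times> L q) \<union> (\<lambda>(vs, v). v # vs) ` (SIGMA vs:L (q - 1). {v\<in>X. B v vs})"
      by (cases "B v vs") (auto simp: L_def image_iff split: if_splits)
  qed
  have c1: "real (card ((\<lambda>(v, vs). v # vs) ` (X \<times> L q))) \<le> 2 ^ D * \<beta> ^ q * real (card X) ^ Suc D"
  proof -
    have "card ((\<lambda>(v, vs). v # vs) ` (X \<times> L q)) \<le> card (X \<times> L q)"
      using X Lfin by (intro card_image_le) auto
    then have "real (card ((\<lambda>(v, vs). v # vs) ` (X \<times> L q))) \<le> real (card X) * real (card (L q))"
      by (simp add: card_cartesian_product flip: of_nat_mult)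
    also have "\<dots> \<le> real (card X) * (2 ^ D * \<beta> ^ q * real (card X) ^ D)"
      by (intro mult_left_mono IH) auto
    finally show ?thesis by (simp add: algebra_simps)
  qed
  show ?case
  proof (cases q)
    \<comment> \<open>Here \<open>q - 1\<close> is again 0, so counting the second family would
      bring an extra factor \<open>\<beta>\<close>. The first family alone covers
      everything.\<close>
    case 0
    have "?S \<subseteq> (\<lambda>(v, vs). v # vs) ` (X \<times> L q)"
    proof
      fix x assume x: "x \<in> ?S"
      then obtain v vs where "x = v # vs" by (cases x) auto
      with x 0 show "x \<in> (\<lambda>(v, vs). v # vs) ` (X \<times> L q)" by (auto simp: L_def image_iff)
    qed
    then have "card ?S \<le> card ((\<lambda>(v, vs). v # vs) ` (X \<times> L q))" using X Lfin by (intro card_mono) auto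
    then have "real (card ?S) \<le> 2 ^ D * \<beta> ^ q * real (card X) ^ Suc D" using c1 by linarith
    also have "\<dots> \<le> 2 ^ Suc D * \<beta> ^ q * real (card X) ^ Suc D"
      using \<beta> by (intro mult_right_mono) auto
    finally show ?thesis .
  next
    case (Suc q')
    have "card ((\<lambda>(vs, v). v # vs) ` (SIGMA vs:L (q - 1). {v\<in>X. B v vs})) \<le> card (SIGMA vs:L (q - 1). {v\<in>X. B v vs})"
      using X Lfin by (intro card_image_le) auto
    also have "\<dots> = (\<Sum>vs\<in>L (q - 1). card {v\<in>X. B v vs})"
      using X Lfin by (intro card_SigmaI) auto
    finally have "real (card ((\<lambda>(vs, v). v # vs) ` (SIGMA vs:L (q - 1). {v\<in>X. B v vs}))) \<le> (\<Sum>vs\<in>L (q - 1). real (card {v\<in>X. B v vs}))"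
      by (simp flip: of_nat_sum)
    also have "\<dots> \<le> (\<Sum>vs\<in>L (q - 1). \<beta> * card X)"
      using Suc.prems by (intro sum_mono) (auto simp: L_def)
    also have "\<dots> = \<beta> * card X * card (L q')" using Suc by simp
    also have "\<dots> \<le> \<beta> * card X * (2 ^ D * \<beta> ^ q' * real (card X) ^ D)"
      using \<beta> by (intro mult_left_mono IH) auto
    also have "\<dots> = 2 ^ D * \<beta> ^ q * real (card X) ^ Suc D" using Suc by simp
    finally have c2: "real (card ((\<lambda>(vs, v). v # vs) ` (SIGMA vs:L (q - 1). {v\<in>X. B v vs}))) \<le> 2 ^ D * \<beta> ^ q * real (card X) ^ Suc D" .
    have "card ?S \<le> card ((\<lambda>(v, vs). v # vs) ` (X \<times> L q) \<union> (\<lambda>(vs, v). v # vs) ` (SIGMA vs:L (q - 1). {v\<in>X. B v vs}))"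
      using X Lfin by (intro card_mono[OF _ sub]) auto
    also have "\<dots> \<le> card ((\<lambda>(v, vs). v # vs) ` (X \<times> L q)) + card ((\<lambda>(vs, v). v # vs) ` (SIGMA vs:L (q - 1). {v\<in>X. B v vs}))"
      by (rule card_Un_le)
    finally show ?thesis using c1 c2 by simp
  qed
qed

section \<open>Grid vectors that create a resonance\<close>

lemma card_vec_product:
  fixes S :: "'n::finite \<Rightarrow> 'a set"
  assumes "\<And>i. finite (S i)"
  shows "finite {v::'a^'n. \<forall>i. v $ i \<in> S i}" "card {v::'a^'n. \<forall>i. v $ i \<in> S i} = (\<Prod>i\<in>UNIV. card (S i))"
proof -
  have b: "bij_betw vec_nth {v::'a^'n. \<forall>i. v $ i \<in> S i} (PiE UNIV S)"
    by (rule bij_betw_byWitness[where f'=vec_lambda]) auto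
  show "finite {v::'a^'n. \<forall>i. v $ i \<in> S i}" using bij_betw_finite[OF b] finite_PiE[of UNIV S] assms by auto
  show "card {v::'a^'n. \<forall>i. v $ i \<in> S i} = (\<Prod>i\<in>UNIV. card (S i))"
    using bij_betw_same_card[OF b] by (simp add: card_PiE)
qed

definition grid :: "nat \<Rightarrow> (int^'n) set" where
  "grid p = {v. \<forall>i. v $ i \<in> {0..<int p}}"

lemma finite_grid: "finite (grid p)" and card_grid: "card (grid p :: (int^'n) set) = p ^ CARD('n)"
  using card_vec_product[where S="\<lambda>_. {0..<int p}"] by (auto simp: grid_def)

lemma prod_if_card:
  fixes a b :: nat
  shows "(\<Prod>i\<in>UNIV. if i \<in> I then a else b) = a ^ card I * b ^ card (- I :: 'n::finite set)"
  by (simp add: prod.If_cases)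

text \<open>Each fibre over the coordinates outside \<open>I\<close> lies in a box with
  \<open>m + 1\<close> integers per coordinate of \<open>I\<close>. The saving per pivot coordinate
  is thus \<open>(m + 1) / p\<close>.\<close>

lemma card_vec_fibered_le:
  fixes Z :: "(int^'n) set"
  assumes Z: "Z \<subseteq> grid p"
    and m: "\<And>v v' i. v \<in> Z \<Longrightarrow> v' \<in> Z \<Longrightarrow> (\<And>j. j \<notin> I \<Longrightarrow> v $ j = v' $ j) \<Longrightarrow> i \<in> I \<Longrightarrow> \<bar>v $ i - v' $ i\<bar> \<le> int m"
  shows "card Z \<le> (m + 1) ^ card I * p ^ card (- I)"
proof -
  define \<rho> where "\<rho> v = (\<chi> j. if j \<in> I then 0 else v $ j)" for v :: "int^'n"
  have Zfin: "finite Z" using Z finite_grid finite_subset by blast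
  have fib: "card {v\<in>Z. \<rho> v = g} \<le> (m + 1) ^ card I" for g
  proof -
    let ?F = "{v\<in>Z. \<rho> v = g}"
    have Ffin: "finite ?F" using Zfin by simp
    define mi where "mi i = Min ((\<lambda>v. v $ i) ` ?F)" for i
    have "?F \<subseteq> {v. \<forall>i. v $ i \<in> (if i \<in> I then {mi i..mi i + int m} else {g $ i})}"
    proof (safe)
      fix v i assume v: "v \<in> Z" "g = \<rho> v"
      show "v $ i \<in> (if i \<in> I then {mi i..mi i + int m} else {\<rho> v $ i})"
      proof (cases "i \<in> I")
        case True
        have ne: "(\<lambda>v. v $ i) ` ?F \<noteq> {}" "finite ((\<lambda>v. v $ i) ` ?F)" using v Ffin by auto
        from Min_in[OF ne(2,1)] obtain v' where v': "v' \<in> Z" "\<rho> v' = g" "mi i = v' $ i" unfolding mi_def by auto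
        have "mi i \<le> v $ i" unfolding mi_def using v ne by (intro Min_le) auto
        moreover have "\<bar>v $ i - v' $ i\<bar> \<le> int m"
        proof (rule m[OF v(1) v'(1) _ True])
          fix j assume "j \<notin> I"
          moreover have "\<rho> v $ j = \<rho> v' $ j" using v v' by simp
          ultimately show "v $ j = v' $ j" by (simp add: \<rho>_def)
        qed
        ultimately show ?thesis using True v' by auto
      next
        case False then show ?thesis by (simp add: \<rho>_def)
      qed
    qed
    then have "card ?F \<le> card {v::int^'n. \<forall>i. v $ i \<in> (if i \<in> I then {mi i..mi i + int m} else {g $ i})}"
      by (intro card_mono card_vec_product(1)) auto
    also have "\<dots> = (\<Prod>i\<in>UNIV. card (if i \<in> I then {mi i..mi i + int m} else {g $ i}))"
      by (rule card_vec_product(2)) auto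
    also have "\<dots> = (\<Prod>i\<in>UNIV. if i \<in> I then m + 1 else 1)" by (intro prod.cong) auto
    also have "\<dots> = (m + 1) ^ card I" by (simp only: prod_if_card) simp
    finally show ?thesis .
  qed
  have rhoZ: "card (\<rho> ` Z) \<le> p ^ card (- I)"
  proof -
    have "\<rho> ` Z \<subseteq> {v. \<forall>i. v $ i \<in> (if i \<in> I then {0} else {0..<int p})}"
      using Z by (auto simp: \<rho>_def grid_def)
    then have "card (\<rho> ` Z) \<le> card {v::int^'n. \<forall>i. v $ i \<in> (if i \<in> I then {0} else {0..<int p})}"
      by (intro card_mono card_vec_product(1)) auto
    also have "\<dots> = (\<Prod>i\<in>UNIV. card (if i \<in> I then {0} else {0..<int p}))"
      by (rule card_vec_product(2)) auto
    also have "\<dots> = (\<Prod>i\<in>UNIV. if i \<in> I then 1 else p)" by (intro prod.cong) auto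
    also have "\<dots> = p ^ card (-I)" by (simp only: prod_if_card) simp
    finally show ?thesis .
  qed
  have "Z = (\<Union>g\<in>\<rho> ` Z. {v\<in>Z. \<rho> v = g})" by auto
  then have "card Z = card (\<Union>g\<in>\<rho> ` Z. {v\<in>Z. \<rho> v = g})" by simp
  also have "\<dots> \<le> (\<Sum>g\<in>\<rho> ` Z. card {v\<in>Z. \<rho> v = g})" using Zfin by (intro card_UN_le) auto
  also have "\<dots> \<le> (\<Sum>g\<in>\<rho> ` Z. (m + 1) ^ card I)" by (intro sum_mono fib)
  also have "\<dots> \<le> (m + 1) ^ card I * p ^ card (- I)" using rhoZ by simp
  finally show ?thesis .
qed

text \<open>Congruence modulo \<open>p\<close> of integer vectors turns into congruence of their
  images modulo the integer lattice, and the grid goes to a mesh of step \<open>1 / p\<close> in the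
  unit cube.\<close>

definition emb :: "nat \<Rightarrow> int^'n \<Rightarrow> real^'n" where
  "emb p v = (\<chi> i. real_of_int (v $ i) / real p)"

definition echelon :: "'n set \<Rightarrow> ('n \<Rightarrow> real^'n) \<Rightarrow> bool" where
  "echelon I u \<longleftrightarrow> (\<forall>i\<in>I. \<forall>i'\<in>I. u i $ i' = (if i' = i then 1 else 0))"

text \<open>Fix the coefficients. In an echelon system, when only the pivot coordinates of
  \<open>v\<close> move, the \<open>i\<close>-th functional moves by the leading coefficient times
  the change of \<open>v $ i / p\<close>. Since that coefficient is a nonzero integer, every pivot
  coordinate is pinned to an interval of length \<open>2 * \<delta>\<close>. The first factor is the
  union bound over the coefficient lists.\<close>

lemma card_resonant_le:
  fixes u :: "'n::finite \<Rightarrow> real^'n"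
  assumes ech: "echelon I u" and \<delta>: "1 \<le> \<delta> * real p" and p: "0 < p" and A: "1 \<le> A"
  shows "real (card {v\<in>grid p. resonant I u \<delta> A (emb p v) vs})
     \<le> real (2 * A) ^ (1 + length vs) * (3 * \<delta>) ^ card I * real (card (grid p :: (int^'n) set))"
proof -
  have \<delta>0: "0 < \<delta>" using \<delta> p by (metis less_le_trans of_nat_0_less_iff zero_less_mult_pos2 zero_less_one)
  define DS where "DS = {x. set x \<subseteq> {d. \<bar>d\<bar> < int A} \<and> length x = 1 + length vs}"
  have dset: "{d. \<bar>d\<bar> < int A} = {- int A<..<int A}" by auto
  have cd: "card {d. \<bar>d\<bar> < int A} \<le> 2 * A" unfolding dset using A by simp
  have fd: "finite {d. \<bar>d\<bar> < int A}" unfolding dset by simp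
  have DSfin: "finite DS" unfolding DS_def by (rule finite_lists_length_eq[OF fd])
  have "card DS = card {d. \<bar>d\<bar> < int A} ^ (1 + length vs)"
    unfolding DS_def by (rule card_lists_length_eq[OF fd])
  also have "\<dots> \<le> (2 * A) ^ (1 + length vs)" using cd by (intro power_mono) auto
  finally have cDS: "card DS \<le> (2 * A) ^ (1 + length vs)" .
  define Z where "Z x = {v\<in>grid p. hd x \<noteq> 0 \<and> (\<forall>i\<in>I. \<bar>u i \<bullet> comb x (emb p v # vs)\<bar> \<le> \<delta>)}" for x
  have Zsub: "Z x \<subseteq> grid p" for x by (auto simp: Z_def)
  have sub: "{v\<in>grid p. resonant I u \<delta> A (emb p v) vs} \<subseteq> (\<Union>x\<in>DS. Z x)"
  proof safe
    fix v assume v: "v \<in> grid p" "resonant I u \<delta> A (emb p v) vs"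
    then obtain d ds where d: "d \<noteq> 0" "\<bar>d\<bar> < int A" "length ds = length vs" "\<forall>x\<in>set ds. \<bar>x\<bar> < int A"
      "\<forall>i\<in>I. \<bar>u i \<bullet> comb (d # ds) (emb p v # vs)\<bar> \<le> \<delta>" unfolding resonant_def by blast
    then have "d # ds \<in> DS" "v \<in> Z (d # ds)" using v by (auto simp: DS_def Z_def)
    then show "v \<in> (\<Union>x\<in>DS. Z x)" by blast
  qed
  \<comment> \<open>The number of grid steps in an interval of length \<open>2 * \<delta>\<close>.
    The hypothesis \<open>1 \<le> \<delta> * real p\<close> absorbs the \<open>+ 1\<close> of the
    point count, which is why 3 replaces 2.\<close>
  define m where "m = nat \<lfloor>2 * \<delta> * p\<rfloor>"
  have cZ: "card (Z x) \<le> (m + 1) ^ card I * p ^ card (- I)" if xD: "x \<in> DS" for x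
  proof (rule card_vec_fibered_le[OF Zsub])
    fix v v' i assume v: "v \<in> Z x" "v' \<in> Z x" and eq: "\<And>j. j \<notin> I \<Longrightarrow> v $ j = v' $ j" and i: "i \<in> I"
    obtain d ds where x: "x = d # ds" using xD by (cases x) (auto simp: DS_def)
    have d0: "d \<noteq> 0" using v x by (auto simp: Z_def)
    have "u i \<bullet> (emb p v - emb p v') = (\<Sum>j\<in>UNIV. u i $ j * ((real_of_int (v $ j) - real_of_int (v' $ j)) / p))"
      by (simp add: inner_vec_def emb_def diff_divide_distrib)
    also have "\<dots> = (\<Sum>j\<in>UNIV. if j = i then (real_of_int (v $ j) - real_of_int (v' $ j)) / p else 0)"
    proof (intro sum.cong refl)
      fix j show "u i $ j * ((real_of_int (v $ j) - real_of_int (v' $ j)) / p)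
         = (if j = i then (real_of_int (v $ j) - real_of_int (v' $ j)) / p else 0)"
        using ech eq[of j] i by (cases "j \<in> I") (auto simp: echelon_def)
    qed
    also have "\<dots> = (real_of_int (v $ i) - real_of_int (v' $ i)) / p" by simp
    finally have e1: "u i \<bullet> (emb p v - emb p v') = (real_of_int (v $ i) - real_of_int (v' $ i)) / p" .
    have "u i \<bullet> comb x (emb p v # vs) - u i \<bullet> comb x (emb p v' # vs) = real_of_int d * (u i \<bullet> (emb p v - emb p v'))"
      by (simp add: x scalar_mult_eq_scaleR inner_add_right inner_diff_right algebra_simps)
    moreover have "\<bar>u i \<bullet> comb x (emb p v # vs)\<bar> \<le> \<delta>" "\<bar>u i \<bullet> comb x (emb p v' # vs)\<bar> \<le> \<delta>"
      using v i by (auto simp: Z_def)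
    ultimately have "\<bar>real_of_int d * (u i \<bullet> (emb p v - emb p v'))\<bar> \<le> 2 * \<delta>" by linarith
    moreover have "1 * \<bar>u i \<bullet> (emb p v - emb p v')\<bar> \<le> \<bar>real_of_int d\<bar> * \<bar>u i \<bullet> (emb p v - emb p v')\<bar>"
      using d0 by (intro mult_right_mono) auto
    ultimately have "\<bar>u i \<bullet> (emb p v - emb p v')\<bar> \<le> 2 * \<delta>" by (simp add: abs_mult)
    then have "\<bar>real_of_int (v $ i) - real_of_int (v' $ i)\<bar> \<le> 2 * \<delta> * p"
      unfolding e1 using p by (simp add: field_simps)
    then have "\<bar>v $ i - v' $ i\<bar> \<le> \<lfloor>2 * \<delta> * p\<rfloor>" by (simp add: le_floor_iff)
    also have "\<dots> \<le> int m" by (simp add: m_def)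
    finally show "\<bar>v $ i - v' $ i\<bar> \<le> int m" .
  qed
  have m1: "real (m + 1) \<le> 3 * \<delta> * p"
  proof -
    have "real m \<le> 2 * \<delta> * p" unfolding m_def using \<delta>0 by (simp add: of_nat_floor)
    then show ?thesis using \<delta> by simp
  qed
  have n: "card I + card (-I) = CARD('n)" using card_Un_disjoint[of I "-I"] by simp
  have "real (card (Z x)) \<le> (3 * \<delta>) ^ card I * real p ^ CARD('n)" if "x \<in> DS" for x
  proof -
    have "real (card (Z x)) \<le> real (m + 1) ^ card I * real p ^ card (- I)"
      using cZ[OF that] by (metis of_nat_le_iff of_nat_mult of_nat_power)
    also have "\<dots> \<le> (3 * \<delta> * p) ^ card I * real p ^ card (-I)"
      using m1 by (intro mult_right_mono power_mono) auto
    also have "\<dots> = (3 * \<delta>) ^ card I * real p ^ CARD('n)"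
      by (simp add: power_mult_distrib n[symmetric] power_add)
    finally show ?thesis .
  qed note cZ' = this
  have Zfin: "finite (Z x)" for x using Zsub finite_grid finite_subset by blast
  have "card {v\<in>grid p. resonant I u \<delta> A (emb p v) vs} \<le> card (\<Union>x\<in>DS. Z x)"
    using DSfin Zfin by (intro card_mono[OF _ sub]) auto
  also have "\<dots> \<le> (\<Sum>x\<in>DS. card (Z x))" using DSfin by (rule card_UN_le)
  finally have "real (card {v\<in>grid p. resonant I u \<delta> A (emb p v) vs}) \<le> (\<Sum>x\<in>DS. real (card (Z x)))"
    by (simp flip: of_nat_sum)
  also have "\<dots> \<le> (\<Sum>x\<in>DS. (3 * \<delta>) ^ card I * real p ^ CARD('n))" by (intro sum_mono cZ')
  also have "\<dots> = real (card DS) * ((3 * \<delta>) ^ card I * real p ^ CARD('n))" by simp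
  also have "\<dots> \<le> real (2 * A) ^ (1 + length vs) * ((3 * \<delta>) ^ card I * real p ^ CARD('n))"
  proof (intro mult_right_mono)
    show "real (card DS) \<le> real (2 * A) ^ (1 + length vs)"
      using cDS by (metis of_nat_le_iff of_nat_power)
  qed (use \<delta>0 in auto)
  finally show ?thesis by (simp add: card_grid)
qed

section \<open>The second moment of the number of hits\<close>

definition vmod :: "nat \<Rightarrow> int^'n \<Rightarrow> int^'n" where
  "vmod p v = (\<chi> i. v $ i mod int p)"

lemma vmod_add_left: "vmod p (vmod p v + w) = vmod p (v + w)"
  by (simp add: vmod_def vec_eq_iff mod_add_left_eq)

lemma vmod_in_grid: "0 < p \<Longrightarrow> vmod p v \<in> grid p"
  by (simp add: vmod_def grid_def)

lemma vmod_eq_iff: "vmod p v = vmod p w \<longleftrightarrow> (\<forall>i. int p dvd v $ i - w $ i)"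
  by (simp add: vmod_def vec_eq_iff mod_eq_dvd_iff)

lemma grid_dvd_eq:
  assumes "v \<in> grid p" "w \<in> grid p" "\<And>i. int p dvd v $ i - w $ i"
  shows "v = w"
proof -
  have "v $ i = w $ i" for i
  proof -
    have "\<bar>v $ i - w $ i\<bar> < int p" using assms(1,2) by (auto simp: grid_def abs_less_iff dest!: spec[of _ i])
    with assms(3)[of i] have "v $ i - w $ i = 0" by (metis abs_of_nat dvd_imp_le_int linorder_not_le)
    then show ?thesis by simp
  qed
  then show ?thesis by (simp add: vec_eq_iff)
qed

text \<open>Translation permutes the residue classes. Averaged over the free translation, each
  single exponent therefore hits \<open>Y\<close> with the exact proportion
  \<open>card Y / card (grid p)\<close>.\<close>

lemma card_translate_grid:
  assumes p: "0 < p" and Y: "Y \<subseteq> grid p"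
  shows "card {v\<in>grid p. vmod p (v + c) \<in> Y} = card Y"
proof -
  let ?f = "\<lambda>v. vmod p (v + c)"
  have inj: "inj_on ?f (grid p)"
  proof (rule inj_onI)
    fix v w assume "v \<in> grid p" "w \<in> grid p" "?f v = ?f w"
    then show "v = w" using grid_dvd_eq[of v p w] by (simp add: vmod_eq_iff)
  qed
  have surj: "?f ` grid p = grid p"
    using p by (intro endo_inj_surj finite_grid inj) (auto simp: vmod_in_grid)
  have "?f ` {v\<in>grid p. vmod p (v + c) \<in> Y} = ?f ` grid p \<inter> Y" by auto
  then have "?f ` {v\<in>grid p. vmod p (v + c) \<in> Y} = Y" unfolding surj using Y by blast
  moreover have "inj_on ?f {v\<in>grid p. vmod p (v + c) \<in> Y}" by (rule inj_on_subset[OF inj]) auto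
  from card_image[OF this] have "card (?f ` {v\<in>grid p. vmod p (v + c) \<in> Y}) = card {v\<in>grid p. vmod p (v + c) \<in> Y}" .
  ultimately show ?thesis by simp
qed

definition words :: "'a set \<Rightarrow> nat \<Rightarrow> 'a list set" where
  "words X r = {ws. set ws \<subseteq> X \<and> length ws = r}"

lemma finite_words: "finite X \<Longrightarrow> finite (words X r)"
  and card_words: "finite X \<Longrightarrow> card (words X r) = card X ^ r"
  by (auto simp: words_def finite_lists_length_eq card_lists_length_eq)

lemma words_Suc: "words X (Suc r) = (\<lambda>(w, ws). w # ws) ` (X \<times> words X r)"
proof -
  have "x \<in> (\<lambda>(w, ws). w # ws) ` (X \<times> words X r)" if "x \<in> words X (Suc r)" for x
    using that by (cases x) (auto simp: words_def image_iff)
  then show ?thesis by (auto simp: words_def)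
qed

lemma sum_words_Suc:
  "(\<Sum>x\<in>words X (Suc r). f x) = (\<Sum>w\<in>X. \<Sum>ws\<in>words X r. f (w # ws))"
proof -
  have "(\<Sum>x\<in>words X (Suc r). f x) = (\<Sum>(w, ws)\<in>X \<times> words X r. f (w # ws))"
    unfolding words_Suc by (subst sum.reindex) (auto simp: inj_on_def case_prod_unfold)
  then show ?thesis by (simp add: sum.cartesian_product)
qed

text \<open>Pairwise independence, cleared of denominators. Equal leading coefficients are absorbed
  into the translation \<open>v\<close>, which reduces to the tails. Different ones make the pair of
  frequencies an invertible linear function of \<open>(w, v)\<close> modulo \<open>p\<close>, so the
  pairs inject into \<open>Y \<times> Y\<close>.\<close>

lemma pair_count_le:
  fixes Y :: "(int^'n) set"
  assumes p: "prime p" and Y: "Y \<subseteq> grid p" and A: "A \<le> p"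
    and ab: "a \<in> exps A r" "b \<in> exps A r" "a \<noteq> b"
  shows "(\<Sum>ws\<in>words (grid p) r. card {v\<in>grid p. vmod p (v + comb a ws) \<in> Y \<and> vmod p (v + comb b ws) \<in> Y}) * card (grid p :: (int^'n) set)
     \<le> card Y ^ 2 * card (grid p :: (int^'n) set) ^ r"
  using ab
proof (induction r arbitrary: a b)
  case 0
  then show ?case by (simp add: exps_def)
next
  case (Suc r)
  let ?X = "grid p :: (int^'n) set"
  have p0: "0 < p" using p by (simp add: prime_gt_0_nat)
  obtain a0 a' where a: "a = a0 # a'" using Suc.prems by (cases a) (auto simp: exps_def)
  obtain b0 b' where b: "b = b0 # b'" using Suc.prems by (cases b) (auto simp: exps_def)
  have ab': "a' \<in> exps A r" "b' \<in> exps A r" and a0: "a0 \<in> {0..<int A}" and b0: "b0 \<in> {0..<int A}"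
    using Suc.prems by (auto simp: a b exps_def)
  let ?c = "\<lambda>w ws. card {v\<in>?X. vmod p (v + (of_int a0 *s w + comb a' ws)) \<in> Y \<and> vmod p (v + (of_int b0 *s w + comb b' ws)) \<in> Y}"
  have S: "(\<Sum>ws\<in>words ?X (Suc r). card {v\<in>?X. vmod p (v + comb a ws) \<in> Y \<and> vmod p (v + comb b ws) \<in> Y})
      = (\<Sum>w\<in>?X. \<Sum>ws\<in>words ?X r. ?c w ws)"
    unfolding sum_words_Suc by (simp add: a b)
  show ?case
  proof (cases "a0 = b0")
    case True
    then have ne: "a' \<noteq> b'" using Suc.prems a b by auto
    have eq: "?c w ws = card {v\<in>?X. vmod p (v + comb a' ws) \<in> Y \<and> vmod p (v + comb b' ws) \<in> Y}" for w ws
    proof -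
      let ?Y = "{v\<in>?X. vmod p (v + comb a' ws) \<in> Y \<and> vmod p (v + comb b' ws) \<in> Y}"
      have "{v\<in>?X. vmod p (v + (of_int a0 *s w + comb a' ws)) \<in> Y \<and> vmod p (v + (of_int b0 *s w + comb b' ws)) \<in> Y}
         = {v\<in>?X. vmod p (v + of_int a0 *s w) \<in> ?Y}"
        using vmod_in_grid[OF p0] by (auto simp: vmod_add_left True add.assoc)
      then show ?thesis using card_translate_grid[OF p0, of ?Y "of_int a0 *s w"] by simp
    qed
    have "(\<Sum>w\<in>?X. \<Sum>ws\<in>words ?X r. ?c w ws) * card ?X
        = card ?X * ((\<Sum>ws\<in>words ?X r. card {v\<in>?X. vmod p (v + comb a' ws) \<in> Y \<and> vmod p (v + comb b' ws) \<in> Y}) * card ?X)"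
      unfolding eq by simp
    also have "\<dots> \<le> card ?X * (card Y ^ 2 * card ?X ^ r)"
      by (intro mult_left_mono Suc.IH[OF ab' ne]) simp
    finally show ?thesis unfolding S by (simp add: algebra_simps)
  next
    \<comment> \<open>The determinant is \<open>a0 - b0\<close>, nonzero and smaller than
      \<open>p\<close> in absolute value. Primality makes it invertible.\<close>
    case False
    have "(\<Sum>w\<in>?X. ?c w ws) \<le> card Y ^ 2" for ws
    proof -
      let ?T = "SIGMA w:?X. {v\<in>?X. vmod p (v + (of_int a0 *s w + comb a' ws)) \<in> Y \<and> vmod p (v + (of_int b0 *s w + comb b' ws)) \<in> Y}"
      let ?f = "\<lambda>(w, v). (vmod p (v + (of_int a0 *s w + comb a' ws)), vmod p (v + (of_int b0 *s w + comb b' ws)))"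
      have "inj_on ?f ?T"
      proof (rule inj_onI, clarify)
        fix w v w' v'
        assume g: "w \<in> ?X" "v \<in> ?X" "w' \<in> ?X" "v' \<in> ?X"
          and e1: "vmod p (v + (of_int a0 *s w + comb a' ws)) = vmod p (v' + (of_int a0 *s w' + comb a' ws))"
          and e2: "vmod p (v + (of_int b0 *s w + comb b' ws)) = vmod p (v' + (of_int b0 *s w' + comb b' ws))"
        have d1: "int p dvd (v $ i - v' $ i) + a0 * (w $ i - w' $ i)" for i
          using e1 unfolding vmod_eq_iff by (auto simp: algebra_simps dest: spec[of _ i])
        have d2: "int p dvd (v $ i - v' $ i) + b0 * (w $ i - w' $ i)" for i
          using e2 unfolding vmod_eq_iff by (auto simp: algebra_simps dest: spec[of _ i])
        have d3: "int p dvd w $ i - w' $ i" for i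
        proof -
          have "int p dvd (a0 - b0) * (w $ i - w' $ i)"
            using dvd_diff[OF d1[of i] d2[of i]] by (simp add: algebra_simps)
          moreover have "\<not> int p dvd a0 - b0"
          proof
            assume "int p dvd a0 - b0"
            moreover have "\<bar>a0 - b0\<bar> < int p" using a0 b0 A by auto
            ultimately show False using False by (metis abs_of_nat dvd_imp_le_int eq_iff_diff_eq_0 linorder_not_le)
          qed
          ultimately show ?thesis using p by (simp add: prime_dvd_mult_iff)
        qed
        then have w: "w = w'" using g by (intro grid_dvd_eq)
        then have "int p dvd v $ i - v' $ i" for i using d1[of i] by simp
        then have "v = v'" using g by (intro grid_dvd_eq)
        with w show "w = w' \<and> v = v'" by simp
      qed
      moreover have "?f ` ?T \<subseteq> Y \<times> Y" by auto
      moreover have "finite (Y \<times> Y)" using Y finite_grid finite_subset by blast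
      ultimately have "card ?T \<le> card (Y \<times> Y)" by (rule card_inj_on_le)
      moreover have "card ?T = (\<Sum>w\<in>?X. ?c w ws)" using finite_grid by (intro card_SigmaI) auto
      ultimately show ?thesis by (simp add: card_cartesian_product power2_eq_square)
    qed
    then have "(\<Sum>ws\<in>words ?X r. \<Sum>w\<in>?X. ?c w ws) \<le> (\<Sum>ws\<in>words ?X r. card Y ^ 2)" by (intro sum_mono)
    also have "\<dots> = card ?X ^ r * card Y ^ 2" by (simp add: card_words finite_grid)
    finally have "(\<Sum>w\<in>?X. \<Sum>ws\<in>words ?X r. ?c w ws) * card ?X \<le> card ?X ^ r * card Y ^ 2 * card ?X"
      by (subst sum.swap) (rule mult_right_mono, auto)
    then show ?thesis unfolding S by (simp add: algebra_simps)
  qed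
qed

text \<open>Chebyshev's inequality for the number of frequencies that hit \<open>Y\<close>; the free translation \<open>v\<close>
  makes the hits of distinct exponents pairwise independent.\<close>

lemma card_missing_le:
  fixes Y :: "(int^'n) set"
  assumes p: "prime p" and Y: "Y \<subseteq> grid p" and A: "A \<le> p"
  shows "real (card {vs\<in>words (grid p) (Suc r). \<forall>a\<in>exps A r. vmod p (hd vs + comb a (tl vs)) \<notin> Y})
      * (real A ^ r * (real (card Y) / real (card (grid p :: (int^'n) set))))
     \<le> real (card (grid p :: (int^'n) set)) ^ Suc r"
proof -
  let ?X = "grid p :: (int^'n) set"
  have p0: "0 < p" using p by (simp add: prime_gt_0_nat)
  define x where "x = real (card ?X)"
  have x0: "x > 0" using p0 by (simp add: x_def card_grid)
  define y where "y = real (card Y)"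
  define \<mu> where "\<mu> = real A ^ r * (y / x)"
  define N where "N v ws = (\<Sum>a\<in>exps A r. if vmod p (v + comb a ws) \<in> Y then 1 else (0::real))" for v ws
  have cX: "card ?X = p ^ CARD('n)" by (rule card_grid)
  have sumX: "(\<Sum>v\<in>?X. if P v then 1 else (0::real)) = real (card {v\<in>?X. P v})" for P
    using finite_grid[of p] by (subst sum.inter_filter[symmetric]) auto
  have M1: "(\<Sum>ws\<in>words ?X r. \<Sum>v\<in>?X. N v ws) = x ^ Suc r * \<mu>"
  proof -
    have "(\<Sum>v\<in>?X. N v ws) = real A ^ r * y" for ws
    proof -
      have "(\<Sum>v\<in>?X. N v ws) = (\<Sum>a\<in>exps A r. \<Sum>v\<in>?X. if vmod p (v + comb a ws) \<in> Y then 1 else 0)"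
        unfolding N_def by (rule sum.swap)
      also have "\<dots> = (\<Sum>a\<in>exps A r. y)"
        unfolding sumX card_translate_grid[OF p0 Y] y_def ..
      finally show ?thesis by (simp add: card_exps)
    qed
    then show ?thesis using x0 by (simp add: card_words[OF finite_grid] \<mu>_def x_def[symmetric])
  qed
  have M2: "(\<Sum>ws\<in>words ?X r. \<Sum>v\<in>?X. (N v ws)\<^sup>2) \<le> x ^ Suc r * \<mu> + x ^ Suc r * \<mu>\<^sup>2"
  proof -
    let ?P = "\<lambda>a b. \<Sum>ws\<in>words ?X r. \<Sum>v\<in>?X. if vmod p (v + comb a ws) \<in> Y \<and> vmod p (v + comb b ws) \<in> Y then 1 else (0::real)"
    have "(N v ws)\<^sup>2 = (\<Sum>a\<in>exps A r. \<Sum>b\<in>exps A r. if vmod p (v + comb a ws) \<in> Y \<and> vmod p (v + comb b ws) \<in> Y then 1 else 0)" for v ws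
      unfolding N_def power2_eq_square sum_product by (intro sum.cong refl) auto
    then have "(\<Sum>ws\<in>words ?X r. \<Sum>v\<in>?X. (N v ws)\<^sup>2)
      = (\<Sum>ws\<in>words ?X r. \<Sum>v\<in>?X. \<Sum>a\<in>exps A r. \<Sum>b\<in>exps A r. if vmod p (v + comb a ws) \<in> Y \<and> vmod p (v + comb b ws) \<in> Y then 1 else 0)"
      by simp
    also have "\<dots> = (\<Sum>ws\<in>words ?X r. \<Sum>a\<in>exps A r. \<Sum>b\<in>exps A r. \<Sum>v\<in>?X. if vmod p (v + comb a ws) \<in> Y \<and> vmod p (v + comb b ws) \<in> Y then 1 else 0)"
      by (intro sum.cong refl, subst sum.swap, intro sum.cong refl sum.swap)
    also have "\<dots> = (\<Sum>a\<in>exps A r. \<Sum>b\<in>exps A r. ?P a b)"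
      by (subst sum.swap, intro sum.cong refl sum.swap)
    \<comment> \<open>The diagonal produces the mean and the off-diagonal pairs at most the squared
      mean, so the variance is at most the mean.\<close>
    also have "\<dots> \<le> (\<Sum>a\<in>exps A r. \<Sum>b\<in>exps A r. (if a = b then x ^ r * y else 0) + x ^ Suc r * (y / x)\<^sup>2)"
    proof (intro sum_mono)
      fix a b assume ab: "a \<in> exps A r" "b \<in> exps A r"
      show "?P a b \<le> (if a = b then x ^ r * y else 0) + x ^ Suc r * (y / x)\<^sup>2"
      proof (cases "a = b")
        case True
        have "?P a b = (\<Sum>ws\<in>words ?X r. y)"
          using True unfolding sumX y_def by (simp add: card_translate_grid[OF p0 Y])
        also have "\<dots> = x ^ r * y" by (simp add: card_words[OF finite_grid] x_def)
        finally show ?thesis using True x0 by simp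
      next
        case False
        have "?P a b = real (\<Sum>ws\<in>words ?X r. card {v\<in>?X. vmod p (v + comb a ws) \<in> Y \<and> vmod p (v + comb b ws) \<in> Y})"
          unfolding sumX by simp
        also have "\<dots> * x \<le> y\<^sup>2 * x ^ r"
          using of_nat_mono[OF pair_count_le[OF p Y A ab False], where 'a=real] unfolding x_def y_def
          by (simp only: of_nat_mult of_nat_power)
        finally have "?P a b \<le> y\<^sup>2 * x ^ r / x" using x0 by (simp add: field_simps)
        also have "\<dots> = x ^ Suc r * (y / x)\<^sup>2" using x0 by (simp add: power2_eq_square)
        finally show ?thesis using False by simp
      qed
    qed
    also have "\<dots> = real A ^ r * (x ^ r * y) + real A ^ r * (real A ^ r * (x ^ Suc r * (y / x)\<^sup>2))"
      by (simp add: sum.distrib finite_exps card_exps distrib_left)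
    also have "\<dots> = x ^ Suc r * \<mu> + x ^ Suc r * \<mu>\<^sup>2"
      using x0 by (simp add: \<mu>_def power2_eq_square field_simps)
    finally show ?thesis .
  qed
  have V: "(\<Sum>ws\<in>words ?X r. \<Sum>v\<in>?X. (N v ws - \<mu>)\<^sup>2) \<le> x ^ Suc r * \<mu>"
  proof -
    have "(\<Sum>ws\<in>words ?X r. \<Sum>v\<in>?X. (N v ws - \<mu>)\<^sup>2)
      = (\<Sum>ws\<in>words ?X r. \<Sum>v\<in>?X. (N v ws)\<^sup>2 - 2 * \<mu> * N v ws + \<mu>\<^sup>2)"
      by (intro sum.cong refl) (simp add: power2_eq_square algebra_simps)
    also have "\<dots> = (\<Sum>ws\<in>words ?X r. \<Sum>v\<in>?X. (N v ws)\<^sup>2) - 2 * \<mu> * (\<Sum>ws\<in>words ?X r. \<Sum>v\<in>?X. N v ws) + x ^ Suc r * \<mu>\<^sup>2"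
      by (simp add: sum.distrib sum_subtractf sum_distrib_left card_words[OF finite_grid] x_def)
    also have "\<dots> \<le> x ^ Suc r * \<mu> + x ^ Suc r * \<mu>\<^sup>2 - 2 * \<mu> * (x ^ Suc r * \<mu>) + x ^ Suc r * \<mu>\<^sup>2"
      using M2 unfolding M1 by simp
    also have "\<dots> = x ^ Suc r * \<mu>" by (simp add: power2_eq_square algebra_simps)
    finally show ?thesis .
  qed
  define miss where "miss = {vs\<in>words ?X (Suc r). \<forall>a\<in>exps A r. vmod p (hd vs + comb a (tl vs)) \<notin> Y}"
  \<comment> \<open>A missing list has \<open>N = 0\<close>, so it contributes
    \<open>\<mu>\<^sup>2\<close> to the variance.\<close>
  have "real (card miss) * \<mu>\<^sup>2 = (\<Sum>vs\<in>miss. \<mu>\<^sup>2)" by simp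
  also have "\<dots> \<le> (\<Sum>vs\<in>miss. (N (hd vs) (tl vs) - \<mu>)\<^sup>2)"
    by (intro sum_mono) (auto simp: miss_def N_def)
  also have "\<dots> \<le> (\<Sum>vs\<in>words ?X (Suc r). (N (hd vs) (tl vs) - \<mu>)\<^sup>2)"
    by (intro sum_mono2 finite_words finite_grid) (auto simp: miss_def)
  also have "\<dots> = (\<Sum>ws\<in>words ?X r. \<Sum>v\<in>?X. (N v ws - \<mu>)\<^sup>2)"
    unfolding sum_words_Suc by (simp, rule sum.swap)
  also note V
  finally have *: "real (card miss) * \<mu>\<^sup>2 \<le> x ^ Suc r * \<mu>" .
  have "\<mu> \<ge> 0" using x0 by (simp add: \<mu>_def y_def)
  then have "real (card miss) * \<mu> \<le> x ^ Suc r"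
  proof (cases "\<mu> = 0")
    case True then show ?thesis using x0 by simp
  next
    case False
    with * \<open>\<mu> \<ge> 0\<close> show ?thesis by (simp add: power2_eq_square)
  qed
  then show ?thesis by (simp only: miss_def \<mu>_def x_def y_def)
qed

section \<open>Generators that are good for all planes at once\<close>

lemma count_along_map: "count_along B (map f vs) = count_along (\<lambda>v ws. B (f v) (map f ws)) vs"
  by (induction vs) auto

lemma count_along_mono:
  assumes "\<And>v ws. set (v # ws) \<subseteq> X \<Longrightarrow> length ws < D \<Longrightarrow> B v ws \<Longrightarrow> B' v ws"
    and "set vs \<subseteq> X" "length vs \<le> D"
  shows "count_along B vs \<le> count_along B' vs"
  using assms(2,3)
proof (induction vs)
  case (Cons v vs)
  then show ?case using assms(1)[of v vs] by auto
qed simp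

lemma comb_nth_bound:
  fixes vs :: "(real^'n) list"
  assumes "length ds = length vs" "\<forall>x\<in>set ds. \<bar>x\<bar> < int A" "\<forall>w\<in>set vs. \<bar>w $ j\<bar> \<le> 1"
  shows "\<bar>comb ds vs $ j\<bar> \<le> real A * length vs"
  using assms
proof (induction ds vs rule: list_induct2)
  case (Cons d ds v vs)
  have "\<bar>real_of_int d * v $ j\<bar> \<le> real A * 1"
    unfolding abs_mult using Cons.prems by (intro mult_mono) auto
  moreover have "\<bar>comb ds vs $ j\<bar> \<le> real A * length vs" using Cons by auto
  ultimately show ?case by (simp add: algebra_simps)
qed simp

text \<open>The combination has entries at most \<open>A * (1 + length vs)\<close>, so moving the
  functionals by \<open>\<kappa>\<close> changes their values by at most \<open>\<delta>\<close>. A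
  resonance at one plane is thus detected, with doubled tolerance, at a nearby point of the
  net.\<close>

lemma resonant_perturb:
  fixes u :: "'n::finite \<Rightarrow> real^'n"
  assumes res: "resonant I u \<delta> A v vs"
    and bd: "\<forall>w\<in>set (v # vs). \<forall>j. \<bar>w $ j\<bar> \<le> 1"
    and close: "\<And>i j. i \<in> I \<Longrightarrow> \<bar>u i $ j - u' i $ j\<bar> \<le> \<kappa>"
    and \<kappa>: "real CARD('n) * (\<kappa> * (real A * (1 + length vs))) \<le> \<delta>"
  shows "resonant I u' (2 * \<delta>) A v vs"
proof -
  from res obtain d ds where d: "d \<noteq> 0" "\<bar>d\<bar> < int A" "length ds = length vs" "\<forall>x\<in>set ds. \<bar>x\<bar> < int A"
      "\<forall>i\<in>I. \<bar>u i \<bullet> comb (d # ds) (v # vs)\<bar> \<le> \<delta>" unfolding resonant_def by blast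
  define y where "y = comb (d # ds) (v # vs)"
  have y: "\<bar>y $ j\<bar> \<le> real A * (1 + length vs)" for j
  proof -
    have "\<bar>comb (d # ds) (v # vs) $ j\<bar> \<le> real A * length (v # vs)"
      using d bd by (intro comb_nth_bound) auto
    then show ?thesis by (simp add: y_def del: comb.simps)
  qed
  have "\<bar>u' i \<bullet> y\<bar> \<le> 2 * \<delta>" if i: "i \<in> I" for i
  proof -
    have "\<bar>(u i - u' i) \<bullet> y\<bar> \<le> (\<Sum>j\<in>UNIV. \<bar>(u i $ j - u' i $ j) * y $ j\<bar>)"
      by (simp add: inner_vec_def sum_abs)
    also have "\<dots> \<le> (\<Sum>j\<in>(UNIV::'n set). \<kappa> * (real A * (1 + length vs)))"
      unfolding abs_mult using close[OF i] y by (intro sum_mono mult_mono) (auto intro: order_trans[OF abs_ge_zero])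
    also have "\<dots> \<le> \<delta>" using \<kappa> by simp
    finally have "\<bar>u i \<bullet> y - u' i \<bullet> y\<bar> \<le> \<delta>" by (simp add: inner_diff_left)
    moreover have "\<bar>u i \<bullet> y\<bar> \<le> \<delta>" using d(5) i by (simp add: y_def)
    ultimately show ?thesis by linarith
  qed
  then show ?thesis unfolding resonant_def y_def using d by blast
qed

lemma emb_grid_bound: "v \<in> grid p \<Longrightarrow> \<bar>emb p v $ j\<bar> \<le> 1"
proof -
  assume "v \<in> grid p"
  then have "0 \<le> v $ j" "v $ j < int p" by (auto simp: grid_def)
  then show ?thesis by (simp add: emb_def divide_le_eq)
qed

text \<open>A union bound over the rounded echelon matrices excludes long chains of resonances for all
  subspaces simultaneously.\<close>

lemma card_resonant_words_le:
  fixes E :: "(real^'n) list"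
  assumes p: "prime p" and A: "1 \<le> A" and R: "0 < R" "R \<le> real p"
    and E: "\<forall>e\<in>set E. \<forall>j. \<bar>e $ j\<bar> \<le> 1"
    and H: "0 < H" "real CARD('n) * (real A * real (D + length E)) * R \<le> real H"
  shows "real (card {vs\<in>words (grid p) D. \<exists>(I::'n set) u. card I = l \<and> echelon I u \<and> (\<forall>i\<in>I. \<forall>j. \<bar>u i $ j\<bar> \<le> real U) \<and>
      q \<le> count_along (\<lambda>v ws. resonant I u (1 / R) A v (ws @ E)) (map (emb p) vs)})
    \<le> 2 ^ CARD('n) * real (2 * (H * U + 1) + 1) ^ (CARD('n) * CARD('n)) *
       (2 ^ D * (real (2 * A) ^ (D + length E) * (6 / R) ^ l) ^ q) * real (card (grid p :: (int^'n) set)) ^ D"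
proof -
  let ?X = "grid p :: (int^'n) set"
  have p0: "0 < p" using p by (simp add: prime_gt_0_nat)
  \<comment> \<open>The net consists of matrices with entries in multiples of \<open>1 / H\<close>;
    only the rows indexed by \<open>I\<close> matter.\<close>
  define um where "um m i = (\<chi> j. real_of_int (m $ i $ j) / real H)" for m :: "int^'n^'n" and i
  define K where "K = int (H * U + 1)"
  define Ms where "Ms = {m::int^'n^'n. \<forall>i. m $ i \<in> {v. \<forall>j. v $ j \<in> {- K..K}}}"
  have fin1: "finite {v::int^'n. \<forall>j. v $ j \<in> {- K..K}}" by (rule card_vec_product(1)) simp
  have finMs: "finite Ms" unfolding Ms_def by (rule card_vec_product(1)) (rule fin1)
  have cK: "card {- K..K} = 2 * (H * U + 1) + 1" by (simp add: K_def nat_eq_iff)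
  have "card {v::int^'n. \<forall>j. v $ j \<in> {- K..K}} = (2 * (H * U + 1) + 1) ^ CARD('n)"
    by (subst card_vec_product(2)) (simp_all only: cK, simp_all)
  then have "card Ms = ((2 * (H * U + 1) + 1) ^ CARD('n)) ^ CARD('n)"
    unfolding Ms_def by (subst card_vec_product(2)[OF fin1]) simp
  then have cMs: "card Ms = (2 * (H * U + 1) + 1) ^ (CARD('n) * CARD('n))" by (simp only: power_mult)
  define B where "B I m v ws = resonant I (um m) (2 / R) A (emb p v) (map (emb p) ws @ E)"
    for I :: "'n set" and m and v :: "int^'n" and ws
  \<comment> \<open>The probability of one resonance. Rounding has doubled the tolerance to
    \<open>2 / R\<close>, and the count of resonant vectors triples it, whence 6.\<close>
  define \<beta> where "\<beta> = real (2 * A) ^ (D + length E) * (6 / R) ^ l"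
  have \<beta>0: "0 \<le> \<beta>" using R by (simp add: \<beta>_def)
  define Par where "Par = {(I::'n set, m). card I = l \<and> m \<in> Ms \<and> echelon I (um m)}"
  have Psub: "Par \<subseteq> UNIV \<times> Ms" by (auto simp: Par_def)
  have finPar: "finite Par" using Psub finMs by (meson finite_SigmaI finite finite_subset)
  have "card Par \<le> card ((UNIV :: 'n set set) \<times> Ms)" using Psub finMs by (intro card_mono) auto
  also have "\<dots> = 2 ^ CARD('n) * (2 * (H * U + 1) + 1) ^ (CARD('n) * CARD('n))"
    by (simp only: card_cartesian_product cMs) (simp add: card_UNIV_set)
  finally have cPar: "card Par \<le> 2 ^ CARD('n) * (2 * (H * U + 1) + 1) ^ (CARD('n) * CARD('n))" .
  define W where "W I m = {vs. set vs \<subseteq> ?X \<and> length vs = D \<and> q \<le> count_along (B I m) vs}" for I m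
  have cW: "real (card (W I m)) \<le> 2 ^ D * \<beta> ^ q * real (card ?X) ^ D" if "(I, m) \<in> Par" for I m
    unfolding W_def
  proof (rule card_count_along_ge[OF finite_grid \<beta>0])
    fix vs :: "(int^'n) list" assume vs: "set vs \<subseteq> ?X" "length vs < D"
    have "real (card {v\<in>?X. B I m v vs})
       \<le> real (2 * A) ^ (1 + length (map (emb p) vs @ E)) * (3 * (2 / R)) ^ card I * real (card ?X)"
      unfolding B_def using that A R p0 by (intro card_resonant_le) (auto simp: Par_def field_simps)
    also have "\<dots> \<le> real (2 * A) ^ (D + length E) * (3 * (2 / R)) ^ card I * real (card ?X)"
      using vs A R by (intro mult_right_mono power_increasing) auto
    finally show "real (card {v\<in>?X. B I m v vs}) \<le> \<beta> * real (card ?X)"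
      using that by (simp add: \<beta>_def Par_def)
  qed
  let ?bad = "{vs\<in>words ?X D. \<exists>(I::'n set) u. card I = l \<and> echelon I u \<and> (\<forall>i\<in>I. \<forall>j. \<bar>u i $ j\<bar> \<le> real U) \<and>
      q \<le> count_along (\<lambda>v ws. resonant I u (1 / R) A v (ws @ E)) (map (emb p) vs)}"
  have sub: "?bad \<subseteq> (\<Union>(I, m)\<in>Par. W I m)"
  proof
    fix vs assume "vs \<in> ?bad"
    then obtain I :: "'n set" and u where vs: "set vs \<subseteq> ?X" "length vs = D" and I: "card I = l" and ech: "echelon I u"
      and ub: "\<And>i j. i \<in> I \<Longrightarrow> \<bar>u i $ j\<bar> \<le> real U"
      and q: "q \<le> count_along (\<lambda>v ws. resonant I u (1 / R) A v (ws @ E)) (map (emb p) vs)"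
      by (auto simp: words_def)
    define m :: "int^'n^'n" where "m = (\<chi> i j. if i \<in> I then \<lfloor>real H * u i $ j\<rfloor> else 0)"
    have fl: "\<bar>u i $ j - um m i $ j\<bar> \<le> 1 / real H" if "i \<in> I" for i j
    proof -
      have "u i $ j - um m i $ j = (real H * u i $ j - of_int \<lfloor>real H * u i $ j\<rfloor>) / real H"
        using H that by (simp add: um_def m_def field_simps)
      moreover have "0 \<le> real H * u i $ j - of_int \<lfloor>real H * u i $ j\<rfloor>" "real H * u i $ j - of_int \<lfloor>real H * u i $ j\<rfloor> \<le> 1"
        by linarith+
      ultimately show ?thesis using H by (simp add: divide_le_cancel)
    qed
    \<comment> \<open>The entries 0 and 1 are multiples of \<open>1 / H\<close>, so rounding down
      keeps the echelon form exact.\<close>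
    have ech': "echelon I (um m)" using ech H by (auto simp: echelon_def um_def m_def)
    have "m $ i $ j \<in> {- K..K}" for i j
    proof (cases "i \<in> I")
      case True
      have "\<bar>real H * u i $ j\<bar> \<le> real H * real U" unfolding abs_mult using ub[OF True] by (intro mult_mono) auto
      then have "\<bar>real H * u i $ j\<bar> \<le> real_of_int (int (H * U))" by simp
      then have "- int (H * U) \<le> \<lfloor>real H * u i $ j\<rfloor>" "\<lfloor>real H * u i $ j\<rfloor> \<le> int (H * U)"
        by (auto simp only: le_floor_iff floor_le_iff abs_le_iff of_int_minus)
      then show ?thesis using True by (simp add: m_def K_def)
    next
      case False
      have "0 \<le> K" unfolding K_def by (rule of_nat_0_le_iff)
      with False show ?thesis by (simp add: m_def)
    qed
    then have "m \<in> Ms" by (simp add: Ms_def)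
    with I ech' have Par: "(I, m) \<in> Par" by (simp add: Par_def)
    have "count_along (\<lambda>v ws. resonant I u (1 / R) A v (ws @ E)) (map (emb p) vs) \<le> count_along (B I m) vs"
      unfolding count_along_map
    proof (rule count_along_mono[OF _ vs(1), of D])
      fix v ws assume v: "set (v # ws) \<subseteq> ?X" "length ws < D" and res: "resonant I u (1 / R) A (emb p v) (map (emb p) ws @ E)"
      have "resonant I (um m) (2 * (1 / R)) A (emb p v) (map (emb p) ws @ E)"
      proof (rule resonant_perturb[OF res _ fl])
        show "\<forall>w\<in>set (emb p v # map (emb p) ws @ E). \<forall>j. \<bar>w $ j\<bar> \<le> 1"
        proof -
          have "\<forall>w\<in>set (v # ws). \<forall>j. \<bar>emb p w $ j\<bar> \<le> 1" using v(1) emb_grid_bound by blast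
          then show ?thesis using E by auto
        qed
        have "real CARD('n) * (real A * (1 + length (map (emb p) ws @ E))) * R \<le> real CARD('n) * (real A * real (D + length E)) * R"
          using v(2) R by (intro mult_right_mono mult_left_mono) auto
        also note H(2)
        finally show "real CARD('n) * (1 / real H * (real A * (1 + length (map (emb p) ws @ E)))) \<le> 1 / R"
          using R H(1) by (simp add: field_simps)
      qed
      then show "B I m v ws" by (simp add: B_def)
    qed (use vs in simp)
    with q have "vs \<in> W I m" using vs by (simp add: W_def)
    with Par show "vs \<in> (\<Union>(I, m)\<in>Par. W I m)" by auto
  qed
  have finW: "finite (W I m)" for I m
    by (rule finite_subset[OF _ finite_words[OF finite_grid, of p D]]) (auto simp: W_def words_def)
  have "card ?bad \<le> card (\<Union>(I, m)\<in>Par. W I m)" using finPar finW by (intro card_mono[OF _ sub]) auto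
  also have "\<dots> \<le> (\<Sum>x\<in>Par. card (case x of (I, m) \<Rightarrow> W I m))" using finPar by (rule card_UN_le)
  finally have "real (card ?bad) \<le> (\<Sum>x\<in>Par. real (card (case x of (I, m) \<Rightarrow> W I m)))"
    by (simp flip: of_nat_sum)
  also have "\<dots> \<le> (\<Sum>x\<in>Par. 2 ^ D * \<beta> ^ q * real (card ?X) ^ D)"
    by (intro sum_mono) (auto intro: cW)
  also have "\<dots> = real (card Par) * (2 ^ D * \<beta> ^ q * real (card ?X) ^ D)" by simp
  also have "\<dots> \<le> real (2 ^ CARD('n) * (2 * (H * U + 1) + 1) ^ (CARD('n) * CARD('n))) * (2 ^ D * \<beta> ^ q * real (card ?X) ^ D)"
    using cPar \<beta>0 by (intro mult_right_mono) (auto simp only: of_nat_le_iff, auto)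
  finally show ?thesis unfolding \<beta>_def by (simp add: mult.assoc)
qed

text \<open>At most a quarter of all lists has \<open>q\<close> resonances for some plane. The
  expected proportion of missed targets is at most 1/8, so by Markov's inequality at most a quarter
  of the lists misses more than half of them. Some list avoids both faults. The range
  \<open>A\<close> of resonances may exceed the range \<open>A0\<close> of the exponents used for
  hits.\<close>

lemma exists_generators:
  fixes E :: "(real^'n) list" and Y :: "'q \<Rightarrow> (int^'n) set"
  assumes p: "prime p" and A: "1 \<le> A" and R: "0 < R" "R \<le> real p"
    and E: "\<forall>e\<in>set E. \<forall>j. \<bar>e $ j\<bar> \<le> 1"
    and H: "0 < H" "real CARD('n) * (real A * real (Suc r + length E)) * R \<le> real H"
    and num: "2 ^ CARD('n) * real (2 * (H * U + 1) + 1) ^ (CARD('n) * CARD('n)) *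
       (2 ^ Suc r * (real (2 * A) ^ (Suc r + length E) * (6 / R) ^ l) ^ q) \<le> 1/4"
    and A0: "A0 \<le> p"
    and Q: "finite Q" and Y: "\<And>y. y \<in> Q \<Longrightarrow> Y y \<subseteq> grid p"
      "\<And>y. y \<in> Q \<Longrightarrow> 8 \<le> real A0 ^ r * (real (card (Y y)) / real (card (grid p :: (int^'n) set)))"
  shows "\<exists>vs\<in>words (grid p) (Suc r).
     (\<forall>(I::'n set) u. card I = l \<longrightarrow> echelon I u \<longrightarrow> (\<forall>i\<in>I. \<forall>j. \<bar>u i $ j\<bar> \<le> real U) \<longrightarrow>
        count_along (\<lambda>v ws. resonant I u (1 / R) A v (ws @ E)) (map (emb p) vs) < q) \<and>
     card Q \<le> 2 * card {y\<in>Q. \<exists>a\<in>exps A0 r. vmod p (hd vs + comb a (tl vs)) \<in> Y y}"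
proof -
  let ?X = "grid p :: (int^'n) set"
  let ?W = "words ?X (Suc r)"
  have p0: "0 < p" using p by (simp add: prime_gt_0_nat)
  define x where "x = real (card ?X) ^ Suc r"
  have x0: "x > 0" using p0 by (simp add: x_def card_grid)
  have cW: "real (card ?W) = x" by (simp add: card_words finite_grid x_def)
  define bad1 where "bad1 = {vs\<in>?W. \<exists>(I::'n set) u. card I = l \<and> echelon I u \<and> (\<forall>i\<in>I. \<forall>j. \<bar>u i $ j\<bar> \<le> real U) \<and>
      q \<le> count_along (\<lambda>v ws. resonant I u (1 / R) A v (ws @ E)) (map (emb p) vs)}"
  have "real (card bad1) \<le> 1/4 * x"
    using card_resonant_words_le[OF p A R E H, of l U q] mult_right_mono[OF num, of x] x0
    unfolding bad1_def x_def by (simp add: mult.assoc)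
  note b1 = this
  define miss where "miss y = {vs\<in>?W. \<forall>a\<in>exps A0 r. vmod p (hd vs + comb a (tl vs)) \<notin> Y y}" for y
  have finW: "finite ?W" by (intro finite_words finite_grid)
  have m8: "8 * real (card (miss y)) \<le> x" if "y \<in> Q" for y
  proof -
    have "real (card (miss y)) * 8 \<le> real (card (miss y)) * (real A0 ^ r * (real (card (Y y)) / real (card ?X)))"
      using Y(2)[OF that] by (intro mult_left_mono) auto
    also have "\<dots> \<le> x" unfolding miss_def x_def by (rule card_missing_le[OF p Y(1)[OF that] A0])
    finally show ?thesis by simp
  qed
  \<comment> \<open>The next estimate counts pairs of a list and a missed target in two
    ways.\<close>
  define bad2 where "bad2 = {vs\<in>?W. card Q < 2 * card {y\<in>Q. vs \<in> miss y}}"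
  have "real (card bad2) * real (card Q) \<le> 1/4 * x * real (card Q)"
  proof -
    have "real (card bad2) * real (card Q) = (\<Sum>vs\<in>bad2. real (card Q))" by simp
    also have "\<dots> \<le> (\<Sum>vs\<in>bad2. 2 * real (card {y\<in>Q. vs \<in> miss y}))"
      by (intro sum_mono) (auto simp: bad2_def)
    also have "\<dots> \<le> (\<Sum>vs\<in>?W. 2 * real (card {y\<in>Q. vs \<in> miss y}))"
      using finW by (intro sum_mono2) (auto simp: bad2_def)
    also have "\<dots> = 2 * (\<Sum>vs\<in>?W. \<Sum>y\<in>Q. if vs \<in> miss y then 1 else 0)"
      using Q by (simp add: sum_distrib_left sum.inter_filter[symmetric])
    also have "\<dots> = 2 * (\<Sum>y\<in>Q. \<Sum>vs\<in>?W. if vs \<in> miss y then 1 else 0)"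
      by (subst sum.swap) simp
    also have "\<dots> = 2 * (\<Sum>y\<in>Q. real (card (miss y)))"
    proof -
      have "{vs\<in>?W. vs \<in> miss y} = miss y" for y by (auto simp: miss_def)
      then show ?thesis using finW by (simp add: sum.inter_filter[symmetric])
    qed
    also have "\<dots> \<le> 2 * (\<Sum>y\<in>Q. x / 8)" using m8 by (intro mult_left_mono sum_mono) (auto simp: mult.commute)
    also have "\<dots> = 1/4 * x * real (card Q)" by simp
    finally show ?thesis .
  qed
  then have b2: "real (card bad2) \<le> 1/4 * x"
  proof (cases "Q = {}")
    case True then show ?thesis using x0 by (simp add: bad2_def)
  next
    case False
    then have "0 < real (card Q)" using Q by (simp add: card_gt_0_iff)
    then show ?thesis using \<open>real (card bad2) * real (card Q) \<le> 1/4 * x * real (card Q)\<close>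
      by (rule mult_right_le_imp_le[rotated])
  qed
  have "\<not> ?W \<subseteq> bad1 \<union> bad2"
  proof
    assume "?W \<subseteq> bad1 \<union> bad2"
    moreover have "finite (bad1 \<union> bad2)" using finW by (simp add: bad1_def bad2_def)
    ultimately have "card ?W \<le> card (bad1 \<union> bad2)" by (rule card_mono[rotated])
    also have "\<dots> \<le> card bad1 + card bad2" by (rule card_Un_le)
    finally have "x \<le> 1/4 * x + 1/4 * x" using b1 b2 cW by linarith
    with x0 show False by simp
  qed
  then obtain vs where vs: "vs \<in> ?W" "vs \<notin> bad1" "vs \<notin> bad2" by blast
  have "card Q \<le> 2 * card {y\<in>Q. \<exists>a\<in>exps A0 r. vmod p (hd vs + comb a (tl vs)) \<in> Y y}"
  proof -
    have "{y\<in>Q. \<exists>a\<in>exps A0 r. vmod p (hd vs + comb a (tl vs)) \<in> Y y} = Q - {y\<in>Q. vs \<in> miss y}"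
      using vs(1) by (auto simp: miss_def)
    then have "card {y\<in>Q. \<exists>a\<in>exps A0 r. vmod p (hd vs + comb a (tl vs)) \<in> Y y} = card Q - card {y\<in>Q. vs \<in> miss y}"
      using Q by (simp only:) (intro card_Diff_subset, auto)
    moreover have "2 * card {y\<in>Q. vs \<in> miss y} \<le> card Q" using vs by (simp add: bad2_def)
    then have "card Q \<le> 2 * (card Q - card {y\<in>Q. vs \<in> miss y})" by linarith
    ultimately show ?thesis by (simp only:)
  qed
  moreover have "\<forall>(I::'n set) u. card I = l \<longrightarrow> echelon I u \<longrightarrow> (\<forall>i\<in>I. \<forall>j. \<bar>u i $ j\<bar> \<le> real U) \<longrightarrow>
        count_along (\<lambda>v ws. resonant I u (1 / R) A v (ws @ E)) (map (emb p) vs) < q"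
  proof (intro allI impI, rule ccontr)
    fix I :: "'n set" and u
    assume "card I = l" "echelon I u" "\<forall>i\<in>I. \<forall>j. \<bar>u i $ j\<bar> \<le> real U"
      "\<not> count_along (\<lambda>v ws. resonant I u (1 / R) A v (ws @ E)) (map (emb p) vs) < q"
    then have "vs \<in> bad1" unfolding bad1_def not_less using vs(1) by blast
    with vs(2) show False by contradiction
  qed
  ultimately show ?thesis using vs(1) by blast
qed

section \<open>The weight of a generator list\<close>

text \<open>The term \<open>16 / (m + 1)\<close> makes the induction telescope, and at
  \<open>m = 0\<close> equality holds. The uniform bound 20 is what the later estimates
  extract.\<close>

lemma sum_inverse_quadratic_le: "(\<Sum>z\<in>{- int m..int m}. 4 / (1 + (real_of_int z)\<^sup>2)) \<le> 20 - 16 / (real m + 1)"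
proof (induction m)
  case (Suc m)
  have "{- int (Suc m)..int (Suc m)} = insert (int (Suc m)) (insert (- int (Suc m)) {- int m..int m})" by auto
  then have "(\<Sum>z\<in>{- int (Suc m)..int (Suc m)}. 4 / (1 + (real_of_int z)\<^sup>2))
    = 8 / (1 + (real m + 1)\<^sup>2) + (\<Sum>z\<in>{- int m..int m}. 4 / (1 + (real_of_int z)\<^sup>2))"
    by (simp add: power2_eq_square algebra_simps)
  also have "\<dots> \<le> 8 / (1 + (real m + 1)\<^sup>2) + (20 - 16 / (real m + 1))" using Suc by simp
  also have "8 / (1 + (real m + 1)\<^sup>2) \<le> 16 / (real m + 1) - 16 / (real m + 2)"
  proof -
    have "16 / (real m + 1) - 16 / (real m + 2) = 16 / ((real m + 1) * (real m + 2))"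
      by (simp add: field_simps)
    moreover have "8 / (1 + (real m + 1)\<^sup>2) \<le> 16 / ((real m + 1) * (real m + 2))"
    proof -
      have "8 * ((real m + 1) * (real m + 2)) \<le> 16 * (1 + (real m + 1)\<^sup>2)"
        by (simp add: power2_eq_square algebra_simps)
      moreover have "0 < (real m + 1) * (real m + 2)" "0 < 1 + (real m + 1)\<^sup>2"
        by (auto intro: add_pos_nonneg)
      ultimately show ?thesis by (simp add: divide_le_eq le_divide_eq field_simps)
    qed
    ultimately show ?thesis by simp
  qed
  finally show ?case by (simp add: add.commute)
qed simp

text \<open>A majorant that depends only on the unit cell of \<open>x\<close>, so that frequencies
  can be sorted by integer parts.\<close>

lemma tent_ft_le_floor: "tent_ft x \<le> 4 / (1 + (real_of_int \<lfloor>x\<rfloor>)\<^sup>2)"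
proof -
  let ?z = "real_of_int \<lfloor>x\<rfloor>"
  \<comment> \<open>Here \<open>y\<close> is a lower bound for \<open>x\<^sup>2\<close> comparable
    with \<open>1 + z\<^sup>2\<close>; the quadratic decay then suffices. The two cells next to the
    origin use the trivial bound 1 instead.\<close>
  have far: ?thesis if y: "1 \<le> y" "y \<le> x\<^sup>2" "1 + ?z\<^sup>2 \<le> 5 * y" for y
  proof -
    have x0: "x \<noteq> 0" using y by auto
    then have "tent_ft x \<le> 1 / (9 * x\<^sup>2)" by (rule tent_ft_le)
    also have "\<dots> \<le> 1 / (9 * y)" using x0 y by (intro divide_left_mono mult_pos_pos) auto
    also have "\<dots> \<le> 4 / (5 * y)" using y by (simp add: field_simps)
    also have "\<dots> \<le> 4 / (1 + ?z\<^sup>2)" using y by (intro divide_left_mono) (auto intro!: mult_pos_pos add_pos_nonneg)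
    finally show ?thesis .
  qed
  have z: "?z \<le> x" "x < ?z + 1" by linarith+
  consider "1 \<le> ?z" | "\<lfloor>x\<rfloor> = 0 \<or> \<lfloor>x\<rfloor> = -1" | "?z \<le> -2" by linarith
  then show ?thesis
  proof cases
    case 1
    have "1\<^sup>2 \<le> ?z\<^sup>2" using 1 by (intro power_mono) auto
    moreover have "?z\<^sup>2 \<le> x\<^sup>2" using 1 z by (intro power_mono) auto
    ultimately show ?thesis by (intro far[of "?z\<^sup>2"]) auto
  next
    case 2
    then have "4 / (1 + ?z\<^sup>2) \<ge> 1" by auto
    then show ?thesis using tent_ft_le_1[of x] by linarith
  next
    case 3
    have "\<bar>?z / 2\<bar> \<le> \<bar>x\<bar>" using z 3 by linarith
    then have "(?z / 2)\<^sup>2 \<le> x\<^sup>2" by (simp only: abs_le_square_iff)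
    moreover have "\<bar>1\<bar> \<le> \<bar>?z / 2\<bar>" using 3 by linarith
    then have "1\<^sup>2 \<le> (?z / 2)\<^sup>2" by (simp only: abs_le_square_iff)
    ultimately show ?thesis by (intro far[of "(?z / 2)\<^sup>2"]) (auto simp: power_divide)
  qed
qed

text \<open>Sort the index set by the integer cells of all \<open>\<theta> i a\<close>. Two members
  of a cell differ by less than 1 in every direction, so a cell holds at most \<open>N\<close> of
  them, and the sum of the majorant over all cells factorises.\<close>

lemma sum_prod_tent_ft_le:
  fixes \<theta> :: "'n::finite \<Rightarrow> 'a \<Rightarrow> real"
  assumes S: "finite S"
    and N: "\<And>S'. S' \<subseteq> S \<Longrightarrow> (\<And>a b i. a \<in> S' \<Longrightarrow> b \<in> S' \<Longrightarrow> i \<in> I \<Longrightarrow> \<bar>\<theta> i a - \<theta> i b\<bar> \<le> 1) \<Longrightarrow> card S' \<le> N"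
  shows "(\<Sum>a\<in>S. \<Prod>i\<in>I. tent_ft (\<theta> i a)) \<le> real N * 20 ^ card I"
proof -
  define \<phi> where "\<phi> a = (\<lambda>i\<in>I. \<lfloor>\<theta> i a\<rfloor>)" for a
  define \<kappa> where "\<kappa> z = 4 / (1 + (real_of_int z)\<^sup>2)" for z :: int
  have \<kappa>0: "\<kappa> z \<ge> 0" for z by (simp add: \<kappa>_def)
  obtain m where m: "\<And>a i. a \<in> S \<Longrightarrow> \<bar>\<lfloor>\<theta> i a\<rfloor>\<bar> \<le> int m"
  proof -
    let ?F = "(\<lambda>(a, i). nat \<bar>\<lfloor>\<theta> i a\<rfloor>\<bar>) ` (S \<times> (UNIV :: 'n set))"
    have "finite ?F" using S by simp
    then obtain m where "\<And>x. x \<in> ?F \<Longrightarrow> x \<le> m" by (meson finite_nat_set_iff_bounded_le)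
    then have "\<And>a i. a \<in> S \<Longrightarrow> nat \<bar>\<lfloor>\<theta> i a\<rfloor>\<bar> \<le> m" by force
    then show ?thesis using that[of m] by (simp add: nat_le_iff)
  qed
  let ?P = "PiE I (\<lambda>_. {- int m..int m})"
  have im: "\<phi> a \<in> ?P" if "a \<in> S" for a using m[OF that] by (auto simp: \<phi>_def abs_le_iff) (metis minus_le_iff)
  have fib: "card {a\<in>S. \<phi> a = g} \<le> N" for g
  proof (rule N)
    fix a b i assume a: "a \<in> {a \<in> S. \<phi> a = g}" and b: "b \<in> {a \<in> S. \<phi> a = g}" and i: "i \<in> I"
    have "\<phi> a i = \<phi> b i" using a b by simp
    then have "\<lfloor>\<theta> i a\<rfloor> = \<lfloor>\<theta> i b\<rfloor>" using i by (simp add: \<phi>_def)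
    then show "\<bar>\<theta> i a - \<theta> i b\<bar> \<le> 1" by linarith
  qed auto
  have "(\<Sum>a\<in>S. \<Prod>i\<in>I. tent_ft (\<theta> i a)) \<le> (\<Sum>a\<in>S. \<Prod>i\<in>I. \<kappa> (\<phi> a i))"
    by (intro sum_mono prod_mono) (auto simp: \<phi>_def \<kappa>_def tent_ft_nonneg tent_ft_le_floor)
  also have "\<dots> = (\<Sum>g\<in>?P. \<Sum>a\<in>{a\<in>S. \<phi> a = g}. \<Prod>i\<in>I. \<kappa> (\<phi> a i))"
    by (rule sum.group[symmetric]) (use S im in \<open>auto intro!: finite_PiE\<close>)
  also have "\<dots> = (\<Sum>g\<in>?P. real (card {a\<in>S. \<phi> a = g}) * (\<Prod>i\<in>I. \<kappa> (g i)))"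
    by (intro sum.cong refl) simp
  also have "\<dots> \<le> (\<Sum>g\<in>?P. real N * (\<Prod>i\<in>I. \<kappa> (g i)))"
    using fib \<kappa>0 by (intro sum_mono mult_right_mono prod_nonneg) auto
  also have "\<dots> = real N * (\<Prod>i\<in>I. \<Sum>z\<in>{- int m..int m}. \<kappa> z)"
    by (subst prod_sum_PiE) (simp_all add: sum_distrib_left[symmetric])
  also have "\<dots> \<le> real N * (\<Prod>i\<in>I. 20)"
  proof (intro mult_left_mono prod_mono conjI)
    have "(\<Sum>z\<in>{- int m..int m}. \<kappa> z) \<le> 20 - 16 / (real m + 1)" unfolding \<kappa>_def by (rule sum_inverse_quadratic_le)
    also have "\<dots> \<le> 20" by simp
    finally show "(\<Sum>z\<in>{- int m..int m}. \<kappa> z) \<le> 20" .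
  qed (auto intro: sum_nonneg \<kappa>0)
  finally show ?thesis by simp
qed

definition box_weight :: "real \<Rightarrow> 'a set \<Rightarrow> ('a \<Rightarrow> real^'n) \<Rightarrow> real^'n \<Rightarrow> real" where
  "box_weight \<rho> S f x = slab_tent UNIV (\<lambda>_. 0) (\<lambda>_. 0) (\<lambda>_. \<rho>) x * (cmod (expsum S f x))\<^sup>2"

lemma box_weight_nonneg: "0 \<le> box_weight \<rho> S f x"
  by (simp add: box_weight_def slab_tent_nonneg)

lemma box_weight_integrable: "0 < \<rho> \<Longrightarrow> integrable lborel (box_weight \<rho> S f)"
  unfolding box_weight_def using slab_tent_mult_integrable[of "\<lambda>_. \<rho>" "\<lambda>x. (cmod (expsum S f x))\<^sup>2"]
  by (simp add: continuous_intros)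

lemma box_weight_support:
  fixes x :: "real^'n"
  assumes \<rho>: "0 < \<rho>" and nz: "slab_tent UNIV (\<lambda>_. 0) (\<lambda>_. 0) (\<lambda>_. \<rho>) x \<noteq> 0"
  shows "\<bar>x $ i\<bar> < \<rho>"
proof -
  have "tent (x $ i / \<rho>) \<noteq> 0" using nz by (auto simp: slab_tent_def)
  then have "\<bar>x $ i / \<rho>\<bar> < 1" using tent_zero by force
  then show ?thesis using \<rho> by simp
qed

text \<open>The box is placed in a ball through the sum of absolute coordinates, which explains the
  later choice of half-width \<open>R / n\<close>.\<close>

lemma box_weight_admissible:
  fixes f :: "'a \<Rightarrow> real^'n"
  assumes "0 < \<rho>"
  shows "admissible_weight (real CARD('n) * \<rho>) (box_weight \<rho> S f)"
  unfolding admissible_weight_def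
proof (intro conjI allI impI box_weight_nonneg box_weight_integrable assms)
  fix x :: "real^'n" assume x: "x \<notin> ball 0 (real CARD('n) * \<rho>)"
  show "box_weight \<rho> S f x = 0"
  proof (rule ccontr)
    assume "box_weight \<rho> S f x \<noteq> 0"
    then have "\<bar>x $ i\<bar> < \<rho>" for i using box_weight_support[OF assms] by (auto simp: box_weight_def)
    then have "(\<Sum>i\<in>UNIV. \<bar>x $ i\<bar>) < (\<Sum>i\<in>(UNIV::'n set). \<rho>)" by (intro sum_strict_mono) auto
    then have "norm x < real CARD('n) * \<rho>" using norm_le_l1_cart[of x] by simp
    with x show False by simp
  qed
qed

text \<open>Expanding the square yields one translated tent transform per pair of exponents. All
  terms are nonnegative, so there is no cancellation anywhere.\<close>

lemma fourier_box_weight: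
  assumes \<rho>: "0 < \<rho>"
  shows "fourier (box_weight \<rho> S f) \<xi> =
    complex_of_real (\<Sum>a\<in>S. \<Sum>b\<in>S. \<Prod>i\<in>UNIV. \<rho> * tent_ft (\<rho> * ((f a - f b - \<xi>) $ i)))"
proof -
  let ?t = "slab_tent UNIV (\<lambda>_. 0) (\<lambda>_. 0) (\<lambda>_. \<rho>)"
  have "complex_of_real (box_weight \<rho> S f x) * cis (- 2 * pi * (x \<bullet> \<xi>))
    = (\<Sum>a\<in>S. \<Sum>b\<in>S. complex_of_real (?t x) * cis (2 * pi * (x \<bullet> (f a - f b - \<xi>))))" for x
  proof -
    have "complex_of_real (box_weight \<rho> S f x) * cis (- 2 * pi * (x \<bullet> \<xi>))
      = complex_of_real (?t x) * (\<Sum>a\<in>S. \<Sum>b\<in>S. cis (2 * pi * (x \<bullet> (f a - f b)))) * cis (- 2 * pi * (x \<bullet> \<xi>))"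
      by (simp only: box_weight_def of_real_mult expsum_norm_sq)
    also have "\<dots> = (\<Sum>a\<in>S. \<Sum>b\<in>S. complex_of_real (?t x) * (cis (2 * pi * (x \<bullet> (f a - f b))) * cis (- 2 * pi * (x \<bullet> \<xi>))))"
      by (simp add: sum_distrib_left sum_distrib_right mult.assoc)
    also have "\<dots> = (\<Sum>a\<in>S. \<Sum>b\<in>S. complex_of_real (?t x) * cis (2 * pi * (x \<bullet> (f a - f b - \<xi>))))"
      by (simp add: cis_mult inner_diff_right algebra_simps)
    finally show ?thesis .
  qed
  then have "fourier (box_weight \<rho> S f) \<xi>
    = (\<integral>x. (\<Sum>a\<in>S. \<Sum>b\<in>S. complex_of_real (?t x) * cis (2 * pi * (x \<bullet> (f a - f b - \<xi>)))) \<partial>lborel)"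
    by (simp add: fourier_def)
  also have "\<dots> = (\<Sum>a\<in>S. \<Sum>b\<in>S. (\<integral>x. complex_of_real (?t x) * cis (2 * pi * (x \<bullet> (f a - f b - \<xi>))) \<partial>lborel))"
    by (subst Bochner_Integration.integral_sum, (intro Bochner_Integration.integrable_sum slab_tent_cis(1) \<rho>),
        intro sum.cong refl Bochner_Integration.integral_sum slab_tent_cis(1) \<rho>)
  also have "\<dots> = (\<Sum>a\<in>S. \<Sum>b\<in>S. complex_of_real (\<Prod>i\<in>UNIV. \<rho> * tent_ft (\<rho> * ((f a - f b - \<xi>) $ i))))"
    by (subst slab_tent_cis(2)) (use \<rho> in \<open>auto simp: slab_dual_def\<close>)
  finally show ?thesis by simp
qed

text \<open>By nonnegativity all pairs outside \<open>T\<close> may be dropped; for those in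
  \<open>T\<close> each of the factors is at least half its maximum.\<close>

lemma fourier_box_weight_ge:
  fixes f :: "'a \<Rightarrow> real^'n"
  assumes \<rho>: "0 < \<rho>" and S: "finite S" and T: "T \<subseteq> S \<times> S"
    and near: "\<And>a b i. (a, b) \<in> T \<Longrightarrow> \<bar>\<rho> * ((f a - f b - \<xi>) $ i)\<bar> \<le> 1/6"
  shows "real (card T) * (\<rho> / 2) ^ CARD('n) \<le> cmod (fourier (box_weight \<rho> S f) \<xi>)"
proof -
  let ?g = "\<lambda>(a, b). \<Prod>i\<in>(UNIV::'n set). \<rho> * tent_ft (\<rho> * ((f a - f b - \<xi>) $ i))"
  have g0: "0 \<le> ?g x" for x using \<rho> by (auto simp: case_prod_unfold tent_ft_nonneg intro!: prod_nonneg)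
  have "real (card T) * (\<rho> / 2) ^ CARD('n) = (\<Sum>x\<in>T. \<Prod>i\<in>(UNIV::'n set). \<rho> * (1/2))" by simp
  also have "\<dots> \<le> (\<Sum>x\<in>T. ?g x)"
  proof (intro sum_mono, clarify)
    fix a b assume ab: "(a, b) \<in> T"
    show "(\<Prod>i\<in>(UNIV::'n set). \<rho> * (1/2)) \<le> (\<Prod>i\<in>(UNIV::'n set). \<rho> * tent_ft (\<rho> * ((f a - f b - \<xi>) $ i)))"
      using \<rho> tent_ft_ge[OF near[OF ab]] by (intro prod_mono conjI mult_left_mono) auto
  qed
  also have "\<dots> \<le> (\<Sum>x\<in>S \<times> S. ?g x)" using S T g0 by (intro sum_mono2) auto
  also have "\<dots> = (\<Sum>a\<in>S. \<Sum>b\<in>S. ?g (a, b))" by (simp add: sum.cartesian_product)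
  also have "\<dots> \<le> cmod (fourier (box_weight \<rho> S f) \<xi>)"
    unfolding fourier_box_weight[OF \<rho>] norm_of_real by simp
  finally show ?thesis .
qed

text \<open>This ties the transform of a slab to resonances: its dual coordinates at the pivots are
  the products with the basis of the plane.\<close>

lemma slab_dual_echelon:
  assumes "echelon I u" "i \<in> I"
  shows "slab_dual I u \<eta> i = u i \<bullet> \<eta>"
proof -
  have "u i \<bullet> \<eta> = (\<Sum>j\<in>I. u i $ j * \<eta> $ j) + (\<Sum>j\<in>-I. u i $ j * \<eta> $ j)"
    unfolding inner_vec_def inner_real_def
    by (subst sum.union_disjoint[symmetric]) auto
  also have "(\<Sum>j\<in>I. u i $ j * \<eta> $ j) = (\<Sum>j\<in>I. if j = i then \<eta> $ j else 0)"
    using assms by (intro sum.cong) (auto simp: echelon_def)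
  finally show ?thesis using assms by (simp add: slab_dual_def)
qed

text \<open>The directions transverse to the plane are estimated trivially by \<open>C\<close>.
  Along the plane, for each fixed second exponent, the cell argument leaves
  \<open>N * 20 ^ card I\<close> instead of \<open>card S\<close>.\<close>

lemma integral_slab_le:
  fixes f :: "'a \<Rightarrow> real^'n"
  assumes S: "finite S" and \<rho>: "0 < \<rho>" and C: "0 < C" and ech: "echelon I u"
    and N: "\<And>S'. S' \<subseteq> S \<Longrightarrow> (\<And>a b i. a \<in> S' \<Longrightarrow> b \<in> S' \<Longrightarrow> i \<in> I \<Longrightarrow> \<bar>u i \<bullet> (f a - f b)\<bar> \<le> 1 / \<rho>) \<Longrightarrow> card S' \<le> N"
  shows "(\<integral>x. slab_tent I u d (\<lambda>i. if i \<in> I then \<rho> else C) x * (cmod (expsum S f x))\<^sup>2 \<partial>lborel)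
     \<le> C ^ (CARD('n) - card I) * \<rho> ^ card I * real (card S) * (real N * 20 ^ card I)"
proof -
  let ?r = "\<lambda>i. if i \<in> I then \<rho> else C"
  have r: "0 < ?r i" for i using \<rho> C by auto
  have tm: "(\<Prod>i\<in>UNIV. ?r i * tent_ft (?r i * slab_dual I u \<eta> i))
     \<le> C ^ (CARD('n) - card I) * \<rho> ^ card I * (\<Prod>i\<in>I. tent_ft (\<rho> * (u i \<bullet> \<eta>)))" for \<eta>
  proof -
    have "(\<Prod>i\<in>UNIV. ?r i * tent_ft (?r i * slab_dual I u \<eta> i))
      = (\<Prod>i\<in>I. ?r i * tent_ft (?r i * slab_dual I u \<eta> i)) * (\<Prod>i\<in>-I. ?r i * tent_ft (?r i * slab_dual I u \<eta> i))"
      by (subst prod.union_disjoint[symmetric]) auto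
    moreover have "(\<Prod>i\<in>I. ?r i * tent_ft (?r i * slab_dual I u \<eta> i)) = \<rho> ^ card I * (\<Prod>i\<in>I. tent_ft (\<rho> * (u i \<bullet> \<eta>)))"
      using slab_dual_echelon[OF ech] by (simp add: prod.distrib)
    moreover have "(\<Prod>i\<in>-I. ?r i * tent_ft (?r i * slab_dual I u \<eta> i)) \<le> (\<Prod>i\<in>-I. C)"
    proof (intro prod_mono conjI)
      fix i assume "i \<in> -I"
      then show "0 \<le> ?r i * tent_ft (?r i * slab_dual I u \<eta> i)" using C by (simp add: tent_ft_nonneg)
      have "C * tent_ft (C * slab_dual I u \<eta> i) \<le> C * 1" using C tent_ft_le_1 by (intro mult_left_mono) auto
      then show "?r i * tent_ft (?r i * slab_dual I u \<eta> i) \<le> C" using \<open>i \<in> -I\<close> by simp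
    qed
    moreover have "(\<Prod>i\<in>-I. C) = C ^ (CARD('n) - card I)" by (simp add: Compl_eq_Diff_UNIV card_Diff_subset)
    moreover have "0 \<le> \<rho> ^ card I * (\<Prod>i\<in>I. tent_ft (\<rho> * (u i \<bullet> \<eta>)))"
      using \<rho> by (simp add: prod_nonneg tent_ft_nonneg)
    ultimately have "(\<Prod>i\<in>UNIV. ?r i * tent_ft (?r i * slab_dual I u \<eta> i))
       \<le> (\<rho> ^ card I * (\<Prod>i\<in>I. tent_ft (\<rho> * (u i \<bullet> \<eta>)))) * C ^ (CARD('n) - card I)"
      by (simp only: mult_left_mono)
    then show ?thesis by (simp only: mult_ac)
  qed
  have "(\<integral>x. slab_tent I u d ?r x * (cmod (expsum S f x))\<^sup>2 \<partial>lborel)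
     \<le> (\<Sum>a\<in>S. \<Sum>b\<in>S. \<Prod>i\<in>UNIV. ?r i * tent_ft (?r i * slab_dual I u (f a - f b) i))"
    by (rule integral_slab_tent_expsum_le[OF r])
  also have "\<dots> \<le> (\<Sum>a\<in>S. \<Sum>b\<in>S. C ^ (CARD('n) - card I) * \<rho> ^ card I * (\<Prod>i\<in>I. tent_ft (\<rho> * (u i \<bullet> (f a - f b)))))"
    by (intro sum_mono tm)
  also have "\<dots> = C ^ (CARD('n) - card I) * \<rho> ^ card I * (\<Sum>b\<in>S. \<Sum>a\<in>S. \<Prod>i\<in>I. tent_ft (\<rho> * (u i \<bullet> (f a - f b))))"
    by (subst sum.swap) (simp add: sum_distrib_left)
  also have "\<dots> \<le> C ^ (CARD('n) - card I) * \<rho> ^ card I * (\<Sum>b\<in>S. real N * 20 ^ card I)"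
  proof (intro mult_left_mono sum_mono sum_prod_tent_ft_le[OF S] N)
    fix b S' a a' i
    assume *: "\<And>a a' i. a \<in> S' \<Longrightarrow> a' \<in> S' \<Longrightarrow> i \<in> I \<Longrightarrow> \<bar>\<rho> * (u i \<bullet> (f a - f b)) - \<rho> * (u i \<bullet> (f a' - f b))\<bar> \<le> 1"
      and "a \<in> S'" "a' \<in> S'" "i \<in> I"
    have "\<rho> * (u i \<bullet> (f a - f b)) - \<rho> * (u i \<bullet> (f a' - f b)) = \<rho> * (u i \<bullet> (f a - f a'))"
      by (simp add: inner_diff_right algebra_simps)
    with *[OF \<open>a \<in> S'\<close> \<open>a' \<in> S'\<close> \<open>i \<in> I\<close>] have "\<rho> * \<bar>u i \<bullet> (f a - f a')\<bar> \<le> 1" using \<rho> by (simp add: abs_mult)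
    then show "\<bar>u i \<bullet> (f a - f a')\<bar> \<le> 1 / \<rho>" using \<rho> by (simp add: field_simps)
  qed (use \<rho> C in auto)
  finally show ?thesis by (simp add: mult_ac)
qed

text \<open>The sheared coordinate vanishes on \<open>b\<close> by the graph representation. On a
  tube it therefore deviates from its value at \<open>v\<close> only by the effect of a vector
  shorter than 1.\<close>

lemma mem_slab_bound:
  fixes b :: "(real^'n) set"
  assumes rep: "\<And>y. y \<in> b \<Longrightarrow> y = (\<Sum>i\<in>I. (y $ i) *\<^sub>R u i)"
    and ub: "\<And>i j. i \<in> I \<Longrightarrow> \<bar>u i $ j\<bar> \<le> U" and U: "0 \<le> U"
    and b0: "b \<noteq> {}" and x: "infdist x ((+) v ` b) < 1"
  shows "\<bar>x $ j - (\<Sum>i\<in>I. u i $ j * x $ i) - (v $ j - (\<Sum>i\<in>I. u i $ j * v $ i))\<bar> \<le> 1 + real CARD('n) * U"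
proof -
  obtain y where y: "y \<in> b" "dist x (v + y) < 1"
  proof -
    have ne: "(+) v ` b \<noteq> {}" using b0 by simp
    have "(INF a\<in>(+) v ` b. dist x a) < 1" using x ne by (simp add: infdist_def)
    then obtain a where "a \<in> (+) v ` b" "dist x a < 1"
      using ne by (subst (asm) cInf_less_iff) (auto intro!: bdd_belowI2[where m=0])
    then show ?thesis using that by auto
  qed
  define h where "h = x - (v + y)"
  have h: "\<bar>h $ i\<bar> \<le> 1" for i
    using component_le_norm_cart[of h i] y(2) by (simp add: h_def dist_norm)
  have xe: "x $ i = v $ i + y $ i + h $ i" for i by (simp add: h_def)
  have yj: "y $ j = (\<Sum>i\<in>I. u i $ j * y $ i)"
  proof -
    have "y $ j = (\<Sum>i\<in>I. (y $ i) *\<^sub>R u i) $ j" using rep[OF y(1)] by simp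
    then show ?thesis by (simp add: mult.commute)
  qed
  have "x $ j - (\<Sum>i\<in>I. u i $ j * x $ i) - (v $ j - (\<Sum>i\<in>I. u i $ j * v $ i)) = h $ j - (\<Sum>i\<in>I. u i $ j * h $ i)"
    unfolding xe using yj by (simp add: distrib_left sum.distrib)
  also have "\<bar>\<dots>\<bar> \<le> \<bar>h $ j\<bar> + \<bar>\<Sum>i\<in>I. u i $ j * h $ i\<bar>" by (rule abs_triangle_ineq4)
  also have "\<dots> \<le> 1 + (\<Sum>i\<in>I. \<bar>u i $ j * h $ i\<bar>)" by (intro add_mono h sum_abs)
  also have "(\<Sum>i\<in>I. \<bar>u i $ j * h $ i\<bar>) \<le> (\<Sum>i\<in>I. U * 1)"
    unfolding abs_mult using ub h U by (intro sum_mono mult_mono) auto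
  also have "\<dots> \<le> real CARD('n) * U" using U by (simp add: mult_right_mono card_mono)
  finally show ?thesis by simp
qed

lemma tent_half_le: "\<bar>x\<bar> \<le> r \<Longrightarrow> 0 < r \<Longrightarrow> 1/2 \<le> tent (x / (2 * r))"
  by (simp add: tent_def abs_mult divide_le_eq)

text \<open>On the intersection of the box with a tube, a slab tent of doubled widths is at least
  \<open>2 ^ - n\<close>, as each of its factors is at least 1/2. It hence dominates the cut-off
  weight pointwise, up to \<open>2 ^ n\<close>.\<close>

lemma max_fun_box_weight_le:
  fixes f :: "'a \<Rightarrow> real^'n"
  assumes S: "finite S" and \<rho>: "0 < \<rho>" and b: "subspace b" "dim b = l"
    and U: "(1 + real CARD('n)) ^ l \<le> U"
    and N: "\<And>S' (I::'n set) u. card I = l \<Longrightarrow> echelon I u \<Longrightarrow> (\<forall>i\<in>I. \<forall>j. \<bar>u i $ j\<bar> \<le> U) \<Longrightarrow>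
       S' \<subseteq> S \<Longrightarrow> (\<And>a b i. a \<in> S' \<Longrightarrow> b \<in> S' \<Longrightarrow> i \<in> I \<Longrightarrow> \<bar>u i \<bullet> (f a - f b)\<bar> \<le> 1 / \<rho>) \<Longrightarrow> card S' \<le> N"
  shows "max_fun (box_weight \<rho> S f) b \<le>
     2 ^ CARD('n) * ((2 * (1 + real CARD('n) * U)) ^ (CARD('n) - l) * (2 * \<rho>) ^ l * real (card S) * (real N * 20 ^ l))"
proof -
  have U0: "0 \<le> U" by (rule order_trans[OF _ U]) simp
  define C where "C = 1 + real CARD('n) * U"
  have C: "0 < C" using U0 by (simp add: C_def add_pos_nonneg)
  from echelon_basis[OF b] obtain I :: "'n set" and u where I: "card I = l"
    and u: "\<forall>i\<in>I. u i \<in> b \<and> (\<forall>i'\<in>I. u i $ i' = (if i' = i then 1 else 0)) \<and>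
        (\<forall>j. \<bar>u i $ j\<bar> \<le> (1 + real CARD('n)) ^ l)"
    and rep: "\<forall>y\<in>b. y = (\<Sum>i\<in>I. (y $ i) *\<^sub>R u i)" by blast
  have ech: "echelon I u" using u by (simp add: echelon_def)
  have ub: "\<bar>u i $ j\<bar> \<le> U" if "i \<in> I" for i j
  proof -
    have "\<bar>u i $ j\<bar> \<le> (1 + real CARD('n)) ^ l" using u that by blast
    then show ?thesis using U by linarith
  qed
  have "(\<integral>x. indicator {x. infdist x ((+) v ` b) < 1} x * box_weight \<rho> S f x \<partial>lborel)
    \<le> 2 ^ CARD('n) * ((2 * C) ^ (CARD('n) - l) * (2 * \<rho>) ^ l * real (card S) * (real N * 20 ^ l))" for v
  proof -
    let ?T = "{x. infdist x ((+) v ` b) < 1}"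
    \<comment> \<open>Along the plane the slab is centred like the box; transversally it is centred
      at the sheared coordinates of the translate.\<close>
    define d where "d j = (if j \<in> I then 0 else v $ j - (\<Sum>i\<in>I. u i $ j * v $ i))" for j
    let ?r = "\<lambda>i. if i \<in> I then 2 * \<rho> else 2 * C"
    have r: "0 < ?r i" for i using \<rho> C by auto
    have "open ?T" by (intro open_Collect_less continuous_intros)
    then have Tm: "?T \<in> sets lborel" by simp
    have pt: "indicator ?T x * slab_tent UNIV (\<lambda>_. 0) (\<lambda>_. 0) (\<lambda>_. \<rho>) x \<le> 2 ^ CARD('n) * slab_tent I u d ?r x" for x
    proof (cases "x \<in> ?T \<and> slab_tent UNIV (\<lambda>_. 0) (\<lambda>_. 0) (\<lambda>_. \<rho>) x \<noteq> 0")
      case False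
      then show ?thesis using slab_tent_nonneg[of I u d ?r x] by auto
    next
      case True
      have 1: "slab_tent UNIV (\<lambda>_. 0) (\<lambda>_. 0) (\<lambda>_. \<rho>) x \<le> 1"
        by (auto simp: slab_tent_def tent_nonneg tent_le_1 intro!: prod_le_1)
      have 2: "(1/2) ^ card I \<le> (\<Prod>i\<in>I. tent ((x $ i - d i) / ?r i))"
      proof -
        have "(\<Prod>i\<in>I. 1/2) \<le> (\<Prod>i\<in>I. tent ((x $ i - d i) / ?r i))"
        proof (intro prod_mono conjI)
          fix i assume "i \<in> I"
          moreover have "\<bar>x $ i\<bar> \<le> \<rho>" by (rule less_imp_le[OF box_weight_support[OF \<rho> conjunct2[OF True]]])
          ultimately show "1/2 \<le> tent ((x $ i - d i) / ?r i)" using tent_half_le[of "x $ i" \<rho>] \<rho> by (simp add: d_def)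
        qed simp
        then show ?thesis by simp
      qed
      have 3: "(1/2) ^ card (-I) \<le> (\<Prod>j\<in>-I. tent ((x $ j - (\<Sum>i\<in>I. u i $ j * x $ i) - d j) / ?r j))"
      proof -
        have "(\<Prod>i\<in>-I. 1/2) \<le> (\<Prod>j\<in>-I. tent ((x $ j - (\<Sum>i\<in>I. u i $ j * x $ i) - d j) / ?r j))"
        proof (intro prod_mono conjI)
          fix j assume j: "j \<in> -I"
          have "\<bar>x $ j - (\<Sum>i\<in>I. u i $ j * x $ i) - (v $ j - (\<Sum>i\<in>I. u i $ j * v $ i))\<bar> \<le> C"
            unfolding C_def using rep ub U0 True subspace_0[OF b(1)] by (intro mem_slab_bound[of b]) auto
          then show "1/2 \<le> tent ((x $ j - (\<Sum>i\<in>I. u i $ j * x $ i) - d j) / ?r j)"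
            using tent_half_le[of _ C] C j by (simp add: d_def)
        qed simp
        then show ?thesis by simp
      qed
      have n: "card I + card (-I) = CARD('n)" using card_Un_disjoint[of I "-I"] by simp
      have "(1/2) ^ CARD('n) \<le> slab_tent I u d ?r x"
        unfolding slab_tent_def n[symmetric] power_add using 2 3 by (intro mult_mono prod_nonneg) (auto simp: tent_nonneg)
      then have "1 \<le> 2 ^ CARD('n) * slab_tent I u d ?r x" by (simp add: power_one_over field_simps)
      then show ?thesis using 1 True by simp
    qed
    have "(\<integral>x. indicator ?T x * box_weight \<rho> S f x \<partial>lborel)
      \<le> (\<integral>x. 2 ^ CARD('n) * (slab_tent I u d ?r x * (cmod (expsum S f x))\<^sup>2) \<partial>lborel)"
    proof (rule integral_mono)
      show "integrable lborel (\<lambda>x. indicator ?T x * box_weight \<rho> S f x)"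
        using integrable_mult_indicator[OF Tm box_weight_integrable[OF \<rho>, of S f]] by simp
      have "continuous_on UNIV (\<lambda>x. (cmod (expsum S f x))\<^sup>2)" by (intro continuous_intros)
      from slab_tent_mult_integrable[where r="?r", OF r this, of I u d]
      show "integrable lborel (\<lambda>x. 2 ^ CARD('n) * (slab_tent I u d ?r x * (cmod (expsum S f x))\<^sup>2))" by simp
      fix x
      show "indicator ?T x * box_weight \<rho> S f x \<le> 2 ^ CARD('n) * (slab_tent I u d ?r x * (cmod (expsum S f x))\<^sup>2)"
        unfolding box_weight_def mult.assoc[symmetric] using pt[of x] by (intro mult_right_mono) auto
    qed
    also have "\<dots> = 2 ^ CARD('n) * (\<integral>x. slab_tent I u d ?r x * (cmod (expsum S f x))\<^sup>2 \<partial>lborel)" by simp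
    also have "\<dots> \<le> 2 ^ CARD('n) * ((2 * C) ^ (CARD('n) - card I) * (2 * \<rho>) ^ card I * real (card S) * (real N * 20 ^ card I))"
    proof (intro mult_left_mono integral_slab_le S ech)
      fix S' assume S': "S' \<subseteq> S" and d: "\<And>a b i. a \<in> S' \<Longrightarrow> b \<in> S' \<Longrightarrow> i \<in> I \<Longrightarrow> \<bar>u i \<bullet> (f a - f b)\<bar> \<le> 1 / (2 * \<rho>)"
      show "card S' \<le> N"
      proof (rule N[OF I ech _ S'])
        fix a b i assume "a \<in> S'" "b \<in> S'" "i \<in> I"
        from d[OF this] have "\<bar>u i \<bullet> (f a - f b)\<bar> \<le> 1 / (2 * \<rho>)" .
        also have "\<dots> \<le> 1 / \<rho>" using \<rho> by (simp add: field_simps)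
        finally show "\<bar>u i \<bullet> (f a - f b)\<bar> \<le> 1 / \<rho>" .
      qed (use ub in blast)
    qed (use \<rho> C in auto)
    finally show ?thesis unfolding I .
  qed
  then show ?thesis unfolding max_fun_def C_def[symmetric] by (intro cSup_least) auto
qed

text \<open>The box is itself a slab over a coordinate plane, of width \<open>\<rho>\<close> in all
  directions, so absence of resonances for that plane controls the total mass as well.\<close>

lemma L1_box_weight_le:
  fixes f :: "'a \<Rightarrow> real^'n"
  assumes S: "finite S" and \<rho>: "0 < \<rho>" and l: "l \<le> CARD('n)" and U: "1 \<le> U"
    and N: "\<And>S' (I::'n set) u. card I = l \<Longrightarrow> echelon I u \<Longrightarrow> (\<forall>i\<in>I. \<forall>j. \<bar>u i $ j\<bar> \<le> U) \<Longrightarrow>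
       S' \<subseteq> S \<Longrightarrow> (\<And>a b i. a \<in> S' \<Longrightarrow> b \<in> S' \<Longrightarrow> i \<in> I \<Longrightarrow> \<bar>u i \<bullet> (f a - f b)\<bar> \<le> 1 / \<rho>) \<Longrightarrow> card S' \<le> N"
  shows "L1_norm (box_weight \<rho> S f) \<le> \<rho> ^ CARD('n) * real (card S) * (real N * 20 ^ l)"
proof -
  obtain I :: "'n set" where I: "card I = l" using l by (metis obtain_subset_with_card_n)
  define u where "u i = (axis i 1 :: real^'n)" for i
  have ech: "echelon I u" by (auto simp: echelon_def u_def axis_def)
  have ub: "\<bar>u i $ j\<bar> \<le> U" for i j using U by (auto simp: u_def axis_def)
  have eq: "slab_tent UNIV (\<lambda>_. 0) (\<lambda>_. 0) (\<lambda>_. \<rho>) x = slab_tent I u (\<lambda>_. 0) (\<lambda>i. if i \<in> I then \<rho> else \<rho>) x" for x :: "real^'n"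
  proof -
    have "(\<Sum>i\<in>I. u i $ j * x $ i) = 0" if "j \<notin> I" for j
      using that by (intro sum.neutral) (auto simp: u_def axis_def)
    then have "slab_tent I u (\<lambda>_. 0) (\<lambda>i. if i \<in> I then \<rho> else \<rho>) x = (\<Prod>i\<in>I. tent (x $ i / \<rho>)) * (\<Prod>j\<in>-I. tent (x $ j / \<rho>))"
      by (simp add: slab_tent_def)
    also have "\<dots> = (\<Prod>i\<in>UNIV. tent (x $ i / \<rho>))" by (subst prod.union_disjoint[symmetric]) auto
    finally show ?thesis by (simp add: slab_tent_def)
  qed
  have "L1_norm (box_weight \<rho> S f) = (\<integral>x. slab_tent I u (\<lambda>_. 0) (\<lambda>i. if i \<in> I then \<rho> else \<rho>) x * (cmod (expsum S f x))\<^sup>2 \<partial>lborel)"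
    unfolding L1_norm_def using box_weight_nonneg by (simp add: box_weight_def eq abs_of_nonneg slab_tent_nonneg)
  also have "\<dots> \<le> \<rho> ^ (CARD('n) - card I) * \<rho> ^ card I * real (card S) * (real N * 20 ^ card I)"
    using \<rho> ub by (intro integral_slab_le S ech N[OF I ech]) auto
  also have "\<rho> ^ (CARD('n) - card I) * \<rho> ^ card I = \<rho> ^ CARD('n)" using l I by (simp add: power_add[symmetric])
  finally show ?thesis using I by simp
qed

section \<open>Peaks at prescribed frequencies\<close>

lemma comb_append:
  "length as = length vs \<Longrightarrow> comb (as @ bs) (vs @ ws) = comb as vs + comb bs ws"
  by (induction as vs rule: list_induct2) (auto simp: add.assoc)

lemma comb_emb: "comb as (map (emb p) vs) = emb p (comb as vs)"
proof (induction as arbitrary: vs)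
  case (Cons a as)
  then show ?case by (cases vs) (auto simp: emb_def vec_eq_iff add_divide_distrib)
qed (auto simp: emb_def vec_eq_iff)

lemma comb_axis:
  assumes "distinct es"
  shows "comb (map (\<lambda>i. z $ i) es) (map (\<lambda>i. axis i (1::real)) es) $ j = (if j \<in> set es then real_of_int (z $ j) else 0)"
  using assms by (induction es) (auto simp: axis_def)

lemma comb_add:
  "length as = length vs \<Longrightarrow> length bs = length vs \<Longrightarrow>
     comb (map2 (+) as bs) vs = comb as vs + comb bs vs"
proof (induction vs arbitrary: as bs)
  case Nil then show ?case by simp
next
  case (Cons v vs)
  then obtain a as' b bs' where "as = a # as'" "bs = b # bs'"
    by (cases as; cases bs) auto
  with Cons.prems Cons.IH[of as' bs'] show ?case
    by (simp add: vec_eq_iff algebra_simps)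
qed

lemma comb_int_bound:
  fixes vs :: "(int^'n) list"
  assumes "length ds = length vs" "\<forall>x\<in>set ds. 0 \<le> x \<and> x < int A" "\<forall>w\<in>set vs. 0 \<le> w $ j \<and> w $ j < int p"
  shows "0 \<le> comb ds vs $ j \<and> comb ds vs $ j \<le> int (A * length vs * p)"
  using assms
proof (induction ds vs rule: list_induct2)
  case (Cons d ds v vs)
  have "d * v $ j \<le> int A * int p" using Cons.prems by (intro mult_mono) auto
  moreover have "0 \<le> d * v $ j" using Cons.prems by simp
  moreover have "0 \<le> comb ds vs $ j \<and> comb ds vs $ j \<le> int (A * length vs * p)" using Cons by auto
  ultimately show ?case by (simp add: algebra_simps)
qed simp

text \<open>Taking \<open>b\<close> from the middle half \<open>[h, 3h)\<close> leaves room to add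
  entries of size up to \<open>h\<close> without leaving \<open>[0, 4h)\<close>. A fixed proportion
  of the exponents thus contributes to the peak at the combination with coefficients
  \<open>c\<close>.\<close>

lemma card_representations_ge:
  assumes c: "length c = L" "\<forall>x\<in>set c. \<bar>x\<bar> \<le> int h"
  shows "\<exists>T \<subseteq> exps (4 * h) L \<times> exps (4 * h) L. card T = (2 * h) ^ L \<and> (\<forall>(a, b)\<in>T. a = map2 (+) b c)"
proof -
  define B where "B = {b. set b \<subseteq> {int h..<3 * int h} \<and> length b = L}"
  have fB: "finite B" and cB: "card B = (2 * h) ^ L"
    using finite_lists_length_eq[of "{int h..<3 * int h}" L] card_lists_length_eq[of "{int h..<3 * int h}" L]
    by (simp_all add: B_def nat_mult_distrib)
  let ?T = "(\<lambda>b. (map2 (+) b c, b)) ` B"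
  have "?T \<subseteq> exps (4 * h) L \<times> exps (4 * h) L"
  proof
    fix x assume "x \<in> ?T"
    then obtain b where b: "b \<in> B" "x = (map2 (+) b c, b)" by auto
    have "set (map2 (+) b c) \<subseteq> {0..<int (4 * h)}"
    proof
      fix y assume "y \<in> set (map2 (+) b c)"
      then obtain s t where st: "(s, t) \<in> set (zip b c)" "y = s + t" by auto
      from set_zip_leftD[OF st(1)] set_zip_rightD[OF st(1)] b c
      have "s \<in> {int h..<3 * int h}" "\<bar>t\<bar> \<le> int h" by (auto simp: B_def)
      with st show "y \<in> {0..<int (4 * h)}" by auto
    qed
    moreover have "set b \<subseteq> {0..<int (4 * h)}" using b by (fastforce simp: B_def)
    ultimately show "x \<in> exps (4 * h) L \<times> exps (4 * h) L" using b c by (auto simp: exps_def B_def)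
  qed
  moreover have "card ?T = (2 * h) ^ L" using cB by (subst card_image) (auto simp: inj_on_def)
  ultimately show ?thesis by (intro exI[of _ ?T]) auto
qed

text \<open>A hit is only a congruence modulo \<open>p\<close>, so the frequency it gives differs
  from \<open>emb p k\<close> by an integer vector. Appending the coordinate vectors
  \<open>E\<close> makes that vector a combination too. Its coefficients are bounded by
  \<open>s\<close> for the size of the targets, 1 for the translation and \<open>A0 * r\<close> for
  the other generators, which dictates \<open>h\<close>.\<close>

lemma weight_exists:
  fixes Y :: "'q \<Rightarrow> (int^'n) set"
  assumes p: "prime p" and h: "1 \<le> h" and \<rho>: "0 < \<rho>" "\<rho> \<le> real p"
    and l: "l \<le> CARD('n)"
    and U: "(1 + real CARD('n)) ^ l \<le> real U"
    and H: "0 < H" "real CARD('n) * (real (4 * h) * real (Suc r + CARD('n))) * \<rho> \<le> real H"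
    and num: "2 ^ CARD('n) * real (2 * (H * U + 1) + 1) ^ (CARD('n) * CARD('n)) *
       (2 ^ Suc r * (real (2 * (4 * h)) ^ (Suc r + CARD('n)) * (6 / \<rho>) ^ l) ^ q) \<le> 1/4"
    and A0: "A0 \<le> p" "A0 * (r + 1) + s + 2 \<le> h"
    and Q: "finite Q" and Y: "\<And>y k i. y \<in> Q \<Longrightarrow> k \<in> Y y \<Longrightarrow> \<bar>k $ i\<bar> \<le> int s * int p"
      "\<And>y. y \<in> Q \<Longrightarrow> inj_on (vmod p) (Y y)"
      "\<And>y. y \<in> Q \<Longrightarrow> 8 \<le> real A0 ^ r * (real (card (Y y)) / real p ^ CARD('n))"
  shows "\<exists>w. admissible_weight (real CARD('n) * \<rho>) w \<and>
     L1_norm w \<le> \<rho> ^ CARD('n) * real (4 * h) ^ (Suc r + CARD('n)) * (real (4 * h) ^ (q + CARD('n)) * 20 ^ l) \<and>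
     max_fun_sup l w \<le> 2 ^ CARD('n) * ((2 * (1 + real CARD('n) * real U)) ^ (CARD('n) - l) * (2 * \<rho>) ^ l * real (4 * h) ^ (Suc r + CARD('n)) * (real (4 * h) ^ (q + CARD('n)) * 20 ^ l)) \<and>
     card Q \<le> 2 * card {y\<in>Q. \<exists>k\<in>Y y. \<forall>\<zeta>. (\<forall>i. \<bar>\<zeta> $ i - emb p k $ i\<bar> \<le> 1 / (6 * \<rho>)) \<longrightarrow>
        real (2 * h) ^ (Suc r + CARD('n)) * (\<rho> / 2) ^ CARD('n) \<le> cmod (fourier w \<zeta>)}"
proof -
  obtain es :: "'n list" where es: "set es = UNIV" "distinct es" using finite_distinct_list[OF finite, of "UNIV :: 'n set"] by auto
  have les: "length es = CARD('n)" using es by (metis distinct_card)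
  define E where "E = map (\<lambda>i. axis i (1::real)) es"
  have E1: "\<forall>e\<in>set E. \<forall>j. \<bar>e $ j\<bar> \<le> 1" by (auto simp: E_def axis_def)
  have lE: "length E = CARD('n)" by (simp add: E_def les)
  have p0: "0 < p" using p by (simp add: prime_gt_0_nat)
  have "\<exists>vs\<in>words (grid p) (Suc r).
     (\<forall>(I::'n set) u. card I = l \<longrightarrow> echelon I u \<longrightarrow> (\<forall>i\<in>I. \<forall>j. \<bar>u i $ j\<bar> \<le> real U) \<longrightarrow>
        count_along (\<lambda>v ws. resonant I u (1 / \<rho>) (4 * h) v (ws @ E)) (map (emb p) vs) < q) \<and>
     card Q \<le> 2 * card {y\<in>Q. \<exists>a\<in>exps A0 r. vmod p (hd vs + comb a (tl vs)) \<in> vmod p ` Y y}"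
  proof (rule exists_generators[OF p _ \<rho> E1 H(1)])
    show "8 \<le> real A0 ^ r * (real (card (vmod p ` Y y)) / real (card (grid p :: (int^'n) set)))" if "y \<in> Q" for y
      using Y(3)[OF that] Y(2)[OF that] by (simp add: card_image card_grid)
    show "vmod p ` Y y \<subseteq> grid p" for y using vmod_in_grid[OF p0] by auto
  qed (use h H num A0 Q lE in auto)
  then obtain vs where vs: "vs \<in> words (grid p) (Suc r)"
    and cnt: "\<And>(I::'n set) u. card I = l \<Longrightarrow> echelon I u \<Longrightarrow> (\<forall>i\<in>I. \<forall>j. \<bar>u i $ j\<bar> \<le> real U) \<Longrightarrow>
        count_along (\<lambda>v ws. resonant I u (1 / \<rho>) (4 * h) v (ws @ E)) (map (emb p) vs) < q"
    and hit: "card Q \<le> 2 * card {y\<in>Q. \<exists>a\<in>exps A0 r. vmod p (hd vs + comb a (tl vs)) \<in> vmod p ` Y y}"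
    by blast
  define G where "G = map (emb p) vs @ E"
  have lG: "length G = Suc r + CARD('n)" using vs lE by (simp add: G_def words_def)
  define S where "S = exps (4 * h) (length G)"
  define f where "f a = comb a G" for a
  have S: "finite S" by (simp add: S_def finite_exps)
  have cS: "real (card S) = real (4 * h) ^ (Suc r + CARD('n))" by (simp add: S_def card_exps lG)
  \<comment> \<open>Fewer than \<open>q\<close> generators are resonant; the coordinate vectors in
    \<open>E\<close> are given up entirely, which adds \<open>CARD('n)\<close> to the
    exponent.\<close>
  have N: "card S' \<le> (4 * h) ^ (q + CARD('n))" if "card I = l" "echelon I u" "\<forall>i\<in>I. \<forall>j. \<bar>u i $ j\<bar> \<le> real U"
       "S' \<subseteq> S" "\<And>a b i. a \<in> S' \<Longrightarrow> b \<in> S' \<Longrightarrow> i \<in> I \<Longrightarrow> \<bar>u i \<bullet> (f a - f b)\<bar> \<le> 1 / \<rho>" for S' and I :: "'n set" and u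
  proof -
    have "card S' \<le> (4 * h) ^ (count_along (\<lambda>v ws. resonant I u (1 / \<rho>) (4 * h) v (ws @ E)) (map (emb p) vs) + length E)"
      using that by (intro card_close_exps_le) (auto simp: S_def f_def G_def)
    also have "\<dots> \<le> (4 * h) ^ (q + CARD('n))"
      using cnt[OF that(1-3)] lE h by (intro power_increasing) auto
    finally show ?thesis .
  qed
  define w where "w = box_weight \<rho> S f"
  have U1: "1 \<le> real U" by (rule order_trans[OF _ U]) (simp add: one_le_power)
  have L1: "L1_norm w \<le> \<rho> ^ CARD('n) * real (card S) * (real ((4 * h) ^ (q + CARD('n))) * 20 ^ l)"
    unfolding w_def by (rule L1_box_weight_le[OF S \<rho>(1) l U1 N])
  have M: "max_fun w b \<le> 2 ^ CARD('n) * ((2 * (1 + real CARD('n) * real U)) ^ (CARD('n) - l) * (2 * \<rho>) ^ l * real (card S) * (real ((4 * h) ^ (q + CARD('n))) * 20 ^ l))"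
    if "b \<in> grassmannian l" for b
    unfolding w_def using that by (intro max_fun_box_weight_le[OF S \<rho>(1) _ _ U N]) (auto simp: grassmannian_def)
  have "grassmannian l \<noteq> ({} :: (real^'n) set set)"
  proof -
    have "l \<le> dim (UNIV :: (real^'n) set)" using l by simp
    then obtain b :: "(real^'n) set" where "subspace b" "dim b = l" by (rule choose_subspace_of_subspace) auto
    then show ?thesis by (auto simp: grassmannian_def)
  qed
  then have M': "max_fun_sup l w \<le> 2 ^ CARD('n) * ((2 * (1 + real CARD('n) * real U)) ^ (CARD('n) - l) * (2 * \<rho>) ^ l * real (card S) * (real ((4 * h) ^ (q + CARD('n))) * 20 ^ l))"
    unfolding max_fun_sup_def using M by (intro cSup_least) auto
  have peak: "real (2 * h) ^ (Suc r + CARD('n)) * (\<rho> / 2) ^ CARD('n) \<le> cmod (fourier w \<zeta>)"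
    if y: "y \<in> Q" and k: "k \<in> Y y" and a: "a \<in> exps A0 r" and eq: "vmod p (hd vs + comb a (tl vs)) = vmod p k"
      and \<zeta>: "\<And>i. \<bar>\<zeta> $ i - emb p k $ i\<bar> \<le> 1 / (6 * \<rho>)" for y k a \<zeta>
  proof -
    obtain v ws where vws: "vs = v # ws" using vs by (cases vs) (auto simp: words_def)
    have vg: "v \<in> grid p" and wg: "set ws \<subseteq> grid p" and lw: "length ws = r" using vs vws by (auto simp: words_def)
    \<comment> \<open>The integer vector lost in the reduction modulo \<open>p\<close>.\<close>
    define z where "z = (\<chi> i. (k $ i - (v + comb a ws) $ i) div int p)"
    have kz: "k $ i = (v + comb a ws) $ i + int p * z $ i" for i
    proof -
      have "(v + comb a ws) $ i mod int p = k $ i mod int p" using eq vws by (simp add: vmod_def vec_eq_iff)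
      then have "int p dvd k $ i - (v + comb a ws) $ i" by (simp add: mod_eq_dvd_iff dvd_diff_commute)
      then show ?thesis by (simp add: z_def)
    qed
    have zb: "\<bar>z $ i\<bar> \<le> int h" for i
    proof -
      have la: "length a = length ws" using a lw by (simp add: exps_def)
      have c: "0 \<le> comb a ws $ i \<and> comb a ws $ i \<le> int (A0 * length ws * p)"
        using a wg by (intro comb_int_bound la) (auto simp: exps_def grid_def)
      have v: "0 \<le> v $ i" "v $ i < int p" using vg by (auto simp: grid_def)
      have "int p * \<bar>z $ i\<bar> = \<bar>k $ i - (v $ i + comb a ws $ i)\<bar>" using kz[of i] by (simp add: abs_mult)
      also have "\<dots> \<le> \<bar>k $ i\<bar> + \<bar>v $ i\<bar> + \<bar>comb a ws $ i\<bar>" by linarith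
      also have "\<dots> \<le> int s * int p + int p + int (A0 * length ws * p)" using Y(1)[OF y k, of i] v c by linarith
      also have "\<dots> = int p * int (s + 1 + A0 * r)" using lw by (simp add: algebra_simps)
      also have "\<dots> \<le> int p * int h"
      proof (intro mult_left_mono)
        have "s + 1 + A0 * r \<le> h" using A0(2) by (simp add: algebra_simps)
        then show "int (s + 1 + A0 * r) \<le> int h" by (simp only: of_nat_le_iff)
      qed simp
      finally show ?thesis using p0 by simp
    qed
    \<comment> \<open>Coefficient 1 belongs to the free translation, \<open>a\<close> to the
      remaining random generators, and \<open>z\<close> to the coordinate vectors.\<close>
    define c where "c = (1 # a) @ map (\<lambda>i. z $ i) es"
    have lc: "length c = length G" using a lG les by (simp add: c_def exps_def)
    have cb: "\<forall>x\<in>set c. \<bar>x\<bar> \<le> int h"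
    proof -
      have "\<bar>x\<bar> \<le> int h" if "x \<in> set a" for x
      proof -
        have "x \<in> {0..<int A0}" using a that by (auto simp: exps_def)
        moreover have "A0 * 1 \<le> A0 * (r + 1)" by (intro mult_left_mono) auto
        ultimately show ?thesis using A0(2) by auto
      qed
      then show ?thesis using zb h by (auto simp: c_def)
    qed
    have fc: "comb c G = emb p k"
    proof -
      have "comb c G = comb (1 # a) (map (emb p) vs) + comb (map (\<lambda>i. z $ i) es) E"
        unfolding c_def G_def using a vs by (intro comb_append) (auto simp: exps_def words_def)
      also have "comb (1 # a) (map (emb p) vs) = emb p (v + comb a ws)"
        unfolding comb_emb by (simp add: vws)
      finally have "comb c G $ i = emb p k $ i" for i
        using p0 comb_axis[OF es(2), of z i] kz[of i] es(1) unfolding E_def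
        by (simp add: emb_def field_simps)
      then show ?thesis by (simp add: vec_eq_iff)
    qed
    obtain T where T: "T \<subseteq> S \<times> S" "card T = (2 * h) ^ length G" "\<forall>(a, b)\<in>T. a = map2 (+) b c"
      using card_representations_ge[OF lc cb] unfolding S_def by blast
    have "real (card T) * (\<rho> / 2) ^ CARD('n) \<le> cmod (fourier w \<zeta>)"
      unfolding w_def
    proof (rule fourier_box_weight_ge[OF \<rho>(1) S T(1)])
      fix a b i assume ab: "(a, b) \<in> T"
      have "a = map2 (+) b c" using T(3) ab by auto
      moreover have "length b = length G" using ab T(1) by (auto simp: S_def exps_def)
      ultimately have "f a = f b + comb c G" unfolding f_def using lc by (simp add: comb_add)
      then have "\<bar>(f a - f b - \<zeta>) $ i\<bar> \<le> 1 / (6 * \<rho>)" using \<zeta>[of i] fc by (simp add: abs_minus_commute)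
      from mult_left_mono[OF this, of \<rho>] show "\<bar>\<rho> * (f a - f b - \<zeta>) $ i\<bar> \<le> 1 / 6"
        using \<rho> by (simp only: abs_mult) (simp add: less_imp_le)
    qed
    then show ?thesis using T(2) lG by simp
  qed
  have "{y\<in>Q. \<exists>a\<in>exps A0 r. vmod p (hd vs + comb a (tl vs)) \<in> vmod p ` Y y}
     \<subseteq> {y\<in>Q. \<exists>k\<in>Y y. \<forall>\<zeta>. (\<forall>i. \<bar>\<zeta> $ i - emb p k $ i\<bar> \<le> 1 / (6 * \<rho>)) \<longrightarrow>
        real (2 * h) ^ (Suc r + CARD('n)) * (\<rho> / 2) ^ CARD('n) \<le> cmod (fourier w \<zeta>)}"
    using peak by blast
  then have "card {y\<in>Q. \<exists>a\<in>exps A0 r. vmod p (hd vs + comb a (tl vs)) \<in> vmod p ` Y y}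
     \<le> card {y\<in>Q. \<exists>k\<in>Y y. \<forall>\<zeta>. (\<forall>i. \<bar>\<zeta> $ i - emb p k $ i\<bar> \<le> 1 / (6 * \<rho>)) \<longrightarrow>
        real (2 * h) ^ (Suc r + CARD('n)) * (\<rho> / 2) ^ CARD('n) \<le> cmod (fourier w \<zeta>)}"
    using Q by (intro card_mono) auto
  then have hit': "card Q \<le> 2 * card {y\<in>Q. \<exists>k\<in>Y y. \<forall>\<zeta>. (\<forall>i. \<bar>\<zeta> $ i - emb p k $ i\<bar> \<le> 1 / (6 * \<rho>)) \<longrightarrow>
        real (2 * h) ^ (Suc r + CARD('n)) * (\<rho> / 2) ^ CARD('n) \<le> cmod (fourier w \<zeta>)}"
    using hit by linarith
  show ?thesis
    using box_weight_admissible[OF \<rho>(1), of S f] L1 M' hit' unfolding w_def[symmetric] cS of_nat_power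
    by (intro exI[of _ w]) auto
qed

section \<open>Choice of the parameters at scale \<open>R\<close>\<close>

lemma eventually_le_powr:
  fixes c e :: real
  assumes "0 < e"
  shows "eventually (\<lambda>R. c \<le> R powr e) at_top"
proof -
  have "c \<le> R powr e" if "max 1 (\<bar>c\<bar> powr (1 / e)) \<le> R" for R
  proof -
    have "\<bar>c\<bar> = (\<bar>c\<bar> powr (1 / e)) powr e" using assms by (simp add: powr_powr)
    also have "\<dots> \<le> R powr e" using that assms by (intro powr_mono2) auto
    finally show ?thesis by linarith
  qed
  then show ?thesis by (intro eventually_at_top_linorderI)
qed

text \<open>The prime is quantified after \<open>R\<close> and may be arbitrarily large, and the
  targets \<open>Y\<close> after the prime: they may be any integer points adapted to the mesh
  \<open>1 / p\<close>, provided each family has density at least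
  \<open>R powr (\<epsilon> - l)\<close>. Half of the families are met.\<close>

theorem resonance_free_weight:
  fixes l s :: nat and \<epsilon> :: real
  assumes l: "1 \<le> l" "l \<le> CARD('n::finite)" and \<epsilon>: "0 < \<epsilon>"
  shows "eventually (\<lambda>R. \<exists>p0. \<forall>p\<ge>p0. prime p \<longrightarrow> (\<forall>(Q::'q set) (Y :: 'q \<Rightarrow> (int^'n) set). finite Q \<longrightarrow>
      (\<forall>y\<in>Q. (\<forall>k\<in>Y y. \<forall>i. \<bar>k $ i\<bar> \<le> int s * int p) \<and> inj_on (vmod p) (Y y) \<and>
          R powr (\<epsilon> - real l) * real p ^ CARD('n) \<le> real (card (Y y))) \<longrightarrow>
      (\<exists>w B. admissible_weight R w \<and> 0 < B \<and>
         L1_norm w * max_fun_sup l w \<le> B\<^sup>2 * R powr (real CARD('n) + real l + \<epsilon>) \<and>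
         card Q \<le> 2 * card {y\<in>Q. \<exists>k\<in>Y y. \<forall>\<zeta>. norm (\<zeta> - emb p k) \<le> 1 / (6 * R) \<longrightarrow>
            B * R powr (real CARD('n) - \<epsilon>) \<le> cmod (fourier w \<zeta>)}))) at_top"
proof -
  define n where "n = CARD('n)"
  have n1: "1 \<le> n" using l by (simp add: n_def)
  define e where "e = min (\<epsilon> / 8) (1/4)"
  have e: "0 < e" "8 * e \<le> \<epsilon>" "e \<le> 1/4" using \<epsilon> by (auto simp: e_def)
  define U where "U = (1 + n) ^ l"
  \<comment> \<open>The net has at most \<open>R powr (4 * n * n)\<close> matrices up to constants,
    and each resonance has probability at most \<open>R powr (- e)\<close>; \<open>q\<close>
    resonances beat the net with a factor \<open>R powr (-2)\<close> to spare.\<close>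
  define q where "q = nat \<lceil>(4 * real n * real n + 2) / e\<rceil>"
  have q: "4 * real n * real n + 2 \<le> e * q"
  proof -
    have "(4 * real n * real n + 2) / e \<le> real q" unfolding q_def by (rule of_nat_ceiling)
    then show ?thesis using e by (simp add: field_simps)
  qed
  \<comment> \<open>Many generators make each coefficient range a tiny power of \<open>R\<close>.
    The first summand keeps the resonance loss, squared because it enters both mass and tubes, below
    \<open>R powr e\<close>; the second keeps small the loss from reserving \<open>n + 1\<close>
    generators for translation and lattice.\<close>
  define r where "r = nat \<lceil>(2 * real l * (real q + real n) + real l * (real n + 1)) / e\<rceil>"
  have r: "2 * real l * (real q + real n) + real l * (real n + 1) \<le> e * r"
  proof -
    have "(2 * real l * (real q + real n) + real l * (real n + 1)) / e \<le> real r" unfolding r_def by (rule of_nat_ceiling)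
    then show ?thesis using e by (simp add: field_simps)
  qed
  define L where "L = Suc r + n"
  have L0: "0 < real L" by (simp add: L_def)
  \<comment> \<open>The coefficient range is about \<open>R powr \<theta>\<close>, so that the
    number of exponents is about \<open>R powr (l - 2 * e)\<close>. Staying below
    \<open>R ^ l\<close> is what makes one resonance improbable.\<close>
  define \<theta> where "\<theta> = (real l - 2 * e) / L"
  have \<theta>L: "\<theta> * L = real l - 2 * e" using L0 by (simp add: \<theta>_def)
  have le: "1/2 \<le> real l - 2 * e" using l e by simp
  have \<theta>0: "0 < \<theta>" unfolding \<theta>_def using le L0 by (intro divide_pos_pos) auto
  have rL: "real r \<le> real L" by (simp add: L_def)
  have \<theta>1: "\<theta> \<le> 1"
  proof -
    have "real l - 2 * e \<le> real L" using l e by (simp add: L_def n_def)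
    then show ?thesis unfolding \<theta>_def using L0 by simp
  qed
  have \<theta>l: "\<theta> * real L \<le> real l" using \<theta>L e by simp
  have \<theta>e: "\<theta> * (2 * (real q + real n)) \<le> e"
  proof -
    have "\<theta> * (2 * (real q + real n)) * L = (\<theta> * L) * (2 * (real q + real n))" by simp
    also have "\<dots> \<le> real l * (2 * (real q + real n))" using \<theta>l by (intro mult_right_mono) auto
    also have "\<dots> = 2 * real l * (real q + real n)" by simp
    also have "\<dots> \<le> e * r" using r by (smt (verit) mult_nonneg_nonneg of_nat_0_le_iff)
    also have "\<dots> \<le> e * L" using e rL by (intro mult_left_mono) auto
    finally show ?thesis using L0 by simp
  qed
  have \<theta>r: "real l - 3 * e \<le> \<theta> * r"
  proof -
    have "\<theta> * real L = \<theta> * r + \<theta> * (real n + 1)" by (simp add: L_def algebra_simps)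
    moreover have "\<theta> * (real n + 1) \<le> e"
    proof -
      have "\<theta> * (real n + 1) * L = (\<theta> * L) * (real n + 1)" by simp
      also have "\<dots> \<le> real l * (real n + 1)" using \<theta>l by (intro mult_right_mono) auto
      also have "\<dots> \<le> e * r" using r by (smt (verit) mult_nonneg_nonneg of_nat_0_le_iff)
      also have "\<dots> \<le> e * L" using e rL by (intro mult_left_mono) auto
      finally show ?thesis using L0 by simp
    qed
    ultimately show ?thesis using \<theta>L by simp
  qed
  define c1 where "c1 = (8 * (real r + 2)) ^ L * (6 * real n) ^ l"
  define c4 where "c4 = 2 * real U * (4 * (real r + 2) * L + 1) + 3"
  define C where "C = 2 * (1 + real n * real U)"
  define c7 where "c7 = 20 ^ l * 20 ^ l * 2 ^ n * C ^ (n - l) * 2 ^ l * (4 * (real r + 2)) ^ (2 * (q + n))"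
  have C0: "0 \<le> C" by (simp add: C_def)
  have c70: "0 \<le> c7" using C0 by (simp add: c7_def)
  have "eventually (\<lambda>R. 1 \<le> R \<and> 2 * (real s + 4) \<le> R powr \<theta> \<and> c1 \<le> R powr e \<and> c4 \<le> R powr 1 \<and>
      2 ^ n * 2 ^ Suc r * 4 \<le> R powr 2 \<and> 8 * 2 ^ r \<le> R powr (5 * e) \<and> c7 \<le> R powr e \<and> 2 ^ L * (2 * real n) ^ n \<le> R powr \<epsilon>) at_top"
    using \<theta>0 e \<epsilon> by (intro eventually_conj eventually_le_powr eventually_ge_at_top) auto
  then show ?thesis
  proof (rule eventually_mono)
    fix R :: real
    assume "1 \<le> R \<and> 2 * (real s + 4) \<le> R powr \<theta> \<and> c1 \<le> R powr e \<and> c4 \<le> R powr 1 \<and>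
      2 ^ n * 2 ^ Suc r * 4 \<le> R powr 2 \<and> 8 * 2 ^ r \<le> R powr (5 * e) \<and> c7 \<le> R powr e \<and> 2 ^ L * (2 * real n) ^ n \<le> R powr \<epsilon>"
    then have R1: "1 \<le> R" and E2: "2 * (real s + 4) \<le> R powr \<theta>" and E3: "c1 \<le> R powr e" and E4: "c4 \<le> R"
      and E5: "2 ^ n * 2 ^ Suc r * 4 \<le> R powr 2" and E6: "8 * 2 ^ r \<le> R powr (5 * e)" and E7: "c7 \<le> R powr e"
      and E8: "2 ^ L * (2 * real n) ^ n \<le> R powr \<epsilon>" by auto
    have R0: "0 < R" using R1 by simp
    have pw: "(R powr x) ^ k = R powr (x * real k)" for x and k :: nat
      using R0 by (simp add: powr_realpow[symmetric] powr_powr)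
    have pn: "R ^ k = R powr (real k)" for k :: nat using R0 by (simp add: powr_realpow)
    define A0 where "A0 = nat \<lfloor>R powr \<theta>\<rfloor>"
    have A0u: "real A0 \<le> R powr \<theta>" unfolding A0_def by (simp add: of_nat_floor)
    have A0l: "R powr \<theta> - 1 \<le> real A0" unfolding A0_def by linarith
    have A0h: "R powr \<theta> / 2 \<le> real A0"     proof -
      have "2 \<le> R powr \<theta>" by (rule order_trans[OF _ E2]) simp
      then have "R powr \<theta> / 2 + 1 \<le> R powr \<theta>" by (simp add: field_simps)
      then show ?thesis using A0l by linarith
    qed
    have A0s: "s + 2 \<le> A0"
    proof -
      have "real (s + 2) \<le> real A0" using A0l E2 by simp
      then show ?thesis by (simp only: of_nat_le_iff)
    qed
    define h where "h = A0 * (r + 1) + s + 2"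
    have h1: "1 \<le> h" by (simp add: h_def)
    have hu: "real h \<le> (real r + 2) * R powr \<theta>"
    proof -
      have "h \<le> A0 * (r + 2)" using A0s by (simp add: h_def)
      then have "real h \<le> real A0 * (real r + 2)" by (metis of_nat_le_iff of_nat_mult of_nat_add of_nat_numeral)
      also have "\<dots> \<le> R powr \<theta> * (real r + 2)" using A0u by (intro mult_right_mono) auto
      finally show ?thesis by (simp add: mult.commute)
    qed
    define \<rho> where "\<rho> = R / n"
    have \<rho>0: "0 < \<rho>" and \<rho>R: "\<rho> \<le> R" and n\<rho>: "real n * \<rho> = R" using R0 n1 by (auto simp: \<rho>_def divide_le_eq)
    \<comment> \<open>The resolution of the net. It is at most a constant times the square of
      \<open>R\<close>, which keeps the net polynomial.\<close>
    define H where "H = nat \<lceil>real n * (real (4 * h) * real L) * \<rho>\<rceil>"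
    have Hl: "real n * (real (4 * h) * real L) * \<rho> \<le> real H" unfolding H_def by (rule of_nat_ceiling)
    have Hpos: "0 < H"
    proof -
      have "0 < real n * (real (4 * h) * real L) * \<rho>" using n1 h1 L0 \<rho>0 by (intro mult_pos_pos) auto
      then show ?thesis using Hl by linarith
    qed
    have R\<theta>: "R powr \<theta> \<le> R" using powr_mono[OF \<theta>1 R1] R0 by simp
    have Hu: "real H \<le> (4 * (real r + 2) * L + 1) * R\<^sup>2"
    proof -
      have "real H \<le> real n * (real (4 * h) * real L) * \<rho> + 1"
      proof -
        have "real (nat \<lceil>x\<rceil>) \<le> x + 1" if "0 \<le> x" for x using that by linarith
        then show ?thesis unfolding H_def using \<rho>0 by simp
      qed
      also have "real n * (real (4 * h) * real L) * \<rho> = 4 * real h * real L * R" using n\<rho> by (simp add: mult_ac)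
      also have "\<dots> \<le> 4 * ((real r + 2) * R) * real L * R"
        using order_trans[OF hu mult_left_mono[OF R\<theta>, of "real r + 2"]] R0 by (intro mult_right_mono mult_left_mono) auto
      also have "\<dots> + 1 \<le> 4 * ((real r + 2) * R) * real L * R + R\<^sup>2"
        using R1 by (simp add: one_le_power)
      finally show ?thesis by (simp add: power2_eq_square algebra_simps)
    qed
    have HU: "real (2 * (H * U + 1) + 1) \<le> R powr 4"
    proof -
      have "real (2 * (H * U + 1) + 1) = 2 * real U * real H + 3" by simp
      also have "\<dots> \<le> 2 * real U * ((4 * (real r + 2) * L + 1) * R\<^sup>2) + 3 * R\<^sup>2"
        using Hu R1 by (intro add_mono mult_left_mono) (auto simp: one_le_power)
      also have "\<dots> = c4 * R\<^sup>2" by (simp add: c4_def algebra_simps)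
      also have "\<dots> \<le> R * R\<^sup>2" using E4 by (intro mult_right_mono) auto
      also have "\<dots> \<le> R\<^sup>2 * R\<^sup>2" using R1 by (intro mult_right_mono) (auto simp: self_le_power)
      also have "\<dots> = R powr 4" using pn[of 4] by (simp flip: power_add)
      finally show ?thesis .
    qed
    have beta: "real (2 * (4 * h)) ^ L * (6 / \<rho>) ^ l \<le> R powr (- e)"
    proof -
      have "real (2 * (4 * h)) ^ L \<le> (8 * ((real r + 2) * R powr \<theta>)) ^ L"
        using hu by (intro power_mono) auto
      also have "\<dots> = (8 * (real r + 2)) ^ L * R powr (real l - 2 * e)"
        by (simp only: mult.assoc[symmetric] power_mult_distrib[of _ "R powr \<theta>"] pw \<theta>L)
      finally have 1: "real (2 * (4 * h)) ^ L \<le> (8 * (real r + 2)) ^ L * R powr (real l - 2 * e)" .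
      have "(6 / \<rho>) ^ l = (6 * real n) ^ l * R powr (- real l)"
      proof -
        have "6 / \<rho> = (6 * real n) / R" by (simp add: \<rho>_def)
        then have "(6 / \<rho>) ^ l = (6 * real n) ^ l / R powr real l" by (simp only: power_divide pn)
        then show ?thesis by (simp add: powr_minus_divide)
      qed
      then have "real (2 * (4 * h)) ^ L * (6 / \<rho>) ^ l \<le> (8 * (real r + 2)) ^ L * R powr (real l - 2 * e) * ((6 * real n) ^ l * R powr (- real l))"
        using 1 by (simp add: mult_right_mono)
      also have "\<dots> = c1 * (R powr (real l - 2 * e) * R powr (- real l))" by (simp add: c1_def)
      also have "\<dots> = c1 * R powr (- 2 * e)" by (simp add: powr_add[symmetric])
      also have "\<dots> \<le> R powr e * R powr (- 2 * e)" using E3 by (intro mult_right_mono) auto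
      also have "\<dots> = R powr (- e)" by (simp add: powr_add[symmetric])
      finally show ?thesis .
    qed
    have num: "2 ^ n * real (2 * (H * U + 1) + 1) ^ (n * n) * (2 ^ Suc r * (real (2 * (4 * h)) ^ L * (6 / \<rho>) ^ l) ^ q) \<le> 1/4"
    proof -
      have "2 ^ n * real (2 * (H * U + 1) + 1) ^ (n * n) * (2 ^ Suc r * (real (2 * (4 * h)) ^ L * (6 / \<rho>) ^ l) ^ q)
        \<le> 2 ^ n * (R powr 4) ^ (n * n) * (2 ^ Suc r * (R powr (- e)) ^ q)"
        using HU beta \<rho>0 by (intro mult_mono power_mono mult_left_mono) (auto intro!: mult_nonneg_nonneg)
      also have "\<dots> = 2 ^ n * 2 ^ Suc r * R powr (4 * real n * real n - e * q)"
      proof -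
        have "R powr (4 * real n * real n - e * q) = R powr (4 * real (n * n)) * R powr (- e * real q)"
          by (simp add: powr_add[symmetric] mult.assoc)
        then show ?thesis by (simp only: pw mult_ac)
      qed
      also have "\<dots> \<le> 2 ^ n * 2 ^ Suc r * R powr (-2)"
        using q R1 by (intro mult_left_mono powr_mono) auto
      also have "\<dots> \<le> 1/4" using E5 R0 by (simp add: powr_minus divide_inverse[symmetric] field_simps)
      finally show ?thesis .
    qed
    have hitnum: "8 \<le> real A0 ^ r * R powr (\<epsilon> - real l)"
    proof -
      have "8 \<le> (1/2) ^ r * R powr (5 * e)" using E6 by (simp add: field_simps power_one_over)
      also have "R powr (5 * e) \<le> R powr (\<theta> * r + (\<epsilon> - real l))" using \<theta>r e R1 by (intro powr_mono) auto
      also have "(1/2) ^ r * R powr (\<theta> * r + (\<epsilon> - real l)) = (R powr \<theta> / 2) ^ r * R powr (\<epsilon> - real l)"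
        by (simp add: powr_add power_divide pw)
      also have "\<dots> \<le> real A0 ^ r * R powr (\<epsilon> - real l)"
        using A0h by (intro mult_right_mono power_mono) auto
      finally show ?thesis by simp
    qed
    have U': "(1 + real CARD('n)) ^ l \<le> real U" by (simp add: U_def n_def)
    \<comment> \<open>The number of exponents: the common size that cancels between the peaks and
      the product of mass and tube bound.\<close>
    define B where "B = real (4 * h) ^ L"
    have B0: "0 < B" using h1 by (simp add: B_def)
    have Bq: "(real (4 * h) ^ (q + n))\<^sup>2 * (20 ^ l * 20 ^ l * 2 ^ n * C ^ (n - l) * 2 ^ l) \<le> R powr (2 * e)"
    proof -
      have "(real (4 * h) ^ (q + n))\<^sup>2 = real (4 * h) ^ (2 * (q + n))" by (simp only: power_mult[symmetric] mult.commute)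
      also have "\<dots> \<le> (4 * ((real r + 2) * R powr \<theta>)) ^ (2 * (q + n))" using hu by (intro power_mono) auto
      also have "\<dots> = (4 * (real r + 2)) ^ (2 * (q + n)) * R powr (\<theta> * (2 * (real q + real n)))"
        by (simp only: mult.assoc[symmetric] power_mult_distrib[of _ "R powr \<theta>"] pw of_nat_mult of_nat_add of_nat_numeral)
      also have "\<dots> \<le> (4 * (real r + 2)) ^ (2 * (q + n)) * R powr e"
        using \<theta>e R1 by (intro mult_left_mono powr_mono) auto
      finally have "(real (4 * h) ^ (q + n))\<^sup>2 * (20 ^ l * 20 ^ l * 2 ^ n * C ^ (n - l) * 2 ^ l)
         \<le> (4 * (real r + 2)) ^ (2 * (q + n)) * R powr e * (20 ^ l * 20 ^ l * 2 ^ n * C ^ (n - l) * 2 ^ l)"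
        using C0 by (intro mult_right_mono) auto
      also have "\<dots> = c7 * R powr e" by (simp add: c7_def)
      also have "\<dots> \<le> R powr e * R powr e" using E7 by (intro mult_right_mono) auto
      finally show ?thesis by (simp add: powr_add[symmetric])
    qed
    have peakB: "B * R powr (real n - \<epsilon>) \<le> real (2 * h) ^ L * (\<rho> / 2) ^ n"
    proof -
      have "real (2 * h) ^ L = B / 2 ^ L"
      proof -
        have "B = 2 ^ L * real (2 * h) ^ L" unfolding B_def power_mult_distrib[symmetric] by simp
        then show ?thesis by simp
      qed
      moreover have "(\<rho> / 2) ^ n = R powr real n / (2 * real n) ^ n"
      proof -
        have "\<rho> / 2 = R / (2 * real n)" by (simp add: \<rho>_def)
        then show ?thesis by (simp only: power_divide pn)
      qed
      ultimately have "real (2 * h) ^ L * (\<rho> / 2) ^ n = B * R powr real n / (2 ^ L * (2 * real n) ^ n)" by simp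
      also have "\<dots> \<ge> B * R powr real n / R powr \<epsilon>"
        using E8 B0 R0 n1 by (intro divide_left_mono mult_pos_pos) auto
      finally show ?thesis by (simp add: powr_diff)
    qed
    show "\<exists>p0. \<forall>p\<ge>p0. prime p \<longrightarrow> (\<forall>(Q::'q set) (Y :: 'q \<Rightarrow> (int^'n) set). finite Q \<longrightarrow>
      (\<forall>y\<in>Q. (\<forall>k\<in>Y y. \<forall>i. \<bar>k $ i\<bar> \<le> int s * int p) \<and> inj_on (vmod p) (Y y) \<and>
          R powr (\<epsilon> - real l) * real p ^ CARD('n) \<le> real (card (Y y))) \<longrightarrow>
      (\<exists>w B. admissible_weight R w \<and> 0 < B \<and>
         L1_norm w * max_fun_sup l w \<le> B\<^sup>2 * R powr (real CARD('n) + real l + \<epsilon>) \<and>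
         card Q \<le> 2 * card {y\<in>Q. \<exists>k\<in>Y y. \<forall>\<zeta>. norm (\<zeta> - emb p k) \<le> 1 / (6 * R) \<longrightarrow>
            B * R powr (real CARD('n) - \<epsilon>) \<le> cmod (fourier w \<zeta>)}))"
    \<comment> \<open>\<open>A0 \<le> p\<close> keeps differences of hit exponents invertible modulo
      \<open>p\<close>, and \<open>R \<le> p\<close> makes the mesh finer than the width
      \<open>1 / R\<close> of a resonance.\<close>
    proof (intro exI[of _ "max A0 (nat \<lceil>R\<rceil>)"] allI impI)
      fix p :: nat and Q :: "'q set" and Y :: "'q \<Rightarrow> (int^'n) set"
      assume pm: "max A0 (nat \<lceil>R\<rceil>) \<le> p" and pp: "prime p" and Q: "finite Q"
        and Y: "\<forall>y\<in>Q. (\<forall>k\<in>Y y. \<forall>i. \<bar>k $ i\<bar> \<le> int s * int p) \<and> inj_on (vmod p) (Y y) \<and>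
          R powr (\<epsilon> - real l) * real p ^ CARD('n) \<le> real (card (Y y))"
      have p0: "0 < real p" using pp by (simp add: prime_gt_0_nat)
      have Rp: "R \<le> real p" using pm by (simp add: nat_le_iff ceiling_le_iff)
      have Y3: "8 \<le> real A0 ^ r * (real (card (Y y)) / real p ^ CARD('n))" if "y \<in> Q" for y
      proof -
        have "R powr (\<epsilon> - real l) * real p ^ CARD('n) \<le> real (card (Y y))" using Y that by blast
        then have "R powr (\<epsilon> - real l) \<le> real (card (Y y)) / real p ^ CARD('n)" using p0 by (simp add: field_simps)
        then have "real A0 ^ r * R powr (\<epsilon> - real l) \<le> real A0 ^ r * (real (card (Y y)) / real p ^ CARD('n))"
          by (intro mult_left_mono) auto
        then show ?thesis using hitnum by linarith
      qed
      have Y1: "\<And>y k i. y \<in> Q \<Longrightarrow> k \<in> Y y \<Longrightarrow> \<bar>k $ i\<bar> \<le> int s * int p" and Y2: "\<And>y. y \<in> Q \<Longrightarrow> inj_on (vmod p) (Y y)"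
        using Y by blast+
      have "\<exists>w. admissible_weight (real CARD('n) * \<rho>) w \<and>
         L1_norm w \<le> \<rho> ^ CARD('n) * real (4 * h) ^ (Suc r + CARD('n)) * (real (4 * h) ^ (q + CARD('n)) * 20 ^ l) \<and>
         max_fun_sup l w \<le> 2 ^ CARD('n) * ((2 * (1 + real CARD('n) * real U)) ^ (CARD('n) - l) * (2 * \<rho>) ^ l * real (4 * h) ^ (Suc r + CARD('n)) * (real (4 * h) ^ (q + CARD('n)) * 20 ^ l)) \<and>
         card Q \<le> 2 * card {y\<in>Q. \<exists>k\<in>Y y. \<forall>\<zeta>. (\<forall>i. \<bar>\<zeta> $ i - emb p k $ i\<bar> \<le> 1 / (6 * \<rho>)) \<longrightarrow>
            real (2 * h) ^ (Suc r + CARD('n)) * (\<rho> / 2) ^ CARD('n) \<le> cmod (fourier w \<zeta>)}"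
        by (rule weight_exists[OF pp h1 \<rho>0 _ l(2) U' Hpos _ _ _ _ Q Y1 Y2 Y3])
           (use Hl num pm Rp \<rho>R in \<open>auto simp: L_def n_def h_def\<close>)
      then obtain w where w1: "admissible_weight R w"
        and w2: "L1_norm w \<le> \<rho> ^ n * B * (real (4 * h) ^ (q + n) * 20 ^ l)"
        and w3: "max_fun_sup l w \<le> 2 ^ n * (C ^ (n - l) * (2 * \<rho>) ^ l * B * (real (4 * h) ^ (q + n) * 20 ^ l))"
        and w4: "card Q \<le> 2 * card {y\<in>Q. \<exists>k\<in>Y y. \<forall>\<zeta>. (\<forall>i. \<bar>\<zeta> $ i - emb p k $ i\<bar> \<le> 1 / (6 * \<rho>)) \<longrightarrow>
            real (2 * h) ^ L * (\<rho> / 2) ^ n \<le> cmod (fourier w \<zeta>)}"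
        unfolding n_def[symmetric] n\<rho> L_def[symmetric] B_def[symmetric] C_def[symmetric] by blast
      have "L1_norm w * max_fun_sup l w \<le> (\<rho> ^ n * B * (real (4 * h) ^ (q + n) * 20 ^ l)) *
          (2 ^ n * (C ^ (n - l) * (2 * \<rho>) ^ l * B * (real (4 * h) ^ (q + n) * 20 ^ l)))"
      proof -
        have L0: "0 \<le> L1_norm w" unfolding L1_norm_def by simp
        have "0 \<le> 2 ^ n * (C ^ (n - l) * (2 * \<rho>) ^ l * B * (real (4 * h) ^ (q + n) * 20 ^ l))"
          using C0 \<rho>0 B0 by simp
        then show ?thesis using w2 w3 L0 mult_left_mono[OF w3 L0] mult_right_mono[OF w2] by (meson order_trans)
      qed
      also have "\<dots> = B\<^sup>2 * (\<rho> ^ n * \<rho> ^ l) * ((real (4 * h) ^ (q + n))\<^sup>2 * (20 ^ l * 20 ^ l * 2 ^ n * C ^ (n - l) * 2 ^ l))"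
        by (simp add: power_mult_distrib power2_eq_square)
      also have "\<dots> \<le> B\<^sup>2 * (R ^ n * R ^ l) * R powr (2 * e)"
        using Bq \<rho>R \<rho>0 R0 C0 by (intro mult_mono mult_left_mono power_mono) auto
      also have "\<dots> = B\<^sup>2 * R powr (real n + real l + 2 * e)" by (simp add: pn powr_add)
      also have "\<dots> \<le> B\<^sup>2 * R powr (real n + real l + \<epsilon>)" using e R1 by (intro mult_left_mono powr_mono) auto
      finally have w5: "L1_norm w * max_fun_sup l w \<le> B\<^sup>2 * R powr (real CARD('n) + real l + \<epsilon>)" by (simp add: n_def)
      have "{y\<in>Q. \<exists>k\<in>Y y. \<forall>\<zeta>. (\<forall>i. \<bar>\<zeta> $ i - emb p k $ i\<bar> \<le> 1 / (6 * \<rho>)) \<longrightarrow>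
            real (2 * h) ^ L * (\<rho> / 2) ^ n \<le> cmod (fourier w \<zeta>)}
        \<subseteq> {y\<in>Q. \<exists>k\<in>Y y. \<forall>\<zeta>. norm (\<zeta> - emb p k) \<le> 1 / (6 * R) \<longrightarrow>
            B * R powr (real CARD('n) - \<epsilon>) \<le> cmod (fourier w \<zeta>)}"
      proof safe
        fix y k
        assume "y \<in> Q" "k \<in> Y y" and *: "\<forall>\<zeta>. (\<forall>i. \<bar>\<zeta> $ i - emb p k $ i\<bar> \<le> 1 / (6 * \<rho>)) \<longrightarrow>
            real (2 * h) ^ L * (\<rho> / 2) ^ n \<le> cmod (fourier w \<zeta>)"
        have "B * R powr (real CARD('n) - \<epsilon>) \<le> cmod (fourier w \<zeta>)" if z: "norm (\<zeta> - emb p k) \<le> 1 / (6 * R)" for \<zeta>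
        proof -
          have "\<bar>\<zeta> $ i - emb p k $ i\<bar> \<le> 1 / (6 * \<rho>)" for i
          proof -
            have "\<bar>(\<zeta> - emb p k) $ i\<bar> \<le> 1 / (6 * R)" using component_le_norm_cart z order_trans by blast
            also have "\<dots> \<le> 1 / (6 * \<rho>)" using \<rho>0 \<rho>R by (intro divide_left_mono) auto
            finally show ?thesis by simp
          qed
          then have "real (2 * h) ^ L * (\<rho> / 2) ^ n \<le> cmod (fourier w \<zeta>)" using * by blast
          then show ?thesis using peakB unfolding n_def by linarith
        qed
        then show "\<exists>k\<in>Y y. \<forall>\<zeta>. norm (\<zeta> - emb p k) \<le> 1 / (6 * R) \<longrightarrow>
            B * R powr (real CARD('n) - \<epsilon>) \<le> cmod (fourier w \<zeta>)" using \<open>k \<in> Y y\<close> by blast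
      qed
      then have "card {y\<in>Q. \<exists>k\<in>Y y. \<forall>\<zeta>. (\<forall>i. \<bar>\<zeta> $ i - emb p k $ i\<bar> \<le> 1 / (6 * \<rho>)) \<longrightarrow>
            real (2 * h) ^ L * (\<rho> / 2) ^ n \<le> cmod (fourier w \<zeta>)}
        \<le> card {y\<in>Q. \<exists>k\<in>Y y. \<forall>\<zeta>. norm (\<zeta> - emb p k) \<le> 1 / (6 * R) \<longrightarrow>
            B * R powr (real CARD('n) - \<epsilon>) \<le> cmod (fourier w \<zeta>)}"
        using Q by (intro card_mono) auto
      then have w6: "card Q \<le> 2 * card {y\<in>Q. \<exists>k\<in>Y y. \<forall>\<zeta>. norm (\<zeta> - emb p k) \<le> 1 / (6 * R) \<longrightarrow>
            B * R powr (real CARD('n) - \<epsilon>) \<le> cmod (fourier w \<zeta>)}" using w4 by linarith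
      show "\<exists>w B. admissible_weight R w \<and> 0 < B \<and>
         L1_norm w * max_fun_sup l w \<le> B\<^sup>2 * R powr (real CARD('n) + real l + \<epsilon>) \<and>
         card Q \<le> 2 * card {y\<in>Q. \<exists>k\<in>Y y. \<forall>\<zeta>. norm (\<zeta> - emb p k) \<le> 1 / (6 * R) \<longrightarrow>
            B * R powr (real CARD('n) - \<epsilon>) \<le> cmod (fourier w \<zeta>)}"
        using w1 B0 w5 w6 by blast
    qed
  qed
qed

section \<open>Parameterised submanifolds\<close>

text \<open>Coordinates are moved one at a time, and the mean value inequality on each segment
  compares with the partial derivative at \<open>x\<close>. The error per coordinate is
  \<open>e * norm v\<close>, hence the division of \<open>e0\<close> by the dimension.\<close>

lemma has_derivative_of_partials:
  fixes f :: "real^'m \<Rightarrow> 'b::real_normed_vector" and D :: "'m \<Rightarrow> real^'m \<Rightarrow> 'b"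
  assumes U: "open U" "x \<in> U"
    and D: "\<And>i y. y \<in> U \<Longrightarrow> ((\<lambda>t. f (y + t *\<^sub>R axis i 1)) has_vector_derivative D i y) (at 0)"
    and cont: "\<And>i. continuous_on U (D i)"
  shows "(f has_derivative (\<lambda>v. \<Sum>i\<in>UNIV. (v $ i) *\<^sub>R D i x)) (at x)"
  unfolding has_derivative_at_alt
proof (intro conjI allI impI)
  show "bounded_linear (\<lambda>v. \<Sum>i\<in>UNIV. (v $ i) *\<^sub>R D i x)"
    by (intro bounded_linear_sum bounded_linear_scaleR_const bounded_linear_vec_nth)
  fix e0 :: real assume "0 < e0"
  define e where "e = e0 / real CARD('m)"
  have e: "0 < e" using \<open>0 < e0\<close> by (simp add: e_def)
  have "\<exists>d>0. \<forall>y. dist y x < d \<longrightarrow> y \<in> U \<and> norm (D i y - D i x) \<le> e" for i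
  proof -
    have "isCont (D i) x" using cont[of i] U by (simp add: continuous_on_eq_continuous_at)
    then obtain d1 where "0 < d1" "\<forall>y. dist y x < d1 \<longrightarrow> dist (D i y) (D i x) < e"
      using e unfolding continuous_at_eps_delta by blast
    moreover obtain d2 where "0 < d2" "ball x d2 \<subseteq> U" using U open_contains_ball by blast
    ultimately show ?thesis
      by (intro exI[of _ "min d1 d2"]) (auto simp: dist_norm norm_minus_commute less_imp_le subset_iff)
  qed
  then obtain dd where dd: "\<And>i. 0 < dd i" "\<And>i y. dist y x < dd i \<Longrightarrow> y \<in> U \<and> norm (D i y - D i x) \<le> e" by metis
  define d where "d = Min (range dd)"
  have d0: "0 < d" using dd(1) by (simp add: d_def)
  have dle: "d \<le> dd i" for i by (simp add: d_def)
  have dU: "y \<in> U" "norm (D i y - D i x) \<le> e" if "dist y x < d" for y i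
    using dd(2)[of y i] that dle[of i] by auto
  have claim: "norm (f (x + (\<Sum>i\<in>S. (v $ i) *\<^sub>R axis i 1)) - f x - (\<Sum>i\<in>S. (v $ i) *\<^sub>R D i x)) \<le> e * real (card S) * norm v"
    if v: "norm v < d" for v and S :: "'m set"
    using finite[of S]
  proof (induction S rule: finite_induct)
    case empty then show ?case by simp
  next
    case (insert i S)
    define y where "y = x + (\<Sum>i\<in>S. (v $ i) *\<^sub>R axis i 1)"
    define P where "P = (\<Sum>k\<in>S. (v $ k) *\<^sub>R axis k (1::real))"
    have comp: "P $ j = (if j \<in> S then v $ j else 0)" for j
      unfolding P_def by (simp add: axis_def if_distrib[of "\<lambda>z. _ * z"] cong: if_cong)
    \<comment> \<open>Each intermediate point deviates from \<open>x\<close> by a vector dominated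
      componentwise by \<open>v\<close>, so it stays in the ball.\<close>
    have near: "dist (y + t *\<^sub>R axis i 1) x < d" if "\<bar>t\<bar> \<le> \<bar>v $ i\<bar>" for t
    proof -
      have "norm (P + t *\<^sub>R axis i 1) \<le> norm v"
        using that insert(2) by (intro norm_le_componentwise_cart) (auto simp: comp axis_def)
      moreover have "y + t *\<^sub>R axis i 1 - x = P + t *\<^sub>R axis i 1" by (simp add: y_def P_def)
      ultimately show ?thesis using v by (simp only: dist_norm)
    qed
    define g where "g t = f (y + t *\<^sub>R axis i 1) - t *\<^sub>R D i x" for t
    have gd: "(g has_derivative (\<lambda>h. h *\<^sub>R (D i (y + t *\<^sub>R axis i 1) - D i x))) (at t within closed_segment 0 (v $ i))"
      if "t \<in> closed_segment 0 (v $ i)" for t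
    proof -
      have t: "\<bar>t\<bar> \<le> \<bar>v $ i\<bar>" using that by (auto simp: closed_segment_eq_real_ivl split: if_splits)
      have "((\<lambda>h. f ((y + t *\<^sub>R axis i 1) + h *\<^sub>R axis i 1)) has_vector_derivative D i (y + t *\<^sub>R axis i 1)) (at 0)"
        by (rule D[OF dU(1)[OF near[OF t]]])
      then have "((\<lambda>h. f ((y + t *\<^sub>R axis i 1) + h *\<^sub>R axis i 1)) \<circ> (\<lambda>h. h - t) has_vector_derivative 1 *\<^sub>R D i (y + t *\<^sub>R axis i 1)) (at t)"
        by (intro vector_diff_chain_at) (auto intro!: derivative_eq_intros)
      moreover have "(\<lambda>h. f ((y + t *\<^sub>R axis i 1) + h *\<^sub>R axis i 1)) \<circ> (\<lambda>h. h - t) = (\<lambda>h. f (y + h *\<^sub>R axis i 1))"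
        by (auto simp: o_def algebra_simps)
      ultimately have "((\<lambda>h. f (y + h *\<^sub>R axis i 1)) has_vector_derivative D i (y + t *\<^sub>R axis i 1)) (at t)" by simp
      then have "(g has_vector_derivative D i (y + t *\<^sub>R axis i 1) - D i x) (at t)"
        unfolding g_def by (auto intro!: derivative_eq_intros)
      then show ?thesis unfolding has_vector_derivative_def by (rule has_derivative_at_withinI)
    qed
    have "norm (g (v $ i) - g 0) \<le> e * norm (v $ i - 0)"
    proof (rule differentiable_bound[OF convex_closed_segment gd])
      fix t assume "t \<in> closed_segment 0 (v $ i)"
      then have t: "\<bar>t\<bar> \<le> \<bar>v $ i\<bar>" by (auto simp: closed_segment_eq_real_ivl split: if_splits)
      show "onorm (\<lambda>h. h *\<^sub>R (D i (y + t *\<^sub>R axis i 1) - D i x)) \<le> e"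
        using dU(2)[OF near[OF t]] e by (intro onorm_bound) (auto simp: mult.commute[of e] intro!: mult_left_mono)
    qed auto
    also have "\<dots> \<le> e * norm v" using e component_le_norm_cart[of v i] by (intro mult_left_mono) auto
    finally have 1: "norm (f (y + (v $ i) *\<^sub>R axis i 1) - (v $ i) *\<^sub>R D i x - f y) \<le> e * norm v" by (simp add: g_def)
    have "norm (f (x + (\<Sum>k\<in>insert i S. (v $ k) *\<^sub>R axis k 1)) - f x - (\<Sum>k\<in>insert i S. (v $ k) *\<^sub>R D k x))
       = norm ((f (y + (v $ i) *\<^sub>R axis i 1) - (v $ i) *\<^sub>R D i x - f y) + (f y - f x - (\<Sum>k\<in>S. (v $ k) *\<^sub>R D k x)))"
      using insert(1,2) by (simp add: y_def algebra_simps)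
    also have "\<dots> \<le> e * norm v + e * real (card S) * norm v"
      by (intro norm_triangle_mono 1) (use insert(3) in \<open>simp add: y_def\<close>)
    also have "\<dots> = e * real (card (insert i S)) * norm v" using insert(1,2) by (simp add: algebra_simps)
    finally show ?case .
  qed
  show "\<exists>d>0. \<forall>y. norm (y - x) < d \<longrightarrow> norm (f y - f x - (\<Sum>i\<in>UNIV. ((y - x) $ i) *\<^sub>R D i x)) \<le> e0 * norm (y - x)"
  proof (intro exI[of _ d] conjI allI impI d0)
    fix y assume "norm (y - x) < d"
    from claim[OF this, of UNIV] have "norm (f (x + (\<Sum>i\<in>UNIV. ((y - x) $ i) *\<^sub>R axis i 1)) - f x - (\<Sum>i\<in>UNIV. ((y - x) $ i) *\<^sub>R D i x)) \<le> e * real CARD('m) * norm (y - x)" .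
    moreover have "(\<Sum>i\<in>UNIV. ((y - x) $ i) *\<^sub>R axis i 1) = y - x"
      using basis_expansion[of "y - x"] by (simp add: scalar_mult_eq_scaleR)
    ultimately show "norm (f y - f x - (\<Sum>i\<in>UNIV. ((y - x) $ i) *\<^sub>R D i x)) \<le> e0 * norm (y - x)"
      by (simp add: e_def del: vector_minus_component)
  qed
qed

definition jac :: "(real^'m \<Rightarrow> real^'n) \<Rightarrow> real^'m \<Rightarrow> real^'m \<Rightarrow> real^'n" where
  "jac s t v = (\<Sum>i\<in>UNIV. (v $ i) *\<^sub>R pdiff [i] s t)"

lemma Ck_on_partial:
  assumes "Ck_on k U s" "1 \<le> k"
  shows "y \<in> U \<Longrightarrow> ((\<lambda>t. s (y + t *\<^sub>R axis i 1)) has_vector_derivative pdiff [i] s y) (at 0)"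
    and "continuous_on U (pdiff [i] s)" and "continuous_on U s"
proof -
  have 1: "\<And>is i x. length is < k \<Longrightarrow> x \<in> U \<Longrightarrow>
        ((\<lambda>t. pdiff is s (x + t *\<^sub>R axis i 1)) has_vector_derivative pdiff (i # is) s x) (at 0)"
    and 2: "\<And>is. length is \<le> k \<Longrightarrow> continuous_on U (pdiff is s)" using assms(1) unfolding Ck_on_def by blast+
  show "y \<in> U \<Longrightarrow> ((\<lambda>t. s (y + t *\<^sub>R axis i 1)) has_vector_derivative pdiff [i] s y) (at 0)"
    using 1[of "[]" y i] assms(2) by simp
  show "continuous_on U (pdiff [i] s)" using 2[of "[i]"] assms(2) by simp
  show "continuous_on U s" using 2[of "[]"] by simp
qed

lemma Ck_on_jac:
  assumes "open U" "Ck_on k U s" "1 \<le> k" "t \<in> U"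
  shows "(s has_derivative jac s t) (at t)"
  unfolding jac_def using Ck_on_partial[OF assms(2,3)] by (intro has_derivative_of_partials[OF assms(1,4)])

lemma jac_linear: "linear (jac s t)"
  unfolding jac_def by (intro linear_compose_sum ballI linear_compose_scale_right)
    (auto simp: linear_iff scaleR_left_distrib)

lemma jac_diff_bound: "norm (jac s t v - jac s' t' v) \<le> (\<Sum>i\<in>UNIV. norm (pdiff [i] s t - pdiff [i] s' t')) * norm v"
proof -
  have "jac s t v - jac s' t' v = (\<Sum>i\<in>UNIV. (v $ i) *\<^sub>R (pdiff [i] s t - pdiff [i] s' t'))"
    by (simp add: jac_def sum_subtractf scaleR_right_diff_distrib)
  also have "norm \<dots> \<le> (\<Sum>i\<in>UNIV. norm v * norm (pdiff [i] s t - pdiff [i] s' t'))"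
    by (intro sum_norm_le) (auto intro!: mult_right_mono simp: component_le_norm_cart)
  finally show ?thesis by (simp add: sum_distrib_left mult.commute)
qed

lemma jac_bound: "norm (jac s t v) \<le> (\<Sum>i\<in>UNIV. norm (pdiff [i] s t)) * norm v"
proof -
  have "norm (jac s t v) \<le> (\<Sum>i\<in>UNIV. norm v * norm (pdiff [i] s t))" unfolding jac_def
    by (intro sum_norm_le) (auto intro!: mult_right_mono simp: component_le_norm_cart)
  then show ?thesis by (simp add: sum_distrib_left mult.commute)
qed

text \<open>The mean value inequality for \<open>s - jac s t\<close> near \<open>t\<close>. Both end
  points are free, which is needed where two converging sequences share a limit.\<close>

lemma Ck_on_strict_derivative:
  assumes U: "open U" and s: "Ck_on k U s" "1 \<le> k" and t: "t \<in> U" and e: "0 < e"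
  shows "\<exists>d>0. \<forall>a\<in>ball t d. \<forall>b\<in>ball t d. norm (s a - s b - jac s t (a - b)) \<le> e * norm (a - b)"
proof -
  let ?g = "\<lambda>y. \<Sum>i\<in>UNIV. norm (pdiff [i] s y - pdiff [i] s t)"
  have "continuous_on U ?g" by (intro continuous_intros Ck_on_partial(2)[OF s])
  then have "isCont ?g t" using U t by (simp add: continuous_on_eq_continuous_at)
  then obtain d1 where d1: "0 < d1" "\<forall>y. dist y t < d1 \<longrightarrow> dist (?g y) (?g t) < e"
    using e unfolding continuous_at_eps_delta by blast
  obtain d2 where d2: "0 < d2" "ball t d2 \<subseteq> U" using U t open_contains_ball by blast
  let ?d = "min d1 d2"
  have "norm (s a - s b - jac s t (a - b)) \<le> e * norm (a - b)" if ab: "a \<in> ball t ?d" "b \<in> ball t ?d" for a b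
  proof -
    have der: "((\<lambda>y. s y - jac s t y) has_derivative (\<lambda>v. jac s y v - jac s t v)) (at y within ball t ?d)" if y: "y \<in> ball t ?d" for y
    proof -
      have "(s has_derivative jac s y) (at y)" using y d2 by (intro Ck_on_jac[OF U s]) auto
      then have "((\<lambda>y. s y - jac s t y) has_derivative (\<lambda>v. jac s y v - jac s t v)) (at y)"
        by (rule has_derivative_diff) (rule linear_imp_has_derivative[OF jac_linear])
      then show ?thesis by (rule has_derivative_at_withinI)
    qed
    have "norm ((s a - jac s t a) - (s b - jac s t b)) \<le> e * norm (a - b)"
    proof (rule differentiable_bound[OF convex_ball der])
      fix y assume y: "y \<in> ball t ?d"
      have "?g y < e" using d1(2)[rule_format, of y] y by (simp add: dist_commute dist_real_def sum_nonneg)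
      show "onorm (\<lambda>v. jac s y v - jac s t v) \<le> e"
      proof (rule onorm_bound)
        fix v
        have "norm (jac s y v - jac s t v) \<le> ?g y * norm v" by (rule jac_diff_bound)
        also have "\<dots> \<le> e * norm v" using \<open>?g y < e\<close> by (intro mult_right_mono) auto
        finally show "norm (jac s y v - jac s t v) \<le> e * norm v" .
      qed (use e in simp)
    qed (use ab in auto)
    then show ?thesis by (simp add: linear_diff[OF jac_linear] algebra_simps)
  qed
  then show ?thesis using d1 d2 by (intro exI[of _ ?d]) auto
qed

lemma compact_unit_cube: "compact unit_cube" and convex_unit_cube: "convex unit_cube"
  by (simp_all add: unit_cube_def)

text \<open>Compactness of the cube times the unit sphere, then homogeneity in
  \<open>v\<close>.\<close>

lemma jac_lower_bound:
  fixes s :: "real^'m \<Rightarrow> real^'n"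
  assumes U: "unit_cube \<subseteq> U" and s: "Ck_on k U s" "1 \<le> k"
    and inj: "\<And>t v. t \<in> unit_cube \<Longrightarrow> v \<noteq> 0 \<Longrightarrow> jac s t v \<noteq> 0"
  shows "\<exists>c>0. \<forall>t\<in>unit_cube. \<forall>v. c * norm v \<le> norm (jac s t v)"
proof -
  let ?K = "(unit_cube :: (real^'m) set) \<times> sphere (0::real^'m) 1"
  have K: "compact ?K" by (intro compact_Times compact_unit_cube compact_sphere)
  have ne: "?K \<noteq> {}"
  proof -
    have "(0::real^'m) \<in> unit_cube" by (auto simp: unit_cube_def mem_box)
    moreover have "axis undefined 1 \<in> sphere (0::real^'m) 1" by simp
    ultimately have "(0, axis undefined 1) \<in> ?K" by (rule SigmaI)
    then show ?thesis by (metis empty_iff)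
  qed
  have "continuous_on ?K (\<lambda>p. norm (jac s (fst p) (snd p)))"
    unfolding jac_def
  proof (intro continuous_intros)
    fix i
    have "continuous_on unit_cube (pdiff [i] s)" using Ck_on_partial(2)[OF s] U continuous_on_subset by blast
    then show "continuous_on ?K (\<lambda>p. pdiff [i] s (fst p))"
      by (rule continuous_on_compose2) (auto intro!: continuous_intros)
  qed
  from continuous_attains_inf[OF K ne this] obtain p where p: "p \<in> ?K" "\<And>q. q \<in> ?K \<Longrightarrow> norm (jac s (fst p) (snd p)) \<le> norm (jac s (fst q) (snd q))"
    by blast
  define c where "c = norm (jac s (fst p) (snd p))"
  have "snd p \<noteq> 0" using p(1) by auto
  then have "0 < c" using inj[of "fst p" "snd p"] p(1) by (auto simp: c_def)
  moreover have "c * norm v \<le> norm (jac s t v)" if t: "t \<in> unit_cube" for t v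
  proof (cases "v = 0")
    case False
    have "c \<le> norm (jac s t (v /\<^sub>R norm v))" using p(2)[of "(t, v /\<^sub>R norm v)"] t False by (simp add: c_def)
    also have "\<dots> = norm (jac s t v) / norm v" by (simp add: linear_scale[OF jac_linear] divide_inverse mult.commute)
    finally show ?thesis using False by (simp add: field_simps)
  qed simp
  ultimately show ?thesis by blast
qed

text \<open>Take a limit of pairs violating smaller and smaller constants. If its two points differ,
  global injectivity is violated; if they coincide, strict differentiability and the bound on the
  differential give a contradiction.\<close>

lemma param_lower_lipschitz:
  fixes s :: "real^'m \<Rightarrow> real^'n"
  assumes U: "open U" "unit_cube \<subseteq> U" and s: "Ck_on k U s" "1 \<le> k"
    and injs: "inj_on s unit_cube"
    and inj: "\<And>t v. t \<in> unit_cube \<Longrightarrow> v \<noteq> 0 \<Longrightarrow> jac s t v \<noteq> 0"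
  shows "\<exists>c>0. \<forall>t\<in>unit_cube. \<forall>t'\<in>unit_cube. c * norm (t - t') \<le> norm (s t - s t')"
proof (rule ccontr)
  assume "\<not> ?thesis"
  then have "\<forall>c>0. \<exists>t\<in>unit_cube. \<exists>t'\<in>unit_cube. norm (s t - s t') < c * norm (t - t')" by (auto simp: not_le)
  then have "\<forall>j::nat. \<exists>p. fst p \<in> unit_cube \<and> snd p \<in> unit_cube \<and> norm (s (fst p) - s (snd p)) < (1 / (real j + 1)) * norm (fst p - snd p)"
  proof (intro allI)
    fix j :: nat
    have "0 < 1 / (real j + 1)" by simp
    with \<open>\<forall>c>0. \<exists>t\<in>unit_cube. \<exists>t'\<in>unit_cube. norm (s t - s t') < c * norm (t - t')\<close>
    obtain t t' where "t \<in> unit_cube" "t' \<in> unit_cube" "norm (s t - s t') < (1 / (real j + 1)) * norm (t - t')" by blast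
    then show "\<exists>p. fst p \<in> unit_cube \<and> snd p \<in> unit_cube \<and> norm (s (fst p) - s (snd p)) < (1 / (real j + 1)) * norm (fst p - snd p)"
      by (intro exI[of _ "(t, t')"]) simp
  qed
  then obtain P where P: "\<And>j. fst (P j) \<in> unit_cube" "\<And>j. snd (P j) \<in> unit_cube"
      "\<And>j. norm (s (fst (P j)) - s (snd (P j))) < (1 / (real j + 1)) * norm (fst (P j) - snd (P j))" by metis
  have "compact (unit_cube \<times> (unit_cube :: (real^'m) set))" by (intro compact_Times compact_unit_cube)
  moreover have "\<forall>j. P j \<in> unit_cube \<times> unit_cube" using P by (simp add: mem_Times_iff)
  ultimately obtain z r where z: "z \<in> unit_cube \<times> unit_cube" and r: "strict_mono r" and lim: "(P \<circ> r) \<longlonglongrightarrow> z"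
    by (rule seq_compactE[OF compact_imp_seq_compact]) blast
  have lim': "(\<lambda>j. P (r j)) \<longlonglongrightarrow> z" using lim by (simp only: o_def)
  have la: "(\<lambda>j. fst (P (r j))) \<longlonglongrightarrow> fst z" and lb: "(\<lambda>j. snd (P (r j))) \<longlonglongrightarrow> snd z"
    by (rule tendsto_fst[OF lim'], rule tendsto_snd[OF lim'])
  have zU: "fst z \<in> U" "snd z \<in> U" using z U by auto
  have scont: "isCont s y" if "y \<in> U" for y using Ck_on_partial(3)[OF s] U(1) that by (simp add: continuous_on_eq_continuous_at)
  show False
  proof (cases "fst z = snd z")
    case False
    have l1: "(\<lambda>j. norm (s (fst (P (r j))) - s (snd (P (r j))))) \<longlonglongrightarrow> norm (s (fst z) - s (snd z))"
      by (intro tendsto_norm tendsto_diff isCont_tendsto_compose[OF scont] la lb zU)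
    have l2: "(\<lambda>j. (1 / (real (r j) + 1)) * norm (fst (P (r j)) - snd (P (r j)))) \<longlonglongrightarrow> 0 * norm (fst z - snd z)"
    proof (intro tendsto_mult tendsto_norm tendsto_diff la lb)
      have "(\<lambda>j. 1 / (real j + 1)) \<longlonglongrightarrow> 0" using LIMSEQ_inverse_real_of_nat by (simp add: inverse_eq_divide add.commute)
      then show "(\<lambda>j. 1 / (real (r j) + 1)) \<longlonglongrightarrow> 0" using LIMSEQ_subseq_LIMSEQ[OF _ r] by (fastforce simp: o_def)
    qed
    have "norm (s (fst z) - s (snd z)) \<le> 0 * norm (fst z - snd z)"
      by (rule LIMSEQ_le[OF l1 l2]) (use P(3) less_imp_le in blast)
    then have "s (fst z) = s (snd z)" by simp
    then show False using injs z False by (auto simp: inj_on_def mem_Times_iff)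
  next
    case True
    obtain c where c: "0 < c" "\<And>v. c * norm v \<le> norm (jac s (fst z) v)"
      using jac_lower_bound[OF U(2) s inj] z by (auto simp: mem_Times_iff)
    obtain d where d: "0 < d" "\<And>a b. a \<in> ball (fst z) d \<Longrightarrow> b \<in> ball (fst z) d \<Longrightarrow> norm (s a - s b - jac s (fst z) (a - b)) \<le> c / 2 * norm (a - b)"
      using Ck_on_strict_derivative[OF U(1) s zU(1), of "c / 2"] c by auto
    have "\<forall>\<^sub>F j in sequentially. dist (fst (P (r j))) (fst z) < d" using la d(1) by (rule tendstoD)
    moreover have "\<forall>\<^sub>F j in sequentially. dist (snd (P (r j))) (snd z) < d" using lb d(1) by (rule tendstoD)
    moreover have "\<forall>\<^sub>F j in sequentially. 2 / c \<le> real j"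
      by (intro eventually_sequentiallyI[of "nat \<lceil>2 / c\<rceil>"]) linarith
    ultimately have "\<forall>\<^sub>F j in sequentially. False"
    proof eventually_elim
      case (elim j)
      let ?a = "fst (P (r j))" and ?b = "snd (P (r j))"
      have "norm (s ?a - s ?b - jac s (fst z) (?a - ?b)) \<le> c / 2 * norm (?a - ?b)"
        using elim True by (intro d(2)) (auto simp: dist_commute)
      moreover have "c * norm (?a - ?b) \<le> norm (jac s (fst z) (?a - ?b))" by (rule c(2))
      moreover have "norm (jac s (fst z) (?a - ?b)) \<le> norm (s ?a - s ?b) + norm (s ?a - s ?b - jac s (fst z) (?a - ?b))"
        by (metis norm_minus_commute norm_triangle_sub)
      ultimately have 1: "c / 2 * norm (?a - ?b) \<le> norm (s ?a - s ?b)" by linarith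
      have "real j \<le> real (r j)" using seq_suble[OF r, of j] by simp
      then have "1 / (real (r j) + 1) \<le> c / 2"
      proof -
        have "2 / c \<le> real (r j) + 1" using elim \<open>real j \<le> real (r j)\<close> by linarith
        then show ?thesis using c(1) by (simp add: field_simps)
      qed
      then have "1 / (real (r j) + 1) * norm (?a - ?b) \<le> c / 2 * norm (?a - ?b)" by (intro mult_right_mono) auto
      then show False using 1 P(3)[of "r j"] by linarith
    qed
    then show False by simp
  qed
qed

section \<open>Stability under small perturbations, and the area element\<close>

lemma Ck_on_D:
  assumes "Ck_on k U s"
  shows "length is < k \<Longrightarrow> x \<in> U \<Longrightarrow>
        ((\<lambda>t. pdiff is s (x + t *\<^sub>R axis i 1)) has_vector_derivative pdiff (i # is) s x) (at 0)"
    and "length is \<le> k \<Longrightarrow> continuous_on U (pdiff is s)"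
  using assms unfolding Ck_on_def by blast+

lemma pdiff_add:
  assumes U: "open U" and f: "Ck_on k U f" and g: "Ck_on k U g"
  shows "length is \<le> k \<Longrightarrow> x \<in> U \<Longrightarrow> pdiff is (\<lambda>x. f x + g x) x = pdiff is f x + pdiff is g x"
    and "length is < k \<Longrightarrow> x \<in> U \<Longrightarrow>
        ((\<lambda>t. pdiff is (\<lambda>x. f x + g x) (x + t *\<^sub>R axis i 1)) has_vector_derivative
           pdiff (i # is) f x + pdiff (i # is) g x) (at 0)"
proof -
  have step: "((\<lambda>t. pdiff is (\<lambda>x. f x + g x) (x + t *\<^sub>R axis i 1)) has_vector_derivative
           pdiff (i # is) f x + pdiff (i # is) g x) (at 0)"
    if IH: "\<And>y. y \<in> U \<Longrightarrow> pdiff is (\<lambda>x. f x + g x) y = pdiff is f y + pdiff is g y"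
      and l: "length is < k" and x: "x \<in> U" for "is" x i
  proof -
    have "((\<lambda>t. pdiff is f (x + t *\<^sub>R axis i 1) + pdiff is g (x + t *\<^sub>R axis i 1)) has_vector_derivative
           pdiff (i # is) f x + pdiff (i # is) g x) (at 0)"
      by (intro has_vector_derivative_add Ck_on_D(1)[OF f l x] Ck_on_D(1)[OF g l x])
    \<comment> \<open>The inductive identity is known on \<open>U\<close> only, so the coordinate
      line must stay in \<open>U\<close> for small parameters.\<close>
    moreover have "open ((\<lambda>t::real. x + t *\<^sub>R axis i 1) -` U)"
      by (intro open_vimage U continuous_intros)
    ultimately show ?thesis
      by (rule has_vector_derivative_transform_within_open) (use IH x in auto)
  qed
  have main: "pdiff is (\<lambda>x. f x + g x) x = pdiff is f x + pdiff is g x" if "length is \<le> k" "x \<in> U" for "is" x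
    using that
  proof (induction "is" arbitrary: x)
    case (Cons i "is")
    have "((\<lambda>t. pdiff is (\<lambda>x. f x + g x) (x + t *\<^sub>R axis i 1)) has_vector_derivative
           pdiff (i # is) f x + pdiff (i # is) g x) (at 0)"
      using Cons by (intro step) auto
    then show ?case by (simp add: vector_derivative_at)
  qed simp
  show "length is \<le> k \<Longrightarrow> x \<in> U \<Longrightarrow> pdiff is (\<lambda>x. f x + g x) x = pdiff is f x + pdiff is g x" by (rule main)
  show "length is < k \<Longrightarrow> x \<in> U \<Longrightarrow>
        ((\<lambda>t. pdiff is (\<lambda>x. f x + g x) (x + t *\<^sub>R axis i 1)) has_vector_derivative
           pdiff (i # is) f x + pdiff (i # is) g x) (at 0)"
    by (intro step main) auto
qed

lemma Ck_on_add:
  assumes U: "open U" and f: "Ck_on k U f" and g: "Ck_on k U g"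
  shows "Ck_on k U (\<lambda>x. f x + g x)"
  unfolding Ck_on_def
proof (intro conjI allI impI)
  fix "is" :: "'a list" and i x assume l: "length is < k" and x: "x \<in> U"
  have "pdiff (i # is) (\<lambda>x. f x + g x) x = pdiff (i # is) f x + pdiff (i # is) g x"
    using l x by (intro pdiff_add(1)[OF assms]) auto
  then show "((\<lambda>t. pdiff is (\<lambda>x. f x + g x) (x + t *\<^sub>R axis i 1)) has_vector_derivative pdiff (i # is) (\<lambda>x. f x + g x) x) (at 0)"
    using pdiff_add(2)[OF assms l x] by (simp only:)
next
  fix "is" :: "'a list" assume l: "length is \<le> k"
  have "continuous_on U (\<lambda>x. pdiff is f x + pdiff is g x)" using Ck_on_D(2)[OF f l] Ck_on_D(2)[OF g l] by (intro continuous_intros)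
  then show "continuous_on U (pdiff is (\<lambda>x. f x + g x))"
    by (rule continuous_on_eq) (use pdiff_add(1)[OF assms l] in simp)
qed

lemma Ck_on_subset: "Ck_on k U f \<Longrightarrow> V \<subseteq> U \<Longrightarrow> Ck_on k V f"
  unfolding Ck_on_def using continuous_on_subset by blast

lemma inj_frechet_derivative_iff:
  assumes "open U" "Ck_on k U s" "1 \<le> k" "t \<in> U"
  shows "inj (frechet_derivative s (at t)) \<longleftrightarrow> (\<forall>v. v \<noteq> 0 \<longrightarrow> jac s t v \<noteq> 0)"
proof -
  have "frechet_derivative s (at t) = jac s t" using frechet_derivative_at[OF Ck_on_jac[OF assms]] by simp
  then show ?thesis using linear_injective_0[OF jac_linear, of s t] by auto
qed

text \<open>Both parts of the embedding property have quantitative forms: \<open>c1\<close> bounds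
  the differential below and \<open>c2\<close> the distance of images. A summand with Lipschitz
  constant at most half of either preserves both.\<close>

lemma small_perturbation_submanifold:
  fixes s :: "real^'m \<Rightarrow> real^'n"
  assumes k: "1 \<le> k" and s: "param_submanifold k s"
  shows "\<exists>\<eta>>0. \<forall>f. Ck_on k UNIV f \<longrightarrow> (\<forall>i x. norm (pdiff [i] f x) \<le> \<eta>) \<longrightarrow> param_submanifold k (\<lambda>x. s x + f x)"
proof -
  obtain U where U: "open U" "unit_cube \<subseteq> U" and sU: "Ck_on k U s" and injs: "inj_on s unit_cube"
    and der: "\<forall>t\<in>unit_cube. inj (frechet_derivative s (at t))"
    using s unfolding param_submanifold_def by blast
  have inj: "jac s t v \<noteq> 0" if "t \<in> unit_cube" "v \<noteq> 0" for t v
    using der that U inj_frechet_derivative_iff[OF U(1) sU k] by blast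
  obtain c1 where c1: "0 < c1" "\<And>t v. t \<in> unit_cube \<Longrightarrow> c1 * norm v \<le> norm (jac s t v)"
    using jac_lower_bound[OF U(2) sU k inj] by blast
  obtain c2 where c2: "0 < c2" "\<And>t t'. t \<in> unit_cube \<Longrightarrow> t' \<in> unit_cube \<Longrightarrow> c2 * norm (t - t') \<le> norm (s t - s t')"
    using param_lower_lipschitz[OF U sU k injs inj] by blast
  define \<eta> where "\<eta> = min c1 c2 / (2 * real CARD('m))"
  have \<eta>0: "0 < \<eta>" using c1 c2 by (simp add: \<eta>_def)
  have \<eta>m: "real CARD('m) * \<eta> = min c1 c2 / 2" by (simp add: \<eta>_def)
  have "param_submanifold k (\<lambda>x. s x + f x)" if f: "Ck_on k UNIV f" and fb: "\<forall>i x. norm (pdiff [i] f x) \<le> \<eta>" for f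
  proof -
    have fU: "Ck_on k U f" using f by (rule Ck_on_subset) simp
    have sum: "Ck_on k U (\<lambda>x. s x + f x)" by (rule Ck_on_add[OF U(1) sU fU])
    have jb: "norm (jac f x v) \<le> min c1 c2 / 2 * norm v" for x v
    proof -
      have "(\<Sum>i\<in>UNIV. norm (pdiff [i] f x)) \<le> (\<Sum>i\<in>(UNIV::'m set). \<eta>)" using fb by (intro sum_mono) auto
      then have "(\<Sum>i\<in>UNIV. norm (pdiff [i] f x)) \<le> min c1 c2 / 2" using \<eta>m by simp
      then show ?thesis using jac_bound[of f x v] mult_right_mono[of _ _ "norm v"] by (meson norm_ge_zero order_trans)
    qed
    have lip: "norm (f a - f b) \<le> min c1 c2 / 2 * norm (a - b)" for a b
    proof (rule differentiable_bound[of UNIV f "jac f"])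
      show "(f has_derivative jac f x) (at x within UNIV)" for x using Ck_on_jac[OF open_UNIV f k] by simp
      show "onorm (jac f x) \<le> min c1 c2 / 2" for x using jb c1 c2 by (intro onorm_bound) auto
    qed auto
    have "inj_on (\<lambda>x. s x + f x) unit_cube"
    proof (rule inj_onI, rule ccontr)
      fix a b assume ab: "a \<in> unit_cube" "b \<in> unit_cube" "s a + f a = s b + f b" "a \<noteq> b"
      have "s a - s b = f b - f a" using ab(3) by (simp add: algebra_simps)
      then have "c2 * norm (a - b) \<le> min c1 c2 / 2 * norm (a - b)"
        using c2(2)[OF ab(1,2)] lip[of b a] by (simp add: norm_minus_commute)
      moreover have "0 < norm (a - b)" using ab(4) by simp
      ultimately have "c2 \<le> min c1 c2 / 2" by (rule mult_right_le_imp_le)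
      then show False using c1(1) c2(1) by (simp add: min_def split: if_splits)
    qed
    moreover have "inj (frechet_derivative (\<lambda>x. s x + f x) (at t))" if t: "t \<in> unit_cube" for t
    proof -
      have tU: "t \<in> U" using t U by blast
      have "jac (\<lambda>x. s x + f x) t v \<noteq> 0" if v: "v \<noteq> 0" for v
      proof
        assume z: "jac (\<lambda>x. s x + f x) t v = 0"
        have "pdiff [i] (\<lambda>x. s x + f x) t = pdiff [i] s t + pdiff [i] f t" for i
          using k by (intro pdiff_add(1)[OF U(1) sU fU _ tU]) auto
        then have "jac (\<lambda>x. s x + f x) t v = jac s t v + jac f t v"
          unfolding jac_def by (simp only: scaleR_right_distrib sum.distrib)
        with z have "jac s t v = - jac f t v" by (simp add: eq_neg_iff_add_eq_0)
        then have "c1 * norm v \<le> min c1 c2 / 2 * norm v" using c1(2)[OF t, of v] jb[of t v] by simp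
        moreover have "0 < norm v" using v by simp
        ultimately have "c1 \<le> min c1 c2 / 2" by (rule mult_right_le_imp_le)
        then show False using c1(1) c2(1) by (simp add: min_def split: if_splits)
      qed
      then show ?thesis using inj_frechet_derivative_iff[OF U(1) sum k tU] by blast
    qed
    ultimately show ?thesis unfolding param_submanifold_def using U sum by blast
  qed
  with \<eta>0 show ?thesis by blast
qed

text \<open>Along the segment from the identity to the Gram matrix all matrices are positive
  definite, hence invertible. The determinant starts at 1 and cannot change sign.\<close>

lemma gram_det_pos:
  fixes a :: "'m::finite \<Rightarrow> real^'n"
  assumes "\<And>v::real^'m. v \<noteq> 0 \<Longrightarrow> (\<Sum>i\<in>UNIV. (v $ i) *\<^sub>R a i) \<noteq> 0"
  shows "0 < det (\<chi> i j. a i \<bullet> a j :: real^'m^'m)"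
proof -
  define M :: "real \<Rightarrow> real^'m^'m" where "M \<tau> = (\<chi> i j. (1 - \<tau>) * (if i = j then 1 else 0) + \<tau> * (a i \<bullet> a j))" for \<tau>
  have quad: "v \<bullet> (M \<tau> *v v) = (1 - \<tau>) * (norm v)\<^sup>2 + \<tau> * (norm (\<Sum>i\<in>UNIV. (v $ i) *\<^sub>R a i))\<^sup>2" for v \<tau>
  proof -
    have "v \<bullet> (M \<tau> *v v) = (\<Sum>i\<in>UNIV. \<Sum>j\<in>UNIV. v $ i * (((1 - \<tau>) * (if i = j then 1 else 0) + \<tau> * (a i \<bullet> a j)) * v $ j))"
      by (simp add: inner_vec_def matrix_vector_mult_def M_def sum_distrib_left)
    also have "\<dots> = (\<Sum>i\<in>UNIV. \<Sum>j\<in>UNIV. (if i = j then (1 - \<tau>) * (v $ i * v $ j) else 0) + \<tau> * (v $ i * (v $ j * (a i \<bullet> a j))))"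
      by (intro sum.cong refl) (auto simp: algebra_simps)
    also have "\<dots> = (1 - \<tau>) * (\<Sum>i\<in>UNIV. v $ i * v $ i) + \<tau> * (\<Sum>i\<in>UNIV. \<Sum>j\<in>UNIV. v $ i * (v $ j * (a i \<bullet> a j)))"
      by (simp add: sum.distrib sum_distrib_left)
    also have "(\<Sum>i\<in>UNIV. v $ i * v $ i) = (norm v)\<^sup>2"
      by (simp add: power2_norm_eq_inner inner_vec_def)
    also have "(\<Sum>i\<in>UNIV. \<Sum>j\<in>UNIV. v $ i * (v $ j * (a i \<bullet> a j))) = (norm (\<Sum>i\<in>UNIV. (v $ i) *\<^sub>R a i))\<^sup>2"
      by (simp add: power2_norm_eq_inner inner_sum_left inner_sum_right sum_distrib_left inner_commute mult.left_commute)
    finally show ?thesis .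
  qed
  have nz: "det (M \<tau>) \<noteq> 0" if "0 \<le> \<tau>" "\<tau> \<le> 1" for \<tau>
  proof
    assume "det (M \<tau>) = 0"
    then have "\<not> invertible (M \<tau>)" by (simp add: invertible_det_nz)
    then have "\<not> (\<exists>B. B ** M \<tau> = mat 1)" using invertible_left_inverse by blast
    then obtain v where v: "v \<noteq> 0" "M \<tau> *v v = 0" using matrix_left_invertible_ker[of "M \<tau>"] by blast
    then have "(1 - \<tau>) * (norm v)\<^sup>2 + \<tau> * (norm (\<Sum>i\<in>UNIV. (v $ i) *\<^sub>R a i))\<^sup>2 = 0" using quad[of v \<tau>] by simp
    moreover have "0 < (norm v)\<^sup>2" "0 < (norm (\<Sum>i\<in>UNIV. (v $ i) *\<^sub>R a i))\<^sup>2" using v(1) assms[OF v(1)] by simp_all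
    moreover have "0 < (1 - \<tau>) * x + \<tau> * y" if "0 < x" "0 < y" for x y :: real
    proof (cases "\<tau> = 1")
      case False
      then show ?thesis using that \<open>0 \<le> \<tau>\<close> \<open>\<tau> \<le> 1\<close> by (intro add_pos_nonneg mult_pos_pos mult_nonneg_nonneg) auto
    qed (use that in simp)
    ultimately show False by (metis less_irrefl)
  qed
  have cont: "continuous_on {0..1} (\<lambda>\<tau>. det (M \<tau>))"
    unfolding det_def M_def by (simp, intro continuous_intros)
  have M0: "det (M 0) = 1"
  proof -
    have "M 0 = mat 1" by (simp add: M_def mat_def)
    then show ?thesis by simp
  qed
  have M1: "M 1 = (\<chi> i j. a i \<bullet> a j)" by (simp add: M_def)
  show ?thesis
  proof (rule ccontr)
    assume "\<not> ?thesis"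
    then have "det (M 1) \<le> 0" by (simp add: M1)
    then obtain \<tau> where "0 \<le> \<tau>" "\<tau> \<le> 1" "det (M \<tau>) = 0"
      using IVT2'[of "\<lambda>\<tau>. det (M \<tau>)" 1 0 0] cont M0 by auto
    with nz show False by blast
  qed
qed

lemma surf_jac_bounds:
  fixes s :: "real^'m \<Rightarrow> real^'n"
  assumes k: "1 \<le> k" and s: "param_submanifold k s"
  shows "\<exists>c>0. \<forall>t\<in>unit_cube. c \<le> surf_jac s t" and "continuous_on unit_cube (surf_jac s)"
proof -
  obtain U where U: "open U" "unit_cube \<subseteq> U" and sU: "Ck_on k U s"
    and der: "\<forall>t\<in>unit_cube. inj (frechet_derivative s (at t))"
    using s unfolding param_submanifold_def by blast
  have inj: "jac s t v \<noteq> 0" if "t \<in> unit_cube" "v \<noteq> 0" for t v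
    using der that U inj_frechet_derivative_iff[OF U(1) sU k] by blast
  have pos: "0 < surf_jac s t" if "t \<in> unit_cube" for t
    unfolding surf_jac_def using inj[OF that] by (simp add: gram_det_pos jac_def)
  have pc: "continuous_on unit_cube (pdiff [i] s)" for i
    using Ck_on_partial(2)[OF sU k] U(2) continuous_on_subset by blast
  show cont: "continuous_on unit_cube (surf_jac s)"
    unfolding surf_jac_def det_def by (simp del: pdiff.simps, intro continuous_intros pc)
  have "unit_cube \<noteq> ({} :: (real^'m) set)" by (auto simp: unit_cube_def mem_box intro!: exI[of _ 0])
  from continuous_attains_inf[OF compact_unit_cube this cont] obtain t0 where "t0 \<in> unit_cube" "\<forall>t\<in>unit_cube. surf_jac s t0 \<le> surf_jac s t" by blast
  then show "\<exists>c>0. \<forall>t\<in>unit_cube. c \<le> surf_jac s t" using pos by blast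
qed

section \<open>Bumps\<close>

lemma DERIV_max_power:
  assumes "1 \<le> r"
  shows "((\<lambda>y::real. max 0 y ^ Suc r) has_real_derivative real (Suc r) * max 0 y ^ r) (at y)"
proof -
  obtain r' where r: "r = Suc r'" using assms by (cases r) auto
  consider "y < 0" | "y = 0" | "0 < y" by linarith
  then show ?thesis
  proof cases
    case 1
    have "((\<lambda>y::real. 0) has_real_derivative 0) (at y)" by simp
    then have "((\<lambda>y::real. max 0 y ^ Suc r) has_real_derivative 0) (at y)"
      by (rule has_field_derivative_transform_within_open[where S="{..<0}"]) (use 1 in auto)
    then show ?thesis using 1 by (simp add: r)
  next
    case 2
    have "((\<lambda>h::real. max 0 h ^ r) \<longlongrightarrow> max 0 0 ^ r) (at 0)" by (intro tendsto_intros)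
    then have "((\<lambda>h::real. (max 0 (0 + h) ^ Suc r - max 0 0 ^ Suc r) / h) \<longlongrightarrow> 0) (at 0)"
    proof (rule Lim_transform_eventually[THEN tendsto_eq_rhs])
      show "\<forall>\<^sub>F h in at 0. max 0 h ^ r = (max 0 (0 + h) ^ Suc r - max 0 0 ^ Suc r) / (h::real)"
        by (auto simp: eventually_at_filter max_def r)
    qed (simp add: r)
    then show ?thesis using 2 by (simp add: DERIV_def r)
  next
    case 3
    have "((\<lambda>y::real. y ^ Suc r) has_real_derivative real (Suc r) * y ^ r) (at y)"
      by (rule DERIV_cong[OF DERIV_pow]) simp
    then have "((\<lambda>y::real. max 0 y ^ Suc r) has_real_derivative real (Suc r) * y ^ r) (at y)"
      by (rule has_field_derivative_transform_within_open[where S="{0<..}"]) (use 3 in auto)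
    then show ?thesis using 3 by simp
  qed
qed

text \<open>The \<open>j\<close>-th derivative of \<open>(max 0 (1 - x\<^sup>2))\<^sup>N\<close> is \<open>(max 0 (1 - x\<^sup>2))\<^bsup>N - j\<^esup>\<close> times the following
  polynomial.\<close>

fun bump_poly :: "nat \<Rightarrow> nat \<Rightarrow> real poly" where
  "bump_poly N 0 = 1"
| "bump_poly N (Suc j) = pderiv (bump_poly N j) * [:1, 0, -1:] + smult (- 2 * real (N - j)) ([:0, 1:] * bump_poly N j)"

text \<open>A bump of finite smoothness suffices, and its derivatives are polynomials times powers
  of \<open>max 0 (1 - x\<^sup>2)\<close>. The family \<open>B\<close> lists them explicitly, so
  that they can serve as candidates in termwise differentiation.\<close>

lemma smooth_bump_exists:
  "\<exists>(B :: nat \<Rightarrow> real \<Rightarrow> real) M. 1 \<le> M \<and> B 0 0 = 1 \<and>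
     (\<forall>j<k. \<forall>x. (B j has_real_derivative B (Suc j) x) (at x)) \<and>
     (\<forall>j\<le>k. continuous_on UNIV (B j) \<and> (\<forall>x. 1 \<le> \<bar>x\<bar> \<longrightarrow> B j x = 0) \<and> (\<forall>x. \<bar>B j x\<bar> \<le> M))"
proof -
  \<comment> \<open>The exponent \<open>N - j\<close> stays at least 2 for all orders up to
    \<open>k\<close>, so each of these derivatives is continuous and vanishes outside the unit
    interval.\<close>
  define N where "N = k + 2"
  define B where "B j x = max 0 (1 - x\<^sup>2) ^ (N - j) * poly (bump_poly N j) x" for j and x :: real
  have der: "(B j has_real_derivative B (Suc j) x) (at x)" if j: "j < k" for j x
  proof -
    define r where "r = N - Suc j"
    have r: "N - j = Suc r" "1 \<le> r" using j by (auto simp: r_def N_def)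
    have "((\<lambda>x. max 0 (1 - x\<^sup>2) ^ Suc r) has_real_derivative real (Suc r) * max 0 (1 - x\<^sup>2) ^ r * (- 2 * x)) (at x)"
      by (rule DERIV_chain2[OF DERIV_max_power[OF r(2)]]) (auto intro!: derivative_eq_intros)
    then have "((\<lambda>x. max 0 (1 - x\<^sup>2) ^ Suc r * poly (bump_poly N j) x) has_real_derivative
        real (Suc r) * max 0 (1 - x\<^sup>2) ^ r * (- 2 * x) * poly (bump_poly N j) x + poly (pderiv (bump_poly N j)) x * max 0 (1 - x\<^sup>2) ^ Suc r) (at x)"
      by (intro DERIV_mult poly_DERIV)
    moreover have "real (Suc r) * max 0 (1 - x\<^sup>2) ^ r * (- 2 * x) * poly (bump_poly N j) x + poly (pderiv (bump_poly N j)) x * max 0 (1 - x\<^sup>2) ^ Suc r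
       = B (Suc j) x"
    proof -
      have "max 0 (1 - x\<^sup>2) ^ Suc r = max 0 (1 - x\<^sup>2) ^ r * (1 - x\<^sup>2)"
        using r(2) by (cases "1 - x\<^sup>2 \<le> 0") (auto simp: max_def)
      then show ?thesis
        by (simp only: B_def bump_poly.simps r_def[symmetric] r(1) poly_add poly_mult poly_smult poly_pCons poly_0)
           (simp add: algebra_simps power2_eq_square)
    qed
    ultimately show ?thesis using r by (simp add: B_def[abs_def])
  qed
  have cont: "continuous_on UNIV (B j)" for j unfolding B_def by (intro continuous_intros)
  have supp: "B j x = 0" if "j \<le> k" "1 \<le> \<bar>x\<bar>" for j x
  proof -
    have "1 \<le> x\<^sup>2" using that(2) abs_le_square_iff[of 1 x] by simp
    then show ?thesis using that(1) by (simp add: B_def N_def max_def)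
  qed
  have "\<exists>M. \<forall>x. \<bar>B j x\<bar> \<le> M" if j: "j \<le> k" for j
  proof -
    have "compact (B j ` {-1..1})" using cont[of j] by (intro compact_continuous_image) (auto intro: continuous_on_subset)
    then obtain M where M: "\<And>x. x \<in> {-1..1} \<Longrightarrow> norm (B j x) \<le> M" using compact_imp_bounded bounded_iff by (metis imageI)
    have "\<bar>B j x\<bar> \<le> max 0 M" for x
    proof (cases "1 \<le> \<bar>x\<bar>")
      case False
      then have "x \<in> {-1..1}" by auto
      from M[OF this] show ?thesis by simp
    qed (use supp[OF j, of x] in simp)
    then show ?thesis by blast
  qed
  then obtain Mf where Mf: "\<And>j x. j \<le> k \<Longrightarrow> \<bar>B j x\<bar> \<le> Mf j" by metis
  define M where "M = Max (insert 1 (Mf ` {..k}))"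
  have M1: "1 \<le> M" by (simp add: M_def)
  have Mb: "\<bar>B j x\<bar> \<le> M" if "j \<le> k" for j x
    by (rule order_trans[OF Mf[OF that]]) (unfold M_def, rule Max_ge, use that in auto)
  have "B 0 0 = 1" by (simp add: B_def)
  then show ?thesis using M1 der cont supp Mb by (intro exI[of _ B] exI[of _ M]) auto
qed

text \<open>The partial derivative, along the list \<open>is\<close>, of a tensor-product bump of
  half-width \<open>\<sigma>\<close> at \<open>t\<close> with height vector \<open>e\<close>. Only
  the number of occurrences of each direction matters, and each derivative contributes
  \<open>1 / \<sigma>\<close>.\<close>

definition bumpd :: "(nat \<Rightarrow> real \<Rightarrow> real) \<Rightarrow> real^'m \<Rightarrow> real \<Rightarrow> real^'n \<Rightarrow> 'm list \<Rightarrow> real^'m \<Rightarrow> real^'n" where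
  "bumpd B t \<sigma> e is x = ((1 / \<sigma>) ^ length is * (\<Prod>i\<in>UNIV. B (count_list is i) ((x $ i - t $ i) / \<sigma>))) *\<^sub>R e"

lemma bumpd_deriv:
  fixes t :: "real^'m" and e :: "real^'n"
  assumes B: "\<And>j x. j < k \<Longrightarrow> (B j has_real_derivative B (Suc j) x) (at x)" and l: "length is < k" and \<sigma>: "0 < \<sigma>"
  shows "((\<lambda>h. bumpd B t \<sigma> e is (x + h *\<^sub>R axis i 1)) has_vector_derivative bumpd B t \<sigma> e (i # is) x) (at 0)"
proof -
  define R where "R = (\<Prod>j\<in>UNIV - {i}. B (count_list is j) ((x $ j - t $ j) / \<sigma>))"
  have c: "count_list is i < k" using l count_le_length[of "is" i] by linarith
  have split: "bumpd B t \<sigma> e is (x + h *\<^sub>R axis i 1)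
     = ((1 / \<sigma>) ^ length is * (B (count_list is i) ((x $ i + h - t $ i) / \<sigma>) * R)) *\<^sub>R e" for h
  proof -
    have "(\<Prod>j\<in>UNIV. B (count_list is j) (((x + h *\<^sub>R axis i 1) $ j - t $ j) / \<sigma>))
      = B (count_list is i) ((x $ i + h - t $ i) / \<sigma>) * (\<Prod>j\<in>UNIV - {i}. B (count_list is j) (((x + h *\<^sub>R axis i 1) $ j - t $ j) / \<sigma>))"
      by (subst prod.remove[of UNIV i]) auto
    also have "(\<Prod>j\<in>UNIV - {i}. B (count_list is j) (((x + h *\<^sub>R axis i 1) $ j - t $ j) / \<sigma>)) = R"
      unfolding R_def by (intro prod.cong) (auto simp: axis_def)
    finally show ?thesis by (simp add: bumpd_def)
  qed
  have "((\<lambda>h. B (count_list is i) ((x $ i + h - t $ i) / \<sigma>)) has_real_derivative B (Suc (count_list is i)) ((x $ i + 0 - t $ i) / \<sigma>) * (1 / \<sigma>)) (at 0)"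
    by (rule DERIV_chain2[OF B[OF c]]) (use \<sigma> in \<open>auto intro!: derivative_eq_intros\<close>)
  then have "((\<lambda>h. (1 / \<sigma>) ^ length is * (B (count_list is i) ((x $ i + h - t $ i) / \<sigma>) * R)) has_real_derivative
     (1 / \<sigma>) ^ length is * (B (Suc (count_list is i)) ((x $ i + 0 - t $ i) / \<sigma>) * (1 / \<sigma>) * R)) (at 0)"
    by (intro DERIV_cmult DERIV_cmult_right)
  then have "((\<lambda>h. ((1 / \<sigma>) ^ length is * (B (count_list is i) ((x $ i + h - t $ i) / \<sigma>) * R)) *\<^sub>R e) has_vector_derivative
     ((1 / \<sigma>) ^ length is * (B (Suc (count_list is i)) ((x $ i + 0 - t $ i) / \<sigma>) * (1 / \<sigma>) * R)) *\<^sub>R e) (at 0)"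
    by (intro has_vector_derivative_scaleR[THEN has_vector_derivative_eq_rhs]) (auto simp: has_real_derivative_iff_has_vector_derivative[symmetric])
  moreover have "((1 / \<sigma>) ^ length is * (B (Suc (count_list is i)) ((x $ i + 0 - t $ i) / \<sigma>) * (1 / \<sigma>) * R)) *\<^sub>R e = bumpd B t \<sigma> e (i # is) x"
  proof -
    have "(\<Prod>j\<in>UNIV. B (count_list (i # is) j) ((x $ j - t $ j) / \<sigma>))
      = B (Suc (count_list is i)) ((x $ i - t $ i) / \<sigma>) * (\<Prod>j\<in>UNIV - {i}. B (count_list (i # is) j) ((x $ j - t $ j) / \<sigma>))"
      by (subst prod.remove[of UNIV i]) auto
    also have "(\<Prod>j\<in>UNIV - {i}. B (count_list (i # is) j) ((x $ j - t $ j) / \<sigma>)) = R"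
      unfolding R_def by (intro prod.cong) auto
    finally show ?thesis by (simp add: bumpd_def)
  qed
  ultimately show ?thesis unfolding split by simp
qed

lemma bumpd_continuous:
  assumes B: "\<And>j. j \<le> k \<Longrightarrow> continuous_on UNIV (B j)" and l: "length is \<le> k" and \<sigma>: "0 < \<sigma>"
  shows "continuous_on UNIV (bumpd B t \<sigma> e is)"
  unfolding bumpd_def
proof (intro continuous_intros)
  fix i
  have "count_list is i \<le> k" using l count_le_length[of "is" i] by linarith
  from B[OF this] show "continuous_on UNIV (\<lambda>x. B (count_list is i) ((x $ i - t $ i) / \<sigma>))"
    by (rule continuous_on_compose2) (use \<sigma> in \<open>auto intro!: continuous_intros\<close>)
qed

lemma bumpd_bound:
  fixes t :: "real^'m"
  assumes B: "\<And>j x. j \<le> k \<Longrightarrow> \<bar>B j x\<bar> \<le> M" and l: "length is \<le> k" and \<sigma>: "0 < \<sigma>"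
  shows "norm (bumpd B t \<sigma> e is x) \<le> (1 / \<sigma>) ^ length is * M ^ CARD('m) * norm e"
proof -
  have "\<bar>\<Prod>i\<in>UNIV. B (count_list is i) ((x $ i - t $ i) / \<sigma>)\<bar> \<le> (\<Prod>i\<in>(UNIV::'m set). M)"
    unfolding abs_prod
  proof (intro prod_mono conjI B)
    fix i :: 'm show "count_list is i \<le> k" using l count_le_length[of "is" i] by linarith
  qed auto
  then show ?thesis using \<sigma> by (simp add: bumpd_def abs_mult mult_right_mono mult_left_mono)
qed

lemma bumpd_zero:
  fixes t :: "real^'m"
  assumes B: "\<And>j x. j \<le> k \<Longrightarrow> 1 \<le> \<bar>x\<bar> \<Longrightarrow> B j x = 0" and l: "length is \<le> k" and \<sigma>: "0 < \<sigma>"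
    and x: "\<sigma> \<le> \<bar>x $ i - t $ i\<bar>"
  shows "bumpd B t \<sigma> e is x = 0"
proof -
  have "count_list is i \<le> k" using l count_le_length[of "is" i] by linarith
  moreover have "1 \<le> \<bar>(x $ i - t $ i) / \<sigma>\<bar>" using x \<sigma> by simp
  ultimately have "B (count_list is i) ((x $ i - t $ i) / \<sigma>) = 0" by (rule B)
  then have "(\<Prod>i\<in>UNIV. B (count_list is i) ((x $ i - t $ i) / \<sigma>)) = 0" by (intro prod_zero) auto
  then show ?thesis by (simp add: bumpd_def)
qed

text \<open>The Weierstrass test gives uniform convergence of every order of candidate derivatives,
  which permits termwise differentiation along coordinate lines. The family \<open>G\<close> carries
  these candidates because \<open>pdiff\<close> of the sum is known only after each differentiation
  has been justified.\<close>

lemma Ck_on_series: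
  fixes G :: "nat \<Rightarrow> 'm list \<Rightarrow> real^'m \<Rightarrow> real^'n"
  assumes der: "\<And>j is i x. length is < k \<Longrightarrow> ((\<lambda>h. G j is (x + h *\<^sub>R axis i 1)) has_vector_derivative G j (i # is) x) (at 0)"
    and cont: "\<And>j is. length is \<le> k \<Longrightarrow> continuous_on UNIV (G j is)"
    and bd: "\<And>j is x. length is \<le> k \<Longrightarrow> norm (G j is x) \<le> M j" and M: "summable M"
  shows "length is \<le> k \<Longrightarrow> pdiff is (\<lambda>x. \<Sum>j. G j [] x) x = (\<Sum>j. G j is x)"
    and "Ck_on k UNIV (\<lambda>x. \<Sum>j. G j [] x)"
proof -
  define F where "F is x = (\<Sum>j. G j is x)" for "is" x
  have unif: "uniform_limit UNIV (\<lambda>n x. \<Sum>j<n. G j is x) (F is) sequentially" if "length is \<le> k" for "is"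
    unfolding F_def using bd[OF that] M by (intro Weierstrass_m_test) auto
  have Fcont: "continuous_on UNIV (F is)" if "length is \<le> k" for "is"
    by (rule uniform_limit_theorem[OF _ unif[OF that]]) (auto intro!: always_eventually continuous_intros cont[OF that])
  have summ: "summable (\<lambda>j. G j is x)" if "length is \<le> k" for "is" x
    by (rule summable_comparison_test'[OF M]) (use bd[OF that] in auto)
  have Fder: "((\<lambda>h. F is (x + h *\<^sub>R axis i 1)) has_vector_derivative F (i # is) x) (at 0)" if l: "length is < k" for "is" i x
  proof -
    let ?y = "\<lambda>h. x + h *\<^sub>R axis i (1::real)"
    have l': "length (i # is) \<le> k" "length is \<le> k" using l by auto
    have d: "((\<lambda>h. G j is (?y h)) has_derivative (\<lambda>v. v *\<^sub>R G j (i # is) (?y h))) (at h within UNIV)" for j h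
    proof -
      have "((\<lambda>h'. G j is (?y h + h' *\<^sub>R axis i 1)) has_vector_derivative G j (i # is) (?y h)) (at 0)" by (rule der[OF l])
      then have "((\<lambda>h'. G j is (?y h + h' *\<^sub>R axis i 1)) \<circ> (\<lambda>h'. h' - h) has_vector_derivative 1 *\<^sub>R G j (i # is) (?y h)) (at h)"
        by (intro vector_diff_chain_at) (auto intro!: derivative_eq_intros)
      moreover have "(\<lambda>h'. G j is (?y h + h' *\<^sub>R axis i 1)) \<circ> (\<lambda>h'. h' - h) = (\<lambda>h. G j is (?y h))"
        by (auto simp: o_def algebra_simps)
      ultimately show ?thesis by (simp add: has_vector_derivative_def)
    qed
    have "\<exists>g. \<forall>h\<in>UNIV. (\<lambda>j. G j is (?y h)) sums g h \<and> (g has_derivative (\<lambda>v. v *\<^sub>R F (i # is) (?y h))) (at h within UNIV)"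
    proof (rule has_derivative_series[OF convex_UNIV d])
      fix e :: real assume "0 < e"
      from uniform_limitD[OF unif[OF l'(1)] this]
      show "\<forall>\<^sub>F n in sequentially. \<forall>h\<in>UNIV. \<forall>v. norm ((\<Sum>j<n. v *\<^sub>R G j (i # is) (?y h)) - v *\<^sub>R F (i # is) (?y h)) \<le> e * norm v"
      proof eventually_elim
        case (elim n)
        show ?case
        proof (intro ballI allI)
          fix h v
          have "(\<Sum>j<n. v *\<^sub>R G j (i # is) (?y h)) - v *\<^sub>R F (i # is) (?y h) = v *\<^sub>R ((\<Sum>j<n. G j (i # is) (?y h)) - F (i # is) (?y h))"
            by (simp add: scaleR_sum_right scaleR_right_diff_distrib)
          moreover have "norm ((\<Sum>j<n. G j (i # is) (?y h)) - F (i # is) (?y h)) \<le> e" using elim by (simp add: dist_norm less_imp_le)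
          ultimately show "norm ((\<Sum>j<n. v *\<^sub>R G j (i # is) (?y h)) - v *\<^sub>R F (i # is) (?y h)) \<le> e * norm v"
            by (simp add: mult.commute[of e] mult_left_mono)
        qed
      qed
    next
      show "(\<lambda>j. G j is (?y 0)) sums F is (?y 0)" unfolding F_def by (rule summable_sums[OF summ[OF l'(2)]])
    qed auto
    then obtain g where g: "\<And>h. (\<lambda>j. G j is (?y h)) sums g h" "\<And>h. (g has_derivative (\<lambda>v. v *\<^sub>R F (i # is) (?y h))) (at h)" by auto
    have "g = (\<lambda>h. F is (?y h))" using g(1) by (auto simp: F_def sums_iff)
    then show ?thesis using g(2)[of 0] by (simp add: has_vector_derivative_def)
  qed
  have P: "pdiff is (\<lambda>x. \<Sum>j. G j [] x) x = F is x" if "length is \<le> k" for "is" x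
    using that
  proof (induction "is" arbitrary: x)
    case (Cons i "is")
    have "pdiff is (\<lambda>x. \<Sum>j. G j [] x) = F is" using Cons by (intro ext) auto
    then show ?case using Fder[of "is" x i] Cons.prems by (simp add: vector_derivative_at)
  qed (simp add: F_def)
  then show "length is \<le> k \<Longrightarrow> pdiff is (\<lambda>x. \<Sum>j. G j [] x) x = (\<Sum>j. G j is x)" by (simp add: F_def)
  have P': "pdiff is (\<lambda>x. \<Sum>j. G j [] x) = F is" if "length is \<le> k" for "is" using P[OF that] by (rule ext)
  show "Ck_on k UNIV (\<lambda>x. \<Sum>j. G j [] x)"
    unfolding Ck_on_def
  proof (intro conjI allI impI)
    fix "is" :: "'m list" and i x assume "length is < k"
    then show "((\<lambda>t. pdiff is (\<lambda>x. \<Sum>j. G j [] x) (x + t *\<^sub>R axis i 1)) has_vector_derivative pdiff (i # is) (\<lambda>x. \<Sum>j. G j [] x) x) (at 0)"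
      using Fder[of "is" x i] P'[of "is"] P'[of "i # is"] by (simp del: pdiff.simps)
  next
    fix "is" :: "'m list" assume "length is \<le> k"
    then show "continuous_on UNIV (pdiff is (\<lambda>x. \<Sum>j. G j [] x))" using Fcont P' by simp
  qed
qed

section \<open>Targets near the submanifold\<close>

lemma Ck_on_lipschitz:
  fixes s :: "real^'m \<Rightarrow> real^'n"
  assumes U: "open U" "unit_cube \<subseteq> U" and s: "Ck_on k U s" "1 \<le> k"
  shows "\<exists>L>0. \<forall>t\<in>unit_cube. \<forall>t'\<in>unit_cube. norm (s t - s t') \<le> L * norm (t - t')"
proof -
  have "continuous_on unit_cube (\<lambda>t. \<Sum>i\<in>UNIV. norm (pdiff [i] s t))"
    using U(2) by (intro continuous_intros continuous_on_subset[OF Ck_on_partial(2)[OF s]])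
  then have "compact ((\<lambda>t. \<Sum>i\<in>UNIV. norm (pdiff [i] s t)) ` unit_cube)"
    using compact_unit_cube by (rule compact_continuous_image)
  then have "bounded ((\<lambda>t. \<Sum>i\<in>UNIV. norm (pdiff [i] s t)) ` unit_cube)" by (rule compact_imp_bounded)
  then obtain L where L: "\<And>t. t \<in> unit_cube \<Longrightarrow> norm (\<Sum>i\<in>UNIV. norm (pdiff [i] s t)) \<le> L"
    unfolding bounded_iff by blast
  have "norm (s t - s t') \<le> max 1 L * norm (t - t')" if "t \<in> unit_cube" "t' \<in> unit_cube" for t t'
  proof (rule differentiable_bound[OF convex_unit_cube _ _ that])
    fix x :: "real^'m" assume x: "x \<in> unit_cube"
    show "(s has_derivative jac s x) (at x within unit_cube)"
      using x U(2) by (intro has_derivative_at_withinI[OF Ck_on_jac[OF U(1) s]]) auto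
    show "onorm (jac s x) \<le> max 1 L"
    proof (rule onorm_bound)
      fix v
      have "(\<Sum>i\<in>UNIV. norm (pdiff [i] s x)) \<le> max 1 L" using L[OF x] by simp
      then show "norm (jac s x v) \<le> max 1 L * norm v"
        by (intro order_trans[OF jac_bound] mult_right_mono) auto
    qed simp
  qed
  then show ?thesis by (intro exI[of _ "max 1 L"]) auto
qed

text \<open>The margin 1/4 keeps small cubes around the chosen parameters inside the domain of the
  surface integral.\<close>

definition inner_cube :: "(real^'m) set" where
  "inner_cube = {t. \<forall>i. 1/4 \<le> t $ i \<and> t $ i \<le> 3/4}"

lemma mem_unit_cube: "t \<in> unit_cube \<longleftrightarrow> (\<forall>i. 0 \<le> t $ i \<and> t $ i \<le> 1)"
proof -
  have "One $ i = (1::real)" for i :: 'a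
    using inner_sum_left_Basis[of "axis i (1::real)" "\<lambda>_. 1"] by (simp add: inner_axis)
  then show ?thesis by (simp add: unit_cube_def mem_box_cart)
qed

lemma inner_cube_margin:
  assumes "t \<in> inner_cube" "\<And>i. \<bar>x $ i - t $ i\<bar> \<le> 1/4"
  shows "x \<in> unit_cube"
  unfolding mem_unit_cube
proof
  fix i
  have "1/4 \<le> t $ i" "t $ i \<le> 3/4" using assms(1) by (auto simp: inner_cube_def)
  then show "0 \<le> x $ i \<and> x $ i \<le> 1" using assms(2)[of i] by linarith
qed

lemma inner_cube_subset: "inner_cube \<subseteq> unit_cube"
  using inner_cube_margin by fastforce

text \<open>The pivots of an echelon basis of the tangent space at the centre of the cube give
  coordinates on which that space projects isomorphically. An open mapping argument then puts a
  whole box of these coordinates into the image of \<open>inner_cube\<close>.\<close>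

lemma coordinate_chart:
  fixes s :: "real^'m \<Rightarrow> real^'n"
  assumes k: "1 \<le> k" and s: "param_submanifold k s"
  shows "\<exists>(J :: 'm \<Rightarrow> 'n) y0 r. inj J \<and> 0 < r \<and>
     (\<forall>y. (\<forall>i. y0 $ i \<le> y $ i \<and> y $ i \<le> y0 $ i + r) \<longrightarrow> (\<exists>t\<in>inner_cube. \<forall>i. s t $ J i = y $ i))"
proof -
  obtain U where U: "open U" "unit_cube \<subseteq> U" and sU: "Ck_on k U s"
    and der: "\<forall>t\<in>unit_cube. inj (frechet_derivative s (at t))"
    using s unfolding param_submanifold_def by blast
  define t0 :: "real^'m" where "t0 = (\<chi> i. 1/2)"
  have t0: "t0 \<in> unit_cube" by (simp add: mem_unit_cube t0_def)
  then have t0U: "t0 \<in> U" using U by blast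
  let ?D = "jac s t0"
  have "inj (frechet_derivative s (at t0))" using der t0 by blast
  then have injD: "inj ?D" using frechet_derivative_at[OF Ck_on_jac[OF U(1) sU k t0U]] by simp
  have sub: "subspace (range ?D)" using jac_linear subspace_UNIV by (rule linear_subspace_image)
  have dim: "dim (range ?D) = CARD('m)" using dim_image_eq[OF jac_linear[of s t0], of UNIV] injD by (simp add: dim_UNIV)
  obtain I :: "'n set" and u where I: "card I = CARD('m)"
    and u0: "\<forall>i\<in>I. u i \<in> range ?D \<and> (\<forall>i'\<in>I. u i $ i' = (if i' = i then 1 else 0)) \<and>
        (\<forall>j. \<bar>u i $ j\<bar> \<le> (1 + real CARD('n)) ^ CARD('m))"
    using echelon_basis[OF sub dim] by blast
  have u: "\<And>i. i \<in> I \<Longrightarrow> u i \<in> range ?D" "\<And>i i'. i \<in> I \<Longrightarrow> i' \<in> I \<Longrightarrow> u i $ i' = (if i' = i then 1 else 0)"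
    using u0 by blast+
  obtain J :: "'m \<Rightarrow> 'n" where J: "bij_betw J UNIV I"
    using finite_same_card_bij[of "UNIV :: 'm set" I] I by auto
  have injJ: "inj J" and JI: "J i \<in> I" for i using J by (auto simp: bij_betw_def)
  have "\<forall>i. \<exists>x. ?D x = u (J i)" using u(1)[OF JI] by (metis rangeE)
  then obtain x where x: "\<And>i. ?D (x i) = u (J i)" by metis
  define f where "f t = (\<chi> i. s t $ J i)" for t
  define f' where "f' v = (\<chi> i. ?D v $ J i)" for v
  \<comment> \<open>A right inverse of the projected differential, read off from preimages of the
    echelon basis.\<close>
  define g' where "g' y = (\<Sum>i\<in>UNIV. (y $ i) *\<^sub>R x i)" for y :: "real^'m"
  have bl: "bounded_linear g'" unfolding g'_def
    by (intro bounded_linear_sum bounded_linear_scaleR_const bounded_linear_vec_nth)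
  have fg: "f' \<circ> g' = id"
  proof (rule ext, simp add: vec_eq_iff, rule allI)
    fix y :: "real^'m" and j
    have "?D (g' y) = (\<Sum>i\<in>UNIV. (y $ i) *\<^sub>R u (J i))"
      unfolding g'_def by (simp add: linear_sum[OF jac_linear] linear_scale[OF jac_linear] x)
    then have "f' (g' y) $ j = (\<Sum>i\<in>UNIV. y $ i * u (J i) $ J j)" by (simp add: f'_def)
    also have "\<dots> = (\<Sum>i\<in>UNIV. if i = j then y $ i else 0)"
      using u(2)[OF JI JI] injJ by (intro sum.cong) (auto simp: inj_def)
    finally show "f' (g' y) $ j = y $ j" by simp
  qed
  have fd: "(f has_derivative f') (at t0)"
  proof -
    have "(s has_derivative ?D) (at t0)" by (rule Ck_on_jac[OF U(1) sU k t0U])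
    then have "((\<lambda>t. s t $ J i) has_derivative (\<lambda>v. ?D v $ J i)) (at t0)" for i
      by (rule bounded_linear.has_derivative[OF bounded_linear_vec_nth])
    then show ?thesis unfolding f_def f'_def
      by (subst has_derivative_componentwise_within) (auto simp: Basis_vec_def inner_axis)
  qed
  have fc: "continuous_on U f" unfolding f_def
    by (intro continuous_intros Ck_on_partial(3)[OF sU k])
  have icU: "inner_cube \<subseteq> U" using inner_cube_subset U(2) by blast
  have int: "t0 \<in> interior inner_cube"
  proof -
    have "box (\<chi> i. 1/4) (\<chi> i. 3/4) \<subseteq> (inner_cube :: (real^'m) set)"
      by (auto simp: inner_cube_def mem_box_cart less_imp_le)
    moreover have "t0 \<in> box (\<chi> i. 1/4) (\<chi> i. 3/4)" by (simp add: t0_def mem_box_cart)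
    ultimately show ?thesis using open_box by (meson interiorI)
  qed
  have "f t0 \<in> interior (f ` inner_cube)"
    by (rule sussmann_open_mapping[OF U(1) fc t0U fd bl fg icU int])
  then obtain e where e: "0 < e" "ball (f t0) e \<subseteq> f ` inner_cube" by (meson mem_interior)
  define r where "r = e / (2 * real CARD('m))"
  have r: "0 < r" using e by (simp add: r_def)
  have "\<exists>t\<in>inner_cube. \<forall>i. s t $ J i = y $ i" if y: "\<forall>i. f t0 $ i \<le> y $ i \<and> y $ i \<le> f t0 $ i + r" for y
  proof -
    have "norm (y - f t0) \<le> (\<Sum>i\<in>UNIV. \<bar>(y - f t0) $ i\<bar>)" by (rule norm_le_l1_cart)
    also have "\<dots> \<le> (\<Sum>i\<in>(UNIV::'m set). r)" 
    proof (intro sum_mono)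
      fix i show "\<bar>(y - f t0) $ i\<bar> \<le> r" using y[rule_format, of i] by simp
    qed
    also have "\<dots> = e / 2" by (simp add: r_def)
    also have "\<dots> < e" using e by simp
    finally have "y \<in> ball (f t0) e" by (simp add: dist_norm norm_minus_commute)
    then obtain t where "t \<in> inner_cube" "y = f t" using e(2) by auto
    then show ?thesis by (intro bexI[of _ t]) (auto simp: f_def)
  qed
  then show ?thesis using injJ r by (intro exI[of _ J] exI[of _ "f t0"] exI[of _ r]) auto
qed

text \<open>Above a box of side \<open>\<sigma> / 2\<close> in the chart coordinates, the points of
  the mesh \<open>1 / p\<close> within \<open>h\<close> of the surface are counted: \<open>m\<close>
  coordinates range freely, the other \<open>n - m\<close> in windows of width \<open>2 * h\<close>
  around the surface. All windows are shorter than 1, so distinct points stay distinct modulo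
  \<open>p\<close>.\<close>

lemma target_points:
  fixes s :: "real^'m \<Rightarrow> real^'n" and J :: "'m \<Rightarrow> 'n" and \<tau> :: "real^'m \<Rightarrow> real^'m"
  assumes J: "inj J" and p: "0 < p"
    and \<sigma>: "0 < \<sigma>" "\<sigma> < 1" "4 \<le> \<sigma> * real p" and h: "0 < h" "h < 1/2" "1 \<le> h * real p"
    and \<tau>: "\<And>y. (\<And>i. c i \<le> y $ i \<and> y $ i \<le> c i + \<sigma> / 2) \<Longrightarrow> \<tau> y \<in> K \<and> (\<forall>i. s (\<tau> y) $ J i = y $ i)"
    and Sb: "\<And>t i. t \<in> K \<Longrightarrow> \<bar>s t $ i\<bar> + 1 \<le> real b"
  shows "\<exists>Y :: (int^'n) set. (\<forall>k\<in>Y. \<forall>i. \<bar>k $ i\<bar> \<le> int b * int p) \<and> inj_on (vmod p) Y \<and>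
     (\<sigma> / 4) ^ CARD('m) * h ^ (CARD('n) - CARD('m)) * real p ^ CARD('n) \<le> real (card Y) \<and>
     (\<forall>k\<in>Y. \<exists>t\<in>K. (\<forall>i. c i \<le> s t $ J i \<and> s t $ J i \<le> c i + \<sigma> / 2) \<and> norm (emb p k - s t) \<le> real CARD('n) * h)"
proof -
  define yk where "yk k = (\<chi> i. real_of_int (k $ J i) / real p)" for k :: "int^'n"
  define Y where "Y = {k. (\<forall>i. c i \<le> yk k $ i \<and> yk k $ i \<le> c i + \<sigma> / 2) \<and>
     (\<forall>v. v \<notin> range J \<longrightarrow> \<bar>real_of_int (k $ v) / real p - s (\<tau> (yk k)) $ v\<bar> \<le> h)}"
  have rp: "0 < real p" using p by simp
  have Yt: "\<tau> (yk k) \<in> K" "s (\<tau> (yk k)) $ J i = yk k $ i" if "k \<in> Y" for k i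
    using \<tau>[of "yk k"] that by (auto simp: Y_def)
  have close: "\<bar>emb p k $ v - s (\<tau> (yk k)) $ v\<bar> \<le> h" if "k \<in> Y" for k v
  proof (cases "v \<in> range J")
    case True
    then obtain i where "v = J i" by auto
    then show ?thesis using Yt(2)[OF that, of i] h by (simp add: emb_def yk_def)
  next
    case False
    then show ?thesis using that by (simp add: Y_def emb_def)
  qed
  have bound: "\<bar>k $ v\<bar> \<le> int b * int p" if "k \<in> Y" for k v
  proof -
    have "\<bar>emb p k $ v\<bar> \<le> real b" using close[OF that, of v] Sb[OF Yt(1)[OF that], of v] h by linarith
    then have "\<bar>real_of_int (k $ v)\<bar> \<le> real b * real p" using rp by (simp add: emb_def abs_divide divide_le_eq)
    then have "real_of_int \<bar>k $ v\<bar> \<le> real_of_int (int b * int p)" by simp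
    then show ?thesis by (simp only: of_int_le_iff)
  qed
  have finY: "finite Y"
  proof (rule finite_subset)
    show "Y \<subseteq> {k. \<forall>i. k $ i \<in> {- (int b * int p)..int b * int p}}" using bound by (auto simp: abs_le_iff minus_le_iff)
    show "finite {k::int^'n. \<forall>i. k $ i \<in> {- (int b * int p)..int b * int p}}" by (rule card_vec_product(1)) simp
  qed
  have small: "k $ v = k' $ v" if d: "int p dvd k $ v - k' $ v" and lt: "\<bar>real_of_int (k $ v) / real p - real_of_int (k' $ v) / real p\<bar> < 1" for k k' :: "int^'n" and v
  proof -
    have "\<bar>real_of_int (k $ v) / real p - real_of_int (k' $ v) / real p\<bar> = \<bar>real_of_int (k $ v - k' $ v)\<bar> / real p"
      by (simp add: diff_divide_distrib[symmetric])
    with lt have "\<bar>real_of_int (k $ v - k' $ v)\<bar> < real p" using rp by (simp add: divide_less_eq)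
    then have "real_of_int \<bar>k $ v - k' $ v\<bar> < real_of_int (int p)" by simp
    then have "\<bar>k $ v - k' $ v\<bar> < int p" by (simp only: of_int_less_iff)
    with d have "k $ v - k' $ v = 0" by (metis abs_of_nat dvd_imp_le_int linorder_not_le)
    then show ?thesis by simp
  qed
  have injY: "inj_on (vmod p) Y"
  proof (rule inj_onI)
    fix k k' assume k: "k \<in> Y" "k' \<in> Y" and eq: "vmod p k = vmod p k'"
    have d: "int p dvd k $ v - k' $ v" for v using eq by (simp add: vmod_eq_iff)
    have Jeq: "k $ J i = k' $ J i" for i
    proof (rule small[OF d])
      have "c i \<le> yk k $ i" "yk k $ i \<le> c i + \<sigma> / 2" "c i \<le> yk k' $ i" "yk k' $ i \<le> c i + \<sigma> / 2"
        using k by (auto simp: Y_def)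
      then have "\<bar>yk k $ i - yk k' $ i\<bar> < 1" using \<sigma> by linarith
      then show "\<bar>real_of_int (k $ J i) / real p - real_of_int (k' $ J i) / real p\<bar> < 1" by (simp add: yk_def)
    qed
    then have yeq: "yk k = yk k'" by (simp add: yk_def)
    have "k $ v = k' $ v" for v
    proof (rule small[OF d])
      show "\<bar>real_of_int (k $ v) / real p - real_of_int (k' $ v) / real p\<bar> < 1"
        using close[OF k(1), of v] close[OF k(2), of v] h yeq by (simp add: emb_def)
    qed
    then show "k = k'" by (simp add: vec_eq_iff)
  qed
  \<comment> \<open>The hypotheses make \<open>\<sigma> * p / 2\<close> and \<open>2 * h * p\<close>
    at least 2, so rounding down loses at most half.\<close>
  define A1 where "A1 = nat \<lfloor>\<sigma> * real p / 2\<rfloor>"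
  define A2 where "A2 = nat \<lfloor>2 * h * real p\<rfloor>"
  have A1: "\<sigma> * real p / 4 \<le> real A1" "real A1 \<le> \<sigma> * real p / 2"
    unfolding A1_def using \<sigma>(3) by linarith+
  have A2: "h * real p \<le> real A2" "real A2 \<le> 2 * h * real p"
    unfolding A2_def using h by linarith+
  define AA where "AA v = (if v \<in> range J then {0..<int A1} else {0..<int A2})" for v :: 'n
  define kJ where "kJ a i = \<lceil>real p * c i\<rceil> + a $ J i" for a :: "int^'n" and i
  define ya where "ya a = (\<chi> i. real_of_int (kJ a i) / real p)" for a :: "int^'n"
  \<comment> \<open>The offsets in chart coordinates come before the others: they fix the surface
    point, whose remaining coordinates centre the windows for the remaining offsets.\<close>
  define \<Phi> where "\<Phi> a = (\<chi> v. if v \<in> range J then kJ a (inv J v) else \<lceil>real p * (s (\<tau> (ya a)) $ v - h)\<rceil> + a $ v)" for a :: "int^'n"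
  have \<Phi>J: "\<Phi> a $ J i = kJ a i" for a i using J by (simp add: \<Phi>_def)
  have yk\<Phi>: "yk (\<Phi> a) = ya a" for a by (simp add: yk_def ya_def \<Phi>J)
  have win: "x \<le> real_of_int (\<lceil>real p * x\<rceil> + z) / real p \<and> real_of_int (\<lceil>real p * x\<rceil> + z) / real p \<le> x + d"
    if z: "0 \<le> z" "z < int N" and N: "real N \<le> d * real p" for x d z N
  proof -
    have z1: "real_of_int z \<le> real N - 1" using z(2) by linarith
    have z0: "0 \<le> real_of_int z" using z(1) by simp
    have "real p * x \<le> real_of_int (\<lceil>real p * x\<rceil> + z)" using z0 by (simp, linarith)
    moreover have "real_of_int (\<lceil>real p * x\<rceil> + z) \<le> real p * x + d * real p" using z1 N by (simp, linarith)
    ultimately show ?thesis using rp by (simp add: field_simps)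
  qed
  have \<Phi>Y: "\<Phi> a \<in> Y" if a: "\<forall>v. a $ v \<in> AA v" for a
  proof -
    have 1: "c i \<le> ya a $ i \<and> ya a $ i \<le> c i + \<sigma> / 2" for i
      unfolding ya_def kJ_def vec_lambda_beta using a[rule_format, of "J i"] A1(2)
      by (intro win[where N=A1]) (auto simp: AA_def)
    have 2: "\<bar>real_of_int (\<Phi> a $ v) / real p - s (\<tau> (ya a)) $ v\<bar> \<le> h" if v: "v \<notin> range J" for v
    proof -
      have av: "0 \<le> a $ v" "a $ v < int A2" using a[rule_format, of v] v by (auto simp: AA_def)
      have "s (\<tau> (ya a)) $ v - h \<le> real_of_int (\<Phi> a $ v) / real p \<and> real_of_int (\<Phi> a $ v) / real p \<le> s (\<tau> (ya a)) $ v - h + 2 * h"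
        unfolding \<Phi>_def vec_lambda_beta using v win[OF av A2(2)] by (simp only: if_False)
      then show ?thesis by (auto simp: abs_le_iff)
    qed
    show ?thesis unfolding Y_def using 1 2 by (simp add: yk\<Phi>)
  qed
  let ?P = "{a::int^'n. \<forall>v. a $ v \<in> AA v}"
  have inj\<Phi>: "inj_on \<Phi> ?P"
  proof (rule inj_onI)
    fix a b assume eq: "\<Phi> a = \<Phi> b"
    have k: "kJ a i = kJ b i" for i using \<Phi>J[of a i] \<Phi>J[of b i] eq by simp
    then have y: "ya a = ya b" by (simp add: ya_def)
    have "a $ v = b $ v" for v
    proof (cases "v \<in> range J")
      case True
      then obtain i where "v = J i" by auto
      then show ?thesis using k[of i] by (simp add: kJ_def)
    next
      case False
      have "\<Phi> a $ v = \<Phi> b $ v" using eq by simp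
      then show ?thesis using False y by (simp add: \<Phi>_def)
    qed
    then show "a = b" by (simp add: vec_eq_iff)
  qed
  have "card ?P \<le> card Y" using \<Phi>Y finY by (intro card_inj_on_le[OF inj\<Phi>]) auto
  moreover have "card ?P = A1 ^ CARD('m) * A2 ^ (CARD('n) - CARD('m))"
  proof -
    have "card ?P = (\<Prod>v\<in>UNIV. card (AA v))" by (rule card_vec_product(2)) (simp add: AA_def)
    also have "\<dots> = (\<Prod>v\<in>UNIV. if v \<in> range J then A1 else A2)" by (intro prod.cong) (auto simp: AA_def)
    also have "\<dots> = A1 ^ card (range J) * A2 ^ card (- range J)" by (rule prod_if_card)
    finally show ?thesis using J by (simp add: card_image Compl_eq_Diff_UNIV card_Diff_subset)
  qed
  ultimately have "real (A1 ^ CARD('m) * A2 ^ (CARD('n) - CARD('m))) \<le> real (card Y)" by (simp only: of_nat_le_iff)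
  moreover have "(\<sigma> / 4) ^ CARD('m) * h ^ (CARD('n) - CARD('m)) * real p ^ CARD('n) \<le> real (A1 ^ CARD('m) * A2 ^ (CARD('n) - CARD('m)))"
  proof -
    have mn: "CARD('m) \<le> CARD('n)" using J by (metis card_inj_on_le finite top_greatest)
    have "(\<sigma> / 4) ^ CARD('m) * h ^ (CARD('n) - CARD('m)) * real p ^ CARD('n)
       = (\<sigma> / 4) ^ CARD('m) * h ^ (CARD('n) - CARD('m)) * real p ^ (CARD('m) + (CARD('n) - CARD('m)))" using mn by simp
    also have "\<dots> = (\<sigma> * real p / 4) ^ CARD('m) * (h * real p) ^ (CARD('n) - CARD('m))"
      by (simp only: power_add power_mult_distrib power_divide) (simp add: field_simps)
    also have "\<dots> \<le> real A1 ^ CARD('m) * real A2 ^ (CARD('n) - CARD('m))"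
      using A1 A2 \<sigma> h by (intro mult_mono power_mono) auto
    finally show ?thesis by simp
  qed
  moreover have "\<exists>t\<in>K. (\<forall>i. c i \<le> s t $ J i \<and> s t $ J i \<le> c i + \<sigma> / 2) \<and> norm (emb p k - s t) \<le> real CARD('n) * h" if k: "k \<in> Y" for k
  proof (intro bexI[of _ "\<tau> (yk k)"] conjI allI)
    show "\<tau> (yk k) \<in> K" by (rule Yt(1)[OF k])
    show "c i \<le> s (\<tau> (yk k)) $ J i" "s (\<tau> (yk k)) $ J i \<le> c i + \<sigma> / 2" for i
      using k unfolding Yt(2)[OF k] by (auto simp: Y_def)
    have "norm (emb p k - s (\<tau> (yk k))) \<le> (\<Sum>v\<in>UNIV. \<bar>(emb p k - s (\<tau> (yk k))) $ v\<bar>)" by (rule norm_le_l1_cart)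
    also have "\<dots> \<le> (\<Sum>v\<in>(UNIV::'n set). h)" using close[OF k] by (intro sum_mono) simp
    finally show "norm (emb p k - s (\<tau> (yk k))) \<le> real CARD('n) * h" by simp
  qed
  ultimately show ?thesis using bound injY by (intro exI[of _ Y]) auto
qed

section \<open>The data of one dyadic scale\<close>

lemma eventually_poly_le_exp:
  fixes c e :: real
  assumes c: "0 < c" and e: "0 < e"
  shows "eventually (\<lambda>j. (real j + 1) ^ C \<le> c * (2 ^ j) powr e) sequentially"
proof -
  define b where "b = e * ln 2"
  have b: "0 < b" using e by (simp add: b_def)
  define c' where "c' = c * b ^ C / exp b"
  have c': "0 < c'" using c b by (simp add: c'_def)
  have "filterlim (\<lambda>j. b * (real j + 1)) at_top sequentially"
  proof (rule filterlim_tendsto_pos_mult_at_top[OF tendsto_const b])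
    show "filterlim (\<lambda>j. real j + 1) at_top sequentially"
      by (rule filterlim_at_top_mono[OF filterlim_real_sequentially]) (auto intro: always_eventually)
  qed
  from filterlim_compose[OF tendsto_power_div_exp_0 this]
  have "((\<lambda>j. (b * (real j + 1)) ^ C / exp (b * (real j + 1))) \<longlongrightarrow> 0) sequentially" .
  from order_tendstoD(2)[OF this c'] show ?thesis
  proof eventually_elim
    case (elim j)
    have "(b * (real j + 1)) ^ C \<le> c' * exp (b * (real j + 1))"
      using elim by (simp add: divide_less_eq less_imp_le)
    also have "\<dots> = c * b ^ C * exp (b * real j)" by (simp add: c'_def distrib_left exp_add)
    finally have "b ^ C * (real j + 1) ^ C \<le> b ^ C * (c * exp (b * real j))" by (simp only: power_mult_distrib mult_ac)
    then have "(real j + 1) ^ C \<le> c * exp (b * real j)" using b by (simp add: mult_le_cancel_left_pos)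
    also have "exp (b * real j) = (2 ^ j) powr e" by (simp add: powr_def ln_realpow b_def mult_ac)
    finally show ?case .
  qed
qed

text \<open>At scale \<open>0\<close> the two bounds on \<open>s t\<close> contradict each other, since \<open>r / 0 = 0\<close>, so \<open>T\<close> is empty.\<close>

definition scale_points :: "(real^'m \<Rightarrow> real^'n) \<Rightarrow> ('m \<Rightarrow> 'n) \<Rightarrow> real^'m \<Rightarrow> real \<Rightarrow> (real^'m) set \<Rightarrow> real \<Rightarrow> nat \<Rightarrow> nat \<Rightarrow>
    real \<Rightarrow> (real^'m) set \<Rightarrow> (real^'m \<Rightarrow> real^'n) \<Rightarrow> bool" where
  "scale_points s J y0 r K \<kappa> k j \<sigma> T X \<longleftrightarrow> 0 < \<sigma> \<and> \<sigma> < 1 \<and> finite T \<and> T \<subseteq> K \<and>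
     (\<forall>t\<in>T. \<forall>i. y0 $ i + r / (real j + 1) + \<sigma> / 4 \<le> s t $ J i \<and> s t $ J i \<le> y0 $ i + r / real j - \<sigma> / 4) \<and>
     (\<forall>t\<in>T. \<forall>t'\<in>T. t \<noteq> t' \<longrightarrow> (\<exists>i. \<sigma> / 2 \<le> \<bar>s t $ J i - s t' $ J i\<bar>)) \<and>
     (\<forall>t\<in>T. norm (X t - s t) \<le> \<kappa> * \<sigma> ^ k / (real j + 1)\<^sup>2)"

text \<open>Only these clauses depend on \<open>\<epsilon>\<close>; what the perturbation needs is
  kept apart in \<open>scale_points\<close>. The last clause says that the spacing
  \<open>\<sigma>\<close> far exceeds the peak width, so that neighbourhoods of distinct points of
  \<open>T\<close> are disjoint.\<close>

definition scale_weight :: "nat \<Rightarrow> real \<Rightarrow> real \<Rightarrow> nat \<Rightarrow> real \<Rightarrow> (real^'m) set \<Rightarrow> (real^'m \<Rightarrow> real^'n) \<Rightarrow> (real^'n \<Rightarrow> real) \<Rightarrow> real \<Rightarrow> bool" where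
  "scale_weight l \<alpha> \<epsilon> j \<sigma> T X w B \<longleftrightarrow> admissible_weight (2 ^ j) w \<and> 0 < B \<and>
     L1_norm w * max_fun_sup l w \<le> B\<^sup>2 * (2 ^ j) powr (real CARD('n) + real l + \<epsilon>) \<and>
     (\<forall>t\<in>T. \<forall>\<zeta>. norm (\<zeta> - X t) \<le> 1 / (6 * 2 ^ j) \<longrightarrow> B * (2 ^ j) powr (real CARD('n) - \<epsilon>) \<le> cmod (fourier w \<zeta>)) \<and>
     (2 ^ j) powr (\<alpha> - \<epsilon>) \<le> real (card T) \<and> real j \<le> \<sigma> * 2 ^ j"

text \<open>The target families of the boxes have density about
  \<open>\<sigma> ^ m * h ^ (n - m)\<close> with \<open>h\<close> about \<open>\<sigma> ^ k\<close>,
  and this has to exceed \<open>R powr (e - l)\<close>. Hence \<open>\<sigma>\<close> is about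
  \<open>R powr (- a)\<close> with \<open>a * d = l - 2 * e\<close>, and the number of boxes is
  about \<open>R powr (a * m)\<close>.\<close>

lemma scale_exists:
  fixes s :: "real^'m \<Rightarrow> real^'n" and J :: "'m \<Rightarrow> 'n"
  assumes mn: "CARD('m) < CARD('n)" and l: "1 \<le> l" "l \<le> CARD('n) - 1" and k: "1 \<le> k"
    and J: "inj J" and r: "0 < r"
    and chart: "\<And>y. (\<And>i. y0 $ i \<le> y $ i \<and> y $ i \<le> y0 $ i + r) \<Longrightarrow> \<exists>t\<in>K. \<forall>i. s t $ J i = y $ i"
    and Sb: "\<And>t i. t \<in> K \<Longrightarrow> \<bar>s t $ i\<bar> + 1 \<le> real b"
    and \<kappa>: "0 < \<kappa>" and \<epsilon>: "0 < \<epsilon>"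
  shows "eventually (\<lambda>j. \<exists>\<sigma> T X w B. scale_points s J y0 r K \<kappa> k j \<sigma> T X \<and>
     scale_weight l (real l * real CARD('m) / (real CARD('m) + real k * (real CARD('n) - real CARD('m)))) \<epsilon> j \<sigma> T X w B) sequentially"
proof -
  define m n where "m = CARD('m)" and "n = CARD('n)"
  define d where "d = m + k * (n - m)"
  have m1: "1 \<le> m" by (simp add: m_def Suc_leI)
  have n1: "1 \<le> n" by (simp add: n_def Suc_leI)
  have dn: "n \<le> d"
  proof -
    have "n - m \<le> k * (n - m)" using k by simp
    moreover have "n = m + (n - m)" using mn by (simp add: m_def n_def)
    ultimately show ?thesis unfolding d_def by linarith
  qed
  have d0: "0 < real d" using dn n1 by simp
  have ld: "real l < real d" using l dn n1 unfolding n_def by linarith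
  define \<alpha> where "\<alpha> = real l * real m / real d"
  have \<alpha>: "real l * real CARD('m) / (real CARD('m) + real k * (real CARD('n) - real CARD('m))) = \<alpha>"
    using mn by (simp add: \<alpha>_def d_def m_def n_def of_nat_diff)
  define e where "e = min \<epsilon> 1 / 4"
  have e: "0 < e" "e \<le> \<epsilon> / 4" "e \<le> 1/4" using \<epsilon> by (auto simp: e_def)
  define a where "a = (real l - 2 * e) / d"
  have ad: "a * d = real l - 2 * e" using d0 by (simp add: a_def)
  have a0: "0 < a" unfolding a_def using l e d0 by (intro divide_pos_pos) auto
  have a1: "a < 1"
  proof -
    have "real l - 2 * e < real d" using ld e by linarith
    then show ?thesis unfolding a_def using d0 by simp
  qed
  have am: "\<alpha> - 2 * e \<le> a * m"
  proof -
    have "a * m = \<alpha> - 2 * e * (real m / real d)" by (simp add: a_def \<alpha>_def diff_divide_distrib left_diff_distrib)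
    moreover have "2 * e * (real m / real d) \<le> 2 * e * 1"
      using e d0 by (intro mult_left_mono) (auto simp: d_def)
    ultimately show ?thesis by simp
  qed
  define C where "C = 2 * (m + (k + 1) * (n - m))"
  define c5 where "c5 = (r / 4) ^ m * (\<kappa> * r ^ k / n) ^ (n - m)"
  have c5: "0 < c5" using r \<kappa> n1 by (simp add: c5_def)
  have two: "filterlim (\<lambda>j::nat. (2::real) ^ j) at_top sequentially"
    using filterlim_realpow_sequentially_gt1[of "2::real"] by (simp add: filterlim_at_top_imp_at_infinity filterlim_at_infinity_imp_filterlim_at_top)
  have core: "eventually (\<lambda>j. \<exists>p0. \<forall>p\<ge>p0. prime p \<longrightarrow> (\<forall>(Q::('m \<Rightarrow> nat) set) (Y :: ('m \<Rightarrow> nat) \<Rightarrow> (int^'n) set). finite Q \<longrightarrow>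
      (\<forall>y\<in>Q. (\<forall>k\<in>Y y. \<forall>i. \<bar>k $ i\<bar> \<le> int b * int p) \<and> inj_on (vmod p) (Y y) \<and>
          (2 ^ j) powr (e - real l) * real p ^ CARD('n) \<le> real (card (Y y))) \<longrightarrow>
      (\<exists>w B. admissible_weight (2 ^ j) w \<and> 0 < B \<and>
         L1_norm w * max_fun_sup l w \<le> B\<^sup>2 * (2 ^ j) powr (real CARD('n) + real l + e) \<and>
         card Q \<le> 2 * card {y\<in>Q. \<exists>k\<in>Y y. \<forall>\<zeta>. norm (\<zeta> - emb p k) \<le> 1 / (6 * 2 ^ j) \<longrightarrow>
            B * (2 ^ j) powr (real CARD('n) - e) \<le> cmod (fourier w \<zeta>)}))) sequentially"
    by (rule eventually_compose_filterlim[OF resonance_free_weight[OF l(1) _ e(1), where s=b] two]) (use l in simp)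
  have ev1: "eventually (\<lambda>j::nat. 1 \<le> j \<and> r < real j \<and> 2 * \<kappa> < real j) sequentially"
    by (intro eventually_sequentiallyI[of "nat \<lceil>\<bar>r\<bar> + 2 * \<bar>\<kappa>\<bar>\<rceil> + 2"]) linarith
  have ev2: "eventually (\<lambda>j. 2 \<le> ((2::real) ^ j) powr a) sequentially"
    using eventually_compose_filterlim[OF eventually_le_powr[OF a0] two] .
  have ev3: "eventually (\<lambda>j. (real j + 1) ^ C \<le> c5 * (2 ^ j) powr e) sequentially"
    by (rule eventually_poly_le_exp[OF c5 e(1)])
  have ev4: "eventually (\<lambda>j. 2 ^ (m + 1) \<le> ((2::real) ^ j) powr (\<epsilon> - 2 * e)) sequentially"
    using e \<epsilon> by (intro eventually_compose_filterlim[OF eventually_le_powr two]) linarith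
  have ev5: "eventually (\<lambda>j. (real j + 1) ^ 3 \<le> r * (2 ^ j) powr (1 - a)) sequentially"
    using r a1 by (intro eventually_poly_le_exp) auto
  show ?thesis
    using core ev1 ev2 ev3 ev4 ev5 unfolding \<alpha>
  proof eventually_elim
    case (elim j)
    define R where "R = (2::real) ^ j"
    have R1: "1 \<le> R" by (simp add: R_def)
    then have R0: "0 < R" by simp
    have j: "1 \<le> j" "r < real j" "2 * \<kappa> < real j" using elim(2) by auto
    have E2: "2 \<le> R powr a" and E3: "(real j + 1) ^ C \<le> c5 * R powr e" and E4: "2 ^ (m + 1) \<le> R powr (\<epsilon> - 2 * e)"
      and E5: "(real j + 1) ^ 3 \<le> r * R powr (1 - a)" using elim by (simp_all add: R_def)
    have pw: "(R powr x) ^ q = R powr (x * real q)" for x and q :: nat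
      using R0 by (simp add: powr_realpow[symmetric] powr_powr)
    define N where "N = nat \<lfloor>R powr a\<rfloor>"
    have Nu: "real N \<le> R powr a" unfolding N_def by (simp add: of_nat_floor)
    have Nl: "R powr a / 2 \<le> real N" unfolding N_def using E2 by linarith
    have N1: "1 \<le> N"
    proof -
      have "1 \<le> real N" using Nl E2 by linarith
      then show ?thesis by simp
    qed
    define J1 where "J1 = (real j + 1)\<^sup>2"
    have J10: "0 < J1" and J1j: "real j \<le> J1" by (auto simp: J1_def power2_eq_square algebra_simps add_pos_nonneg)
    \<comment> \<open>In each chart coordinate, \<open>N\<close> intervals of length
      \<open>\<sigma>\<close> exactly fill the interval from \<open>r / (j + 1)\<close> to
      \<open>r / j\<close> reserved for scale \<open>j\<close>.\<close>
    define \<sigma> where "\<sigma> = r / (real N * (real j * (real j + 1)))"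
    have Njj: "0 < real N * (real j * (real j + 1))" using N1 j by simp
    have \<sigma>0: "0 < \<sigma>" using r Njj by (simp add: \<sigma>_def)
    have N\<sigma>: "real N * \<sigma> = r / real j - r / (real j + 1)"
    proof -
      have "real N * \<sigma> = r / (real j * (real j + 1))" using N1 by (simp add: \<sigma>_def)
      also have "\<dots> = r / real j - r / (real j + 1)" using j by (simp add: field_simps)
      finally show ?thesis .
    qed
    have \<sigma>1: "\<sigma> < 1"
    proof -
      have "1 * (real j * 1) \<le> real N * (real j * (real j + 1))" using N1 j by (intro mult_mono) auto
      then have "r < real N * (real j * (real j + 1))" using j(2) by linarith
      then show ?thesis unfolding \<sigma>_def using Njj by simp
    qed
    have \<sigma>l: "r * R powr (- a) / J1 \<le> \<sigma>"
    proof -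
      have "real N * (real j * (real j + 1)) \<le> R powr a * J1"
        unfolding J1_def power2_eq_square using Nu by (intro mult_mono) auto
      then have "r / (R powr a * J1) \<le> \<sigma>" unfolding \<sigma>_def using r Njj R0 J10 by (intro divide_left_mono) auto
      then show ?thesis by (simp add: powr_minus divide_inverse mult_ac)
    qed
    \<comment> \<open>The factor \<open>\<sigma> ^ k\<close> is the displacement that a bump of
      width \<open>\<sigma>\<close> can have with bounded \<open>k\<close>-th derivatives.
      \<open>J1\<close> makes the scales summable, and \<open>n\<close> turns a coordinate bound
      into a norm bound.\<close>
    define h where "h = \<kappa> * \<sigma> ^ k / (J1 * real n)"
    have h0: "0 < h" using \<kappa> \<sigma>0 J10 n1 by (simp add: h_def)
    have h1: "h < 1/2"
    proof -
      have "\<sigma> ^ k \<le> 1" using \<sigma>0 \<sigma>1 by (intro power_le_one) auto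
      then have "\<kappa> * \<sigma> ^ k \<le> \<kappa> * 1" using \<kappa> by (intro mult_left_mono) auto
      also have "\<kappa> * 1 < J1 / 2" using j J1j by simp
      also have "\<dots> \<le> J1 * real n / 2" using J10 n1 by simp
      finally show ?thesis unfolding h_def using J10 n1 by (simp add: divide_less_eq)
    qed
    have dens: "R powr (e - real l) \<le> (\<sigma> / 4) ^ m * h ^ (n - m)"
    proof -
      define x where "x = r * R powr (- a) / J1"
      have x0: "0 < x" using r R0 J10 by (simp add: x_def)
      have J1C: "J1 ^ (m + (k + 1) * (n - m)) = (real j + 1) ^ C" by (simp only: J1_def C_def power_mult)
      have "R powr (e - real l) = R powr (- (real l - 2 * e)) / R powr e" by (simp add: powr_diff[symmetric])
      also have "\<dots> \<le> R powr (- (real l - 2 * e)) * (c5 / J1 ^ (m + (k + 1) * (n - m)))"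
      proof -
        have "1 / R powr e \<le> c5 / (real j + 1) ^ C" using E3 R0 by (simp add: field_simps)
        then have "R powr (- (real l - 2 * e)) * (1 / R powr e) \<le> R powr (- (real l - 2 * e)) * (c5 / (real j + 1) ^ C)"
          by (intro mult_left_mono) auto
        then show ?thesis unfolding J1C by simp
      qed
      also have "\<dots> = (x / 4) ^ m * (\<kappa> * x ^ k / (J1 * real n)) ^ (n - m)"
      proof -
        have "R powr (- (real l - 2 * e)) = (R powr (- a)) ^ d" by (simp add: pw ad)
        also have "\<dots> = (R powr (- a)) ^ m * ((R powr (- a)) ^ k) ^ (n - m)" by (simp only: d_def power_add power_mult)
        finally have 1: "R powr (- (real l - 2 * e)) = (R powr (- a)) ^ m * ((R powr (- a)) ^ k) ^ (n - m)" .
        have 2: "J1 ^ (m + (k + 1) * (n - m)) = J1 ^ m * (J1 ^ (k + 1)) ^ (n - m)" by (simp only: power_add power_mult)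
        have 3: "x / 4 = (r / 4) * R powr (- a) / J1" by (simp add: x_def)
        have 4: "\<kappa> * x ^ k / (J1 * real n) = (\<kappa> * r ^ k / n) * (R powr (- a)) ^ k / J1 ^ (k + 1)"
          by (simp add: x_def power_mult_distrib power_divide mult_ac)
        show ?thesis unfolding 1 2 3 4 c5_def by (simp only: power_mult_distrib power_divide) (simp add: mult_ac)
      qed
      also have "\<dots> \<le> (\<sigma> / 4) ^ m * h ^ (n - m)"
      proof (intro mult_mono power_mono)
        show "x / 4 \<le> \<sigma> / 4" using \<sigma>l by (simp add: x_def)
        have "x ^ k \<le> \<sigma> ^ k" using \<sigma>l x0 by (intro power_mono) (auto simp: x_def)
        then show "\<kappa> * x ^ k / (J1 * real n) \<le> h" unfolding h_def using \<kappa> J10 n1 by (intro divide_right_mono mult_left_mono) auto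
      qed (use x0 \<sigma>0 h0 \<kappa> J10 in auto)
      finally show ?thesis .
    qed
    obtain p0 where p0: "\<forall>p\<ge>p0. prime p \<longrightarrow> (\<forall>(Q::('m \<Rightarrow> nat) set) (Y :: ('m \<Rightarrow> nat) \<Rightarrow> (int^'n) set). finite Q \<longrightarrow>
      (\<forall>y\<in>Q. (\<forall>k\<in>Y y. \<forall>i. \<bar>k $ i\<bar> \<le> int b * int p) \<and> inj_on (vmod p) (Y y) \<and>
          R powr (e - real l) * real p ^ CARD('n) \<le> real (card (Y y))) \<longrightarrow>
      (\<exists>w B. admissible_weight R w \<and> 0 < B \<and>
         L1_norm w * max_fun_sup l w \<le> B\<^sup>2 * R powr (real CARD('n) + real l + e) \<and>
         card Q \<le> 2 * card {y\<in>Q. \<exists>k\<in>Y y. \<forall>\<zeta>. norm (\<zeta> - emb p k) \<le> 1 / (6 * R) \<longrightarrow>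
            B * R powr (real CARD('n) - e) \<le> cmod (fourier w \<zeta>)}))"
      using elim(1) unfolding R_def[symmetric] by (rule exE)
    \<comment> \<open>The prime comes after \<open>\<sigma>\<close> and \<open>h\<close>, so that
      the mesh resolves both.\<close>
    obtain p where pp: "prime p" "p0 + nat \<lceil>4 / \<sigma>\<rceil> + nat \<lceil>1 / h\<rceil> < p" using bigger_prime by blast
    have pp0: "p0 \<le> p" using pp by simp
    have p\<sigma>: "4 \<le> \<sigma> * real p"
    proof -
      have "4 / \<sigma> \<le> real p" using pp(2) by linarith
      then show ?thesis using \<sigma>0 by (simp add: field_simps)
    qed
    have ph: "1 \<le> h * real p"
    proof -
      have "1 / h \<le> real p" using pp(2) by linarith
      then show ?thesis using h0 by (simp add: field_simps)
    qed
    define Q where "Q = PiE (UNIV::'m set) (\<lambda>_. {..<N})"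
    have Qfin: "finite Q" and Qcard: "card Q = N ^ m" by (auto simp: Q_def card_PiE m_def intro!: finite_PiE)
    define c where "c q i = y0 $ i + r / (real j + 1) + real (q i) * \<sigma> + \<sigma> / 4" for q :: "'m \<Rightarrow> nat" and i
    define \<tau> where "\<tau> y = (SOME t. t \<in> K \<and> (\<forall>i. s t $ J i = y $ i))" for y
    have cl: "y0 $ i + r / (real j + 1) + \<sigma> / 4 \<le> c q i" for q i using \<sigma>0 by (simp add: c_def)
    have cu: "c q i + \<sigma> / 2 \<le> y0 $ i + r / real j - \<sigma> / 4" if "q \<in> Q" for q i
    proof -
      have "q i + 1 \<le> N" using that by (auto simp: Q_def PiE_iff Suc_le_eq)
      then have "real (q i + 1) * \<sigma> \<le> real N * \<sigma>" using \<sigma>0 by (intro mult_right_mono) (auto simp only: of_nat_le_iff)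
      then show ?thesis unfolding N\<sigma> by (simp add: c_def algebra_simps)
    qed
    have rj: "r / real j \<le> r" using j r by (simp add: divide_le_eq)
    have rj0: "0 < r / (real j + 1)" using r by (intro divide_pos_pos) auto
    have \<tau>: "\<tau> y \<in> K \<and> (\<forall>i. s (\<tau> y) $ J i = y $ i)" if q: "q \<in> Q" and y: "\<And>i. c q i \<le> y $ i \<and> y $ i \<le> c q i + \<sigma> / 2" for q y
    proof -
      have "\<exists>t\<in>K. \<forall>i. s t $ J i = y $ i"
      proof (rule chart)
        fix i show "y0 $ i \<le> y $ i \<and> y $ i \<le> y0 $ i + r"
          using y[of i] cl[of i q] cu[OF q, of i] rj rj0 \<sigma>0 by linarith
      qed
      then show ?thesis unfolding \<tau>_def using someI_ex[of "\<lambda>t. t \<in> K \<and> (\<forall>i. s t $ J i = y $ i)"] by blast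
    qed
    have "\<exists>Y :: (int^'n) set. (\<forall>k\<in>Y. \<forall>i. \<bar>k $ i\<bar> \<le> int b * int p) \<and> inj_on (vmod p) Y \<and>
     (\<sigma> / 4) ^ CARD('m) * h ^ (CARD('n) - CARD('m)) * real p ^ CARD('n) \<le> real (card Y) \<and>
     (\<forall>k\<in>Y. \<exists>t\<in>K. (\<forall>i. c q i \<le> s t $ J i \<and> s t $ J i \<le> c q i + \<sigma> / 2) \<and> norm (emb p k - s t) \<le> real CARD('n) * h)" if "q \<in> Q" for q
      by (rule target_points[OF J _ \<sigma>0 \<sigma>1 p\<sigma> h0 h1 ph \<tau>[OF that] Sb]) (use pp in \<open>auto simp: prime_gt_0_nat\<close>)
    then obtain Y :: "('m \<Rightarrow> nat) \<Rightarrow> (int^'n) set" where Y: "\<And>q. q \<in> Q \<Longrightarrow> (\<forall>k\<in>Y q. \<forall>i. \<bar>k $ i\<bar> \<le> int b * int p) \<and> inj_on (vmod p) (Y q) \<and>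
     (\<sigma> / 4) ^ CARD('m) * h ^ (CARD('n) - CARD('m)) * real p ^ CARD('n) \<le> real (card (Y q)) \<and>
     (\<forall>k\<in>Y q. \<exists>t\<in>K. (\<forall>i. c q i \<le> s t $ J i \<and> s t $ J i \<le> c q i + \<sigma> / 2) \<and> norm (emb p k - s t) \<le> real CARD('n) * h)"
      by metis
    have Yc: "R powr (e - real l) * real p ^ CARD('n) \<le> real (card (Y q))" if "q \<in> Q" for q
    proof -
      have "R powr (e - real l) * real p ^ CARD('n) \<le> (\<sigma> / 4) ^ CARD('m) * h ^ (CARD('n) - CARD('m)) * real p ^ CARD('n)"
        using dens by (intro mult_right_mono) (auto simp: m_def n_def)
      then show ?thesis using Y[OF that] by linarith
    qed
    have "\<forall>y\<in>Q. (\<forall>k\<in>Y y. \<forall>i. \<bar>k $ i\<bar> \<le> int b * int p) \<and> inj_on (vmod p) (Y y) \<and>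
          R powr (e - real l) * real p ^ CARD('n) \<le> real (card (Y y))"
    proof
      fix q assume q: "q \<in> Q"
      show "(\<forall>k\<in>Y q. \<forall>i. \<bar>k $ i\<bar> \<le> int b * int p) \<and> inj_on (vmod p) (Y q) \<and>
          R powr (e - real l) * real p ^ CARD('n) \<le> real (card (Y q))"
        using Y[OF q] Yc[OF q] by (elim conjE) (intro conjI)
    qed
    from p0[THEN spec, THEN mp, OF pp0, THEN mp, OF pp(1), THEN spec, THEN spec, THEN mp, OF Qfin, THEN mp, OF this]
    obtain w B where w: "admissible_weight R w" "0 < B"
         "L1_norm w * max_fun_sup l w \<le> B\<^sup>2 * R powr (real CARD('n) + real l + e)"
         "card Q \<le> 2 * card {y\<in>Q. \<exists>k\<in>Y y. \<forall>\<zeta>. norm (\<zeta> - emb p k) \<le> 1 / (6 * R) \<longrightarrow>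
            B * R powr (real CARD('n) - e) \<le> cmod (fourier w \<zeta>)}"
      by (elim exE conjE)
    define Q' where "Q' = {y\<in>Q. \<exists>k\<in>Y y. \<forall>\<zeta>. norm (\<zeta> - emb p k) \<le> 1 / (6 * R) \<longrightarrow>
            B * R powr (real CARD('n) - e) \<le> cmod (fourier w \<zeta>)}"
    have Q'Q: "Q' \<subseteq> Q" by (auto simp: Q'_def)
    have "\<forall>q\<in>Q'. \<exists>kt. snd kt \<in> K \<and> (\<forall>\<zeta>. norm (\<zeta> - emb p (fst kt)) \<le> 1 / (6 * R) \<longrightarrow>
            B * R powr (real CARD('n) - e) \<le> cmod (fourier w \<zeta>)) \<and>
         (\<forall>i. c q i \<le> s (snd kt) $ J i \<and> s (snd kt) $ J i \<le> c q i + \<sigma> / 2) \<and> norm (emb p (fst kt) - s (snd kt)) \<le> real CARD('n) * h"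
    proof
      fix q assume q: "q \<in> Q'"
      then obtain k where k: "k \<in> Y q" "\<forall>\<zeta>. norm (\<zeta> - emb p k) \<le> 1 / (6 * R) \<longrightarrow>
            B * R powr (real CARD('n) - e) \<le> cmod (fourier w \<zeta>)" by (auto simp: Q'_def)
      moreover obtain t where "t \<in> K" "(\<forall>i. c q i \<le> s t $ J i \<and> s t $ J i \<le> c q i + \<sigma> / 2)" "norm (emb p k - s t) \<le> real CARD('n) * h"
        using Y[of q] q Q'Q k(1) by blast
      ultimately show "\<exists>kt. snd kt \<in> K \<and> (\<forall>\<zeta>. norm (\<zeta> - emb p (fst kt)) \<le> 1 / (6 * R) \<longrightarrow>
            B * R powr (real CARD('n) - e) \<le> cmod (fourier w \<zeta>)) \<and>
         (\<forall>i. c q i \<le> s (snd kt) $ J i \<and> s (snd kt) $ J i \<le> c q i + \<sigma> / 2) \<and> norm (emb p (fst kt) - s (snd kt)) \<le> real CARD('n) * h"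
        by (intro exI[of _ "(k, t)"]) simp
    qed
    then obtain kt where kt: "\<And>q. q \<in> Q' \<Longrightarrow> snd (kt q) \<in> K"
         "\<And>q \<zeta>. q \<in> Q' \<Longrightarrow> norm (\<zeta> - emb p (fst (kt q))) \<le> 1 / (6 * R) \<Longrightarrow> B * R powr (real CARD('n) - e) \<le> cmod (fourier w \<zeta>)"
         "\<And>q i. q \<in> Q' \<Longrightarrow> c q i \<le> s (snd (kt q)) $ J i \<and> s (snd (kt q)) $ J i \<le> c q i + \<sigma> / 2"
         "\<And>q. q \<in> Q' \<Longrightarrow> norm (emb p (fst (kt q)) - s (snd (kt q))) \<le> real CARD('n) * h"
      by (subst (asm) bchoice_iff) blast
    define tt where "tt q = snd (kt q)" for q
    have sep: "\<exists>i. \<sigma> / 2 \<le> \<bar>s (tt q) $ J i - s (tt q') $ J i\<bar>" if q: "q \<in> Q'" "q' \<in> Q'" "q \<noteq> q'" for q q'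
    proof -
      obtain i where i: "q i \<noteq> q' i" using q(3) by auto
      have "\<sigma> / 2 \<le> \<bar>s (tt q) $ J i - s (tt q') $ J i\<bar>"
      proof (cases "q i < q' i")
        case True
        then have "real (q i) + 1 \<le> real (q' i)" by linarith
        then have "(real (q i) + 1) * \<sigma> \<le> real (q' i) * \<sigma>" using \<sigma>0 by (intro mult_right_mono) auto
        then have "c q i + \<sigma> \<le> c q' i" by (simp add: c_def algebra_simps)
        then show ?thesis using kt(3)[OF q(1), of i] kt(3)[OF q(2), of i] unfolding tt_def by linarith
      next
        case False
        then have "real (q' i) + 1 \<le> real (q i)" using i by linarith
        then have "(real (q' i) + 1) * \<sigma> \<le> real (q i) * \<sigma>" using \<sigma>0 by (intro mult_right_mono) auto
        then have "c q' i + \<sigma> \<le> c q i" by (simp add: c_def algebra_simps)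
        then show ?thesis using kt(3)[OF q(1), of i] kt(3)[OF q(2), of i] unfolding tt_def by linarith
      qed
      then show ?thesis by blast
    qed
    have injt: "inj_on tt Q'"
    proof (rule inj_onI, rule ccontr)
      fix q q' assume "q \<in> Q'" "q' \<in> Q'" "tt q = tt q'" "q \<noteq> q'"
      from sep[OF this(1,2,4)] this(3) show False using \<sigma>0 by simp
    qed
    define T where "T = tt ` Q'"
    define X where "X t = emb p (fst (kt (inv_into Q' tt t)))" for t
    have Xt: "X (tt q) = emb p (fst (kt q))" if "q \<in> Q'" for q using that injt by (simp add: X_def)
    have Rpos: "R powr x \<le> R powr y" if "x \<le> y" for x y using that R1 by (rule powr_mono)
    have P: "scale_points s J y0 r K \<kappa> k j \<sigma> T X"
      unfolding scale_points_def
    proof (intro conjI ballI allI impI)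
      show "finite T" using Qfin Q'Q finite_subset by (auto simp: T_def)
      show "T \<subseteq> K" using kt(1) by (auto simp: T_def tt_def)
    next
      fix t i assume "t \<in> T"
      then obtain q where q: "q \<in> Q'" "t = tt q" by (auto simp: T_def)
      have "q \<in> Q" using q Q'Q by blast
      show "y0 $ i + r / (real j + 1) + \<sigma> / 4 \<le> s t $ J i" using cl[of i q] kt(3)[OF q(1), of i] q by (simp add: tt_def)
      show "s t $ J i \<le> y0 $ i + r / real j - \<sigma> / 4" using cu[OF \<open>q \<in> Q\<close>, of i] kt(3)[OF q(1), of i] q by (simp add: tt_def)
    next
      fix t t' assume "t \<in> T" "t' \<in> T" "t \<noteq> t'"
      then show "\<exists>i. \<sigma> / 2 \<le> \<bar>s t $ J i - s t' $ J i\<bar>" using sep by (auto simp: T_def)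
    next
      fix t assume "t \<in> T"
      then obtain q where q: "q \<in> Q'" "t = tt q" by (auto simp: T_def)
      have "norm (X t - s t) \<le> real CARD('n) * h" using kt(4)[OF q(1)] Xt[OF q(1)] q by (simp add: tt_def)
      also have "\<dots> = \<kappa> * \<sigma> ^ k / (real j + 1)\<^sup>2" using n1 by (simp add: h_def J1_def n_def)
      finally show "norm (X t - s t) \<le> \<kappa> * \<sigma> ^ k / (real j + 1)\<^sup>2" .
    qed (use \<sigma>0 \<sigma>1 in auto)
    have W: "scale_weight l \<alpha> \<epsilon> j \<sigma> T X w B"
      unfolding scale_weight_def R_def[symmetric]
    proof (intro conjI ballI allI impI)
      have "B\<^sup>2 * R powr (real CARD('n) + real l + e) \<le> B\<^sup>2 * R powr (real CARD('n) + real l + \<epsilon>)"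
        using e by (intro mult_left_mono Rpos) auto
      then show "L1_norm w * max_fun_sup l w \<le> B\<^sup>2 * R powr (real CARD('n) + real l + \<epsilon>)" using w(3) by linarith
    next
      fix t \<zeta> assume "t \<in> T" and z: "norm (\<zeta> - X t) \<le> 1 / (6 * R)"
      then obtain q where q: "q \<in> Q'" "t = tt q" by (auto simp: T_def)
      have "B * R powr (real CARD('n) - \<epsilon>) \<le> B * R powr (real CARD('n) - e)"
        using e w(2) by (intro mult_left_mono Rpos) auto
      also have "\<dots> \<le> cmod (fourier w \<zeta>)" using z q Xt[OF q(1)] by (intro kt(2)[OF q(1)]) simp
      finally show "B * R powr (real CARD('n) - \<epsilon>) \<le> cmod (fourier w \<zeta>)" .
    next
      have "R powr (\<alpha> - \<epsilon>) * 2 ^ (m + 1) \<le> R powr (\<alpha> - \<epsilon>) * R powr (\<epsilon> - 2 * e)"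
        using E4 by (intro mult_left_mono) auto
      also have "\<dots> = R powr (\<alpha> - 2 * e)" by (simp add: powr_add[symmetric])
      also have "\<dots> \<le> R powr (a * m)" by (rule Rpos[OF am])
      also have "\<dots> = (R powr a / 2) ^ m * 2 ^ m" by (simp add: pw power_divide)
      also have "\<dots> \<le> real N ^ m * 2 ^ m" using Nl by (intro mult_right_mono power_mono) auto
      also have "real N ^ m = real (card Q)" by (simp add: Qcard)
      also have "\<dots> \<le> 2 * real (card T)"
      proof -
        have "card T = card Q'" unfolding T_def by (rule card_image[OF injt])
        then show ?thesis using w(4) unfolding Q'_def[symmetric] by linarith
      qed
      finally show "R powr (\<alpha> - \<epsilon>) \<le> real (card T)" by simp
    next
      have "real j * J1 \<le> (real j + 1) ^ 3"
        by (simp add: J1_def power3_eq_cube power2_eq_square mult_right_mono)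
      also note E5
      finally have "real j \<le> r * R powr (1 - a) / J1" using J10 by (simp add: field_simps)
      also have "\<dots> = r * R powr (- a) / J1 * R" using R0 by (simp add: powr_diff powr_minus field_simps)
      also have "\<dots> \<le> \<sigma> * R" using \<sigma>l R0 by (intro mult_right_mono) auto
      finally show "real j \<le> \<sigma> * R" .
    qed (use w in auto)
    show ?case using P W by blast
  qed
qed

section \<open>The perturbation\<close>

text \<open>At stage \<open>j\<close> the smallest tolerance \<open>1 / (i + 1)\<close> with
  \<open>i \<le> j\<close> that can be met is used, and any safe datum if there is none. Each fixed
  tolerance is met eventually, so the chosen one is eventually at least as small.\<close>

lemma diagonal_choice:
  fixes P :: "real \<Rightarrow> nat \<Rightarrow> 'd \<Rightarrow> bool"
  assumes safe: "\<And>j. \<exists>d. S j d"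
    and mono: "\<And>e e' j d. P e j d \<Longrightarrow> e \<le> e' \<Longrightarrow> P e' j d"
    and ev: "\<And>e. 0 < e \<Longrightarrow> eventually (\<lambda>j. \<exists>d. S j d \<and> P e j d) sequentially"
  shows "\<exists>D. (\<forall>j. S j (D j)) \<and> (\<forall>e>0. eventually (\<lambda>j. P e j (D j)) sequentially)"
proof -
  define G where "G j = {i. i \<le> j \<and> (\<exists>d. S j d \<and> P (1 / (real i + 1)) j d)}" for j
  have finG: "finite (G j)" for j by (rule finite_subset[of _ "{..j}"]) (auto simp: G_def)
  have "\<exists>d. S j d \<and> (G j \<noteq> {} \<longrightarrow> P (1 / (real (Max (G j)) + 1)) j d)" for j
  proof (cases "G j = {}")
    case True then show ?thesis using safe by blast
  next
    case False
    then have "Max (G j) \<in> G j" using finG by (intro Max_in)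
    then show ?thesis by (auto simp: G_def)
  qed
  then obtain D where D: "\<And>j. S j (D j)" "\<And>j. G j \<noteq> {} \<Longrightarrow> P (1 / (real (Max (G j)) + 1)) j (D j)" by metis
  have "eventually (\<lambda>j. P e j (D j)) sequentially" if e: "0 < e" for e
  proof -
    define i where "i = nat \<lceil>1 / e\<rceil>"
    have "1 / e \<le> real i + 1" unfolding i_def by linarith
    then have ie: "1 / (real i + 1) \<le> e" using e by (simp add: field_simps)
    have "eventually (\<lambda>j. \<exists>d. S j d \<and> P (1 / (real i + 1)) j d) sequentially" by (rule ev) simp
    moreover have "eventually (\<lambda>j. i \<le> j) sequentially" by (rule eventually_ge_at_top)
    ultimately show ?thesis
    proof eventually_elim
      case (elim j)
      then have iG: "i \<in> G j" by (simp add: G_def)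
      then have "i \<le> Max (G j)" using finG by (intro Max_ge)
      then have "1 / (real (Max (G j)) + 1) \<le> 1 / (real i + 1)" by (intro divide_left_mono) auto
      then have "1 / (real (Max (G j)) + 1) \<le> e" using ie by linarith
      moreover have "P (1 / (real (Max (G j)) + 1)) j (D j)" using iG by (intro D(2)) auto
      ultimately show ?case using mono by blast
    qed
  qed
  then show ?thesis using D(1) by blast
qed

lemma scale_weight_mono:
  assumes "scale_weight l \<alpha> \<epsilon> j \<sigma> T X w B" "\<epsilon> \<le> \<epsilon>'"
  shows "scale_weight l \<alpha> \<epsilon>' j \<sigma> (T :: (real^'m) set) (X :: real^'m \<Rightarrow> real^'n) w B"
proof -
  have R: "((2::real) ^ j) powr x \<le> (2 ^ j) powr y" if "x \<le> y" for x y using that by (intro powr_mono) auto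
  have 1: "admissible_weight (2 ^ j) w" "0 < B"
     "L1_norm w * max_fun_sup l w \<le> B\<^sup>2 * (2 ^ j) powr (real CARD('n) + real l + \<epsilon>)"
     "\<And>t \<zeta>. t \<in> T \<Longrightarrow> norm (\<zeta> - X t) \<le> 1 / (6 * 2 ^ j) \<Longrightarrow> B * (2 ^ j) powr (real CARD('n) - \<epsilon>) \<le> cmod (fourier w \<zeta>)"
     "(2 ^ j) powr (\<alpha> - \<epsilon>) \<le> real (card T)" "real j \<le> \<sigma> * 2 ^ j"
    using assms(1) unfolding scale_weight_def by auto
  have "B\<^sup>2 * (2 ^ j) powr (real CARD('n) + real l + \<epsilon>) \<le> B\<^sup>2 * (2 ^ j) powr (real CARD('n) + real l + \<epsilon>')"
    using assms(2) by (intro mult_left_mono R) auto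
  moreover have "B * (2 ^ j) powr (real CARD('n) - \<epsilon>') \<le> B * (2 ^ j) powr (real CARD('n) - \<epsilon>)"
    using assms(2) 1(2) by (intro mult_left_mono R) auto
  moreover have "((2::real) ^ j) powr (\<alpha> - \<epsilon>') \<le> (2 ^ j) powr (\<alpha> - \<epsilon>)" using assms(2) by (intro R) auto
  ultimately show ?thesis unfolding scale_weight_def using 1 order_trans by blast
qed

lemma norm_sum_disjoint_le:
  fixes f :: "'a \<Rightarrow> 'b::real_normed_vector"
  assumes "finite T" "0 \<le> c" "\<And>t. t \<in> T \<Longrightarrow> norm (f t) \<le> c"
    and "\<And>t t'. t \<in> T \<Longrightarrow> t' \<in> T \<Longrightarrow> t \<noteq> t' \<Longrightarrow> f t = 0 \<or> f t' = 0"
  shows "norm (\<Sum>t\<in>T. f t) \<le> c"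
proof (cases "\<exists>t\<in>T. f t \<noteq> 0")
  case True
  then obtain t where t: "t \<in> T" "f t \<noteq> 0" by blast
  have "(\<Sum>t\<in>T. f t) = f t + (\<Sum>t\<in>T - {t}. f t)" using assms(1) t(1) by (rule sum.remove)
  also have "(\<Sum>t\<in>T - {t}. f t) = 0" using assms(4)[OF t(1)] t by (intro sum.neutral) auto
  finally show ?thesis using assms(3)[OF t(1)] by simp
next
  case False
  then have "(\<Sum>t\<in>T. f t) = 0" by (intro sum.neutral) auto
  then show ?thesis using assms(2) by simp
qed

lemma bumpd_minus: "bumpd B t \<sigma> (- e) is x = - bumpd B t \<sigma> e is x"
  by (simp add: bumpd_def)

text \<open>All scales are superposed: the bumps have pairwise disjoint supports, so each prescribed value
  is attained, and the bump at scale \<open>j\<close> has \<open>C\<^sup>k\<close> norm of order \<open>1/j\<^sup>2\<close>.\<close>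

lemma perturbation_exists:
  fixes s :: "real^'m \<Rightarrow> real^'n" and J :: "'m \<Rightarrow> 'n"
  assumes lip: "\<forall>t\<in>K. \<forall>t'\<in>K. norm (s t - s t') \<le> L * norm (t - t')" and L: "0 < L"
    and r: "0 < r" and \<rho>: "0 < \<rho>"
  shows "\<exists>\<kappa>>0. \<exists>\<mu>>0. \<forall>\<sigma> T X. (\<forall>j. scale_points s J y0 r K \<kappa> k j (\<sigma> j) (T j) (X j)) \<longrightarrow>
     (\<exists>f. Ck_on k UNIV f \<and> (\<forall>is x. length is \<le> k \<longrightarrow> norm (pdiff is f x) \<le> \<rho>) \<and>
        (\<forall>is x. length is \<le> k \<longrightarrow> norm (pdiff is (\<lambda>x. - f x) x) \<le> \<rho>) \<and>
        (\<forall>j. \<forall>t\<in>T j. f t = X j t - s t) \<and>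
        (\<forall>j. \<forall>t\<in>T j. \<forall>t'\<in>T j. t \<noteq> t' \<longrightarrow> (\<exists>i. 2 * \<mu> * \<sigma> j \<le> \<bar>t $ i - t' $ i\<bar>)))"
proof -
  obtain B :: "nat \<Rightarrow> real \<Rightarrow> real" and M where BM: "1 \<le> M \<and> B 0 0 = 1 \<and>
     (\<forall>j<k. \<forall>x. (B j has_real_derivative B (Suc j) x) (at x)) \<and>
     (\<forall>j\<le>k. continuous_on UNIV (B j) \<and> (\<forall>x. 1 \<le> \<bar>x\<bar> \<longrightarrow> B j x = 0) \<and> (\<forall>x. \<bar>B j x\<bar> \<le> M))"
    using smooth_bump_exists[of k] by (elim exE)
  have M1: "1 \<le> M" and B00: "B 0 0 = 1"
    and Bder: "\<And>j x. j < k \<Longrightarrow> (B j has_real_derivative B (Suc j) x) (at x)"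
    and Bc: "\<And>j. j \<le> k \<Longrightarrow> continuous_on UNIV (B j)"
    and Bz: "\<And>j x. j \<le> k \<Longrightarrow> 1 \<le> \<bar>x\<bar> \<Longrightarrow> B j x = 0" and Bb: "\<And>j x. j \<le> k \<Longrightarrow> \<bar>B j x\<bar> \<le> M"
    using BM by simp_all
  \<comment> \<open>Parameters closer than \<open>\<mu> * (\<sigma> j + \<sigma> j')\<close> in all
    coordinates would have images closer than a quarter of \<open>\<sigma> j + \<sigma> j'\<close>,
    against the separation in the chart. Bumps of half-width \<open>\<mu> * \<sigma> j\<close> are
    therefore disjoint.\<close>
  define \<mu> where "\<mu> = 1 / (4 * (L * real CARD('m)) + 4)"
  have Lm: "0 < L * real CARD('m)" using L by simp
  have \<mu>0: "0 < \<mu>" using Lm by (simp add: \<mu>_def add_pos_pos)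
  have \<mu>1: "\<mu> \<le> 1" using Lm by (simp add: \<mu>_def divide_le_eq)
  have \<mu>L: "L * real CARD('m) * \<mu> < 1/4" using Lm by (simp add: \<mu>_def divide_less_eq)
  define Cb where "Cb = (1 / \<mu>) ^ k * M ^ CARD('m)"
  have Cb0: "0 < Cb" using \<mu>0 M1 by (simp add: Cb_def)
  have summ: "summable (\<lambda>j. 1 / (real j + 1)\<^sup>2)"
    using summable_Suc_iff[of "\<lambda>j. inverse (real j ^ 2)"] inverse_power_summable[of 2, where 'a=real]
    by (simp add: inverse_eq_divide add.commute)
  define Z where "Z = (\<Sum>j. 1 / (real j + 1)\<^sup>2)"
  have Z0: "0 \<le> Z" unfolding Z_def by (rule suminf_nonneg[OF summ]) simp
  \<comment> \<open>Normalises the series of bump norms, with total \<open>Z\<close>, to at most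
    \<open>\<rho>\<close>; adding 1 avoids a case distinction for the sign of the
    denominator.\<close>
  define \<kappa> where "\<kappa> = \<rho> / (Cb * (Z + 1))"
  have \<kappa>0: "0 < \<kappa>" using \<rho> Cb0 Z0 by (simp add: \<kappa>_def)
  define Mj where "Mj j = Cb * \<kappa> * (1 / (real j + 1)\<^sup>2)" for j
  have Mjs: "summable Mj" unfolding Mj_def by (intro summable_mult summ)
  have Mjt: "suminf Mj \<le> \<rho>"
  proof -
    have "suminf Mj = Cb * \<kappa> * Z" unfolding Mj_def Z_def by (rule suminf_mult[OF summ])
    also have "\<dots> = \<rho> * (Z / (Z + 1))" using Cb0 Z0 by (simp add: \<kappa>_def)
    also have "\<dots> \<le> \<rho> * 1" using \<rho> Z0 by (intro mult_left_mono) (auto simp: divide_le_eq)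
    finally show ?thesis by simp
  qed
  have "\<exists>f. Ck_on k UNIV f \<and> (\<forall>is x. length is \<le> k \<longrightarrow> norm (pdiff is f x) \<le> \<rho>) \<and>
        (\<forall>is x. length is \<le> k \<longrightarrow> norm (pdiff is (\<lambda>x. - f x) x) \<le> \<rho>) \<and>
        (\<forall>j. \<forall>t\<in>T j. f t = X j t - s t) \<and>
        (\<forall>j. \<forall>t\<in>T j. \<forall>t'\<in>T j. t \<noteq> t' \<longrightarrow> (\<exists>i. 2 * \<mu> * \<sigma> j \<le> \<bar>t $ i - t' $ i\<bar>))"
    if sp: "\<forall>j. scale_points s J y0 r K \<kappa> k j (\<sigma> j) (T j) (X j)" for \<sigma> T X
  proof -
    have \<sigma>0: "0 < \<sigma> j" and \<sigma>1: "\<sigma> j < 1" and Tf: "finite (T j)" and TK: "T j \<subseteq> K" for j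
      using sp by (auto simp: scale_points_def)
    have lo: "y0 $ i + r / (real j + 1) + \<sigma> j / 4 \<le> s t $ J i" and hi: "s t $ J i \<le> y0 $ i + r / real j - \<sigma> j / 4"
      if "t \<in> T j" for j t i using sp that by (auto simp: scale_points_def)
    have same: "\<exists>i. \<sigma> j / 2 \<le> \<bar>s t $ J i - s t' $ J i\<bar>" if "t \<in> T j" "t' \<in> T j" "t \<noteq> t'" for j t t'
      using sp that unfolding scale_points_def by blast
    have Xb: "norm (X j t - s t) \<le> \<kappa> * \<sigma> j ^ k / (real j + 1)\<^sup>2" if "t \<in> T j" for j t
      using sp that unfolding scale_points_def by blast
    have lt: "\<exists>i. (\<sigma> j + \<sigma> j') / 4 \<le> \<bar>s t $ J i - s t' $ J i\<bar>" if t: "t \<in> T j" "t' \<in> T j'" and jj: "j < j'" for j j' t t'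
    proof -
      have rj: "r / real j' \<le> r / (real j + 1)" using jj r by (intro divide_left_mono) auto
      have gap: "(c + d) / 4 \<le> u - v" if "z + r / (real j + 1) + c / 4 \<le> u" "v \<le> z + r / real j' - d / 4" for c d u v z
      proof -
        have "(c + d) / 4 = c / 4 + d / 4" by (simp add: add_divide_distrib)
        then show ?thesis using that rj by linarith
      qed
      have "(\<sigma> j + \<sigma> j') / 4 \<le> \<bar>s t $ J i - s t' $ J i\<bar>" for i
        using order_trans[OF gap[OF lo[OF t(1), of i] hi[OF t(2), of i]] abs_ge_self] by blast
      then show ?thesis by blast
    qed
    have sepy: "\<exists>i. (\<sigma> j + \<sigma> j') / 4 \<le> \<bar>s t $ J i - s t' $ J i\<bar>" if t: "t \<in> T j" "t' \<in> T j'" and ne: "(j, t) \<noteq> (j', t')" for j j' t t'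
    proof -
      consider "j < j'" | "j' < j" | "j = j'" "t \<noteq> t'" using ne by force
      then show ?thesis
      proof cases
        case 1 then show ?thesis by (rule lt[OF t])
      next
        case 2
        from lt[OF t(2,1) 2] show ?thesis by (simp add: abs_minus_commute add.commute)
      next
        case 3
        with same[of t j t'] t show ?thesis by auto
      qed
    qed
    have sept: "\<exists>i. \<mu> * \<sigma> j + \<mu> * \<sigma> j' \<le> \<bar>t $ i - t' $ i\<bar>" if t: "t \<in> T j" "t' \<in> T j'" and ne: "(j, t) \<noteq> (j', t')" for j j' t t'
    proof (rule ccontr)
      assume "\<not> ?thesis"
      then have d: "\<bar>(t - t') $ i\<bar> \<le> \<mu> * (\<sigma> j + \<sigma> j')" for i by (auto simp: not_le distrib_left less_imp_le)
      obtain i where i: "(\<sigma> j + \<sigma> j') / 4 \<le> \<bar>s t $ J i - s t' $ J i\<bar>" using sepy[OF t ne] by blast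
      have "norm (t - t') \<le> (\<Sum>i\<in>UNIV. \<bar>(t - t') $ i\<bar>)" by (rule norm_le_l1_cart)
      also have "\<dots> \<le> (\<Sum>i\<in>(UNIV::'m set). \<mu> * (\<sigma> j + \<sigma> j'))" by (intro sum_mono d)
      finally have nt: "norm (t - t') \<le> real CARD('m) * (\<mu> * (\<sigma> j + \<sigma> j'))" by simp
      have "\<bar>s t $ J i - s t' $ J i\<bar> \<le> norm (s t - s t')" using component_le_norm_cart[of "s t - s t'" "J i"] by simp
      also have "\<dots> \<le> L * norm (t - t')" using lip t TK by blast
      also have "\<dots> \<le> L * (real CARD('m) * (\<mu> * (\<sigma> j + \<sigma> j')))" using nt L by (intro mult_left_mono) auto
      also have "\<dots> = (L * real CARD('m) * \<mu>) * (\<sigma> j + \<sigma> j')" by simp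
      also have "\<dots> < 1/4 * (\<sigma> j + \<sigma> j')" using \<mu>L \<sigma>0[of j] \<sigma>0[of j'] by (intro mult_strict_right_mono) auto
      finally show False using i by simp
    qed
    have \<mu>\<sigma>: "0 < \<mu> * \<sigma> j" for j using \<mu>0 \<sigma>0 by simp
    define e where "e j t = X j t - s t" for j t
    have dis: "bumpd B t (\<mu> * \<sigma> j) v is x = 0 \<or> bumpd B t' (\<mu> * \<sigma> j') v' is x = 0"
      if t: "t \<in> T j" "t' \<in> T j'" and ne: "(j, t) \<noteq> (j', t')" and l: "length is \<le> k" for j j' t t' v v' "is" x
    proof -
      obtain i where i: "\<mu> * \<sigma> j + \<mu> * \<sigma> j' \<le> \<bar>t $ i - t' $ i\<bar>" using sept[OF t ne] by blast
      then have "\<mu> * \<sigma> j \<le> \<bar>x $ i - t $ i\<bar> \<or> \<mu> * \<sigma> j' \<le> \<bar>x $ i - t' $ i\<bar>" by linarith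
      moreover have "bumpd B t (\<mu> * \<sigma> j) v is x = 0" if "\<mu> * \<sigma> j \<le> \<bar>x $ i - t $ i\<bar>"
        by (rule bumpd_zero[where B=B and k=k, OF _ l \<mu>\<sigma> that]) (rule Bz)
      moreover have "bumpd B t' (\<mu> * \<sigma> j') v' is x = 0" if "\<mu> * \<sigma> j' \<le> \<bar>x $ i - t' $ i\<bar>"
        by (rule bumpd_zero[where B=B and k=k, OF _ l \<mu>\<sigma> that]) (rule Bz)
      ultimately show ?thesis by blast
    qed
    \<comment> \<open>The sign \<open>c\<close> lets one construction cover \<open>f\<close> and
      \<open>- f\<close>, whose derivatives are bounded separately: the difference of the two
      parameterisations will be \<open>- f\<close>.\<close>
    define G where "G c j is x = (\<Sum>t\<in>T j. bumpd B t (\<mu> * \<sigma> j) (c *\<^sub>R e j t) is x)" for c j "is" x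
    have Gder: "((\<lambda>h. G c j is (x + h *\<^sub>R axis i 1)) has_vector_derivative G c j (i # is) x) (at 0)" if "length is < k" for c j "is" i x
      unfolding G_def using that by (intro has_vector_derivative_sum bumpd_deriv[where B=B and k=k, OF Bder] \<mu>\<sigma>)
    have Gcont: "continuous_on UNIV (G c j is)" if "length is \<le> k" for c j "is"
      unfolding G_def using that by (intro continuous_on_sum bumpd_continuous[where B=B and k=k, OF Bc] \<mu>\<sigma>)
    have Gb: "norm (G c j is x) \<le> Mj j" if c: "\<bar>c\<bar> = 1" and l: "length is \<le> k" for c j "is" x
      unfolding G_def
    proof (rule norm_sum_disjoint_le[OF Tf])
      show "0 \<le> Mj j" using Cb0 \<kappa>0 by (simp add: Mj_def)
      fix t assume t: "t \<in> T j"
      have "norm (bumpd B t (\<mu> * \<sigma> j) (c *\<^sub>R e j t) is x) \<le> (1 / (\<mu> * \<sigma> j)) ^ length is * M ^ CARD('m) * norm (c *\<^sub>R e j t)"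
        by (rule bumpd_bound[where B=B and k=k, OF Bb l \<mu>\<sigma>])
      also have "\<dots> = (1 / \<mu>) ^ length is * (1 / \<sigma> j) ^ length is * M ^ CARD('m) * norm (e j t)"
        using c by (simp add: power_mult_distrib[symmetric])
      \<comment> \<open>The height \<open>\<kappa> * \<sigma> ^ k\<close> absorbs the
        \<open>\<sigma> ^ - k\<close> of up to \<open>k\<close> derivatives; this is where the
        smoothness enters the exponent.\<close>
      also have "\<dots> \<le> (1 / \<mu>) ^ k * (1 / \<sigma> j) ^ k * M ^ CARD('m) * (\<kappa> * \<sigma> j ^ k / (real j + 1)\<^sup>2)"
        using \<mu>0 \<mu>1 \<sigma>0[of j] \<sigma>1[of j] M1 l Xb[OF t] by (intro mult_mono power_increasing) (auto simp: e_def)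
      also have "\<dots> = (1 / \<mu>) ^ k * M ^ CARD('m) * \<kappa> * (((1 / \<sigma> j) ^ k * \<sigma> j ^ k) / (real j + 1)\<^sup>2)" by simp
      also have "(1 / \<sigma> j) ^ k * \<sigma> j ^ k = 1" using \<sigma>0[of j] by (simp add: power_mult_distrib[symmetric])
      finally show "norm (bumpd B t (\<mu> * \<sigma> j) (c *\<^sub>R e j t) is x) \<le> Mj j" by (simp add: Mj_def Cb_def)
    next
      fix t t' assume "t \<in> T j" "t' \<in> T j" "t \<noteq> t'"
      then show "bumpd B t (\<mu> * \<sigma> j) (c *\<^sub>R e j t) is x = 0 \<or> bumpd B t' (\<mu> * \<sigma> j) (c *\<^sub>R e j t') is x = 0"
        by (intro dis l) auto
    qed
    define F where "F c x = (\<Sum>j. G c j [] x)" for c x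
    have FCk: "Ck_on k UNIV (F c)" if "\<bar>c\<bar> = 1" for c
      unfolding F_def[abs_def] by (rule Ck_on_series(2)[OF Gder Gcont Gb[OF that] Mjs])
    have Fb: "norm (pdiff is (F c) x) \<le> \<rho>" if c: "\<bar>c\<bar> = 1" and l: "length is \<le> k" for c "is" x
    proof -
      have "pdiff is (F c) x = (\<Sum>j. G c j is x)"
        unfolding F_def[abs_def] by (rule Ck_on_series(1)[OF Gder Gcont Gb[OF c] Mjs l])
      also have "norm \<dots> \<le> (\<Sum>j. norm (G c j is x))"
        by (intro summable_norm summable_comparison_test'[OF Mjs, of 0]) (use Gb[OF c l] in auto)
      also have "\<dots> \<le> suminf Mj"
        by (intro suminf_le Gb[OF c l] Mjs summable_comparison_test'[OF Mjs, of 0]) (use Gb[OF c l] in auto)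
      finally show ?thesis using Mjt by linarith
    qed
    have neg: "F (-1) = (\<lambda>x. - F 1 x)"
    proof
      fix x
      have "summable (\<lambda>j. G 1 j [] x)" by (rule summable_comparison_test'[OF Mjs, of 0]) (use Gb[of 1 "[]"] in auto)
      then have "- F 1 x = (\<Sum>j. - G 1 j [] x)" unfolding F_def by (rule suminf_minus[symmetric])
      also have "\<dots> = F (-1) x" unfolding F_def G_def by (simp add: bumpd_minus sum_negf)
      finally show "F (-1) x = - F 1 x" by simp
    qed
    have val: "F 1 t = X j t - s t" if t: "t \<in> T j" for j t
    proof -
      have self: "bumpd B t (\<mu> * \<sigma> j) v [] t = v" for v by (simp add: bumpd_def B00)
      \<comment> \<open>Disjointness is tested at the point \<open>t\<close> with a nonzero vector
        on the bump of \<open>t\<close>, which does not vanish there.\<close>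
      have other: "bumpd B t' (\<mu> * \<sigma> j') (v::real^'n) [] t = 0" if t': "t' \<in> T j'" "(j', t') \<noteq> (j, t)" for j' t' v
      proof -
        have "bumpd B t' (\<mu> * \<sigma> j') v [] t = 0 \<or> bumpd B t (\<mu> * \<sigma> j) (axis undefined 1 :: real^'n) [] t = 0"
          using t t' by (intro dis) auto
        then show ?thesis unfolding self by (metis axis_eq_0_iff zero_neq_one)
      qed
      have Gz: "G 1 j' [] t = 0" if "j' \<noteq> j" for j'
        unfolding G_def using that by (intro sum.neutral ballI other) auto
      have "F 1 t = (\<Sum>j'\<in>{j}. G 1 j' [] t)" unfolding F_def using Gz by (intro suminf_finite) auto
      also have "\<dots> = G 1 j [] t" by simp
      also have "\<dots> = bumpd B t (\<mu> * \<sigma> j) (1 *\<^sub>R e j t) [] t + (\<Sum>t'\<in>T j - {t}. bumpd B t' (\<mu> * \<sigma> j) (1 *\<^sub>R e j t') [] t)"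
        unfolding G_def by (rule sum.remove[OF Tf t])
      also have "(\<Sum>t'\<in>T j - {t}. bumpd B t' (\<mu> * \<sigma> j) (1 *\<^sub>R e j t') [] t) = 0"
        by (intro sum.neutral ballI other) auto
      finally show ?thesis by (simp add: self e_def)
    qed
    have sep2: "\<exists>i. 2 * \<mu> * \<sigma> j \<le> \<bar>t $ i - t' $ i\<bar>" if "t \<in> T j" "t' \<in> T j" "t \<noteq> t'" for j t t'
      using sept[of t j t' j] that by (auto simp: mult.assoc)
    show ?thesis
    proof (intro exI[of _ "F 1"] conjI allI impI ballI)
      show "Ck_on k UNIV (F 1)" by (rule FCk) simp
      show "norm (pdiff is (F 1) x) \<le> \<rho>" if "length is \<le> k" for "is" x using that by (intro Fb) auto
      show "norm (pdiff is (\<lambda>x. - F 1 x) x) \<le> \<rho>" if "length is \<le> k" for "is" x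
        unfolding neg[symmetric] using that by (intro Fb) auto
    qed (use val sep2 in auto)
  qed
  then show ?thesis using \<kappa>0 \<mu>0 by blast
qed

section \<open>The lower bound\<close>

lemma fourier_measurable:
  fixes w :: "real^'n \<Rightarrow> real"
  assumes "integrable lborel w"
  shows "fourier w \<in> borel_measurable borel"
proof -
  have [measurable]: "w \<in> borel_measurable borel" using borel_measurable_integrable[OF assms] by simp
  have [measurable]: "cis \<in> borel_measurable borel" by (intro borel_measurable_continuous_onI continuous_intros)
  have "(\<lambda>\<xi>. \<integral>x. complex_of_real (w x) * cis (- 2 * pi * (x \<bullet> \<xi>)) \<partial>lborel) \<in> borel_measurable borel"
    by (rule lborel.borel_measurable_lebesgue_integral) measurable
  then show ?thesis by (simp add: fourier_def[abs_def])
qed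

lemma fourier_bound:
  assumes "integrable lborel w"
  shows "cmod (fourier w \<xi>) \<le> L1_norm w"
  unfolding fourier_def L1_norm_def by (rule order_trans[OF integral_norm_bound]) (simp add: norm_mult)

lemma surf_integrable:
  fixes s :: "real^'m \<Rightarrow> real^'n"
  assumes w: "integrable lborel w" and s: "continuous_on unit_cube s" and j: "continuous_on unit_cube (surf_jac s)"
  shows "integrable lborel (\<lambda>t. indicator unit_cube t * (cmod (fourier w (s t)))\<^sup>2 * surf_jac s t)"
proof -
  have cube: "unit_cube \<in> sets (borel :: (real^'m) measure)" by (simp add: unit_cube_def)
  let ?s = "\<lambda>t. indicator unit_cube t *\<^sub>R s t" and ?j = "\<lambda>t. indicator unit_cube t *\<^sub>R surf_jac s t"
  have [measurable]: "?s \<in> borel_measurable borel" "?j \<in> borel_measurable borel"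
    by (rule borel_measurable_continuous_on_indicator[OF cube s], rule borel_measurable_continuous_on_indicator[OF cube j])
  have [measurable]: "fourier w \<in> borel_measurable borel" by (rule fourier_measurable[OF w])
  \<comment> \<open>The truncated maps are measurable on the whole space, and the truncated area
    element restores the indicator of the cube.\<close>
  have eq: "indicator unit_cube t * (cmod (fourier w (s t)))\<^sup>2 * surf_jac s t = (cmod (fourier w (?s t)))\<^sup>2 * ?j t" for t
    by (simp add: indicator_def)
  have "bounded (surf_jac s ` unit_cube)" by (intro compact_imp_bounded compact_continuous_image j compact_unit_cube)
  then obtain M where M: "\<And>t. t \<in> unit_cube \<Longrightarrow> \<bar>surf_jac s t\<bar> \<le> M" unfolding bounded_iff by auto
  have M0: "0 \<le> M" using M[of 0] by (auto simp: mem_unit_cube)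
  show ?thesis unfolding eq
  proof (rule Bochner_Integration.integrable_bound)
    show "integrable lborel (\<lambda>t::real^'m. indicator unit_cube t *\<^sub>R ((L1_norm w)\<^sup>2 * M))"
      by (intro borel_integrable_compact compact_unit_cube continuous_intros)
    show "(\<lambda>t. (cmod (fourier w (?s t)))\<^sup>2 * ?j t) \<in> borel_measurable lborel" by measurable
    show "AE t in lborel. norm ((cmod (fourier w (?s t)))\<^sup>2 * ?j t) \<le> norm (indicator unit_cube t *\<^sub>R ((L1_norm w)\<^sup>2 * M))"
    proof (rule AE_I2)
      fix t :: "real^'m"
      have "(cmod (fourier w (s t)))\<^sup>2 * \<bar>surf_jac s t\<bar> \<le> (L1_norm w)\<^sup>2 * M" if "t \<in> unit_cube"
        using M[OF that] fourier_bound[OF w] by (intro mult_mono power_mono) auto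
      then show "norm ((cmod (fourier w (?s t)))\<^sup>2 * ?j t) \<le> norm (indicator unit_cube t *\<^sub>R ((L1_norm w)\<^sup>2 * M))"
        using M0 by (auto simp: indicator_def abs_mult)
    qed
  qed
qed

text \<open>The cubes of half-width \<open>\<delta>\<close> around the points of \<open>T\<close>
  are disjoint, and on each of them the transform is at least \<open>a\<close>.\<close>

lemma surf_L2_norm_ge:
  fixes s :: "real^'m \<Rightarrow> real^'n"
  assumes w: "integrable lborel w" and s: "continuous_on unit_cube s" and j: "continuous_on unit_cube (surf_jac s)"
    and c: "0 < c" "\<And>t. t \<in> unit_cube \<Longrightarrow> c \<le> surf_jac s t"
    and T: "finite T" and \<delta>: "0 < \<delta>"
    and sep: "\<And>t t'. t \<in> T \<Longrightarrow> t' \<in> T \<Longrightarrow> t \<noteq> t' \<Longrightarrow> \<exists>i. 2 * \<delta> < \<bar>t $ i - t' $ i\<bar>"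
    and near: "\<And>t x. t \<in> T \<Longrightarrow> (\<And>i. \<bar>x $ i - t $ i\<bar> \<le> \<delta>) \<Longrightarrow> x \<in> unit_cube \<and> a \<le> cmod (fourier w (s x))"
    and a: "0 \<le> a"
  shows "c * a\<^sup>2 * (real (card T) * (2 * \<delta>) ^ CARD('m)) \<le> (surf_L2_norm s (fourier w))\<^sup>2"
proof -
  define Q where "Q t = cbox (t - (\<chi> i. \<delta>)) (t + (\<chi> i. \<delta>))" for t :: "real^'m"
  have Q: "x \<in> Q t \<longleftrightarrow> (\<forall>i. \<bar>x $ i - t $ i\<bar> \<le> \<delta>)" for x t
    unfolding Q_def mem_box_cart by (intro iff_allI) (auto simp: abs_le_iff)
  have disj: "disjoint_family_on Q T"
    unfolding disjoint_family_on_def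
  proof (intro ballI impI, rule ccontr)
    fix t t' assume t: "t \<in> T" "t' \<in> T" "t \<noteq> t'" and "Q t \<inter> Q t' \<noteq> {}"
    then obtain x where x: "x \<in> Q t" "x \<in> Q t'" by blast
    obtain i where "2 * \<delta> < \<bar>t $ i - t' $ i\<bar>" using sep[OF t] by blast
    moreover have "\<bar>x $ i - t $ i\<bar> \<le> \<delta>" "\<bar>x $ i - t' $ i\<bar> \<le> \<delta>" using x by (auto simp: Q)
    ultimately show False by linarith
  qed
  have Qm: "measure lborel (Q t) = (2 * \<delta>) ^ CARD('m)" for t
  proof -
    have ne: "Q t \<noteq> {}" using Q[of t t] \<delta> by auto
    then have "measure lborel (Q t) = (\<Prod>i\<in>UNIV. (t + (\<chi> i. \<delta>)) $ i - (t - (\<chi> i. \<delta>)) $ i)"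
      unfolding Q_def by (rule content_cbox_cart)
    then show ?thesis by simp
  qed
  let ?A = "\<Union>t\<in>T. Q t"
  have Am: "measure lborel ?A = real (card T) * (2 * \<delta>) ^ CARD('m)"
  proof -
    have "measure lborel ?A = (\<Sum>t\<in>T. measure lborel (Q t))"
    proof (rule measure_finite_Union[OF T _ disj])
      show "emeasure lborel (Q t) \<noteq> \<infinity>" for t
        unfolding Q_def using emeasure_lborel_cbox_finite by (rule less_imp_neq)
    qed (auto simp: Q_def)
    then show ?thesis by (simp add: Qm)
  qed
  have Aint: "integrable lborel (\<lambda>t::real^'m. indicator ?A t *\<^sub>R (c * a\<^sup>2))"
    using T by (intro borel_integrable_compact compact_UN continuous_intros) (auto simp: Q_def)
  let ?h = "\<lambda>t. indicator unit_cube t * (cmod (fourier w (s t)))\<^sup>2 * surf_jac s t"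
  have hint: "integrable lborel ?h" by (rule surf_integrable[OF w s j])
  have h0: "0 \<le> ?h t" for t using c(1) c(2)[of t] by (auto simp: indicator_def)
  have "c * a\<^sup>2 * (real (card T) * (2 * \<delta>) ^ CARD('m)) = (\<integral>t. indicator ?A t *\<^sub>R (c * a\<^sup>2) \<partial>lborel)"
  proof -
    have "(\<integral>t. indicator ?A t *\<^sub>R (c * a\<^sup>2) \<partial>lborel) = measure lborel ?A * (c * a\<^sup>2)"
      by (simp add: Q_def)
    then show ?thesis by (simp add: Am)
  qed
  also have "\<dots> \<le> (\<integral>t. ?h t \<partial>lborel)"
  proof (rule integral_mono[OF Aint hint])
    fix x
    show "indicator ?A x *\<^sub>R (c * a\<^sup>2) \<le> ?h x"
    proof (cases "x \<in> ?A")
      case True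
      then obtain t where "t \<in> T" "x \<in> Q t" by blast
      then have "x \<in> unit_cube" "a \<le> cmod (fourier w (s x))" using near[of t x] by (auto simp: Q)
      moreover have "a\<^sup>2 * c \<le> (cmod (fourier w (s x)))\<^sup>2 * surf_jac s x"
        using calculation c(1) c(2)[of x] a by (intro mult_mono power_mono) auto
      ultimately show ?thesis using True by (simp add: mult.commute)
    next
      case False
      then show ?thesis using h0[of x] by simp
    qed
  qed
  also have "\<dots> = (surf_L2_norm s (fourier w))\<^sup>2"
  proof -
    have "0 \<le> (\<integral>t. ?h t \<partial>lborel)" by (rule integral_nonneg_AE, rule AE_I2, rule h0)
    then show ?thesis unfolding surf_L2_norm_def by simp
  qed
  finally show ?thesis .
qed

text \<open>Tube integrals lie between 0 and the total mass, so both suprema are over nonempty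
  bounded sets and have their intended meaning.\<close>

lemma max_fun_sup_nonneg:
  fixes w :: "real^'n \<Rightarrow> real"
  assumes w: "admissible_weight R w" and l: "l \<le> CARD('n)"
  shows "0 \<le> max_fun_sup l w"
proof -
  have w0: "\<And>x. 0 \<le> w x" and wi: "integrable lborel w" using w by (auto simp: admissible_weight_def)
  have tube: "0 \<le> (\<integral>x. indicator {x. infdist x ((+) v ` b) < 1} x * w x \<partial>lborel) \<and>
      (\<integral>x. indicator {x. infdist x ((+) v ` b) < 1} x * w x \<partial>lborel) \<le> (\<integral>x. w x \<partial>lborel)" for v b
  proof
    show "0 \<le> (\<integral>x. indicator {x. infdist x ((+) v ` b) < 1} x * w x \<partial>lborel)" using w0 by simp
    have "open {x. infdist x ((+) v ` b) < 1}" by (intro open_Collect_less continuous_intros)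
    then have "{x. infdist x ((+) v ` b) < 1} \<in> sets lborel" by simp
    from integrable_mult_indicator[OF this wi]
    show "(\<integral>x. indicator {x. infdist x ((+) v ` b) < 1} x * w x \<partial>lborel) \<le> (\<integral>x. w x \<partial>lborel)"
      using wi w0 by (intro integral_mono) (auto simp: indicator_def)
  qed
  have mf: "0 \<le> max_fun w b \<and> max_fun w b \<le> (\<integral>x. w x \<partial>lborel)" for b
  proof
    show "0 \<le> max_fun w b" unfolding max_fun_def
    proof (rule cSup_upper2)
      show "(\<integral>x. indicator {x. infdist x ((+) 0 ` b) < 1} x * w x \<partial>lborel)
         \<in> {(\<integral>x. indicator {x. infdist x ((+) v ` b) < 1} x * w x \<partial>lborel) | v. True}" by blast
      show "0 \<le> (\<integral>x. indicator {x. infdist x ((+) 0 ` b) < 1} x * w x \<partial>lborel)" using tube[of 0 b] by blast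
      show "bdd_above {(\<integral>x. indicator {x. infdist x ((+) v ` b) < 1} x * w x \<partial>lborel) | v. True}"
        using tube[where b=b] by (intro bdd_aboveI[of _ "\<integral>x. w x \<partial>lborel"]) blast
    qed
    show "max_fun w b \<le> (\<integral>x. w x \<partial>lborel)" unfolding max_fun_def
      by (rule cSup_least) (use tube in auto)
  qed
  have "l \<le> dim (UNIV :: (real^'n) set)" using l by simp
  then obtain b :: "(real^'n) set" where "subspace b" "dim b = l" by (rule choose_subspace_of_subspace) auto
  then have "max_fun w b \<in> max_fun w ` grassmannian l" by (auto simp: grassmannian_def)
  moreover have "bdd_above (max_fun w ` grassmannian l)" using mf by (intro bdd_aboveI2) auto
  ultimately show ?thesis unfolding max_fun_sup_def using mf by (meson cSup_upper2)
qed

text \<open>Each competing constant is tested on \<open>w\<close>. Positivity of the surface norm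
  excludes nonpositive constants and a vanishing right-hand side, so the inequality may be squared
  and divided.\<close>

lemma C_prime_sq_ge:
  fixes s :: "real^'m \<Rightarrow> real^'n"
  assumes w: "admissible_weight R w" and S: "0 < surf_L2_norm s (fourier w)" and x: "0 \<le> x" and l: "l \<le> CARD('n)"
    and le: "x * (R powr (real CARD('n) - real l - real CARD('m)) * (L1_norm w * max_fun_sup l w)) \<le> (surf_L2_norm s (fourier w))\<^sup>2"
  shows "ereal x \<le> (C_prime l s R)\<^sup>2"
proof -
  let ?e = "real CARD('n) - real l - real CARD('m)"
  have "ereal (sqrt x) \<le> C_prime l s R"
    unfolding C_prime_def
  proof (rule Inf_greatest, safe)
    fix C assume C: "\<forall>w. admissible_weight R w \<longrightarrow> surf_L2_norm s (fourier w)
        \<le> R powr (?e / 2) * C * sqrt (L1_norm w) * sqrt (max_fun_sup l w)"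
    define P where "P = R powr (?e / 2) * sqrt (L1_norm w) * sqrt (max_fun_sup l w)"
    have SC: "surf_L2_norm s (fourier w) \<le> C * P" using C w by (simp add: P_def mult_ac)
    have L0: "0 \<le> L1_norm w" by (simp add: L1_norm_def)
    have CP: "0 < C * P" using S SC by linarith
    have M0: "0 \<le> max_fun_sup l w" by (rule max_fun_sup_nonneg[OF w l])
    have "P \<ge> 0" using L0 M0 by (simp add: P_def)
    then have P0: "0 < P" and C0: "0 < C" using CP by (auto simp: zero_less_mult_iff)
    have "P\<^sup>2 = R powr ?e * (L1_norm w * max_fun_sup l w)"
    proof -
      have "(R powr (?e / 2))\<^sup>2 = R powr ?e" by (simp add: power2_eq_square powr_add[symmetric])
      then show ?thesis using L0 M0 by (simp add: P_def power_mult_distrib)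
    qed
    then have "x * P\<^sup>2 \<le> (surf_L2_norm s (fourier w))\<^sup>2" using le by simp
    also have "\<dots> \<le> (C * P)\<^sup>2" using SC S by (intro power_mono) auto
    finally have "x * P\<^sup>2 \<le> C\<^sup>2 * P\<^sup>2" by (simp add: power_mult_distrib)
    then have "x \<le> C\<^sup>2" using P0 by simp
    then have "sqrt x \<le> sqrt (C\<^sup>2)" by (rule real_sqrt_le_mono)
    then show "ereal (sqrt x) \<le> ereal C" using C0 by simp
  qed
  moreover have "0 \<le> C_prime l s R" by (rule order_trans[OF _ calculation]) (simp add: x)
  ultimately have "ereal (sqrt x) * ereal (sqrt x) \<le> C_prime l s R * C_prime l s R"
    using x by (intro ereal_mult_mono) auto
  then show ?thesis using x by (simp add: power2_eq_square)
qed

section \<open>From dyadic scales to all radii\<close>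

lemma eventually_dyadic:
  assumes "eventually P sequentially"
  shows "\<exists>R0\<ge>1. \<forall>R\<ge>R0. \<exists>j. P j \<and> 2 ^ j \<le> R \<and> R < 2 * (2::real) ^ j"
proof -
  obtain N where N: "\<And>j. N \<le> j \<Longrightarrow> P j" using assms unfolding eventually_sequentially by blast
  have "\<exists>j. P j \<and> 2 ^ j \<le> R \<and> R < 2 * (2::real) ^ j" if R: "2 ^ N \<le> R" for R
  proof -
    define S where "S = {j. (2::real) ^ j \<le> R}"
    obtain n where n: "R < 2 ^ n" using real_arch_pow[of 2 R] by auto
    have "j \<le> n" if "j \<in> S" for j
    proof (rule ccontr)
      assume "\<not> j \<le> n"
      then have "(2::real) ^ n \<le> 2 ^ j" by (intro power_increasing) auto
      moreover have "2 ^ j \<le> R" using that by (simp add: S_def)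
      ultimately show False using n by linarith
    qed
    then have fin: "finite S" by (intro finite_subset[of S "{..n}"]) auto
    have NS: "N \<in> S" using R by (simp add: S_def)
    define j where "j = Max S"
    have jS: "j \<in> S" unfolding j_def using fin NS by (intro Max_in) auto
    have "N \<le> j" unfolding j_def using fin NS by (intro Max_ge)
    moreover have "Suc j \<notin> S"
    proof
      assume "Suc j \<in> S"
      then have "Suc j \<le> j" unfolding j_def using fin by (intro Max_ge)
      then show False by simp
    qed
    ultimately show ?thesis using N jS by (intro exI[of _ j]) (auto simp: S_def)
  qed
  moreover have "(1::real) \<le> 2 ^ N" by simp
  ultimately show ?thesis by blast
qed

text \<open>The exponent may have either sign, and the factor covers the worse of the two
  cases.\<close>

lemma powr_ratio_ge:
  fixes R R' :: real
  assumes "0 < R'" "R' \<le> R" "R \<le> 2 * R'"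
  shows "R powr x * 2 powr (- \<bar>x\<bar>) \<le> R' powr x"
proof -
  have R: "0 < R" using assms by simp
  have "2 powr (- \<bar>x\<bar>) \<le> (R' / R) powr x"
  proof (cases "0 \<le> x")
    case True
    have "(1/2) powr x \<le> (R' / R) powr x" using True assms R by (intro powr_mono2) (auto simp: field_simps)
    moreover have "(1/2) powr x = 2 powr (- \<bar>x\<bar>)" using True by (simp add: powr_minus_divide powr_divide)
    ultimately show ?thesis by simp
  next
    case False
    have "1 powr x \<le> (R' / R) powr x" using False assms R by (intro powr_mono2') (auto simp: field_simps)
    moreover have "2 powr (- \<bar>x\<bar>) \<le> 2 powr 0" by (intro powr_mono) auto
    ultimately show ?thesis by simp
  qed
  then have "R powr x * 2 powr (- \<bar>x\<bar>) \<le> R powr x * (R' / R) powr x" by (intro mult_left_mono) auto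
  also have "\<dots> = R' powr x" using R assms by (simp add: powr_mult[symmetric])
  finally show ?thesis .
qed

lemma growth_of_C_prime:
  fixes s' :: "real^'m \<Rightarrow> real^'n"
  assumes l: "l \<le> CARD('n)" and k: "1 \<le> k" and s': "param_submanifold k s'" and \<mu>: "0 < \<mu>"
    and TK: "\<And>j. T j \<subseteq> inner_cube" "\<And>j. finite (T j)"
    and val: "\<And>j t. t \<in> T j \<Longrightarrow> s' t = X j t"
    and sep: "\<And>j t t'. t \<in> T j \<Longrightarrow> t' \<in> T j \<Longrightarrow> t \<noteq> t' \<Longrightarrow> \<exists>i. 2 * \<mu> * \<sigma> j \<le> \<bar>t $ i - t' $ i\<bar>"
    and W: "\<And>e. 0 < e \<Longrightarrow> eventually (\<lambda>j. scale_weight l \<alpha> e j (\<sigma> j) (T j) (X j) (w j) (B j)) sequentially"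
    and \<epsilon>: "0 < \<epsilon>"
  shows "\<exists>R0. \<forall>R\<ge>R0. (C_prime l s' R)\<^sup>2 \<ge> ereal (R powr (\<alpha> - \<epsilon>))"
proof -
  define m n where "m = CARD('m)" and "n = CARD('n)"
  have m0: "0 < real m" by (simp add: m_def)
  obtain U where U: "open U" "unit_cube \<subseteq> U" and sU: "Ck_on k U s'" using s' unfolding param_submanifold_def by blast
  have sc: "continuous_on unit_cube s'" using Ck_on_partial(3)[OF sU k] U(2) continuous_on_subset by blast
  obtain L where L: "0 < L" "\<And>t t'. t \<in> unit_cube \<Longrightarrow> t' \<in> unit_cube \<Longrightarrow> norm (s' t - s' t') \<le> L * norm (t - t')"
    using Ck_on_lipschitz[OF U sU k] by blast
  obtain c0 where c0: "0 < c0" "\<And>t. t \<in> unit_cube \<Longrightarrow> c0 \<le> surf_jac s' t" using surf_jac_bounds(1)[OF k s'] by blast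
  note jc = surf_jac_bounds(2)[OF k s']
  \<comment> \<open>The first bound keeps the cubes in the unit cube; the second keeps their images
    within \<open>1 / (6 * R')\<close> of the peak frequency.\<close>
  define c1 where "c1 = min (1/4) (1 / (6 * L * real m))"
  have c1: "0 < c1" "c1 \<le> 1/4" using L m0 by (auto simp: c1_def)
  have c1L: "L * (real m * c1) \<le> 1 / 6"
  proof -
    have "L * (real m * c1) \<le> L * (real m * (1 / (6 * L * real m)))" using L m0 by (intro mult_left_mono) (auto simp: c1_def)
    also have "\<dots> = 1/6" using L m0 by simp
    finally show ?thesis .
  qed
  \<comment> \<open>The loss is \<open>4 * e\<close>: two from the squared peak, one from the number
    of points, one from mass and tubes. The remaining \<open>\<epsilon> / 2\<close> absorbs
    constants.\<close>
  define e where "e = \<epsilon> / 8"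
  have e: "0 < e" using \<epsilon> by (simp add: e_def)
  define g where "g = real n - real l - real m"
  define c2 where "c2 = c0 * (2 * c1) ^ m"
  have c2: "0 < c2" using c0 c1 by (simp add: c2_def)
  define c3 where "c3 = c2 * 2 powr (- \<bar>g\<bar>) * 2 powr (- \<bar>\<alpha> - 4 * e\<bar>)"
  have c3: "0 < c3" using c2 by (simp add: c3_def)
  have "eventually (\<lambda>j. scale_weight l \<alpha> e j (\<sigma> j) (T j) (X j) (w j) (B j) \<and> c1 / \<mu> < real j) sequentially"
    using W[OF e] by (rule eventually_conj) (rule eventually_sequentiallyI[of "nat \<lceil>c1 / \<mu>\<rceil> + 1"], linarith)
  from eventually_dyadic[OF this] obtain R1 where R1: "1 \<le> R1" "\<And>R. R1 \<le> R \<Longrightarrow> \<exists>j. (scale_weight l \<alpha> e j (\<sigma> j) (T j) (X j) (w j) (B j) \<and> c1 / \<mu> < real j) \<and> 2 ^ j \<le> R \<and> R < 2 * (2::real) ^ j"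
    by blast
  have "eventually (\<lambda>R. 1 / c3 \<le> R powr (\<epsilon> - 4 * e)) at_top" using \<epsilon> by (intro eventually_le_powr) (simp add: e_def)
  then obtain R2 where R2: "\<And>R. R2 \<le> R \<Longrightarrow> 1 / c3 \<le> R powr (\<epsilon> - 4 * e)" unfolding eventually_at_top_linorder by blast
  have "ereal (R powr (\<alpha> - \<epsilon>)) \<le> (C_prime l s' R)\<^sup>2" if R: "max R1 R2 \<le> R" for R
  proof -
    have Rpos: "0 < R" using R R1(1) by simp
    obtain j where SW: "scale_weight l \<alpha> e j (\<sigma> j) (T j) (X j) (w j) (B j)" and jj: "c1 / \<mu> < real j" and jR: "2 ^ j \<le> R" "R < 2 * 2 ^ j"
      using R1(2)[of R] R by auto
    define R' where "R' = (2::real) ^ j"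
    have R'0: "0 < R'" and R'R: "R' \<le> R" "R \<le> 2 * R'" using jR by (auto simp: R'_def)
    have adm: "admissible_weight R' (w j)" and B0: "0 < B j"
      and LM: "L1_norm (w j) * max_fun_sup l (w j) \<le> (B j)\<^sup>2 * R' powr (real n + real l + e)"
      and pk: "\<And>t \<zeta>. t \<in> T j \<Longrightarrow> norm (\<zeta> - X j t) \<le> 1 / (6 * R') \<Longrightarrow> B j * R' powr (real n - e) \<le> cmod (fourier (w j) \<zeta>)"
      and cT: "R' powr (\<alpha> - e) \<le> real (card (T j))" and \<sigma>j: "real j \<le> \<sigma> j * R'"
      using SW unfolding scale_weight_def R'_def n_def by blast+
    have wi: "integrable lborel (w j)" and admR: "admissible_weight R (w j)"
      using adm R'R unfolding admissible_weight_def by auto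
    define \<delta> where "\<delta> = c1 / R'"
    have \<delta>0: "0 < \<delta>" using c1 R'0 by (simp add: \<delta>_def)
    have R'1: "1 \<le> R'" by (simp add: R'_def)
    have \<delta>1: "\<delta> \<le> 1/4"
    proof -
      have "\<delta> \<le> c1 / 1" unfolding \<delta>_def using c1 R'1 by (intro divide_left_mono) auto
      then show ?thesis using c1 by simp
    qed
    have \<delta>\<sigma>: "\<delta> < \<mu> * \<sigma> j"
    proof -
      have "c1 < \<mu> * real j" using jj \<mu> by (simp add: field_simps)
      also have "\<dots> \<le> \<mu> * (\<sigma> j * R')" using \<sigma>j \<mu> by (intro mult_left_mono) auto
      finally show ?thesis unfolding \<delta>_def using R'0 by (simp add: field_simps)
    qed
    define a where "a = B j * R' powr (real n - e)"
    have a0: "0 < a" using B0 R'0 by (simp add: a_def)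
    have lower: "c0 * a\<^sup>2 * (real (card (T j)) * (2 * \<delta>) ^ CARD('m)) \<le> (surf_L2_norm s' (fourier (w j)))\<^sup>2"
    proof (rule surf_L2_norm_ge[OF wi sc jc c0 TK(2) \<delta>0])
      fix t t' assume "t \<in> T j" "t' \<in> T j" "t \<noteq> t'"
      from sep[OF this] obtain i where "2 * \<mu> * \<sigma> j \<le> \<bar>t $ i - t' $ i\<bar>" by blast
      then show "\<exists>i. 2 * \<delta> < \<bar>t $ i - t' $ i\<bar>" using \<delta>\<sigma> by (intro exI[of _ i]) simp
    next
      fix t x assume t: "t \<in> T j" and x: "\<And>i. \<bar>x $ i - t $ i\<bar> \<le> \<delta>"
      have tc: "t \<in> inner_cube" using t TK by blast
      have xc: "x \<in> unit_cube" by (rule inner_cube_margin[OF tc]) (rule order_trans[OF x \<delta>1])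
      have tu: "t \<in> unit_cube" using tc inner_cube_subset by blast
      have "norm (s' x - X j t) \<le> L * norm (x - t)" using L(2)[OF xc tu] val[OF t] by simp
      also have "norm (x - t) \<le> (\<Sum>i\<in>UNIV. \<bar>(x - t) $ i\<bar>)" by (rule norm_le_l1_cart)
      also have "\<dots> \<le> (\<Sum>i\<in>(UNIV::'m set). \<delta>)" using x by (intro sum_mono) simp
      also have "L * (\<Sum>i\<in>(UNIV::'m set). \<delta>) = L * (real m * c1) / R'" by (simp add: \<delta>_def m_def)
      also have "\<dots> \<le> (1/6) / R'" using c1L R'0 by (intro divide_right_mono) auto
      finally have "norm (s' x - X j t) \<le> 1 / (6 * R')" using L(1) by simp
      then show "x \<in> unit_cube \<and> a \<le> cmod (fourier (w j) (s' x))" using xc pk[OF t] by (simp add: a_def)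
    qed (use a0 in auto)
    have p1: "R' powr (\<alpha> - 4 * e + g) * (B j)\<^sup>2 * R' powr (real n + real l + e) * c2 \<le> c0 * a\<^sup>2 * (real (card (T j)) * (2 * \<delta>) ^ CARD('m))"
    proof -
      have a2: "a\<^sup>2 = (B j)\<^sup>2 * R' powr (2 * (real n - e))"
        by (simp add: a_def power_mult_distrib power2_eq_square powr_add[symmetric])
      have d2: "(2 * \<delta>) ^ CARD('m) = (2 * c1) ^ m * R' powr (- real m)"
        using R'0 by (simp add: \<delta>_def m_def[symmetric] power_divide powr_minus_divide powr_realpow)
      have "R' powr (\<alpha> - 4 * e + g) * R' powr (real n + real l + e) = R' powr (2 * (real n - e)) * (R' powr (\<alpha> - e) * R' powr (- real m))"
        by (simp add: powr_add[symmetric] g_def algebra_simps)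
      then have "R' powr (\<alpha> - 4 * e + g) * (B j)\<^sup>2 * R' powr (real n + real l + e) * c2
         = c0 * ((B j)\<^sup>2 * R' powr (2 * (real n - e))) * (R' powr (\<alpha> - e) * ((2 * c1) ^ m * R' powr (- real m)))"
        by (simp add: c2_def mult_ac)
      also have "\<dots> \<le> c0 * ((B j)\<^sup>2 * R' powr (2 * (real n - e))) * (real (card (T j)) * ((2 * c1) ^ m * R' powr (- real m)))"
        using cT c0 c1 by (intro mult_left_mono mult_right_mono) auto
      finally show ?thesis unfolding a2 d2 .
    qed
    have S2: "0 < (surf_L2_norm s' (fourier (w j)))\<^sup>2"
    proof -
      have "0 < R' powr (\<alpha> - 4 * e + g) * (B j)\<^sup>2 * R' powr (real n + real l + e) * c2"
        using R'0 B0 c2 by (intro mult_pos_pos) auto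
      then show ?thesis using p1 lower by linarith
    qed
    have S0: "0 < surf_L2_norm s' (fourier (w j))"
    proof -
      have "0 \<le> surf_L2_norm s' (fourier (w j))" unfolding surf_L2_norm_def
      proof (rule real_sqrt_ge_zero, rule integral_nonneg_AE, rule AE_I2)
        fix t
        show "0 \<le> indicator unit_cube t * (cmod (fourier (w j) (s' t)))\<^sup>2 * surf_jac s' t"
          using c0(1) c0(2)[of t] by (auto simp: indicator_def)
      qed
      then show ?thesis using S2 by (cases "surf_L2_norm s' (fourier (w j)) = 0") auto
    qed
    \<comment> \<open>Replacing the dyadic radius by \<open>R\<close> costs the constants collected
      in \<open>c3\<close>, which the spare power of \<open>R\<close> pays for.\<close>
    have "R powr (\<alpha> - \<epsilon>) * R powr g \<le> R' powr (\<alpha> - 4 * e + g) * c2"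
    proof -
      have "1 \<le> c3 * R powr (\<epsilon> - 4 * e)" using R2[of R] R c3 by (simp add: field_simps)
      then have "R powr (\<alpha> - \<epsilon>) * 1 \<le> R powr (\<alpha> - \<epsilon>) * (c3 * R powr (\<epsilon> - 4 * e))" by (intro mult_left_mono) auto
      also have "\<dots> = c3 * R powr (\<alpha> - 4 * e)" by (simp add: mult.left_commute powr_add[symmetric])
      finally have "R powr (\<alpha> - \<epsilon>) * R powr g \<le> c3 * R powr (\<alpha> - 4 * e) * R powr g" by (intro mult_right_mono) auto
      also have "\<dots> = c2 * ((R powr (\<alpha> - 4 * e) * 2 powr (- \<bar>\<alpha> - 4 * e\<bar>)) * (R powr g * 2 powr (- \<bar>g\<bar>)))"
        by (simp add: c3_def mult_ac)
      also have "\<dots> \<le> c2 * (R' powr (\<alpha> - 4 * e) * R' powr g)"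
        using c2 R'0 R'R by (intro mult_left_mono mult_mono powr_ratio_ge) auto
      also have "\<dots> = R' powr (\<alpha> - 4 * e + g) * c2" by (simp add: powr_add)
      finally show ?thesis .
    qed
    note p2 = this
    show ?thesis
    proof (rule C_prime_sq_ge[OF admR S0 _ l])
      have "R powr (\<alpha> - \<epsilon>) * (R powr (real CARD('n) - real l - real CARD('m)) * (L1_norm (w j) * max_fun_sup l (w j)))
         = (R powr (\<alpha> - \<epsilon>) * R powr g) * (L1_norm (w j) * max_fun_sup l (w j))"
        by (simp add: g_def m_def n_def)
      also have "\<dots> \<le> (R powr (\<alpha> - \<epsilon>) * R powr g) * ((B j)\<^sup>2 * R' powr (real n + real l + e))"
        using LM by (intro mult_left_mono) auto
      also have "\<dots> \<le> (R' powr (\<alpha> - 4 * e + g) * c2) * ((B j)\<^sup>2 * R' powr (real n + real l + e))"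
        using p2 by (intro mult_right_mono) auto
      also have "\<dots> = R' powr (\<alpha> - 4 * e + g) * (B j)\<^sup>2 * R' powr (real n + real l + e) * c2" by (simp add: mult_ac)
      also note p1
      also note lower
      finally show "R powr (\<alpha> - \<epsilon>) * (R powr (real CARD('n) - real l - real CARD('m)) * (L1_norm (w j) * max_fun_sup l (w j)))
         \<le> (surf_L2_norm s' (fourier (w j)))\<^sup>2" .
    qed simp
  qed
  then show ?thesis by blast
qed

theorem theorem5p1:
  fixes s :: "real^'m \<Rightarrow> real^'n" and l k :: nat
  assumes "CARD('m) < CARD('n)" and "1 \<le> l" and "l \<le> CARD('n) - 1" and "2 \<le> k"
    and "param_submanifold k s"
  shows "\<forall>\<rho>>0. \<exists>s' :: real^'m \<Rightarrow> real^'n.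
           param_submanifold k s'
         \<and> (\<forall>\<gamma>. length \<gamma> < k \<longrightarrow>
              (\<forall>t\<in>unit_cube. norm (pdiff \<gamma> (\<lambda>x. s x - s' x) t) \<le> \<rho>))
         \<and> (\<forall>\<epsilon>>0. \<exists>R0. \<forall>R\<ge>R0.
              (C_prime l s' R)\<^sup>2 \<ge>
                ereal (R powr (real l * real CARD('m)
                   / (real CARD('m) + real k * (real CARD('n) - real CARD('m))) - \<epsilon>)))"
proof (intro allI impI)
  fix \<rho> :: real assume \<rho>: "0 < \<rho>"
  let ?\<alpha> = "real l * real CARD('m) / (real CARD('m) + real k * (real CARD('n) - real CARD('m)))"
  have k1: "1 \<le> k" using assms(4) by simp
  obtain U where U: "open U" "unit_cube \<subseteq> U" and sU: "Ck_on k U s" using assms(5) unfolding param_submanifold_def by blast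
  obtain \<eta> where \<eta>: "0 < \<eta>" "\<And>f. Ck_on k UNIV f \<Longrightarrow> (\<forall>i x. norm (pdiff [i] f x) \<le> \<eta>) \<Longrightarrow> param_submanifold k (\<lambda>x. s x + f x)"
    using small_perturbation_submanifold[OF k1 assms(5)] by blast
  obtain J :: "'m \<Rightarrow> 'n" and y0 r where J: "inj J" and r: "0 < r"
    and chart: "\<forall>y. (\<forall>i. y0 $ i \<le> y $ i \<and> y $ i \<le> y0 $ i + r) \<longrightarrow> (\<exists>t\<in>inner_cube. \<forall>i. s t $ J i = y $ i)"
    using coordinate_chart[OF k1 assms(5)] by blast
  obtain L where L: "0 < L" "\<And>t t'. t \<in> unit_cube \<Longrightarrow> t' \<in> unit_cube \<Longrightarrow> norm (s t - s t') \<le> L * norm (t - t')"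
    using Ck_on_lipschitz[OF U sU k1] by blast
  have lipK: "\<forall>t\<in>inner_cube. \<forall>t'\<in>inner_cube. norm (s t - s t') \<le> L * norm (t - t')"
    using L(2) inner_cube_subset by blast
  have "continuous_on unit_cube s" using Ck_on_partial(3)[OF sU k1] U(2) continuous_on_subset by blast
  then have "bounded (s ` unit_cube)" by (intro compact_imp_bounded compact_continuous_image compact_unit_cube)
  then obtain b0 where b0: "\<And>t. t \<in> unit_cube \<Longrightarrow> norm (s t) \<le> b0" unfolding bounded_iff by blast
  define b where "b = nat \<lceil>b0 + 1\<rceil>"
  have Sb: "\<bar>s t $ i\<bar> + 1 \<le> real b" if "t \<in> inner_cube" for t i
  proof -
    have "t \<in> unit_cube" using that inner_cube_subset by blast
    then have "\<bar>s t $ i\<bar> \<le> b0" using b0[of t] component_le_norm_cart[of "s t" i] by linarith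
    then show ?thesis unfolding b_def by linarith
  qed
  \<comment> \<open>The bound \<open>\<rho>\<close> is the required closeness; \<open>\<eta>\<close>
    keeps the perturbed map an embedding.\<close>
  have \<rho>': "0 < min \<rho> \<eta>" using \<rho> \<eta> by simp
  obtain \<kappa> \<mu> where \<kappa>: "0 < \<kappa>" and \<mu>: "0 < \<mu>" and pert: "\<forall>\<sigma> T X. (\<forall>j. scale_points s J y0 r inner_cube \<kappa> k j (\<sigma> j) (T j) (X j)) \<longrightarrow>
     (\<exists>f. Ck_on k UNIV f \<and> (\<forall>is x. length is \<le> k \<longrightarrow> norm (pdiff is f x) \<le> min \<rho> \<eta>) \<and>
        (\<forall>is x. length is \<le> k \<longrightarrow> norm (pdiff is (\<lambda>x. - f x) x) \<le> min \<rho> \<eta>) \<and>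
        (\<forall>j. \<forall>t\<in>T j. f t = X j t - s t) \<and>
        (\<forall>j. \<forall>t\<in>T j. \<forall>t'\<in>T j. t \<noteq> t' \<longrightarrow> (\<exists>i. 2 * \<mu> * \<sigma> j \<le> \<bar>t $ i - t' $ i\<bar>)))"
    using perturbation_exists[of inner_cube s L r "min \<rho> \<eta>" J y0 k, OF lipK L(1) r \<rho>'] by (elim exE conjE)
  define SP where "SP j d = (case d of (\<sigma>, T, X, w, B) \<Rightarrow> scale_points s J y0 r inner_cube \<kappa> k j \<sigma> T X)"
    for j and d :: "real \<times> (real^'m) set \<times> (real^'m \<Rightarrow> real^'n) \<times> (real^'n \<Rightarrow> real) \<times> real"
  define SW where "SW e j d = (case d of (\<sigma>, T, X, w, B) \<Rightarrow> scale_weight l ?\<alpha> e j \<sigma> T X w B)"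
    for e j and d :: "real \<times> (real^'m) set \<times> (real^'m \<Rightarrow> real^'n) \<times> (real^'n \<Rightarrow> real) \<times> real"
  have "\<exists>D. (\<forall>j. SP j (D j)) \<and> (\<forall>e>0. eventually (\<lambda>j. SW e j (D j)) sequentially)"
  proof (rule diagonal_choice)
    \<comment> \<open>At scales without usable data, an empty point set adds nothing to the
      perturbation.\<close>
    show "\<exists>d. SP j d" for j
      by (intro exI[of _ "(1/2, {}, \<lambda>_. 0, \<lambda>_. 0, 0)"]) (simp add: SP_def scale_points_def)
    show "SW e' j d" if "SW e j d" "e \<le> e'" for e e' j d
      using that scale_weight_mono by (auto simp: SW_def split: prod.splits)
    show "eventually (\<lambda>j. \<exists>d. SP j d \<and> SW e j d) sequentially" if e: "0 < e" for e
    proof -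
      have "eventually (\<lambda>j. \<exists>\<sigma> T X w B. scale_points s J y0 r inner_cube \<kappa> k j \<sigma> T X \<and> scale_weight l ?\<alpha> e j \<sigma> T X w B) sequentially"
        using chart by (intro scale_exists[OF assms(1-3) k1 J r _ Sb \<kappa> e]) auto
      then show ?thesis
      proof eventually_elim
        case (elim j)
        then obtain \<sigma> T X w B where "scale_points s J y0 r inner_cube \<kappa> k j \<sigma> T X" "scale_weight l ?\<alpha> e j \<sigma> T X w B" by blast
        then show ?case by (intro exI[of _ "(\<sigma>, T, X, w, B)"]) (simp add: SP_def SW_def)
      qed
    qed
  qed
  then obtain D where D: "\<And>j. SP j (D j)" "\<And>e. 0 < e \<Longrightarrow> eventually (\<lambda>j. SW e j (D j)) sequentially" by blast
  define \<sigma> where "\<sigma> j = fst (D j)" for j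
  define T where "T j = fst (snd (D j))" for j
  define X where "X j = fst (snd (snd (D j)))" for j
  define w where "w j = fst (snd (snd (snd (D j))))" for j
  define B where "B j = snd (snd (snd (snd (D j))))" for j
  have sp: "\<forall>j. scale_points s J y0 r inner_cube \<kappa> k j (\<sigma> j) (T j) (X j)"
    using D(1) by (simp add: SP_def case_prod_unfold \<sigma>_def T_def X_def)
  have sw: "eventually (\<lambda>j. scale_weight l ?\<alpha> e j (\<sigma> j) (T j) (X j) (w j) (B j)) sequentially" if "0 < e" for e
    using D(2)[OF that] by (simp add: SW_def case_prod_unfold \<sigma>_def T_def X_def w_def B_def)
  obtain f where f: "Ck_on k UNIV f" "\<forall>is x. length is \<le> k \<longrightarrow> norm (pdiff is f x) \<le> min \<rho> \<eta>"
      "\<forall>is x. length is \<le> k \<longrightarrow> norm (pdiff is (\<lambda>x. - f x) x) \<le> min \<rho> \<eta>"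
      "\<forall>j. \<forall>t\<in>T j. f t = X j t - s t"
      "\<forall>j. \<forall>t\<in>T j. \<forall>t'\<in>T j. t \<noteq> t' \<longrightarrow> (\<exists>i. 2 * \<mu> * \<sigma> j \<le> \<bar>t $ i - t' $ i\<bar>)"
    using pert[THEN spec, THEN spec, THEN spec, THEN mp, OF sp] by (elim exE conjE)
  define s' where "s' x = s x + f x" for x
  have "norm (pdiff [i] f x) \<le> \<eta>" for i x
  proof -
    have "norm (pdiff [i] f x) \<le> min \<rho> \<eta>" using f(2) k1 by (simp del: pdiff.simps)
    then show ?thesis by simp
  qed
  then have ps: "param_submanifold k s'" unfolding s'_def[abs_def] using f(1) by (intro \<eta>(2)) auto
  have "norm (pdiff \<gamma> (\<lambda>x. s x - s' x) t) \<le> \<rho>" if "length \<gamma> < k" for \<gamma> t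
  proof -
    have "(\<lambda>x. s x - s' x) = (\<lambda>x. - f x)" by (simp add: s'_def)
    then have "norm (pdiff \<gamma> (\<lambda>x. s x - s' x) t) \<le> min \<rho> \<eta>" using f(3) that by simp
    then show ?thesis by simp
  qed
  moreover have "\<exists>R0. \<forall>R\<ge>R0. (C_prime l s' R)\<^sup>2 \<ge> ereal (R powr (?\<alpha> - \<epsilon>))" if \<epsilon>: "0 < \<epsilon>" for \<epsilon>
  proof (rule growth_of_C_prime[OF _ k1 ps \<mu> _ _ _ _ sw \<epsilon>])
    show "l \<le> CARD('n)" using assms(3) by simp
    show "T j \<subseteq> inner_cube" "finite (T j)" for j using sp by (auto simp: scale_points_def)
    show "s' t = X j t" if "t \<in> T j" for j t using f(4) that by (simp add: s'_def)
    show "\<exists>i. 2 * \<mu> * \<sigma> j \<le> \<bar>t $ i - t' $ i\<bar>" if "t \<in> T j" "t' \<in> T j" "t \<noteq> t'" for j t t'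
      using f(5) that by blast
  qed
  ultimately show "\<exists>s' :: real^'m \<Rightarrow> real^'n.
           param_submanifold k s'
         \<and> (\<forall>\<gamma>. length \<gamma> < k \<longrightarrow>
              (\<forall>t\<in>unit_cube. norm (pdiff \<gamma> (\<lambda>x. s x - s' x) t) \<le> \<rho>))
         \<and> (\<forall>\<epsilon>>0. \<exists>R0. \<forall>R\<ge>R0. (C_prime l s' R)\<^sup>2 \<ge> ereal (R powr (?\<alpha> - \<epsilon>)))"
    using ps by (intro exI[of _ s']) auto
qed

end
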